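(* There exists an absolute constant $\eta>0$ such that the following holds. There is a randomized single-pass streaming algorithm that, for any $1\le k\le n$ and $\epsilon\in(0,1/100)$, given an $n$-vertex graph $G$ whose edges arrive in a stream in adversarial order, with high probability computes a $(1-\epsilon)$-approximate maximum matching of $G$, in exponential time and space \[ O\left(\frac{n^2}{k}\log^2 k+\mathrm{RS}\left(n,\frac{\eta\epsilon^2}{k}\right)\cdot\log\left(\frac{n^2}{\mathrm{RS}(n,\eta\epsilon^2/k)}\right)\cdot\log^2 k\cdot\log(k/\epsilon)\right). \] Moreover, there is a deterministic single-pass streaming algorithm that returns a matching of size at least $\mu(G)-\epsilon n$ in exponential time and space \[ O\left(\frac{n^2}{k}\log k+\mathrm{RS}\left(n,\frac{\epsilon}{16k}\right)\cdot\log\left(\frac{n^2}{\mathrm{RS}(n,\epsilon/16k)}\right)\cdot\log k\cdot\log(k/\epsilon)\right). \]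
   Context: $\mu(G)$ is the maximum matching size of $G$. A matching $M$ in a graph is induced if the subgraph induced on the vertices of $M$ contains only the edges of $M$. For integers $r,t\ge1$, a graph is an $(r,t)$-Ruzsa–Szemerédi (RS) graph if its edge set can be partitioned into $t$ induced matchings each of size $r$. For an integer $n\ge1$ and $\beta\in(0,1/2)$, $\mathrm{RS}(n,\beta)$ denotes the maximum number of edges of an $n$-vertex RS graph whose induced matchings have size $\beta n$. In the single-pass streaming model the algorithm reads the edges once in the stream order with space measured in bits. "With high probability" means probability at least $1-1/n^c$ for any desired constant $c$.
   Formalization: The factors log k are read as max(1, log₂ k), since for k = 1 the stated space bound would be 0 bits; and in RS(n,β) the induced matchings have size ⌈βn⌉, since βn need not be an integer. *)

theory Defs
  imports
    "HOL-Probability.Probability"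
    "HOL-Library.Disjoint_Sets"
    "HOL-Library.Log_Nat"
begin

section \<open>Graphs, matchings and Ruzsa--Szemeredi graphs\<close>

text \<open>A simple graph on the vertex set \<open>{0, ..., n - 1}\<close> is given by its set of edges.\<close>

definition simple_graph :: "nat \<Rightarrow> nat set set \<Rightarrow> bool" where
  "simple_graph n E \<longleftrightarrow> E \<subseteq> {e. e \<subseteq> {..<n} \<and> card e = 2}"

definition matching :: "nat set set \<Rightarrow> nat set set \<Rightarrow> bool" where
  "matching E M \<longleftrightarrow> M \<subseteq> E \<and> disjoint M"

definition max_matching_size :: "nat set set \<Rightarrow> nat" where
  "max_matching_size E = Max {card M |M. matching E M}"

definition induced_matching :: "nat set set \<Rightarrow> nat set set \<Rightarrow> bool" where
  "induced_matching E M \<longleftrightarrow> matching E M \<and> {e \<in> E. e \<subseteq> \<Union>M} = M"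

definition RS_graph :: "nat \<Rightarrow> nat \<Rightarrow> nat set set \<Rightarrow> bool" where
  "RS_graph r t E \<longleftrightarrow> 1 \<le> r \<and> 1 \<le> t \<and>
     (\<exists>P. partition_on E P \<and> card P = t \<and> (\<forall>M\<in>P. induced_matching E M \<and> card M = r))"

text \<open>Since \<open>\<beta> n\<close> need not be an integer, the size of the induced matchings is
  \<open>\<lceil>\<beta> n\<rceil>\<close>, the least integer that is at least \<open>\<beta> n\<close>.  The inserted \<open>0\<close> only matters if
  there is no such RS graph at all, e.g. if \<open>n = 1\<close>.\<close>

definition RS :: "nat \<Rightarrow> real \<Rightarrow> nat" where
  "RS n \<beta> = Max (insert 0
     {card E |E. simple_graph n E \<and> (\<exists>t. RS_graph (nat \<lceil>\<beta> * real n\<rceil>) t E)})"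

section \<open>Uniform single-pass streaming algorithms\<close>

text \<open>An algorithm is one fixed program, independent of all parameters, over
  registers that hold natural numbers in binary.  Each operation takes its operands from registers
  and stores its result in a register, so there are no intermediate values that escape the
  space count below.  Some conventions:
  \<^item> \<open>Eps x y\<close> sets \<open>x\<close> to \<open>\<lfloor>\<epsilon> y\<rfloor>\<close>.  This is how a program accesses its real parameter \<open>\<epsilon>\<close>, which
    in general has no finite encoding.
  \<^item> \<open>Flip x\<close> sets \<open>x\<close> to the result of a fair coin toss.
  \<^item> \<open>Read x y\<close> removes the next edge from the stream and stores its end points in \<open>x\<close> and \<open>y\<close>.
    At the end of the stream it sets both to \<open>0\<close>, which cannot be confused with an edge.
  \<^item> \<open>Emit x y\<close> appends an edge to the write-only output.
  \<^item> \<open>IfNZ\<close> and \<open>WhileNZ\<close> test whether a register is nonzero.\<close>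

type_synonym reg = nat

datatype binop = Add | Sub | Mul | Quo | Rem

datatype com =
    Skip
  | Const reg nat
  | Op binop reg reg reg
  | Eps reg reg
  | Flip reg
  | Read reg reg
  | Emit reg reg
  | Seq com com
  | IfNZ reg com com
  | WhileNZ reg com

record config =
  regs :: "reg \<Rightarrow> nat"
  stream_in :: "(nat \<times> nat) list"
  stream_out :: "(nat \<times> nat) list"

fun apply_op :: "binop \<Rightarrow> nat \<Rightarrow> nat \<Rightarrow> nat" where
  "apply_op Add a b = a + b"
| "apply_op Sub a b = a - b"
| "apply_op Mul a b = a * b"
| "apply_op Quo a b = a div b"
| "apply_op Rem a b = a mod b"

definition set_reg :: "reg \<Rightarrow> nat \<Rightarrow> config \<Rightarrow> config" where
  "set_reg x v s = s\<lparr>regs := (regs s)(x := v)\<rparr>"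

fun read_edge :: "reg \<Rightarrow> reg \<Rightarrow> config \<Rightarrow> config" where
  "read_edge x y s = (case stream_in s of
       [] \<Rightarrow> set_reg y 0 (set_reg x 0 s)
     | (u, v) # es \<Rightarrow> (set_reg y v (set_reg x u s))\<lparr>stream_in := es\<rparr>)"

text \<open>One step of a computation, with \<open>Skip\<close> as the halted program.\<close>

fun step :: "real \<Rightarrow> com \<Rightarrow> config \<Rightarrow> (com \<times> config) pmf" where
  "step \<epsilon> Skip s = return_pmf (Skip, s)"
| "step \<epsilon> (Const x v) s = return_pmf (Skip, set_reg x v s)"
| "step \<epsilon> (Op f x y z) s = return_pmf (Skip, set_reg x (apply_op f (regs s y) (regs s z)) s)"
| "step \<epsilon> (Eps x y) s = return_pmf (Skip, set_reg x (nat \<lfloor>\<epsilon> * real (regs s y)\<rfloor>) s)"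
| "step \<epsilon> (Flip x) s = map_pmf (\<lambda>b. (Skip, set_reg x (of_bool b) s)) (bernoulli_pmf (1/2))"
| "step \<epsilon> (Read x y) s = return_pmf (Skip, read_edge x y s)"
| "step \<epsilon> (Emit x y) s =
     return_pmf (Skip, s\<lparr>stream_out := stream_out s @ [(regs s x, regs s y)]\<rparr>)"
| "step \<epsilon> (Seq p q) s =
     (if p = Skip then return_pmf (q, s)
      else map_pmf (\<lambda>(p', s'). (Seq p' q, s')) (step \<epsilon> p s))"
| "step \<epsilon> (IfNZ x p q) s = return_pmf (if regs s x \<noteq> 0 then p else q, s)"
| "step \<epsilon> (WhileNZ x p) s =
     return_pmf (if regs s x \<noteq> 0 then Seq p (WhileNZ x p) else Skip, s)"

fun coin_free :: "com \<Rightarrow> bool" where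
  "coin_free (Flip x) \<longleftrightarrow> False"
| "coin_free (Seq p q) \<longleftrightarrow> coin_free p \<and> coin_free q"
| "coin_free (IfNZ x p q) \<longleftrightarrow> coin_free p \<and> coin_free q"
| "coin_free (WhileNZ x p) \<longleftrightarrow> coin_free p"
| "coin_free p \<longleftrightarrow> True"

text \<open>The parameters \<open>n\<close> and \<open>k\<close> are passed in registers \<open>0\<close> and \<open>1\<close>.\<close>

definition init_config :: "nat \<Rightarrow> nat \<Rightarrow> (nat \<times> nat) list \<Rightarrow> config" where
  "init_config n k es = \<lparr>regs = (\<lambda>_. 0)(0 := n, 1 := k), stream_in = es, stream_out = []\<rparr>"

fun run :: "com \<Rightarrow> nat \<Rightarrow> nat \<Rightarrow> real \<Rightarrow> (nat \<times> nat) list \<Rightarrow> nat \<Rightarrow> (com \<times> config) pmf" where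
  "run A n k \<epsilon> es 0 = return_pmf (A, init_config n k es)"
| "run A n k \<epsilon> es (Suc t) = bind_pmf (run A n k \<epsilon> es t) (\<lambda>(p, s). step \<epsilon> p s)"

text \<open>The running time and the space of a randomized algorithm are worst-case over its coin tosses.
  Note that \<open>floorlog 2 v\<close> is the number of binary digits of \<open>v\<close>, with \<open>floorlog 2 0 = 0\<close>, and
  that only finitely many registers can ever be nonzero.\<close>

definition halts_within :: "com \<Rightarrow> nat \<Rightarrow> nat \<Rightarrow> real \<Rightarrow> (nat \<times> nat) list \<Rightarrow> nat \<Rightarrow> bool" where
  "halts_within A n k \<epsilon> es T \<longleftrightarrow> (\<forall>(p, s) \<in> set_pmf (run A n k \<epsilon> es T). p = Skip)"

definition space_bits :: "config \<Rightarrow> nat" where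
  "space_bits s = (\<Sum>x | regs s x \<noteq> 0. floorlog 2 (regs s x))"

definition space_within :: "com \<Rightarrow> nat \<Rightarrow> nat \<Rightarrow> real \<Rightarrow> (nat \<times> nat) list \<Rightarrow> real \<Rightarrow> bool" where
  "space_within A n k \<epsilon> es S \<longleftrightarrow>
     (\<forall>t. \<forall>(p, s) \<in> set_pmf (run A n k \<epsilon> es t). real (space_bits s) \<le> S)"

definition edges_of :: "(nat \<times> nat) list \<Rightarrow> nat set set" where
  "edges_of es = (\<lambda>(u, v). {u, v}) ` set es"

definition output_edges :: "com \<times> config \<Rightarrow> nat set set" where
  "output_edges c = edges_of (stream_out (snd c))"

text \<open>Every edge occurs exactly once in the stream, in an arbitrary order, and with
  its end points listed in an arbitrary order.\<close>

definition edge_stream :: "nat set set \<Rightarrow> (nat \<times> nat) list \<Rightarrow> bool" where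
  "edge_stream E es \<longleftrightarrow> distinct (map (\<lambda>(u, v). {u, v}) es) \<and> edges_of es = E"

text \<open>Exponential time means \<open>2\<close> to the power of a polynomial in \<open>n\<close>.\<close>

definition exp_time :: "nat \<Rightarrow> nat \<Rightarrow> nat" where
  "exp_time a n = 2 ^ (a * n ^ a)"

text \<open>The factors \<open>log k\<close> in the space bounds vanish for \<open>k = 1\<close>, where they must be
  read as \<open>1\<close>.  For \<open>k \<ge> 2\<close> this is the binary logarithm.\<close>

definition lg :: "real \<Rightarrow> real" where
  "lg x = max 1 (log 2 x)"

end

theory Submission
  imports Defs
begin

text \<open>The algorithms collect edges in a buffer of \<open>\<Theta>(n\<^sup>2 / k)\<close> edges. Whenever it is full, the set \<open>Z\<close> of all
  stored edges is replaced by a small subset \<open>W\<close> such that, whatever edges arrive later, the matching number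
  drops by at most \<open>O(\<epsilon> n / k)\<close>; there are \<open>O(k)\<close> such rounds. By the Tutte--Berge formula, a graph with a small
  matching number is certified by a labelling of its vertices by a set (label \<open>0\<close>) and components, where no edge
  joins two components. Hence it suffices that for every labelling without a violated edge in \<open>W\<close>, few
  vertices cover its violated edges in \<open>Z\<close>: they can be moved to label \<open>0\<close>. Such a \<open>W\<close> is built greedily:
  as long as it fails, some edge of \<open>Z\<close> lies in many of the pairs of vertex sets still to be hit, for
  otherwise random such pairs would give a Ruzsa--Szemeredi graph with too many edges. So \<open>|W| = O(RS log)\<close>.
  Storing \<open>W\<close> in \<open>O(|W| log (n\<^sup>2 / |W|))\<close> bits and finding everything by exhaustive search gives the
  deterministic bound.

  For a multiplicative error, the vertices are hashed into \<open>i\<close> values, and the property is required at the same time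
  for all hashed graphs with \<open>i\<close> a power of two, with an error proportional to \<open>\<epsilon>\<^sup>2 i / k\<close>. A value \<open>i\<close> near
  \<open>\<mu>(G) / \<epsilon>\<close> keeps almost all of a maximum matching with high probability. Matchings that are too small for
  this are preserved exactly by a kernel.\<close>

section \<open>Matchings and the Tutte--Berge formula\<close>

text \<open>The space of the model counts every intermediate value of one uniform program. So the
  program constructs nothing: reduced set, buffer and matching are each the least number that passes
  a test, and only the existence of a small witness is proved. A single bound \<open>V\<close> on
  all register contents then gives the space, as \<open>log V\<close> per register, and the time, as
  a power of \<open>V\<close>.

  A second obstacle is that a hashed graph has only \<open>i\<close> vertices, while the space is
  measured by the RS number on \<open>n\<close> vertices. The tolerated error shrinks in proportion
  to \<open>i\<close>, so about \<open>n / i\<close> disjoint copies of an RS graph on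
  \<open>i\<close> vertices fit on \<open>n\<close> vertices and have matchings of the right size.

  The hash function is fully random. Its \<open>O(n log n)\<close> bits are affordable because
  \<open>log n\<close> is \<open>O((n / k) log k)\<close>. Exponential moments of the number of
  collisions make the failure probability exponentially small in \<open>\<epsilon> \<mu>\<close>;
  where hashing is used, the choice of the kernel size makes this product large enough. Both
  algorithms are instances of one core, the deterministic one with all hashed levels switched
  off.\<close>

definition graph_on :: "nat set \<Rightarrow> nat set set \<Rightarrow> bool" where
  "graph_on V E \<longleftrightarrow> E \<subseteq> {e. e \<subseteq> V \<and> card e = 2}"

abbreviation mu :: "nat set set \<Rightarrow> nat" where
  "mu \<equiv> max_matching_size"

lemma graph_on_finite: "finite V \<Longrightarrow> graph_on V E \<Longrightarrow> finite E"
  unfolding graph_on_def by (rule finite_subset[of _ "Pow V"]) auto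

lemma graph_on_mono: "graph_on V E \<Longrightarrow> E' \<subseteq> E \<Longrightarrow> graph_on V E'"
  unfolding graph_on_def by auto

lemma graph_on_edge: "graph_on V E \<Longrightarrow> e \<in> E \<Longrightarrow> \<exists>u v. e = {u, v} \<and> u \<noteq> v \<and> u \<in> V \<and> v \<in> V"
proof -
  assume "graph_on V E" "e \<in> E"
  then have e: "e \<subseteq> V" "card e = 2" unfolding graph_on_def by auto
  from e(2) obtain u v where "e = {u, v}" "u \<noteq> v" by (auto simp: card_2_iff)
  with e(1) show ?thesis by blast
qed

lemma matching_mono: "matching E M \<Longrightarrow> E \<subseteq> E' \<Longrightarrow> matching E' M"
  unfolding matching_def by auto

lemma matching_subset: "matching E M \<Longrightarrow> M' \<subseteq> M \<Longrightarrow> matching E M'"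
  unfolding matching_def by (auto intro: pairwise_subset)

lemma matching_insert:
  assumes "matching E M" "e \<in> E" "e \<inter> \<Union>M = {}"
  shows "matching E (insert e M)"
  using assms unfolding matching_def pairwise_insert disjnt_def by blast

lemma matching_sizes_finite: "finite E \<Longrightarrow> finite {card M |M. matching E M}"
  by (rule finite_subset[of _ "card ` Pow E"]) (auto simp: matching_def)

lemma matching_empty [simp]: "matching E {}"
  by (simp add: matching_def)

lemma mu_ge: "finite E \<Longrightarrow> matching E M \<Longrightarrow> card M \<le> mu E"
  unfolding max_matching_size_def by (rule Max_ge[OF matching_sizes_finite]) auto

lemma mu_attained: assumes "finite E" obtains M where "matching E M" "card M = mu E"
proof -
  have "mu E \<in> {card M |M. matching E M}"
    unfolding max_matching_size_def by (rule Max_in[OF matching_sizes_finite[OF assms]]) (use matching_empty in blast)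
  then show ?thesis using that by auto
qed

lemma mu_le: assumes "finite E" "\<And>M. matching E M \<Longrightarrow> card M \<le> b" shows "mu E \<le> b"
  using mu_attained[OF assms(1)] assms(2) by metis

lemma matching_unique: "matching E M \<Longrightarrow> e \<in> M \<Longrightarrow> e' \<in> M \<Longrightarrow> x \<in> e \<Longrightarrow> x \<in> e' \<Longrightarrow> e = e'"
  unfolding matching_def pairwise_def disjnt_def by blast

lemma card_Union_matching:
  assumes "graph_on V E" "finite V" "matching E M"
  shows "card (\<Union>M) = 2 * card M"
proof -
  have c: "\<And>e. e \<in> M \<Longrightarrow> card e = 2" using assms unfolding graph_on_def matching_def by auto
  have "card (\<Union>M) = sum card M"
    using assms(3) c by (intro card_Union_disjoint) (auto simp: matching_def intro: card_ge_0_finite)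
  also have "\<dots> = 2 * card M" using c by simp
  finally show ?thesis .
qed

text \<open>A violated edge would join two different components of the labelling. A labelling that
  no edge violates is a Tutte--Berge certificate, with \<open>bnd\<close> as the bound that it
  proves.\<close>

definition viol :: "(nat \<Rightarrow> nat) \<Rightarrow> nat set \<Rightarrow> bool" where
  "viol f e \<longleftrightarrow> (\<exists>u\<in>e. \<exists>v\<in>e. f u \<noteq> 0 \<and> f v \<noteq> 0 \<and> f u \<noteq> f v)"

text \<open>Label \<open>0\<close> marks the Tutte--Berge set, the other labels its components.\<close>

definition bnd :: "nat set \<Rightarrow> (nat \<Rightarrow> nat) \<Rightarrow> nat" where
  "bnd V f = card {v \<in> V. f v = 0} + (\<Sum>c \<in> f ` V - {0}. card {v \<in> V. f v = c} div 2)"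

text \<open>An edge of \<open>M\<close> either meets the vertices with label \<open>0\<close>, at
  most one edge for each of them, or lies inside a single component, which has room for half of its
  vertices only.\<close>

lemma matching_le_bnd:
  assumes V: "finite V" and g: "graph_on V E" and nv: "\<forall>e\<in>E. \<not> viol f e" and M: "matching E M"
  shows "card M \<le> bnd V f"
proof -
  let ?U = "{v \<in> V. f v = 0}" and ?C = "f ` V - {0}"
  have ME: "M \<subseteq> E" and fM: "finite M" 
    using M graph_on_finite[OF V g] finite_subset unfolding matching_def by auto
  define M0 where "M0 = {e \<in> M. e \<inter> ?U \<noteq> {}}"
  define Mc where "Mc c = {e \<in> M. e \<subseteq> {v \<in> V. f v = c}}" for c
  have ee: "e \<subseteq> V \<and> card e = 2" if "e \<in> M" for e using that ME g unfolding graph_on_def by auto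
  have cov: "M \<subseteq> M0 \<union> (\<Union>c\<in>?C. Mc c)"
  proof
    fix e assume e: "e \<in> M"
    then obtain u v where uv: "e = {u, v}" "u \<noteq> v" using ee card_2_iff by metis
    then have V': "u \<in> V" "v \<in> V" using ee e by auto
    have nv': "\<not> viol f e" using nv e ME by auto
    show "e \<in> M0 \<union> (\<Union>c\<in>?C. Mc c)"
    proof (cases "f u = 0 \<or> f v = 0")
      case True then show ?thesis using uv V' e unfolding M0_def by auto
    next
      case False
      then have "f u = f v" using nv' uv unfolding viol_def by auto
      then have "e \<in> Mc (f u)" using uv V' e unfolding Mc_def by auto
      then show ?thesis using False V' by auto
    qed
  qed
  have m0: "card M0 \<le> card ?U"
  proof -
    obtain h where h: "\<And>e. e \<in> M0 \<Longrightarrow> h e \<in> e \<inter> ?U"       using bchoice[of M0 "\<lambda>e x. x \<in> e \<inter> ?U"] unfolding M0_def by blast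
    have "inj_on h M0"
    proof (rule inj_onI)
      fix x y assume a: "x \<in> M0" "y \<in> M0" "h x = h y"
      then have "h x \<in> x" "h x \<in> y" using h[of x] h[of y] by auto
      then show "x = y" using matching_unique[OF M] a unfolding M0_def by auto
    qed
    moreover have "h ` M0 \<subseteq> ?U" using h by auto
    ultimately show ?thesis using V by (intro card_inj_on_le) auto
  qed
  have mc: "card (Mc c) \<le> card {v \<in> V. f v = c} div 2" for c
  proof -
    have "matching E (Mc c)" using matching_subset[OF M] unfolding Mc_def by auto
    then have "2 * card (Mc c) = card (\<Union>(Mc c))" using card_Union_matching[OF g V] by simp
    also have "\<dots> \<le> card {v \<in> V. f v = c}" using V unfolding Mc_def by (intro card_mono) auto
    finally show ?thesis by simp
  qed
  have "card M \<le> card (M0 \<union> (\<Union>c\<in>?C. Mc c))"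
    using cov fM V by (intro card_mono) (auto simp: M0_def Mc_def)
  also have "\<dots> \<le> card M0 + card (\<Union>c\<in>?C. Mc c)" by (rule card_Un_le)
  also have "card (\<Union>c\<in>?C. Mc c) \<le> (\<Sum>c\<in>?C. card (Mc c))" using V by (intro card_UN_le) auto
  also have "\<dots> \<le> (\<Sum>c\<in>?C. card {v \<in> V. f v = c} div 2)" by (intro sum_mono mc)
  finally show ?thesis using m0 unfolding bnd_def by linarith
qed

text \<open>Each relabelled vertex adds at most one to the first summand, and components only
  shrink. This makes a small vertex cover of the violated edges a cheap repair.\<close>

lemma bnd_move:
  assumes V: "finite V" and C: "C \<subseteq> V"
  shows "bnd V (\<lambda>v. if v \<in> C then 0 else f v) \<le> bnd V f + card C"
proof -
  let ?g = "\<lambda>v. if v \<in> C then 0 else f v"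
  have "{v \<in> V. ?g v = 0} \<subseteq> {v \<in> V. f v = 0} \<union> C" by auto
  then have "card {v \<in> V. ?g v = 0} \<le> card ({v \<in> V. f v = 0} \<union> C)"
    using V C finite_subset by (intro card_mono) auto
  also have "\<dots> \<le> card {v \<in> V. f v = 0} + card C" by (rule card_Un_le)
  finally have 1: "card {v \<in> V. ?g v = 0} \<le> card {v \<in> V. f v = 0} + card C" .
  have "(\<Sum>c \<in> ?g ` V - {0}. card {v \<in> V. ?g v = c} div 2) \<le> (\<Sum>c \<in> ?g ` V - {0}. card {v \<in> V. f v = c} div 2)"
    using V by (intro sum_mono div_le_mono card_mono) (auto split: if_splits)
  also have "\<dots> \<le> (\<Sum>c \<in> f ` V - {0}. card {v \<in> V. f v = c} div 2)"
    using V by (intro sum_mono2) auto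
  finally show ?thesis using 1 unfolding bnd_def by linarith
qed

text \<open>Gallai: when every vertex is missed by some maximum matching, ``no maximum matching misses both''
  is transitive. Among all \<open>M\<close> missing \<open>u, w\<close> and \<open>N\<close> missing \<open>v\<close> take a pair with
  the largest intersection; an edge of \<open>M\<close> at a vertex missed by \<open>N\<close> can be exchanged into \<open>N\<close>.\<close>

lemma gallai_transitive:
  assumes V: "finite V" and g: "graph_on V E" and vV: "v \<in> V"
    and N: "matching E N0" "card N0 = mu E" "v \<notin> \<Union>N0"
    and M: "matching E M0" "card M0 = mu E" "u \<notin> \<Union>M0" "w \<notin> \<Union>M0" "u \<noteq> w"
    and uv: "\<And>K. matching E K \<Longrightarrow> card K = mu E \<Longrightarrow> u \<in> \<Union>K \<or> v \<in> \<Union>K"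
    and wv: "\<And>K. matching E K \<Longrightarrow> card K = mu E \<Longrightarrow> w \<in> \<Union>K \<or> v \<in> \<Union>K"
  shows False
proof -
  have fE: "finite E" by (rule graph_on_finite[OF V g])
  define P where "P p \<longleftrightarrow> (case p of (M, N) \<Rightarrow> matching E M \<and> card M = mu E \<and> u \<notin> \<Union>M \<and> w \<notin> \<Union>M \<and>
    matching E N \<and> card N = mu E \<and> v \<notin> \<Union>N)" for p
  have "P (M0, N0)" using M N unfolding P_def by auto
  moreover have "\<forall>y. P y \<longrightarrow> card (fst y \<inter> snd y) < Suc (card E)"
    using fE unfolding P_def matching_def less_Suc_eq_le by (auto intro!: card_mono)
  ultimately have "\<exists>x. P x \<and> (\<forall>y. P y \<longrightarrow> card (fst y \<inter> snd y) \<le> card (fst x \<inter> snd x))"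
    by (rule ex_has_greatest_nat)
  then obtain p where p: "P p" "\<And>y. P y \<Longrightarrow> card (fst y \<inter> snd y) \<le> card (fst p \<inter> snd p)"
    by blast
  obtain M N where MN: "p = (M, N)" by (cases p)
  have M: "matching E M" "card M = mu E" "u \<notin> \<Union>M" "w \<notin> \<Union>M"
    and N: "matching E N" "card N = mu E" "v \<notin> \<Union>N" using p(1) MN unfolding P_def by auto
  have fin: "finite (\<Union>M)" "finite (\<Union>N)" "finite M" "finite N"
    using M(1) N(1) g V fE finite_subset unfolding matching_def graph_on_def
    by (auto intro!: finite_subset[OF _ V]) 
  have uwN: "u \<in> \<Union>N" "w \<in> \<Union>N" using uv wv N by blast+
  \<comment> \<open>Both matchings cover equally many vertices, and \<open>N\<close> covers the two
    vertices \<open>u\<close> and \<open>w\<close> that \<open>M\<close> misses. So \<open>M\<close>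
    covers two vertices that \<open>N\<close> misses, one of them other than
    \<open>v\<close>.\<close>
  have "card (\<Union>M) = card (\<Union>N)" using card_Union_matching[OF g V] M N by simp
  then have eq: "card (\<Union>M - \<Union>N) = card (\<Union>N - \<Union>M)"
    using fin by (simp add: card_Diff_subset_Int Int_commute)
  have "card {u, w} \<le> card (\<Union>N - \<Union>M)" using fin uwN M by (intro card_mono) auto
  then have "2 \<le> card (\<Union>M - \<Union>N)" using eq \<open>u \<noteq> w\<close> by simp
  then have "\<not> (\<Union>M - \<Union>N \<subseteq> {v})" using card_mono[of "{v}" "\<Union>M - \<Union>N"] by auto
  then obtain x where x: "x \<in> \<Union>M" "x \<notin> \<Union>N" "x \<noteq> v" by blast
  then obtain e where e: "e \<in> M" "x \<in> e" by auto
  have eE: "e \<in> E" "card e = 2" using e M(1) g unfolding matching_def graph_on_def by auto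
  obtain y where y: "e = {x, y}" "x \<noteq> y"
  proof -
    obtain a b where ab: "e = {a, b}" "a \<noteq> b" using eE(2) card_2_iff by metis
    show thesis
    proof (cases "x = a")
      case True then show thesis using that[of b] ab by blast
    next
      case False then show thesis using that[of a] ab e(2) by blast
    qed
  qed
  have "y \<in> \<Union>N"
  proof (rule ccontr)
    assume "y \<notin> \<Union>N"
    then have "matching E (insert e N)" using matching_insert[OF N(1) eE(1)] x(2) y by auto
    then have "card (insert e N) \<le> mu E" using mu_ge[OF fE] by blast
    moreover have "e \<notin> N" using x(2) e by auto
    ultimately show False using N(2) fin by simp
  qed
  then obtain e' where e': "e' \<in> N" "y \<in> e'" by auto
  \<comment> \<open>The exchange keeps the matching maximum and away from \<open>v\<close>. It gains
    the edge \<open>e\<close> of \<open>M\<close> at the expense of \<open>e'\<close>, which is not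
    in \<open>M\<close> because it shares \<open>y\<close> with \<open>e\<close>.\<close>
  define N' where "N' = insert e (N - {e'})"
  have eN: "e \<notin> N" using x(2) e by auto
  have "matching E N'" unfolding N'_def
  proof (rule matching_insert)
    show "matching E (N - {e'})" using matching_subset[OF N(1)] by auto
    show "e \<in> E" by fact
    show "e \<inter> \<Union>(N - {e'}) = {}" using y x(2) matching_unique[OF N(1) _ e'(1) _ e'(2)] by auto
  qed
  moreover have "card N' = mu E" unfolding N'_def using eN fin e' N(2)
    by (metis DiffD1 card.insert card_Suc_Diff1 finite_Diff)
  moreover have "v \<notin> \<Union>N'" using N(3) y x(3) \<open>y \<in> \<Union>N\<close> unfolding N'_def by auto
  ultimately have "P (M, N')" using M unfolding P_def by auto
  then have "card (M \<inter> N') \<le> card (M \<inter> N)" using p(2)[of "(M, N')"] MN by simp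
  moreover have "e' \<notin> M" using matching_unique[OF M(1) _ e(1), of e' y] e' y x(2) by auto
  then have "M \<inter> N' = insert e (M \<inter> N)" unfolding N'_def using e by auto
  ultimately show False using eN fin by simp
qed

text \<open>Induction on the number of vertices. A vertex in every maximum matching gets label
  \<open>0\<close>, and deleting it lowers the matching number. If there is none, then the classes
  of Gallai's relation are the components. The last clause bounds the labels by \<open>n\<close> on
  the vertex set \<open>{..<n}\<close>, so that labellings can be enumerated.\<close>

theorem tutte_berge:
  assumes "finite V" "graph_on V E"
  shows "\<exists>f. (\<forall>e\<in>E. \<not> viol f e) \<and> bnd V f \<le> mu E \<and> (\<forall>v\<in>V. f v = 0 \<or> (\<exists>u\<in>V. f v = Suc u))"
  using assms
proof (induction "card V" arbitrary: V E rule: less_induct)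
  case less
  note V = less.prems(1) and g = less.prems(2)
  have fE: "finite E" by (rule graph_on_finite[OF V g])
  define mx where "mx M \<longleftrightarrow> matching E M \<and> card M = mu E" for M
  show ?case
  proof (cases "\<exists>v\<in>V. \<forall>M. mx M \<longrightarrow> v \<in> \<Union>M")
    case True
    then obtain v where v: "v \<in> V" "\<And>M. mx M \<Longrightarrow> v \<in> \<Union>M" by blast
    define E' V' where "E' = {e \<in> E. v \<notin> e}" and "V' = V - {v}"
    have g': "graph_on V' E'" "finite V'" using g V unfolding graph_on_def E'_def V'_def by auto
    have "card V' < card V" using v V unfolding V'_def by (intro psubset_card_mono) auto
    from less.hyps[OF this g'(2,1)] obtain f where f: "\<forall>e\<in>E'. \<not> viol f e" "bnd V' f \<le> mu E'"
      "\<forall>u\<in>V'. f u = 0 \<or> (\<exists>w\<in>V'. f u = Suc w)" by blast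
    have mlt: "mu E' < mu E"
    proof (rule ccontr)
      assume a: "\<not> mu E' < mu E"
      have fE': "finite E'" using fE unfolding E'_def by auto
      obtain M where M: "matching E' M" "card M = mu E'" using mu_attained[OF fE'] .
      have ME: "matching E M" using M(1) matching_mono unfolding E'_def by blast
      then have "mx M" using a M mu_ge[OF fE ME] unfolding mx_def by auto
      then have "v \<in> \<Union>M" by (rule v)
      then show False using M(1) unfolding E'_def matching_def by auto
    qed
    define f' where "f' = f(v := 0)"
    have "\<forall>e\<in>E. \<not> viol f' e"
    proof
      fix e assume e: "e \<in> E"
      show "\<not> viol f' e"
      proof (cases "v \<in> e")
        case False
        then have "\<not> viol f e" using f(1) e unfolding E'_def by auto
        moreover have "\<And>u. u \<in> e \<Longrightarrow> f' u = f u" using False unfolding f'_def by auto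
        ultimately show ?thesis unfolding viol_def by simp
      next
        case True
        obtain u where "e = {v, u}" using True e g unfolding graph_on_def 
          by (auto simp: card_2_iff)
        then show ?thesis unfolding viol_def f'_def by auto
      qed
    qed
    moreover have "bnd V f' \<le> mu E"
    proof -
      have "{u \<in> V. f' u = 0} = insert v {u \<in> V'. f u = 0}" using v unfolding f'_def V'_def by auto
      then have 1: "card {u \<in> V. f' u = 0} = Suc (card {u \<in> V'. f u = 0})"
        using g'(2) unfolding V'_def by (subst card.insert[symmetric]) auto
      have 2: "f' ` V - {0} = f ` V' - {0}" unfolding f'_def V'_def by auto
      have 3: "{u \<in> V. f' u = c} = {u \<in> V'. f u = c}" if "c \<noteq> 0" for c
        using that unfolding f'_def V'_def by auto
      have "bnd V f' = Suc (bnd V' f)" unfolding bnd_def 1 2 using 3 by simp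
      then show ?thesis using f(2) mlt by simp
    qed
    moreover have "\<forall>u\<in>V. f' u = 0 \<or> (\<exists>w\<in>V. f' u = Suc w)"
      using f(3) unfolding f'_def V'_def by auto
    ultimately show ?thesis by blast
  next
    case False
    then have miss: "\<And>v. v \<in> V \<Longrightarrow> \<exists>M. mx M \<and> v \<notin> \<Union>M" by auto
    \<comment> \<open>For \<open>u \<noteq> v\<close> the relation says that no maximum matching
      misses both. Adjacent vertices are related, as otherwise their edge would enlarge a maximum
      matching, so no edge leaves a class.\<close>
    define r where "r u v \<longleftrightarrow> u = v \<or> (\<forall>M. mx M \<longrightarrow> u \<in> \<Union>M \<or> v \<in> \<Union>M)" for u v
    have rsym: "r u v \<Longrightarrow> r v u" for u v unfolding r_def by blast
    have rtrans: "r u w" if ruvw: "r u v" "r v w" "v \<in> V" for u v w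
    proof (rule ccontr)
      assume n: "\<not> r u w"
      then obtain M where M: "mx M" "u \<notin> \<Union>M" "w \<notin> \<Union>M" "u \<noteq> w" unfolding r_def by blast
      have "u \<noteq> v" "v \<noteq> w" using ruvw n by auto
      moreover obtain N where N: "mx N" "v \<notin> \<Union>N" using miss[OF ruvw(3)] by blast
      ultimately have "\<And>K. mx K \<Longrightarrow> u \<in> \<Union>K \<or> v \<in> \<Union>K" "\<And>K. mx K \<Longrightarrow> w \<in> \<Union>K \<or> v \<in> \<Union>K"
        using ruvw unfolding r_def by blast+
      then show False
        using gallai_transitive[OF V g ruvw(3), of N M u w] M N unfolding mx_def by blast
    qed
    define K where "K u = {v \<in> V. r u v}" for u
    \<comment> \<open>A class is named by its least vertex; the successor keeps the label
      \<open>0\<close> free.\<close>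
    define f where "f u = Suc (Min (K u))" for u
    have Kfin: "finite (K u)" for u using V unfolding K_def by auto
    have Kne: "u \<in> V \<Longrightarrow> u \<in> K u" for u unfolding K_def r_def by auto
    have Keq: "K u = K v" if "r u v" "u \<in> V" "v \<in> V" for u v
      unfolding K_def using rtrans rsym that by blast
    have adj: "r u v" if "{u, v} \<in> E" for u v
    proof (rule ccontr)
      assume "\<not> r u v"
      then obtain M where M: "mx M" "u \<notin> \<Union>M" "v \<notin> \<Union>M" "u \<noteq> v" unfolding r_def by blast
      then have "matching E (insert {u, v} M)" using matching_insert[OF _ that] unfolding mx_def by auto
      then have "card (insert {u, v} M) \<le> mu E" using mu_ge[OF fE] by blast
      moreover have "{u, v} \<notin> M" "finite M" using M fE finite_subset unfolding mx_def matching_def by auto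
      ultimately show False using M(1) unfolding mx_def by simp
    qed
    have feq: "f u = f v \<Longrightarrow> u \<in> V \<Longrightarrow> v \<in> V \<Longrightarrow> r u v" for u v
    proof -
      assume a: "f u = f v" "u \<in> V" "v \<in> V"
      then have "Min (K u) = Min (K v)" unfolding f_def by simp
      moreover have "Min (K u) \<in> K u" "Min (K v) \<in> K v" using Kfin Kne a by (auto intro!: Min_in)
      ultimately have "r u (Min (K u))" "r v (Min (K u))" "Min (K u) \<in> V" unfolding K_def by auto
      then show "r u v" using rtrans rsym by blast
    qed
    have edge: "\<exists>u v. e = {u, v} \<and> u \<in> V \<and> v \<in> V \<and> f u = f v" if e: "e \<in> E" for e
    proof -
      obtain u v where uv: "e = {u, v}" "u \<in> V" "v \<in> V" using graph_on_edge[OF g e] by blast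
      then have uv': "u \<in> V" "v \<in> V" "r u v" using e adj by auto
      have "f u = f v" using Keq[OF uv'(3,1,2)] unfolding f_def by simp
      then show ?thesis using uv uv' by blast
    qed
    have nv: "\<forall>e\<in>E. \<not> viol f e"
    proof
      fix e assume "e \<in> E"
      then obtain u v where "e = {u, v}" "f u = f v" using edge by blast
      then show "\<not> viol f e" unfolding viol_def by auto
    qed
    obtain M where M: "matching E M" "card M = mu E" using mu_attained[OF fE] .
    have fM: "finite M" using M(1) fE finite_subset unfolding matching_def by auto
    define Mc where "Mc c = {e \<in> M. e \<subseteq> {v \<in> V. f v = c}}" for c
    \<comment> \<open>Two vertices of one class that \<open>M\<close> misses would contradict their
      relation. So \<open>M\<close> misses at most one vertex of each class and matches the others
      inside the class.\<close>
    have half: "card {v \<in> V. f v = c} div 2 \<le> card (Mc c)" for c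
    proof -
      have "matching E (Mc c)" using matching_subset[OF M(1)] unfolding Mc_def by auto
      then have 1: "2 * card (Mc c) = card (\<Union>(Mc c))" using card_Union_matching[OF g V] by simp
      have sub: "{v \<in> V. f v = c} \<inter> \<Union>M \<subseteq> \<Union>(Mc c)"
      proof
        fix x assume "x \<in> {v \<in> V. f v = c} \<inter> \<Union>M"
        then obtain e where e: "e \<in> M" "x \<in> e" "f x = c" by auto
        then have "e \<in> E" using M(1) unfolding matching_def by auto
        then have "e \<subseteq> {v \<in> V. f v = c}" using edge[of e] e by auto
        then show "x \<in> \<Union>(Mc c)" using e unfolding Mc_def by auto
      qed
      have "x = y" if "x \<in> {v \<in> V. f v = c} - \<Union>M" "y \<in> {v \<in> V. f v = c} - \<Union>M" for x y
      proof -
        have "r x y" using that by (intro feq) auto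
        then show ?thesis using that M unfolding r_def mx_def by blast
      qed
      moreover have "finite ({v \<in> V. f v = c} - \<Union>M)" using V by auto
      ultimately have "card ({v \<in> V. f v = c} - \<Union>M) \<le> 1"
        unfolding One_nat_def by (subst card_le_Suc0_iff_eq) blast+
      moreover have "card {v \<in> V. f v = c} = card ({v \<in> V. f v = c} - \<Union>M) + card ({v \<in> V. f v = c} \<inter> \<Union>M)"
        using V card_Int_Diff[of "{v \<in> V. f v = c}" "\<Union>M"] by simp
      moreover have "card ({v \<in> V. f v = c} \<inter> \<Union>M) \<le> card (\<Union>(Mc c))"
        using sub V by (intro card_mono) (auto simp: Mc_def intro: finite_subset[OF _ V])
      ultimately show ?thesis using 1 by linarith
    qed
    have "bnd V f \<le> (\<Sum>c\<in>f ` V. card (Mc c))"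
    proof -
      have "0 \<notin> f ` V" unfolding f_def by auto
      then have e: "{v \<in> V. f v = 0} = {}" "f ` V - {0} = f ` V" unfolding f_def by auto
      show ?thesis unfolding bnd_def e by (auto intro!: sum_mono half)
    qed
    also have "\<dots> = card (\<Union>c\<in>f ` V. Mc c)"
    proof (rule card_UN_disjoint[symmetric])
      show "finite (f ` V)" using V by auto
      show "\<forall>i\<in>f ` V. finite (Mc i)" using fM unfolding Mc_def by auto
      have "Mc i \<inter> Mc j = {}" if "i \<noteq> j" for i j
      proof -
        have "e = {}" if "e \<in> Mc i" "e \<in> Mc j" for e using that \<open>i \<noteq> j\<close> unfolding Mc_def by auto
        moreover have "{} \<notin> M" using M(1) g unfolding matching_def graph_on_def by auto
        ultimately show ?thesis unfolding Mc_def by blast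
      qed
      then show "\<forall>i\<in>f ` V. \<forall>j\<in>f ` V. i \<noteq> j \<longrightarrow> Mc i \<inter> Mc j = {}" by blast
    qed
    also have "\<dots> \<le> card M" using fM unfolding Mc_def by (intro card_mono) auto
    finally have "bnd V f \<le> mu E" using M(2) by simp
    moreover have "\<forall>v\<in>V. f v = 0 \<or> (\<exists>u\<in>V. f v = Suc u)"
    proof
      fix v assume "v \<in> V"
      then have "Min (K v) \<in> K v" using Kfin Kne by (intro Min_in) auto
      then show "f v = 0 \<or> (\<exists>u\<in>V. f v = Suc u)" unfolding f_def K_def by auto
    qed
    ultimately show ?thesis using nv by blast
  qed
qed


section \<open>Small covers\<close>

text \<open>This makes \<open>w\<close> a substitute for \<open>G\<close>: an optimal labelling for
  \<open>w\<close> and all later edges may violate edges of \<open>G\<close>, and \<open>C\<close>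
  repairs it at a price of at most \<open>Q\<close>. Bounding the labels by \<open>L\<close> leaves
  finitely many labellings of the vertices to check.\<close>

definition covers :: "nat \<Rightarrow> nat \<Rightarrow> nat \<Rightarrow> nat set set \<Rightarrow> nat set set \<Rightarrow> bool" where
  "covers L N Q w G \<longleftrightarrow> (\<forall>f. (\<forall>v<N. f v \<le> L) \<and> (\<forall>e\<in>w. \<not> viol f e) \<longrightarrow>
     (\<exists>C. C \<subseteq> {..<N} \<and> card C \<le> Q \<and> (\<forall>e\<in>G. viol f e \<longrightarrow> e \<inter> C \<noteq> {})))"

text \<open>Take an optimal labelling for \<open>w \<union> X\<close>. It can violate only edges of
  \<open>G\<close>, and giving label \<open>0\<close> to a cover \<open>C\<close> of these yields a
  certificate for \<open>G \<union> X\<close> whose bound is larger by at most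
  \<open>card C\<close>.\<close>

lemma covers_mu:
  assumes c: "covers L N Q w G" and NL: "N \<le> L"
    and g: "graph_on {..<N} (G \<union> X)" "graph_on {..<N} (w \<union> X)"
  shows "mu (G \<union> X) \<le> mu (w \<union> X) + Q"
proof -
  obtain f where f: "\<forall>e\<in>w \<union> X. \<not> viol f e" "bnd {..<N} f \<le> mu (w \<union> X)"
    "\<forall>v\<in>{..<N}. f v = 0 \<or> (\<exists>u\<in>{..<N}. f v = Suc u)"
    using tutte_berge[OF _ g(2)] by blast
  have "\<forall>v<N. f v \<le> L"
  proof (intro allI impI)
    fix v assume "v < N"
    then have "f v = 0 \<or> (\<exists>u<N. f v = Suc u)" using f(3) by auto
    then show "f v \<le> L" using NL by auto
  qed
  then have "(\<forall>v<N. f v \<le> L) \<and> (\<forall>e\<in>w. \<not> viol f e)" using f(1) by blast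
  from c[unfolded covers_def, THEN spec[of _ f], THEN mp, OF this]
  obtain C where C: "C \<subseteq> {..<N}" "card C \<le> Q" "\<forall>e\<in>G. viol f e \<longrightarrow> e \<inter> C \<noteq> {}"
    by (elim exE conjE)
  define f' where "f' = (\<lambda>v. if v \<in> C then 0 else f v)"
  have "\<forall>e\<in>G \<union> X. \<not> viol f' e"
  proof (intro ballI notI)
    fix e assume e: "e \<in> G \<union> X" and vi: "viol f' e"
    then obtain u v where uv: "u \<in> e" "v \<in> e" "f' u \<noteq> 0" "f' v \<noteq> 0" "f' u \<noteq> f' v" unfolding viol_def by blast
    then have nC: "u \<notin> C" "v \<notin> C" unfolding f'_def by (auto split: if_splits)
    then have "viol f e" using uv unfolding viol_def f'_def by auto
    then have "e \<in> G" using e f(1) by blast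
    then have ne: "e \<inter> C \<noteq> {}" using C(3) \<open>viol f e\<close> by blast
    obtain x y where "e = {x, y}" using graph_on_edge[OF g(1) e] by blast
    moreover have "u \<noteq> v" using uv by auto
    ultimately have "e = {u, v}" using uv(1,2) by auto
    then show False using ne nC by auto
  qed
  then have "card M \<le> bnd {..<N} f'" if "matching (G \<union> X) M" for M
    using matching_le_bnd[OF _ g(1)] that by blast
  then have "mu (G \<union> X) \<le> bnd {..<N} f'" by (intro mu_le graph_on_finite[OF _ g(1)]) auto
  also have "\<dots> \<le> bnd {..<N} f + card C" unfolding f'_def by (rule bnd_move) (use C in auto)
  finally show ?thesis using f(2) C(2) by linarith
qed

lemma covers_refl: "covers L N Q G G"
  unfolding covers_def by (intro allI impI exI[of _ "{}"]) auto

text \<open>A random subset of \<open>V\<close> contains \<open>a p\<close> but not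
  \<open>b p\<close> with probability \<open>1 / 4\<close>, so some subset is right for a quarter of
  the pairs. The index set \<open>P\<close> counts repeated pairs separately.\<close>

lemma quarter_cut:
  fixes a b :: "'i \<Rightarrow> 'v"
  assumes P: "finite P" and V: "finite V" and ab: "\<And>p. p \<in> P \<Longrightarrow> a p \<in> V \<and> b p \<in> V \<and> a p \<noteq> b p"
  shows "\<exists>L. card P \<le> 4 * card {p\<in>P. a p \<in> L \<and> b p \<notin> L}"
proof (rule ccontr)
  assume "\<nexists>L. card P \<le> 4 * card {p\<in>P. a p \<in> L \<and> b p \<notin> L}"
  then have lt: "4 * card {p\<in>P. a p \<in> L \<and> b p \<notin> L} < card P" for L by (simp add: not_le)
  have each: "4 * card {L \<in> Pow V. a p \<in> L \<and> b p \<notin> L} = 2 ^ card V" if p: "p \<in> P" for p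
  proof -
    have "{L \<in> Pow V. a p \<in> L \<and> b p \<notin> L} = insert (a p) ` Pow (V - {a p, b p})"
    proof (intro equalityI subsetI)
      fix L assume "L \<in> {L \<in> Pow V. a p \<in> L \<and> b p \<notin> L}"
      then have "L = insert (a p) (L - {a p})" "L - {a p} \<in> Pow (V - {a p, b p})" by auto
      then show "L \<in> insert (a p) ` Pow (V - {a p, b p})" by blast
    qed (use ab[OF p] in auto)
    moreover have "inj_on (insert (a p)) (Pow (V - {a p, b p}))" by (intro inj_onI) blast
    ultimately have "card {L \<in> Pow V. a p \<in> L \<and> b p \<notin> L} = 2 ^ card (V - {a p, b p})"
      using V by (simp add: card_image card_Pow)
    moreover have "card V = Suc (Suc (card (V - {a p, b p})))"
    proof -
      have "card (V - {a p, b p}) = card V - card {a p, b p}" using ab[OF p] V by (intro card_Diff_subset) auto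
      moreover have "card {a p, b p} \<le> card V" using ab[OF p] V by (intro card_mono) auto
      ultimately show ?thesis using ab[OF p] by simp
    qed
    ultimately show ?thesis by simp
  qed
  have "card P * 2 ^ card V = (\<Sum>p\<in>P. 4 * card {L \<in> Pow V. a p \<in> L \<and> b p \<notin> L})" using each by simp
  also have "\<dots> = (\<Sum>p\<in>P. \<Sum>L\<in>Pow V. 4 * of_bool (a p \<in> L \<and> b p \<notin> L))"
    using V by (intro sum.cong refl) (simp add: sum_distrib_left[symmetric] of_bool_def sum.If_cases Int_def)
  also have "\<dots> = (\<Sum>L\<in>Pow V. \<Sum>p\<in>P. 4 * of_bool (a p \<in> L \<and> b p \<notin> L))" by (rule sum.swap)
  also have "\<dots> = (\<Sum>L\<in>Pow V. 4 * card {p\<in>P. a p \<in> L \<and> b p \<notin> L})"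
    using P by (intro sum.cong refl) (simp add: sum_distrib_left[symmetric] of_bool_def sum.If_cases Int_def)
  also have "\<dots> < (\<Sum>L\<in>Pow V. card P)" by (rule sum_strict_mono) (use V lt in auto)
  also have "\<dots> = card P * 2 ^ card V" using V by (simp add: card_Pow)
  finally show False by simp
qed

text \<open>The cost \<open>c\<close> makes the derandomization of picking \<open>s\<close> random elements inductive.\<close>

lemma pick_sequence:
  fixes w :: "'a \<Rightarrow> 'a \<Rightarrow> real" and \<alpha> :: real
  assumes F: "finite F" "F \<noteq> {}" and w: "(\<Sum>x\<in>F. \<Sum>y\<in>F. w x y) \<le> \<alpha> * (card F)^2" and \<alpha>: "0 \<le> \<alpha>"
  shows "\<exists>x. (\<forall>i<s. x i \<in> F) \<and> (\<Sum>i<s. \<Sum>j<s. if i = j then 0 else w (x i) (x j)) + (\<Sum>i<s. c (x i))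
     \<le> (real s)^2 * \<alpha> + s * ((\<Sum>y\<in>F. c y) / card F)"
proof (induction s arbitrary: c)
  case (Suc s)
  let ?n = "real (card F)"
  have n: "?n > 0" using F by (simp add: card_gt_0_iff)
  \<comment> \<open>\<open>r y\<close> is the expected weight between \<open>y\<close> and one
    random further element. The next pick \<open>y\<close> is one for which its cost plus the
    expected weight to the \<open>s\<close> remaining elements is at most average.\<close>
  define r where "r y = (\<Sum>z\<in>F. w y z + w z y) / ?n" for y
  have "\<exists>y\<in>F. c y + s * r y \<le> (\<Sum>y\<in>F. c y) / ?n + 2 * s * \<alpha>"
  proof (rule ccontr)
    assume "\<not> ?thesis"
    then have "(\<Sum>y\<in>F. (\<Sum>y\<in>F. c y) / ?n + 2 * s * \<alpha>) < (\<Sum>y\<in>F. c y + s * r y)"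
      using F by (intro sum_strict_mono) (auto simp: not_le)
    also have "\<dots> = (\<Sum>y\<in>F. c y) + s * (\<Sum>y\<in>F. r y)" by (simp add: sum.distrib sum_distrib_left)
    also have "(\<Sum>y\<in>F. r y) = ((\<Sum>y\<in>F. \<Sum>z\<in>F. w y z) + (\<Sum>y\<in>F. \<Sum>z\<in>F. w z y)) / ?n"
      unfolding r_def by (simp add: sum_divide_distrib[symmetric] sum.distrib)
    also have "(\<Sum>y\<in>F. \<Sum>z\<in>F. w z y) = (\<Sum>y\<in>F. \<Sum>z\<in>F. w y z)" by (rule sum.swap)
    also have "((\<Sum>y\<in>F. \<Sum>z\<in>F. w y z) + (\<Sum>y\<in>F. \<Sum>z\<in>F. w y z)) / ?n \<le> 2 * (\<alpha> * ?n^2) / ?n"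
      using w n by (intro divide_right_mono) auto
    also have "\<dots> = 2 * \<alpha> * ?n" using n by (simp add: power2_eq_square)
    finally have "?n * ((\<Sum>y\<in>F. c y) / ?n + 2 * s * \<alpha>) < (\<Sum>y\<in>F. c y) + s * (2 * \<alpha> * ?n)"
      by (simp add: mult_left_mono)
    then show False using n by (simp add: field_simps)
  qed
  then obtain y where y: "y \<in> F" "c y + s * r y \<le> (\<Sum>y\<in>F. c y) / ?n + 2 * s * \<alpha>" by blast
  \<comment> \<open>The weights between \<open>y\<close> and the elements still to be picked become
    part of their cost.\<close>
  define c' where "c' z = c z + (w y z + w z y)" for z
  obtain x where x: "\<forall>i<s. x i \<in> F" "(\<Sum>i<s. \<Sum>j<s. if i = j then 0 else w (x i) (x j)) + (\<Sum>i<s. c' (x i))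
     \<le> (real s)^2 * \<alpha> + s * ((\<Sum>y\<in>F. c' y) / card F)" using Suc.IH[of c'] by blast
  have c'F: "(\<Sum>z\<in>F. c' z) / ?n = (\<Sum>z\<in>F. c z) / ?n + r y"
    unfolding c'_def r_def by (simp add: sum.distrib add_divide_distrib)
  define x' where "x' = x(s := y)"
  have in_F: "\<forall>i<Suc s. x' i \<in> F" using x(1) y(1) unfolding x'_def by auto
  have e: "(\<Sum>i<s. \<Sum>j<s. if i = j then 0 else w (x' i) (x' j)) = (\<Sum>i<s. \<Sum>j<s. if i = j then 0 else w (x i) (x j))"
    unfolding x'_def by (intro sum.cong) auto
  have "(\<Sum>i<Suc s. \<Sum>j<Suc s. if i = j then 0 else w (x' i) (x' j)) + (\<Sum>i<Suc s. c (x' i))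
    = (\<Sum>i<s. \<Sum>j<s. if i = j then 0 else w (x i) (x j)) + (\<Sum>i<s. w (x i) y) + (\<Sum>j<s. w y (x j)) + (\<Sum>i<s. c (x i)) + c y"
    by (simp add: sum.distrib e) (simp add: x'_def)
  also have "\<dots> = (\<Sum>i<s. \<Sum>j<s. if i = j then 0 else w (x i) (x j)) + (\<Sum>i<s. c' (x i)) + c y"
    unfolding c'_def by (simp add: sum.distrib)
  also have "\<dots> \<le> (real s)^2 * \<alpha> + s * ((\<Sum>z\<in>F. c z) / ?n) + (c y + s * r y)"
    using x(2) c'F by (simp add: algebra_simps)
  also have "\<dots> \<le> (real s)^2 * \<alpha> + s * ((\<Sum>z\<in>F. c z) / ?n) + ((\<Sum>y\<in>F. c y) / ?n + 2 * s * \<alpha>)"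
    using y(2) by simp
  \<comment> \<open>\<open>s\<^sup>2 + 2 s\<close> is one less than \<open>(s + 1)\<^sup>2\<close>,
    which leaves a spare \<open>\<alpha>\<close>.\<close>
  also have "\<dots> = (real (Suc s))^2 * \<alpha> + Suc s * ((\<Sum>y\<in>F. c y) / ?n) - \<alpha>"
    by (simp add: power2_eq_square algebra_simps add_divide_distrib)
  finally have "(\<Sum>i<Suc s. \<Sum>j<Suc s. if i = j then 0 else w (x' i) (x' j)) + (\<Sum>i<Suc s. c (x' i))
    \<le> (real (Suc s))^2 * \<alpha> + Suc s * ((\<Sum>y\<in>F. c y) / ?n) - \<alpha>" .
  then have "(\<Sum>i<Suc s. \<Sum>j<Suc s. if i = j then 0 else w (x' i) (x' j)) + (\<Sum>i<Suc s. c (x' i))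
    \<le> (real (Suc s))^2 * \<alpha> + Suc s * ((\<Sum>y\<in>F. c y) / ?n)" using \<alpha> by linarith
  then show ?case using in_F by blast
qed simp

section \<open>Ruzsa--Szemeredi numbers and families of induced matchings\<close>

lemma split_into_parts:
  assumes "finite S" "1 \<le> r"
  shows "\<exists>Q. disjoint Q \<and> finite Q \<and> (\<forall>q\<in>Q. q \<subseteq> S \<and> card q = r) \<and> card Q = card S div r"
  using assms
proof (induction "card S" arbitrary: S rule: less_induct)
  case less
  show ?case
  proof (cases "card S < r")
    case True
    then show ?thesis by (intro exI[of _ "{}"]) auto
  next
    case False
    then obtain q where q: "q \<subseteq> S" "card q = r" by (meson not_less obtain_subset_with_card_n)
    have fq: "finite q" using q less.prems finite_subset by auto
    have c: "card (S - q) = card S - r" using q fq by (simp add: card_Diff_subset)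
    then have "card (S - q) < card S" using False less.prems by simp
    then obtain Q where Q: "disjoint Q" "finite Q" "\<forall>p\<in>Q. p \<subseteq> S - q \<and> card p = r" "card Q = card (S - q) div r"
      using less.hyps[of "S - q"] less.prems by auto
    have "q \<noteq> {}" using q less.prems by auto
    then have nq: "q \<notin> Q" using Q(3) by blast
    have "disjoint (insert q Q)" using Q(1,3) unfolding pairwise_insert disjnt_def by blast
    moreover have "card (insert q Q) = card S div r"
      using nq Q(2,4) c False less.prems by (simp add: le_div_geq)
    ultimately show ?thesis using Q q by (intro exI[of _ "insert q Q"]) auto
  qed
qed

text \<open>Indexed by the integer size of the matchings, because the hashed graphs lead to sizes
  and vertex numbers other than those of \<open>RS n \<beta>\<close>.\<close>

definition RSn :: "nat \<Rightarrow> nat \<Rightarrow> nat" where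
  "RSn n r = Max (insert 0 {card E |E. simple_graph n E \<and> (\<exists>t. RS_graph r t E)})"

lemma simple_graph_iff: "simple_graph n E \<longleftrightarrow> graph_on {..<n} E"
  unfolding simple_graph_def graph_on_def ..

lemma RSn_sizes_finite: "finite {card E |E. simple_graph n E \<and> (\<exists>t. RS_graph r t E)}"
proof (rule finite_subset)
  show "{card E |E. simple_graph n E \<and> (\<exists>t. RS_graph r t E)} \<subseteq> card ` Pow (Pow {..<n})"
    unfolding simple_graph_def by auto
qed simp

lemma RSn_ge: "graph_on {..<n} E \<Longrightarrow> RS_graph r t E \<Longrightarrow> card E \<le> RSn n r"
  unfolding RSn_def by (rule Max_ge) (use RSn_sizes_finite in \<open>auto simp: simple_graph_iff\<close>)

lemma RSn_attained:
  assumes "RSn n r > 0" obtains E t where "graph_on {..<n} E" "RS_graph r t E" "card E = RSn n r"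
proof -
  have "RSn n r \<in> insert 0 {card E |E. simple_graph n E \<and> (\<exists>t. RS_graph r t E)}"
    unfolding RSn_def by (rule Max_in) (use RSn_sizes_finite in auto)
  then show thesis using assms that by (auto simp: simple_graph_iff)
qed

lemma RS_RSn: "RS n \<beta> = RSn n (nat \<lceil>\<beta> * real n\<rceil>)"
  unfolding RS_def RSn_def ..

text \<open>The matchings may have different sizes: each is cut into parts of size \<open>r\<close>,
  and a remainder is discarded. The parts must be induced and not only the whole matchings, so
  \<open>ind\<close> speaks of every subset \<open>T\<close>.\<close>

lemma RSn_family:
  assumes r: "1 \<le> r" and I: "finite I" and g: "\<And>i. i \<in> I \<Longrightarrow> graph_on {..<N} (S i)"
    and m: "\<And>i. i \<in> I \<Longrightarrow> disjoint (S i)"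
    and d: "\<And>i j. i \<in> I \<Longrightarrow> j \<in> I \<Longrightarrow> i \<noteq> j \<Longrightarrow> S i \<inter> S j = {}"
    and ind: "\<And>i j e T. i \<in> I \<Longrightarrow> j \<in> I \<Longrightarrow> e \<in> S j \<Longrightarrow> T \<subseteq> S i \<Longrightarrow> e \<subseteq> \<Union>T \<Longrightarrow> e \<in> T"
  shows "(\<Sum>i\<in>I. card (S i) div r) * r \<le> RSn N r"
proof -
  have fS: "i \<in> I \<Longrightarrow> finite (S i)" for i using g graph_on_finite by blast
  have "\<forall>i\<in>I. \<exists>Q. disjoint Q \<and> finite Q \<and> (\<forall>q\<in>Q. q \<subseteq> S i \<and> card q = r) \<and> card Q = card (S i) div r"
    using split_into_parts[OF fS r] by blast
  then obtain Q where Q: "\<And>i. i \<in> I \<Longrightarrow> disjoint (Q i) \<and> finite (Q i) \<and> (\<forall>q\<in>Q i. q \<subseteq> S i \<and> card q = r) \<and> card (Q i) = card (S i) div r"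
    by (metis (no_types, lifting) bchoice)
  define P where "P = (\<Union>i\<in>I. Q i)"
  have fP: "finite P" using I Q unfolding P_def by auto
  have cP: "card p = r" if "p \<in> P" for p using that Q unfolding P_def by auto
  have ne: "p \<noteq> {}" if "p \<in> P" for p using cP[OF that] r by auto
  have dP: "disjoint P"
    unfolding pairwise_def disjnt_def
  proof (intro ballI impI)
    fix p q assume pq: "p \<in> P" "q \<in> P" "p \<noteq> q"
    then obtain i j where ij: "i \<in> I" "j \<in> I" "p \<in> Q i" "q \<in> Q j" unfolding P_def by auto
    show "p \<inter> q = {}"
    proof (cases "i = j")
      case True then show ?thesis using Q[OF ij(1)] ij pq(3) unfolding pairwise_def disjnt_def by auto
    next
      case False then show ?thesis using d[OF ij(1,2)] Q[OF ij(1)] Q[OF ij(2)] ij by blast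
    qed
  qed
  have "card P = (\<Sum>i\<in>I. card (Q i))" unfolding P_def
  proof (rule card_UN_disjoint[OF I])
    show "\<forall>i\<in>I. finite (Q i)" using Q by blast
    show "\<forall>i\<in>I. \<forall>j\<in>I. i \<noteq> j \<longrightarrow> Q i \<inter> Q j = {}"
    proof (intro ballI impI)
      fix i j assume ij: "i \<in> I" "j \<in> I" "i \<noteq> j"
      show "Q i \<inter> Q j = {}"
      proof (rule ccontr)
        assume "Q i \<inter> Q j \<noteq> {}"
        then obtain q where q: "q \<in> Q i" "q \<in> Q j" by blast
        then have "q \<subseteq> S i" "q \<subseteq> S j" "q \<noteq> {}" using Q ij ne[of q] unfolding P_def by blast+
        then show False using d[OF ij] by blast
      qed
    qed
  qed
  also have "\<dots> = (\<Sum>i\<in>I. card (S i) div r)" using Q by (intro sum.cong) auto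
  finally have cardP: "card P = (\<Sum>i\<in>I. card (S i) div r)" .
  show ?thesis
  proof (cases "P = {}")
    case True
    then show ?thesis using cardP by simp
  next
    case False
    define E where "E = \<Union>P"
    have sub: "E \<subseteq> (\<Union>i\<in>I. S i)" using Q unfolding E_def P_def by blast
    then have gE: "graph_on {..<N} E" using g unfolding graph_on_def by blast
    have "card E = (\<Sum>p\<in>P. card p)" unfolding E_def
      by (rule card_Union_disjoint[OF dP]) (use cP r in \<open>auto intro: card_ge_0_finite\<close>)
    also have "\<dots> = card P * r" using cP by simp
    finally have cE: "card E = card P * r" .
    have "RS_graph r (card P) E"
      unfolding RS_graph_def
    proof (intro conjI exI[of _ P])
      show "1 \<le> card P" using False fP by (simp add: Suc_le_eq card_gt_0_iff)
      show "partition_on E P" using dP ne unfolding partition_on_def E_def by blast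
      show "\<forall>M\<in>P. induced_matching E M \<and> card M = r"
      proof (intro ballI conjI)
        fix M assume M: "M \<in> P"
        then obtain i where i: "i \<in> I" "M \<in> Q i" unfolding P_def by auto
        then have MS: "M \<subseteq> S i" using Q by blast
        show "card M = r" using cP[OF M] .
        have "matching E M" unfolding matching_def
          using M m[OF i(1)] MS pairwise_subset unfolding E_def by blast
        moreover have "e \<in> M" if "e \<in> E" "e \<subseteq> \<Union>M" for e
        proof -
          from that(1) sub have "e \<in> (\<Union>i\<in>I. S i)" by (rule subsetD[rotated])
          then obtain j where "j \<in> I" "e \<in> S j" by auto
          then show ?thesis using ind[OF i(1) _ _ MS that(2)] by blast
        qed
        moreover have "M \<subseteq> E" using M unfolding E_def by blast
        ultimately show "induced_matching E M" unfolding induced_matching_def by blast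
      qed
    qed (use r in auto)
    then show ?thesis using RSn_ge[OF gE] cE cardP by metis
  qed
qed


section \<open>Popular edges and small covers\<close>

definition cut :: "nat set \<times> nat set \<Rightarrow> nat set set" where
  "cut x = {{u, v} |u v. u \<in> fst x \<and> v \<in> snd x}"

text \<open>If no edge were popular, then picking \<open>s\<close> random pairs, deleting from each matching the edges
  in the other cuts, and directing everything across one global cut would leave induced matchings with
  too many edges for a Ruzsa--Szemeredi graph.\<close>

lemma popular_edge:
  fixes F :: "(nat set \<times> nat set) set"
  assumes r: "1 \<le> r" and F: "finite F" "F \<noteq> {}" and G: "graph_on {..<N} G" and R: "r \<le> RSn N r"
    and FM: "\<And>x. x \<in> F \<Longrightarrow> \<exists>M. matching (G \<inter> cut x) M \<and> card M = 16 * r"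
  shows "\<exists>e\<in>G. r * card F \<le> 4 * RSn N r * card {x \<in> F. e \<in> cut x}"
proof (rule ccontr)
  assume "\<not> ?thesis"
  then have unpop: "4 * RSn N r * card {x \<in> F. e \<in> cut x} \<le> r * card F" if "e \<in> G" for e
    using that by (meson nat_le_linear)
  define R where "R = RSn N r"
  have R1: "1 \<le> R" using R r unfolding R_def by simp
  \<comment> \<open>The least \<open>s\<close> with \<open>s * r > R\<close>: induced matchings with
    \<open>s * r\<close> edges in total would exceed the RS number, while \<open>s * r\<close> is
    still at most \<open>2 * R\<close>.\<close>
  define s where "s = R div r + 1"
  have "R < s * r" unfolding s_def using r by (metis add.commute dividend_less_div_times less_eq_Suc_le One_nat_def mult_Suc plus_1_eq_Suc)
  have srR: "s * r \<le> 2 * R" using R unfolding s_def R_def by (simp add: algebra_simps) (metis add_mono div_times_less_eq_dividend mult_2 mult.commute)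
  obtain M where M: "\<And>x. x \<in> F \<Longrightarrow> matching (G \<inter> cut x) (M x) \<and> card (M x) = 16 * r"
    using bchoice[of F "\<lambda>x M. matching (G \<inter> cut x) M \<and> card M = 16 * r"] FM by blast
  have fG: "finite G" using graph_on_finite[OF _ G] by simp
  have fM: "finite (M x)" if "x \<in> F" for x using M[OF that] r by (intro card_ge_0_finite) auto
  define w where "w x y = real (card (M x \<inter> cut y))" for x y
  \<comment> \<open>The average weight of a pair: each of the \<open>16 * r\<close> edges of a
    matching lies in at most \<open>r * card F / (4 * R)\<close> of the cuts.\<close>
  define \<alpha> where "\<alpha> = 4 * (real r)^2 / R"
  have "(\<Sum>y\<in>F. w x y) \<le> \<alpha> * card F" if x: "x \<in> F" for x
  proof -
    have "(\<Sum>y\<in>F. card (M x \<inter> cut y)) = (\<Sum>y\<in>F. \<Sum>e\<in>M x. of_bool (e \<in> cut y))"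
      using fM[OF x] by (intro sum.cong refl) (simp add: of_bool_def sum.If_cases)
    also have "\<dots> = (\<Sum>e\<in>M x. \<Sum>y\<in>F. of_bool (e \<in> cut y))" by (rule sum.swap)
    also have "\<dots> = (\<Sum>e\<in>M x. card {y \<in> F. e \<in> cut y})"
      using F by (intro sum.cong refl) (simp add: of_bool_def sum.If_cases Int_def)
    finally have "4 * R * (\<Sum>y\<in>F. card (M x \<inter> cut y)) = (\<Sum>e\<in>M x. 4 * R * card {y \<in> F. e \<in> cut y})"
      by (simp add: sum_distrib_left)
    also have "\<dots> \<le> (\<Sum>e\<in>M x. r * card F)"
      using M[OF x] unpop unfolding matching_def R_def by (intro sum_mono) auto
    also have "\<dots> = 16 * r * (r * card F)" using M[OF x] by simp
    finally have "real (4 * R * (\<Sum>y\<in>F. card (M x \<inter> cut y))) \<le> real (16 * r * (r * card F))"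
      by (rule of_nat_mono)
    then have "4 * real R * (\<Sum>y\<in>F. w x y) \<le> 16 * real r * (real r * card F)" unfolding w_def by simp
    then show ?thesis using R1 unfolding \<alpha>_def by (simp add: field_simps power2_eq_square)
  qed
  then have "(\<Sum>x\<in>F. \<Sum>y\<in>F. w x y) \<le> (\<Sum>x\<in>F. \<alpha> * card F)" by (intro sum_mono)
  also have "\<dots> = \<alpha> * (card F)^2" by (simp add: power2_eq_square)
  finally have "(\<Sum>x\<in>F. \<Sum>y\<in>F. w x y) \<le> \<alpha> * (card F)^2" .
  moreover have "0 \<le> \<alpha>" unfolding \<alpha>_def by simp
  ultimately obtain x where xF: "\<And>i. i < s \<Longrightarrow> x i \<in> F" and
    xw: "(\<Sum>i<s. \<Sum>j<s. if i = j then 0 else w (x i) (x j)) \<le> (real s)^2 * \<alpha>"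
    using pick_sequence[OF F, where w = w and \<alpha> = \<alpha> and s = s and c = "\<lambda>_. 0"] by auto
  define M' where "M' i = M (x i) - (\<Union>j\<in>{..<s} - {i}. cut (x j))" for i
  have M'card: "16 * r \<le> card (M' i) + (\<Sum>j<s. if i = j then 0 else card (M (x i) \<inter> cut (x j)))" if i: "i < s" for i
  proof -
    have "M (x i) \<subseteq> M' i \<union> (\<Union>j\<in>{..<s} - {i}. M (x i) \<inter> cut (x j))" unfolding M'_def by blast
    then have "card (M (x i)) \<le> card (M' i \<union> (\<Union>j\<in>{..<s} - {i}. M (x i) \<inter> cut (x j)))"
      using fM[OF xF[OF i]] by (intro card_mono) (auto simp: M'_def)
    also have "\<dots> \<le> card (M' i) + card (\<Union>j\<in>{..<s} - {i}. M (x i) \<inter> cut (x j))" by (rule card_Un_le)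
    also have "card (\<Union>j\<in>{..<s} - {i}. M (x i) \<inter> cut (x j)) \<le> (\<Sum>j\<in>{..<s} - {i}. card (M (x i) \<inter> cut (x j)))"
      by (rule card_UN_le) simp
    also have "\<dots> = (\<Sum>j\<in>{..<s} - {i}. if i = j then 0 else card (M (x i) \<inter> cut (x j)))" by (intro sum.cong) auto
    also have "\<dots> \<le> (\<Sum>j<s. if i = j then 0 else card (M (x i) \<inter> cut (x j)))"
      by (intro sum_mono2) auto
    finally show ?thesis using M[OF xF[OF i]] by simp
  qed
  \<comment> \<open>Origin of the constant \<open>16\<close>: by
    \<open>s\<^sup>2 \<alpha> \<le> 8 s r\<close> half of the \<open>16 s r\<close> edges survive
    the deletions, and a quarter of these the global cut. Rounding to multiples of \<open>r\<close>
    then leaves at least \<open>s r\<close>, which is more than \<open>R\<close>.\<close>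
  have "real (s * (16 * r)) \<le> real (\<Sum>i<s. card (M' i) + (\<Sum>j<s. if i = j then 0 else card (M (x i) \<inter> cut (x j))))"
    using sum_mono[of "{..<s}" "\<lambda>_. 16 * r", OF M'card] by (intro of_nat_mono) simp
  also have "\<dots> = real (\<Sum>i<s. card (M' i)) + (\<Sum>i<s. \<Sum>j<s. if i = j then 0 else w (x i) (x j))"
    unfolding w_def by (simp add: sum.distrib if_distrib[of real] cong: if_cong)
  also have "\<dots> \<le> real (\<Sum>i<s. card (M' i)) + (real s)^2 * \<alpha>" using xw by simp
  also have "(real s)^2 * \<alpha> \<le> 8 * (real s * real r)"
  proof -
    have "(real s)^2 * \<alpha> = 4 * (real s * real r) * (real (s * r) / R)" unfolding \<alpha>_def by (simp add: power2_eq_square)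
    also have "real (s * r) / R \<le> 2" using srR R1 by (simp add: divide_le_eq del: of_nat_mult)
    finally show ?thesis by (simp add: mult_left_mono)
  qed
  finally have "real (8 * (s * r)) \<le> real (\<Sum>i<s. card (M' i))" by (simp add: mult.commute)
  then have big: "8 * (s * r) \<le> (\<Sum>i<s. card (M' i))" by (simp only: of_nat_le_iff)
  define P where "P = Sigma {..<s} M'"
  have fM': "finite (M' i)" if "i < s" for i using fM[OF xF[OF that]] unfolding M'_def by auto
  have fP: "finite P" unfolding P_def using fM' by auto
  have M'M: "M' i \<subseteq> M (x i)" for i unfolding M'_def by auto
  have "\<forall>p\<in>P. \<exists>ab. snd p = {fst ab, snd ab} \<and> fst ab \<in> fst (x (fst p)) \<and> snd ab \<in> snd (x (fst p))"
  proof
    fix p assume "p \<in> P"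
    then have "snd p \<in> cut (x (fst p))" using M'M M xF unfolding P_def matching_def by fastforce
    then show "\<exists>ab. snd p = {fst ab, snd ab} \<and> fst ab \<in> fst (x (fst p)) \<and> snd ab \<in> snd (x (fst p))"
      unfolding cut_def by auto
  qed
  then obtain ab where ab: "\<And>p. p \<in> P \<Longrightarrow> snd p = {fst (ab p), snd (ab p)} \<and> fst (ab p) \<in> fst (x (fst p)) \<and> snd (ab p) \<in> snd (x (fst p))"
    using bchoice[of P "\<lambda>p ab. snd p = {fst ab, snd ab} \<and> fst ab \<in> fst (x (fst p)) \<and> snd ab \<in> snd (x (fst p))"] by blast
  have PG: "snd p \<in> G" if "p \<in> P" for p
    using that M'M M xF unfolding P_def matching_def by fastforce
  have abV: "fst (ab p) \<in> {..<N} \<and> snd (ab p) \<in> {..<N} \<and> fst (ab p) \<noteq> snd (ab p)" if p: "p \<in> P" for p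
  proof -
    have "snd p \<subseteq> {..<N}" "card (snd p) = 2" using PG[OF p] G unfolding graph_on_def by auto
    then show ?thesis using ab[OF p] by auto
  qed
  obtain L where L: "card P \<le> 4 * card {p \<in> P. fst (ab p) \<in> L \<and> snd (ab p) \<notin> L}"
    using quarter_cut[OF fP finite_lessThan[of N], of "\<lambda>p. fst (ab p)" "\<lambda>p. snd (ab p)"] abV by blast
  \<comment> \<open>All edges now lead from \<open>L\<close> to its complement. So an edge of
    \<open>S j\<close> inside the vertices of \<open>S i\<close> goes from the first to the second
    side of \<open>x i\<close>, which puts it into \<open>cut (x i)\<close> and forces
    \<open>i = j\<close>.\<close>
  define S where "S i = {e \<in> M' i. fst (ab (i, e)) \<in> L \<and> snd (ab (i, e)) \<notin> L}" for i
  have SM': "S i \<subseteq> M' i" for i unfolding S_def by auto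
  have fS: "finite (S i)" if "i < s" for i using finite_subset[OF SM' fM'[OF that]] .
  have "{p \<in> P. fst (ab p) \<in> L \<and> snd (ab p) \<notin> L} = Sigma {..<s} S" unfolding P_def S_def by auto
  then have cS: "card {p \<in> P. fst (ab p) \<in> L \<and> snd (ab p) \<notin> L} = (\<Sum>i<s. card (S i))"
    using fS by (simp add: card_SigmaI)
  have "card P = (\<Sum>i<s. card (M' i))" unfolding P_def using fM' by (simp add: card_SigmaI)
  then have S2: "2 * (s * r) \<le> (\<Sum>i<s. card (S i))" using big L cS by linarith
  have Se: "\<exists>u v. e = {u, v} \<and> u \<in> L \<and> v \<notin> L \<and> u \<in> fst (x i) \<and> v \<in> snd (x i)" if "i < s" "e \<in> S i" for i e
  proof -
    have "(i, e) \<in> P" using that SM' unfolding P_def by auto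
    from ab[OF this] show ?thesis using that(2) unfolding S_def by auto
  qed
  have "(\<Sum>i<s. card (S i) div r) * r \<le> RSn N r"
  proof (rule RSn_family[OF r])
    fix i assume "i \<in> {..<s}"
    then have i: "i < s" by simp
    have mi: "matching (G \<inter> cut (x i)) (M (x i))" using M xF[OF i] by blast
    show "graph_on {..<N} (S i)"
      using graph_on_mono[OF G] SM'[of i] M'M[of i] mi unfolding matching_def by blast
    show "disjoint (S i)" using pairwise_subset[of disjnt "M (x i)" "S i"] mi SM'[of i] M'M[of i] unfolding matching_def by blast
    fix j assume "j \<in> {..<s}"
    then have j: "j < s" by simp
    have mj: "matching (G \<inter> cut (x j)) (M (x j))" using M xF[OF j] by blast
    show "S i \<inter> S j = {}" if ij: "i \<noteq> j"
    proof (rule ccontr)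
      assume "S i \<inter> S j \<noteq> {}"
      then obtain e where e: "e \<in> S i" "e \<in> S j" by blast
      then have "e \<in> M (x j)" using SM' M'M by blast
      then have "e \<in> cut (x j)" using mj unfolding matching_def by blast
      moreover have "e \<in> M' i" using e SM' by blast
      ultimately show False using ij j unfolding M'_def by blast
    qed
    fix e T assume e: "e \<in> S j" and T: "T \<subseteq> S i" and eT: "e \<subseteq> \<Union>T"
    obtain u v where uv: "e = {u, v}" "u \<in> L" "v \<notin> L" using Se[OF j e] by blast
    then obtain e1 e2 where e12: "e1 \<in> T" "u \<in> e1" "e2 \<in> T" "v \<in> e2" using eT by auto
    obtain u1 v1 where u1: "e1 = {u1, v1}" "u1 \<in> L" "v1 \<notin> L" "u1 \<in> fst (x i)" using Se[OF i, of e1] e12(1) T by blast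
    obtain u2 v2 where u2: "e2 = {u2, v2}" "u2 \<in> L" "v2 \<notin> L" "v2 \<in> snd (x i)" using Se[OF i, of e2] e12(3) T by blast
    have "u = u1" "v = v2" using u1 u2 uv e12 by auto
    then have "e \<in> cut (x i)" using uv(1) u1 u2 unfolding cut_def by auto
    then have "i = j" using e SM'[of j] i unfolding M'_def by blast
    then have "e \<in> M (x i)" "e1 \<in> M (x i)" using e e12(1) T SM'[of i] M'M[of i] by blast+
    then have "e = e1" using matching_unique[OF mi _ _ _ e12(2)] uv(1) by blast
    then show "e \<in> T" using e12 by simp
  qed simp
  moreover have "s * r \<le> (\<Sum>i<s. card (S i) div r) * r"
  proof -
    have "card (S i) \<le> (card (S i) div r) * r + r" for i
      using mod_less_divisor[of r "card (S i)"] r div_mult_mod_eq[of "card (S i)" r] by linarith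
    then have "(\<Sum>i<s. card (S i)) \<le> (\<Sum>i<s. (card (S i) div r) * r + r)" by (intro sum_mono)
    also have "\<dots> = (\<Sum>i<s. card (S i) div r) * r + s * r" by (simp add: sum.distrib sum_distrib_right)
    finally show ?thesis using S2 by linarith
  qed
  ultimately show False using \<open>R < s * r\<close> unfolding R_def by linarith
qed

text \<open>Choosing an element that hits a fraction \<open>1 / \<kappa>\<close> of what is left
  lowers \<open>\<kappa> * ln (card F)\<close> by at least one, since
  \<open>ln (1 - 1 / \<kappa>) \<le> - (1 / \<kappa>)\<close>.\<close>

lemma greedy_hitting_set:
  fixes \<kappa> :: real and hit :: "'e \<Rightarrow> 'x \<Rightarrow> bool"
  assumes \<kappa>: "1 \<le> \<kappa>" and F: "finite F" "F \<noteq> {}"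
    and pop: "\<And>F'. F' \<subseteq> F \<Longrightarrow> F' \<noteq> {} \<Longrightarrow> \<exists>e\<in>G. card F' \<le> \<kappa> * card {x\<in>F'. hit e x}"
  shows "\<exists>w\<subseteq>G. finite w \<and> card w \<le> \<kappa> * ln (card F) + 1 \<and> (\<forall>x\<in>F. \<exists>e\<in>w. hit e x)"
  using F pop
proof (induction "card F" arbitrary: F rule: less_induct)
  case less
  obtain e where e: "e \<in> G" "card F \<le> \<kappa> * card {x\<in>F. hit e x}" using less.prems(3)[of F] less.prems(2) by blast
  define F' where "F' = {x\<in>F. \<not> hit e x}"
  have cF: "card F > 0" using less.prems by (simp add: card_gt_0_iff)
  have fF': "finite F'" using less.prems(1) unfolding F'_def by simp
  have "{x\<in>F. hit e x} = F - F'" unfolding F'_def by auto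
  then have c: "real (card {x\<in>F. hit e x}) = card F - real (card F')"
    using less.prems(1) unfolding F'_def by (simp add: card_Diff_subset of_nat_diff card_mono)
  have l: "real (card F') \<le> (1 - 1 / \<kappa>) * card F"
    using e(2) \<kappa> unfolding c by (simp add: field_simps)
  show ?case
  proof (cases "F' = {}")
    case True
    have "\<kappa> * ln (card F) \<ge> 0" using \<kappa> cF by simp
    then show ?thesis using True e(1) unfolding F'_def by (intro exI[of _ "{e}"]) auto
  next
    case False
    then have cF': "card F' > 0" using fF' by (simp add: card_gt_0_iff)
    have "(1 - 1 / \<kappa>) * card F = card F - card F / \<kappa>" by (simp add: algebra_simps)
    moreover have "0 < card F / \<kappa>" using \<kappa> cF by simp
    ultimately have "real (card F') < card F" using l by linarith
    then have "card F' < card F" by simp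
    moreover have "\<And>F''. F'' \<subseteq> F' \<Longrightarrow> F'' \<noteq> {} \<Longrightarrow> \<exists>e\<in>G. card F'' \<le> \<kappa> * card {x\<in>F''. hit e x}"
      by (intro less.prems(3)) (auto simp: F'_def)
    ultimately obtain w where w: "w \<subseteq> G" "finite w" "card w \<le> \<kappa> * ln (card F') + 1" "\<forall>x\<in>F'. \<exists>e\<in>w. hit e x"
      using less.hyps[of F'] fF' False by blast
    have "0 < (1 - 1 / \<kappa>) * card F" using l cF' by linarith
    then have p: "0 < 1 - 1 / \<kappa>" using cF by (simp add: zero_less_mult_iff)
    have "ln (card F') \<le> ln ((1 - 1 / \<kappa>) * card F)" using l cF' by (intro ln_mono) auto
    also have "\<dots> = ln (1 - 1 / \<kappa>) + ln (card F)" by (subst ln_mult) (use p cF in auto)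
    also have "ln (1 - 1 / \<kappa>) \<le> - (1 / \<kappa>)" using ln_le_minus_one[OF p] by simp
    finally have "\<kappa> * ln (card F') \<le> \<kappa> * (- (1 / \<kappa>) + ln (card F))" using \<kappa> by (intro mult_left_mono) auto
    also have "\<dots> = \<kappa> * ln (card F) - 1" using \<kappa> by (simp add: field_simps)
    finally have "\<kappa> * ln (card F') \<le> \<kappa> * ln (card F) - 1" .
    moreover have "card (insert e w) \<le> card w + 1" using w(2) by (simp add: card_insert_if)
    then have "real (card (insert e w)) \<le> card w + 1" by linarith
    ultimately have "card (insert e w) \<le> \<kappa> * ln (card F) + 1" using w(3) by linarith
    moreover have "\<forall>x\<in>F. \<exists>e'\<in>insert e w. hit e' x" using w(4) unfolding F'_def by blast
    ultimately show ?thesis using w e by (intro exI[of _ "insert e w"]) auto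
  qed
qed

text \<open>The classical bound \<open>(e n / q) ^ q\<close>. It follows from
  \<open>q ^ q / fact q \<le> exp q\<close>, whose left side is one term of the exponential
  series.\<close>

lemma ln_binomial_le:
  assumes "1 \<le> q" "q \<le> n"
  shows "ln (real (n choose q)) \<le> q * (1 + ln (n / q))"
proof -
  have "real q ^ q / fact q \<le> exp (real q)"
  proof -
    have "(\<Sum>i\<in>{q}. real q ^ i / fact i) \<le> (\<Sum>i. real q ^ i / fact i)"
      using summable_exp_generic[of "real q"]
      by (intro sum_le_suminf) (auto simp: scaleR_conv_of_real field_simps)
    also have "\<dots> = exp (real q)" unfolding exp_def by (simp add: scaleR_conv_of_real field_simps)
    finally show ?thesis by simp
  qed
  then have f: "real q ^ q \<le> exp (real q) * fact q" by (simp add: field_simps)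
  have "(n choose q) * fact q \<le> n ^ q" by (rule binomial_fact_pow)
  then have "real (n choose q) * fact q \<le> real n ^ q" by (metis of_nat_fact of_nat_le_iff of_nat_mult of_nat_power)
  then have "real (n choose q) * fact q * real q ^ q \<le> real n ^ q * (exp (real q) * fact q)"
    using f by (intro mult_mono) auto
  then have "real (n choose q) * real q ^ q \<le> real n ^ q * exp (real q)"
    by (simp add: field_simps)
  then have "real (n choose q) \<le> exp (real q) * (n / q) ^ q" using assms by (simp add: power_divide field_simps)
  moreover have "0 < real (n choose q)" using assms by simp
  ultimately have "ln (real (n choose q)) \<le> ln (exp (real q) * (n / q) ^ q)" by (intro ln_mono) auto
  also have "\<dots> = q * (1 + ln (n / q))" using assms by (simp add: ln_mult ln_realpow algebra_simps)
  finally show ?thesis .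
qed

text \<open>Applied to the pairs of sides of all matchings of size \<open>16 r\<close>. If too many disjoint edges of
  \<open>G\<close> violate \<open>f\<close>, then a cut of the labels yields such a pair, hence an edge of \<open>w\<close> violating \<open>f\<close>.\<close>

theorem cover_exists:
  assumes r: "1 \<le> r" and G: "graph_on {..<N} G" and R: "r \<le> RSn N r" and Q: "128 * r \<le> Q"
  shows "\<exists>w\<subseteq>G. card w \<le> 128 * real (RSn N r) * (1 + ln (1 + N / r)) + 1 \<and> covers L N Q w G"
proof -
  define F where "F = {(A, B). A \<subseteq> {..<N} \<and> B \<subseteq> {..<N} \<and> card A = 16 * r \<and> card B = 16 * r \<and>
    (\<exists>M. matching (G \<inter> cut (A, B)) M \<and> card M = 16 * r)}"
  let ?S = "{A. A \<subseteq> {..<N} \<and> card A = 16 * r}"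
  have FS: "F \<subseteq> ?S \<times> ?S" unfolding F_def by auto
  have cS: "finite ?S" "card ?S = N choose (16 * r)" by (auto simp: n_subsets)
  have fF: "finite F" by (rule finite_subset[OF FS]) (use cS(1) in simp)
  define B where "B = 128 * real (RSn N r) * (1 + ln (1 + N / r)) + 1"
  have ln0: "0 \<le> ln (1 + real N / r)" using r by (intro ln_ge_zero) simp
  have "\<exists>w\<subseteq>G. finite w \<and> card w \<le> B \<and> (\<forall>x\<in>F. \<exists>e\<in>w. e \<in> cut x)"
  proof (cases "F = {}")
    case True
    then show ?thesis using ln0 unfolding B_def by (intro exI[of _ "{}"]) simp
  next
    case False
    \<comment> \<open>With \<open>ln (card F)\<close> at most
      \<open>32 * r * (1 + ln (1 + N / r))\<close>, this popularity gives the leading factor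
      \<open>128 * RSn N r\<close>.\<close>
    define \<kappa> where "\<kappa> = 4 * real (RSn N r) / r"
    have \<kappa>: "1 \<le> \<kappa>" unfolding \<kappa>_def using R r by (simp add: field_simps)
    have "\<exists>e\<in>G. card F' \<le> \<kappa> * card {x\<in>F'. e \<in> cut x}" if F': "F' \<subseteq> F" "F' \<noteq> {}" for F'
    proof -
      have "\<exists>e\<in>G. r * card F' \<le> 4 * RSn N r * card {x \<in> F'. e \<in> cut x}"
        using F' finite_subset[OF _ fF] unfolding F_def by (intro popular_edge[OF r _ _ G R]) auto
      then obtain e where e: "e \<in> G" "r * card F' \<le> 4 * RSn N r * card {x \<in> F'. e \<in> cut x}" by blast
      then have "real (r * card F') \<le> real (4 * RSn N r * card {x \<in> F'. e \<in> cut x})" by (intro of_nat_mono)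
      then have "card F' \<le> \<kappa> * card {x\<in>F'. e \<in> cut x}" using r unfolding \<kappa>_def by (simp add: field_simps)
      then show ?thesis using e(1) by blast
    qed
    from greedy_hitting_set[OF \<kappa> fF False this] obtain w where
      w: "w \<subseteq> G" "finite w" "card w \<le> \<kappa> * ln (card F) + 1" "\<forall>x\<in>F. \<exists>e\<in>w. e \<in> cut x" by auto
    obtain A where "A \<subseteq> {..<N}" "card A = 16 * r" using False unfolding F_def by blast
    then have qN: "16 * r \<le> N" using card_mono[of "{..<N}" A] by simp
    have cF: "0 < card F" using False fF by (simp add: card_gt_0_iff)
    have "card F \<le> (N choose (16 * r)) * (N choose (16 * r))"
      using card_mono[OF _ FS] cS by (simp add: card_cartesian_product)
    then have "real (card F) \<le> real (N choose (16 * r)) * real (N choose (16 * r))"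
      by (metis of_nat_le_iff of_nat_mult)
    then have "ln (card F) \<le> ln (real (N choose (16 * r)) * real (N choose (16 * r)))"
      using cF by (intro ln_mono) auto
    also have "\<dots> = 2 * ln (N choose (16 * r))" using qN by (simp add: ln_mult)
    also have "\<dots> \<le> 2 * (real (16 * r) * (1 + ln (N / real (16 * r))))" using ln_binomial_le[of "16 * r" N] r qN by simp
    also have "ln (N / real (16 * r)) \<le> ln (1 + N / r)"
      using r qN by (intro ln_mono) (auto simp: field_simps)
    finally have "ln (card F) \<le> 2 * (real (16 * r) * (1 + ln (1 + N / r)))" by (simp add: mult_left_mono)
    then have "\<kappa> * ln (card F) \<le> \<kappa> * (2 * (real (16 * r) * (1 + ln (1 + N / r))))" using \<kappa> by (intro mult_left_mono) auto
    also have "\<dots> = B - 1" using r unfolding \<kappa>_def B_def by simp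
    finally have "card w \<le> B" using w(3) by linarith
    then show ?thesis using w(1,2,4) by blast
  qed
  then obtain w where w: "w \<subseteq> G" "finite w" "card w \<le> B" "\<forall>x\<in>F. \<exists>e\<in>w. e \<in> cut x" by blast
  have "covers L N Q w G"
    unfolding covers_def
  proof (intro allI impI)
    fix f :: "nat \<Rightarrow> nat" assume "(\<forall>v<N. f v \<le> L) \<and> (\<forall>e\<in>w. \<not> viol f e)"
    then have fw: "\<And>e. e \<in> w \<Longrightarrow> \<not> viol f e" by blast
    define E where "E = {e \<in> G. viol f e}"
    have gE: "graph_on {..<N} E" using graph_on_mono[OF G] unfolding E_def by auto
    have fE: "finite E" using graph_on_finite[OF _ gE] by simp
    \<comment> \<open>\<open>C\<close> will consist of the vertices of \<open>M\<close>; they meet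
      every violated edge by maximality.\<close>
    obtain M where M: "matching E M" "card M = mu E" using mu_attained[OF fE] .
    have ME: "M \<subseteq> E" using M(1) unfolding matching_def by auto
    have fM: "finite M" using finite_subset[OF ME fE] .
    define C where "C = \<Union>M"
    have "C \<subseteq> {..<N}" using ME gE unfolding C_def graph_on_def by blast
    moreover have "\<forall>e\<in>G. viol f e \<longrightarrow> e \<inter> C \<noteq> {}"
    proof (intro ballI impI notI)
      fix e assume e: "e \<in> G" "viol f e" "e \<inter> C = {}"
      then have "matching E (insert e M)" using matching_insert[OF M(1)] unfolding E_def C_def by blast
      then have "card (insert e M) \<le> mu E" by (rule mu_ge[OF fE])
      moreover have "e \<noteq> {}" using e(2) unfolding viol_def by auto
      then have "e \<notin> M" using e(3) unfolding C_def by auto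
      ultimately show False using fM M(2) by simp
    qed
    moreover have "card C \<le> Q"
    proof (rule ccontr)
      assume nQ: "\<not> card C \<le> Q"
      have "card C = 2 * card M" unfolding C_def using card_Union_matching[OF gE _ M(1)] by simp
      then have big: "64 * r \<le> card M" using nQ Q by linarith
      have "\<forall>e\<in>M. \<exists>p. e = {fst p, snd p} \<and> f (fst p) \<noteq> 0 \<and> f (snd p) \<noteq> 0 \<and> f (fst p) \<noteq> f (snd p)"
      proof
        fix e assume "e \<in> M"
        then have e: "e \<in> E" "viol f e" using ME unfolding E_def by auto
        obtain x y where xy: "e = {x, y}" using graph_on_edge[OF gE e(1)] by blast
        obtain u v where uv: "u \<in> e" "v \<in> e" "f u \<noteq> 0" "f v \<noteq> 0" "f u \<noteq> f v" using e(2) unfolding viol_def by blast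
        then have "e = {u, v}" using xy by auto
        then show "\<exists>p. e = {fst p, snd p} \<and> f (fst p) \<noteq> 0 \<and> f (snd p) \<noteq> 0 \<and> f (fst p) \<noteq> f (snd p)"
          using uv by (intro exI[of _ "(u, v)"]) auto
      qed
      then obtain p where p: "\<And>e. e \<in> M \<Longrightarrow> e = {fst (p e), snd (p e)} \<and> f (fst (p e)) \<noteq> 0 \<and> f (snd (p e)) \<noteq> 0 \<and> f (fst (p e)) \<noteq> f (snd (p e))"
        using bchoice[of M "\<lambda>e p. e = {fst p, snd p} \<and> f (fst p) \<noteq> 0 \<and> f (snd p) \<noteq> 0 \<and> f (fst p) \<noteq> f (snd p)"] by blast
      define a b where "a e = fst (p e)" and "b e = snd (p e)" for e
      have ab: "e = {a e, b e}" "f (a e) \<noteq> 0" "f (b e) \<noteq> 0" "f (a e) \<noteq> f (b e)" if "e \<in> M" for e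
        using p[OF that] unfolding a_def b_def by auto
      \<comment> \<open>The labels are cut and not the vertices. An edge between the two sides then
        has ends with different labels even if it is not in the matching. Of the
        \<open>64 * r\<close> edges \<open>16 * r\<close> remain.\<close>
      have "\<exists>L. card M \<le> 4 * card {e\<in>M. f (a e) \<in> L \<and> f (b e) \<notin> L}"
        by (rule quarter_cut[OF fM, of "(f \<circ> a) ` M \<union> (f \<circ> b) ` M"]) (use fM ab in auto)
      then obtain L where L: "card M \<le> 4 * card {e\<in>M. f (a e) \<in> L \<and> f (b e) \<notin> L}" by blast
      then have "16 * r \<le> card {e\<in>M. f (a e) \<in> L \<and> f (b e) \<notin> L}" using big by linarith
      then obtain M2 where M2: "M2 \<subseteq> {e\<in>M. f (a e) \<in> L \<and> f (b e) \<notin> L}" "card M2 = 16 * r"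
        by (rule obtain_subset_with_card_n)
      then have M2M: "M2 \<subseteq> M" by auto
      have inj: "inj_on a M2" "inj_on b M2"
      proof -
        have "x = y" if "x \<in> M2" "y \<in> M2" "a x = a y" for x y
          using matching_unique[OF M(1), of x y "a x"] ab[of x] ab[of y] M2M that by blast
        then show "inj_on a M2" by (auto intro: inj_onI)
        have "x = y" if "x \<in> M2" "y \<in> M2" "b x = b y" for x y
          using matching_unique[OF M(1), of x y "b x"] ab[of x] ab[of y] M2M that by blast
        then show "inj_on b M2" by (auto intro: inj_onI)
      qed
      have inN: "a e < N \<and> b e < N" if "e \<in> M2" for e
      proof -
        have "e \<subseteq> {..<N}" using that M2M ME gE unfolding graph_on_def by blast
        moreover have "a e \<in> e" "b e \<in> e" using ab(1)[of e] that M2M by blast+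
        ultimately show ?thesis by auto
      qed
      have "e \<in> cut (a ` M2, b ` M2)" if "e \<in> M2" for e
        using ab(1)[of e] that M2M unfolding cut_def by auto
      then have "matching (G \<inter> cut (a ` M2, b ` M2)) M2"
        using matching_subset[OF M(1) M2M] unfolding matching_def E_def by blast
      then have "(a ` M2, b ` M2) \<in> F" using inN inj M2(2) unfolding F_def by (auto simp: card_image)
      then obtain e where e: "e \<in> w" "e \<in> cut (a ` M2, b ` M2)" using w(4) by blast
      then obtain e1 e2 where e12: "e = {a e1, b e2}" "e1 \<in> M2" "e2 \<in> M2" unfolding cut_def by auto
      have "f (a e1) \<in> L" "f (b e2) \<notin> L" "f (a e1) \<noteq> 0" "f (b e2) \<noteq> 0" using e12 M2(1) ab by auto
      then have "f (a e1) \<noteq> f (b e2)" by auto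
      then have "viol f e" using \<open>f (a e1) \<noteq> 0\<close> \<open>f (b e2) \<noteq> 0\<close> unfolding viol_def e12(1) by auto
      then show False using fw[OF e(1)] by simp
    qed
    ultimately show "\<exists>C. C \<subseteq> {..<N} \<and> card C \<le> Q \<and> (\<forall>e\<in>G. viol f e \<longrightarrow> e \<inter> C \<noteq> {})" by blast
  qed
  then show ?thesis using w unfolding B_def by blast
qed


text \<open>Single edges are induced in every graph. This prices the trivial reduction that keeps
  all of \<open>G\<close>, for tolerances too small to allow larger matchings.\<close>

lemma graph_on_le_RSn_1:
  assumes G: "graph_on {..<N} G" shows "card G \<le> RSn N 1"
proof (cases "G = {}")
  case False
  have fG: "finite G" using graph_on_finite[OF _ G] by simp
  have c2: "e \<in> G \<Longrightarrow> card e = 2" for e using G unfolding graph_on_def by auto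
  have "RS_graph 1 (card G) G" unfolding RS_graph_def
  proof (intro conjI exI[of _ "(\<lambda>e. {e}) ` G"])
    show "1 \<le> card G" using False fG by (simp add: Suc_le_eq card_gt_0_iff)
    show "partition_on G ((\<lambda>e. {e}) ` G)" unfolding partition_on_def pairwise_def disjnt_def by auto
    show "card ((\<lambda>e. {e}) ` G) = card G" by (intro card_image) (auto intro: inj_onI)
    show "\<forall>M\<in>(\<lambda>e. {e}) ` G. induced_matching G M \<and> card M = 1"
    proof
      fix M assume "M \<in> (\<lambda>e. {e}) ` G"
      then obtain e where e: "e \<in> G" "M = {e}" by auto
      have "e' = e" if "e' \<in> G" "e' \<subseteq> e" for e'
        using card_subset_eq[of e e'] that c2[OF e(1)] c2[OF that(1)] card_ge_0_finite[of e] by simp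
      then have "{e' \<in> G. e' \<subseteq> \<Union>M} = M" using e by auto
      then show "induced_matching G M \<and> card M = 1" using e unfolding induced_matching_def matching_def by auto
    qed
  qed simp
  then show ?thesis by (rule RSn_ge[OF G])
qed simp

text \<open>A single matching is an RS graph. Hence \<open>RSn N r < r\<close> is possible only for
  \<open>N < 2 * r\<close>, where a cover may afford all vertices.\<close>

lemma RSn_ge_single:
  assumes r: "1 \<le> r" "2 * r \<le> N" shows "r \<le> RSn N r"
proof -
  define e where "e i = {2 * i, 2 * i + 1 :: nat}" for i
  define S where "S = e ` {..<r}"
  have inj: "inj_on e {..<r}" unfolding e_def by (intro inj_onI) (auto simp: doubleton_eq_iff)
  have "(\<Sum>i\<in>{()}. card S div r) * r \<le> RSn N r"
  proof (rule RSn_family[OF r(1)])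
    show "graph_on {..<N} S" using r(2) unfolding graph_on_def S_def e_def by auto
    have eq: "e i = e j" if "x \<in> e i" "x \<in> e j" for x i j
    proof -
      have "x div 2 = i" "x div 2 = j" using that unfolding e_def by auto
      then show ?thesis by simp
    qed
    then show "disjoint S" unfolding S_def pairwise_def disjnt_def by blast
    fix f T assume f: "f \<in> S" "T \<subseteq> S" "f \<subseteq> \<Union>T"
    then obtain i where i: "f = e i" unfolding S_def by auto
    then have "2 * i \<in> f" unfolding e_def by auto
    then obtain g where g: "g \<in> T" "2 * i \<in> g" using f(3) by auto
    then obtain j where "g = e j" using f(2) unfolding S_def by auto
    then have "f = g" using eq i g(2) \<open>2 * i \<in> f\<close> by blast
    then show "f \<in> T" using g(1) by simp
  qed auto
  moreover have "card S = r" unfolding S_def using card_image[OF inj] by simp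
  ultimately show ?thesis using r(1) by simp
qed

text \<open>\<open>m\<close> disjoint copies of an RS graph, where the copies of each induced matching are united and then
  cut into pieces of the size wanted.\<close>

lemma RSn_copies:
  assumes a: "1 \<le> a" and r: "1 \<le> r" and mN: "m * N \<le> n" and ma: "r \<le> m * a"
  shows "m * RSn N a \<le> 2 * RSn n r"
proof (cases "RSn N a = 0")
  case False
  then obtain E t where E: "graph_on {..<N} E" "RS_graph a t E" "card E = RSn N a" using RSn_attained by blast
  obtain P where P: "partition_on E P" "\<And>M. M \<in> P \<Longrightarrow> induced_matching E M \<and> card M = a"
    using E(2) unfolding RS_graph_def by blast
  have fE: "finite E" using graph_on_finite[OF _ E(1)] by simp
  have PE: "\<Union>P = E" and dP: "disjoint P" using P(1) unfolding partition_on_def by auto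
  have fP: "finite P" using PE fE by (metis finite_UnionD)
  have "card E = (\<Sum>M\<in>P. card M)" unfolding PE[symmetric]
    by (rule card_Union_disjoint[OF dP]) (use P(2) a in \<open>auto intro: card_ge_0_finite\<close>)
  then have cE: "card E = card P * a" using P(2) by simp
  define sh where "sh j = (\<lambda>v. v + j * N)" for j :: nat
  define S where "S M = (\<lambda>(j, e). sh j ` e) ` ({..<m} \<times> M)" for M
  have eN: "e \<subseteq> {..<N} \<and> card e = 2" if "e \<in> E" for e using that E(1) unfolding graph_on_def by auto
  have MP: "matching E M" "M \<subseteq> E" if "M \<in> P" for M using P(2)[OF that] unfolding induced_matching_def matching_def by auto
  have shj: "sh j v div N = j" "sh j v mod N = v" if "v < N" for j v using that unfolding sh_def by auto
  have share: "j = j' \<and> x = x'" if "x < N" "x' < N" "sh j x = sh j' x'" for j j' x x'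
    using shj[OF that(1), of j] shj[OF that(2), of j'] that(3) by simp
  have SE: "\<exists>j e. j < m \<and> e \<in> M \<and> f = sh j ` e" if "f \<in> S M" for f M using that unfolding S_def by auto
  have ne: "e \<noteq> {}" if "e \<in> E" for e using eN[OF that] by auto
  have uniq: "j = j' \<and> x \<in> e'" if u: "x \<in> e" "e \<in> E" "e' \<in> E" "sh j x \<in> sh j' ` e'" for x e e' j j'
  proof -
    obtain x' where x': "x' \<in> e'" "sh j x = sh j' x'" using u(4) by auto
    have "x < N" "x' < N" using eN[OF u(2)] eN[OF u(3)] u(1) x'(1) by auto
    then show ?thesis using share x' by blast
  qed
  have inj: "inj_on (\<lambda>(j, e). sh j ` e) ({..<m} \<times> E)"
  proof (rule inj_onI, clarify)
    fix j e j' e' assume h: "e \<in> E" "e' \<in> E" "sh j ` e = sh j' ` e'"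
    have "j = j' \<and> x \<in> e'" if "x \<in> e" for x using uniq[OF that h(1,2)] h(3) that by blast
    moreover have "j' = j \<and> x \<in> e" if "x \<in> e'" for x using uniq[OF that h(2,1)] h(3) that by blast
    moreover obtain y where "y \<in> e" using ne[OF h(1)] by blast
    ultimately show "j = j' \<and> e = e'" by blast
  qed
  have cS: "card (S M) = m * a" if "M \<in> P" for M
  proof -
    have "inj_on (\<lambda>(j, e). sh j ` e) ({..<m} \<times> M)" by (rule inj_on_subset[OF inj]) (use MP[OF that] in auto)
    then show ?thesis unfolding S_def using P(2)[OF that] by (simp add: card_image card_cartesian_product)
  qed
  have mS: "f = f'" if M: "M \<in> P" and f: "f \<in> S M" "f' \<in> S M" "y \<in> f" "y \<in> f'" for M f f' y
  proof -
    obtain j e where e: "e \<in> M" "f = sh j ` e" using SE[OF f(1)] by blast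
    obtain j' e' where e': "e' \<in> M" "f' = sh j' ` e'" using SE[OF f(2)] by blast
    obtain x where x: "x \<in> e" "y = sh j x" using f(3) e(2) by auto
    have "e \<in> E" "e' \<in> E" "sh j x \<in> sh j' ` e'" using e(1) e' x(2) f(4) MP(2)[OF M] by auto
    then have "j = j' \<and> x \<in> e'" by (rule uniq[OF x(1)])
    then show ?thesis using matching_unique[OF MP(1)[OF M] e(1) e'(1) x(1)] e e' by blast
  qed
  have "(\<Sum>M\<in>P. card (S M) div r) * r \<le> RSn n r"
  proof (rule RSn_family[OF r fP])
    fix M assume M: "M \<in> P"
    show "graph_on {..<n} (S M)" unfolding graph_on_def
    proof
      fix f assume "f \<in> S M"
      then obtain j e where e: "j < m" "e \<in> M" "f = sh j ` e" using SE by blast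
      have e': "e \<subseteq> {..<N}" "card e = 2" using eN MP[OF M] e by auto
      have "sh j v < n" if "v \<in> e" for v
      proof -
        have "v < N" using that e' by auto
        then have "sh j v < (j + 1) * N" unfolding sh_def by simp
        also have "\<dots> \<le> m * N" using e(1) by (intro mult_right_mono) auto
        finally show ?thesis using mN by simp
      qed
      moreover have "card f = 2" unfolding e(3) using e'(2) by (subst card_image) (auto simp: sh_def intro: inj_onI)
      ultimately show "f \<in> {e. e \<subseteq> {..<n} \<and> card e = 2}" using e(3) by auto
    qed
    show "disjoint (S M)" unfolding pairwise_def disjnt_def using mS[OF M] by blast
    fix M' assume M': "M' \<in> P"
    show "S M \<inter> S M' = {}" if "M \<noteq> M'"
    proof (rule ccontr)
      assume "S M \<inter> S M' \<noteq> {}"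
      then obtain f where "f \<in> S M" "f \<in> S M'" by blast
      then obtain j e j' e' where e: "j < m" "e \<in> M" "f = sh j ` e" "j' < m" "e' \<in> M'" "f = sh j' ` e'" using SE by metis
      moreover have "(j, e) \<in> {..<m} \<times> E" "(j', e') \<in> {..<m} \<times> E" using e MP[OF M] MP[OF M'] by auto
      ultimately have "(j, e) = (j', e')" by (intro inj_onD[OF inj]) auto
      then show False using dP M M' that e unfolding pairwise_def disjnt_def by blast
    qed
    fix f T assume f: "f \<in> S M'" and T: "T \<subseteq> S M" and fT: "f \<subseteq> \<Union>T"
    obtain j e where e: "j < m" "e \<in> M'" "f = sh j ` e" using SE[OF f] by blast
    have eE: "e \<in> E" using MP[OF M'] e by auto
    have "x \<in> \<Union>M" if x: "x \<in> e" for x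
    proof -
      obtain g where g: "g \<in> T" "sh j x \<in> g" using fT x e(3) by auto
      then obtain j' e' where e': "e' \<in> M" "g = sh j' ` e'" using SE T by blast
      then have "x \<in> e'" using uniq[OF x eE, of e' j j'] g(2) MP[OF M] by blast
      then show ?thesis using e' by auto
    qed
    then have "e \<in> M" using eE P(2)[OF M] unfolding induced_matching_def by blast
    then have fS: "f \<in> S M" using e unfolding S_def by auto
    obtain x where x: "x \<in> f" using ne[OF eE] e(3) by auto
    then obtain g where g: "g \<in> T" "x \<in> g" using fT by auto
    then have "f = g" using mS[OF M fS _ x] T by blast
    then show "f \<in> T" using g by simp
  qed
  moreover have "(\<Sum>M\<in>P. card (S M) div r) = card P * (m * a div r)" using cS by simp
  ultimately have 1: "card P * (m * a div r) * r \<le> RSn n r" by simp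
  \<comment> \<open>Rounding \<open>m * a \<ge> r\<close> down to a multiple of \<open>r\<close>
    loses at most one half; this is the factor \<open>2\<close> of the conclusion.\<close>
  have "m * a \<le> 2 * ((m * a div r) * r)"
  proof -
    have "1 \<le> m * a div r" using ma r div_le_mono[of r "m * a" r] by simp
    then have "r \<le> (m * a div r) * r" by simp
    moreover have "m * a = (m * a div r) * r + m * a mod r" by simp
    moreover have "m * a mod r < r" using r by simp
    ultimately show ?thesis by linarith
  qed
  then have "card P * (m * a) \<le> card P * (2 * ((m * a div r) * r))" by (rule mult_left_mono) simp
  also have "\<dots> = 2 * (card P * (m * a div r) * r)" by simp
  also have "\<dots> \<le> 2 * RSn n r" using 1 by simp
  finally show ?thesis using cE E(3) by (simp add: ac_simps)
qed simp

text \<open>Frees \<open>cover_exists\<close> from its side conditions. A tolerance below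
  \<open>128\<close> is met by keeping \<open>G\<close> itself, and if \<open>RSn N a < a\<close>
  then there are at most \<open>Q\<close> vertices, which together cover everything.\<close>

lemma cover_exists_all:
  fixes Q :: nat
  assumes G: "graph_on {..<N} G"
  defines "a \<equiv> max 1 (Q div 128)"
  shows "\<exists>w\<subseteq>G. card w \<le> 128 * real (RSn N a) * (1 + ln (1 + N / a)) + 1 \<and> covers L N Q w G"
proof -
  have a1: "1 \<le> a" unfolding a_def by simp
  have ln0: "0 \<le> ln (1 + real N / a)" using a1 by (intro ln_ge_zero) simp
  show ?thesis
  proof (cases "Q < 128")
    case True
    then have a: "a = 1" unfolding a_def by simp
    have "real (card G) \<le> real (RSn N a)" using graph_on_le_RSn_1[OF G] a by simp
    also have "\<dots> \<le> 128 * real (RSn N a) * (1 + ln (1 + N / a))"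
      using mult_left_mono[of 1 "128 * (1 + ln (1 + real N / a))" "real (RSn N a)"] ln0 by (simp add: algebra_simps)
    finally show ?thesis using covers_refl by (intro exI[of _ G]) auto
  next
    case Q: False
    then have aQ: "128 * a \<le> Q" unfolding a_def by simp
    show ?thesis
    proof (cases "a \<le> RSn N a")
      case True
      then show ?thesis using cover_exists[OF a1 G True aQ] by blast
    next
      case False
      then have "N < 2 * a" using RSn_ge_single[OF a1] by (meson not_le)
      then have "N \<le> Q" using aQ by linarith
      then have "covers L N Q {} G" unfolding covers_def
      proof (intro allI impI exI[of _ "{..<N}"] conjI ballI)
        fix e assume "e \<in> G"
        then show "e \<inter> {..<N} \<noteq> {}" using graph_on_edge[OF G] by blast
      qed auto
      then show ?thesis using ln0 by (intro exI[of _ "{}"]) simp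
    qed
  qed
qed

section \<open>Kernels and hashing\<close>

text \<open>\<open>A\<close> plays the vertices of at most \<open>s\<close> other matching edges: an
  edge of \<open>G\<close> that extends these can be exchanged for an edge of
  \<open>w\<close>.\<close>

definition kern :: "nat \<Rightarrow> nat \<Rightarrow> nat set set \<Rightarrow> nat set set \<Rightarrow> bool" where
  "kern n s w G \<longleftrightarrow> (\<forall>A. A \<subseteq> {..<n} \<and> card A \<le> 2 * s \<and> (\<exists>e\<in>G. e \<inter> A = {}) \<longrightarrow> (\<exists>e\<in>w. e \<inter> A = {}))"

text \<open>Among the matchings with \<open>min (mu (G \<union> X)) (s + 1)\<close> edges take one
  with the most edges in \<open>w \<union> X\<close>. An edge outside could be exchanged, because
  the other edges number at most \<open>s\<close> and block at most \<open>2 * s\<close> vertices;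
  hence the bound \<open>s + 1\<close>.\<close>

lemma kern_mu:
  assumes g: "graph_on {..<n} (G \<union> X)" and wG: "w \<subseteq> G" and k: "kern n s w G"
  shows "min (mu (G \<union> X)) (s + 1) \<le> mu (w \<union> X)"
proof -
  have fG: "finite (G \<union> X)" using graph_on_finite[OF _ g] by simp
  obtain M0 where M0: "matching (G \<union> X) M0" "card M0 = mu (G \<union> X)" using mu_attained[OF fG] .
  define j where "j = min (mu (G \<union> X)) (s + 1)"
  have "j \<le> card M0" using M0(2) unfolding j_def by simp
  then obtain M1 where M1: "M1 \<subseteq> M0" "card M1 = j" by (rule obtain_subset_with_card_n)
  define P where "P M \<longleftrightarrow> matching (G \<union> X) M \<and> card M = j" for M
  have fin: "finite M" if "P M" for M using that fG finite_subset unfolding P_def matching_def by blast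
  have P1: "P M1" unfolding P_def using M1 matching_subset[OF M0(1)] by auto
  have "card (M \<inter> (w \<union> X)) \<le> j" if "P M" for M
    using card_mono[OF fin[OF that], of "M \<inter> (w \<union> X)"] that unfolding P_def by auto
  then have "\<forall>M. P M \<longrightarrow> card (M \<inter> (w \<union> X)) < Suc j" by (simp add: less_Suc_eq_le)
  with P1 have "\<exists>M. P M \<and> (\<forall>M'. P M' \<longrightarrow> card (M' \<inter> (w \<union> X)) \<le> card (M \<inter> (w \<union> X)))"
    by (rule ex_has_greatest_nat)
  then obtain M where M: "P M" and mx: "\<And>M'. P M' \<Longrightarrow> card (M' \<inter> (w \<union> X)) \<le> card (M \<inter> (w \<union> X))" by blast
  have mM: "matching (G \<union> X) M" using M unfolding P_def by simp
  have "M \<subseteq> w \<union> X"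
  proof (rule ccontr)
    assume "\<not> M \<subseteq> w \<union> X"
    then obtain e where e: "e \<in> M" "e \<notin> w \<union> X" by blast
    define A where "A = \<Union>(M - {e})"
    have mA: "matching (G \<union> X) (M - {e})" using matching_subset[OF mM] by auto
    have "card A = 2 * card (M - {e})" unfolding A_def using card_Union_matching[OF g _ mA] by simp
    also have "card (M - {e}) = j - 1" using M e fin[OF M] unfolding P_def by simp
    finally have cA: "card A \<le> 2 * s" unfolding j_def by auto
    have AV: "A \<subseteq> {..<n}" using mA g unfolding A_def matching_def graph_on_def by blast
    have "e \<in> G" using e mM unfolding matching_def by auto
    moreover have "e \<inter> A = {}" using matching_unique[OF mM e(1)] unfolding A_def by blast
    ultimately obtain e' where e': "e' \<in> w" "e' \<inter> A = {}" using k cA AV unfolding kern_def by blast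
    have e'n: "e' \<notin> M - {e}"
    proof
      assume "e' \<in> M - {e}"
      then have "e' = {}" using e'(2) unfolding A_def by blast
      moreover have "e' \<in> G \<union> X" using e'(1) wG by auto
      ultimately show False using g unfolding graph_on_def by auto
    qed
    define M' where "M' = insert e' (M - {e})"
    have "matching (G \<union> X) M'" unfolding M'_def using matching_insert[OF mA] e' wG unfolding A_def by blast
    moreover have "card M' = j"
    proof -
      have "card M' = Suc (card (M - {e}))" unfolding M'_def using e'n fin[OF M] by simp
      also have "\<dots> = card M" using e(1) fin[OF M] by (rule card_Suc_Diff1[rotated])
      finally show ?thesis using M unfolding P_def by simp
    qed
    ultimately have "P M'" unfolding P_def by simp
    then have "card (M' \<inter> (w \<union> X)) \<le> card (M \<inter> (w \<union> X))" by (rule mx)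
    moreover have "M' \<inter> (w \<union> X) = insert e' (M \<inter> (w \<union> X))" using e e' unfolding M'_def by auto
    moreover have "e' \<notin> M \<inter> (w \<union> X)" using e'n e e' by auto
    ultimately show False using fin[OF M] by simp
  qed
  then have "matching (w \<union> X) M" using mM unfolding matching_def by auto
  then have "card M \<le> mu (w \<union> X)" by (rule mu_ge[rotated]) (use fG wG in \<open>auto intro: finite_subset\<close>)
  then show ?thesis using M unfolding P_def j_def by simp
qed

lemma card_le_if_hit:
  assumes "finite A" and "\<And>e. e \<in> w \<Longrightarrow> e \<inter> A \<noteq> {}" and "\<And>e e' x. e \<in> w \<Longrightarrow> e' \<in> w \<Longrightarrow> x \<in> A \<Longrightarrow> x \<in> e \<Longrightarrow> x \<in> e' \<Longrightarrow> e = e'"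
  shows "card w \<le> card A"
proof -
  have "\<forall>e\<in>w. \<exists>x. x \<in> e \<inter> A" using assms(2) by blast
  then obtain h where h: "\<And>e. e \<in> w \<Longrightarrow> h e \<in> e \<inter> A" using bchoice[of w "\<lambda>e x. x \<in> e \<inter> A"] by blast
  have "inj_on h w"
  proof (rule inj_onI)
    fix e e' assume "e \<in> w" "e' \<in> w" "h e = h e'"
    then show "e = e'" using assms(3)[of e e' "h e"] h[of e] h[of e'] by auto
  qed
  moreover have "h ` w \<subseteq> A" using h by auto
  ultimately show ?thesis using assms(1) card_inj_on_le by blast
qed

text \<open>A matching of \<open>2 * s + 1\<close> edges serves as \<open>w\<close>, since
  \<open>2 * s\<close> vertices cannot meet all of it. If there is none, then at most
  \<open>4 * s\<close> matched vertices meet all edges, and up to \<open>2 * s + 1\<close> edges are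
  kept at each: a set \<open>A\<close> without \<open>v\<close> meets at most \<open>2 * s\<close>
  edges at \<open>v\<close>.\<close>

lemma kern_exists:
  assumes g: "graph_on {..<n} G"
  shows "\<exists>w\<subseteq>G. kern n s w G \<and> card w \<le> 16 * (s + 1)^2"
proof -
  have fG: "finite G" using graph_on_finite[OF _ g] by simp
  obtain M where M: "matching G M" "card M = mu G" using mu_attained[OF fG] .
  have MG: "M \<subseteq> G" using M(1) unfolding matching_def by auto
  have fM: "finite M" using finite_subset[OF MG fG] .
  show ?thesis
  proof (cases "2 * s + 1 \<le> card M")
    case True
    then obtain w where w: "w \<subseteq> M" "card w = 2 * s + 1" using obtain_subset_with_card_n by metis
    have "kern n s w G" unfolding kern_def
    proof (intro allI impI)
      fix A assume A: "A \<subseteq> {..<n} \<and> card A \<le> 2 * s \<and> (\<exists>e\<in>G. e \<inter> A = {})"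
      show "\<exists>e\<in>w. e \<inter> A = {}"
      proof (rule ccontr)
        assume "\<not> ?thesis"
        moreover have "finite A" using A finite_subset by blast
        ultimately have "card w \<le> card A" using matching_unique[OF M(1)] w(1) by (intro card_le_if_hit) blast+
        then show False using A w(2) by simp
      qed
    qed
    moreover have "card w \<le> 16 * (s + 1)^2" using w(2) by (simp add: power2_eq_square)
    ultimately show ?thesis using w(1) MG by (intro exI[of _ w]) auto
  next
    case False
    define U where "U = \<Union>M"
    have cU: "card U \<le> 4 * s" using card_Union_matching[OF g _ M(1)] False unfolding U_def by simp
    have fU: "finite U" using MG g finite_subset[of U "{..<n}"] unfolding U_def graph_on_def by blast
    define Ev where "Ev v = {e \<in> G. v \<in> e}" for v
    have "\<exists>W. W \<subseteq> Ev v \<and> card W = min (card (Ev v)) (2 * s + 1)" for v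
    proof -
      have "min (card (Ev v)) (2 * s + 1) \<le> card (Ev v)" by simp
      then obtain W where "W \<subseteq> Ev v" "card W = min (card (Ev v)) (2 * s + 1)" by (rule obtain_subset_with_card_n)
      then show ?thesis by blast
    qed
    then obtain W where W: "\<And>v. W v \<subseteq> Ev v \<and> card (W v) = min (card (Ev v)) (2 * s + 1)" by metis
    define w where "w = (\<Union>v\<in>U. W v)"
    have wG: "w \<subseteq> G" using W unfolding w_def Ev_def by blast
    have "card w \<le> (\<Sum>v\<in>U. card (W v))" unfolding w_def by (rule card_UN_le[OF fU])
    also have "\<dots> \<le> (\<Sum>v\<in>U. 2 * s + 1)" using W by (intro sum_mono) simp
    also have "\<dots> \<le> 4 * s * (2 * s + 1)" using mult_right_mono[OF cU, of "2 * s + 1"] by simp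
    also have "\<dots> \<le> 16 * (s + 1)^2" by (simp add: power2_eq_square algebra_simps)
    finally have cw: "card w \<le> 16 * (s + 1)^2" .
    have "kern n s w G" unfolding kern_def
    proof (intro allI impI)
      fix A assume A: "A \<subseteq> {..<n} \<and> card A \<le> 2 * s \<and> (\<exists>e\<in>G. e \<inter> A = {})"
      then obtain e where e: "e \<in> G" "e \<inter> A = {}" by blast
      have fA: "finite A" using A finite_subset by blast
      have "e \<inter> U \<noteq> {}"
      proof
        assume eU: "e \<inter> U = {}"
        then have "card (insert e M) \<le> mu G" using mu_ge[OF fG] matching_insert[OF M(1) e(1)] unfolding U_def by blast
        moreover have "e \<noteq> {}" using e(1) g unfolding graph_on_def by auto
        then have "e \<notin> M" using eU unfolding U_def by blast
        ultimately show False using M(2) fM by simp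
      qed
      then obtain v where v: "v \<in> e" "v \<in> U" by auto
      then have vA: "v \<notin> A" using e by auto
      have eEv: "e \<in> Ev v" using e v unfolding Ev_def by auto
      have fEv: "finite (Ev v)" using fG unfolding Ev_def by simp
      show "\<exists>e\<in>w. e \<inter> A = {}"
      proof (cases "card (Ev v) \<le> 2 * s + 1")
        case True
        then have "W v = Ev v" using W[of v] fEv by (intro card_subset_eq) auto
        then show ?thesis using eEv e v unfolding w_def by blast
      next
        case False
        show ?thesis
        proof (rule ccontr)
          assume n: "\<not> ?thesis"
          have "card (W v) \<le> card A"
          proof (rule card_le_if_hit[OF fA])
            fix e assume "e \<in> W v" then show "e \<inter> A \<noteq> {}" using n v unfolding w_def by blast
          next
            fix e e' x assume h: "e \<in> W v" "e' \<in> W v" "x \<in> A" "x \<in> e" "x \<in> e'"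
            have "e \<in> G" "v \<in> e" "e' \<in> G" "v \<in> e'" "x \<noteq> v" using h W vA unfolding Ev_def by auto
            then show "e = e'" using graph_on_edge[OF g, of e] graph_on_edge[OF g, of e'] h(4,5) by auto
          qed
          then show False using A W[of v] False by simp
        qed
      qed
    qed
    then show ?thesis using wG cw by blast
  qed
qed

section \<open>Hashing the vertices of a graph\<close>

definition himg :: "(nat \<Rightarrow> nat) \<Rightarrow> nat set set \<Rightarrow> nat set set" where
  "himg h E = {h ` e |e. e \<in> E \<and> card (h ` e) = 2}"

lemma himg_Un: "himg h (E \<union> E') = himg h E \<union> himg h E'"
  unfolding himg_def by auto

lemma himg_mono: "E \<subseteq> E' \<Longrightarrow> himg h E \<subseteq> himg h E'"
  unfolding himg_def by auto

lemma himg_graph_on: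
  assumes "graph_on V E" "\<And>v. v \<in> V \<Longrightarrow> h v < N" shows "graph_on {..<N} (himg h E)"
  using assms unfolding graph_on_def himg_def by fastforce

text \<open>Covers are found in hashed graphs but stored as original edges, one preimage for each
  hashed edge.\<close>

lemma himg_preimage:
  assumes "finite E" "w' \<subseteq> himg h E"
  shows "\<exists>w\<subseteq>E. card w \<le> card w' \<and> w' \<subseteq> himg h w"
proof -
  have "\<forall>e'\<in>w'. \<exists>e. e \<in> E \<and> h ` e = e' \<and> card (h ` e) = 2" using assms(2) unfolding himg_def by blast
  from bchoice[OF this] obtain p where p: "\<forall>e'\<in>w'. p e' \<in> E \<and> h ` (p e') = e' \<and> card (h ` (p e')) = 2"
    by (elim exE)
  have "finite (himg h E)" using assms(1) unfolding himg_def by simp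
  then have "finite w'" using assms(2) finite_subset by blast
  then have "card (p ` w') \<le> card w'" by (rule card_image_le)
  moreover have "w' \<subseteq> himg h (p ` w')" unfolding himg_def using p by blast
  moreover have "p ` w' \<subseteq> E" using p by auto
  ultimately show ?thesis by blast
qed

text \<open>Edges with disjoint images are disjoint, so a matching lifts.\<close>

lemma mu_himg_le:
  assumes "finite E" shows "mu (himg h E) \<le> mu E"
proof (rule mu_le)
  show "finite (himg h E)" using assms unfolding himg_def by simp
  fix M' assume M': "matching (himg h E) M'"
  then have "\<forall>e'\<in>M'. \<exists>e. e \<in> E \<and> h ` e = e'" unfolding himg_def matching_def by blast
  from bchoice[OF this] obtain p where p: "\<forall>e'\<in>M'. p e' \<in> E \<and> h ` (p e') = e'"
    by (elim exE)
  have inj: "inj_on p M'" by (rule inj_onI) (metis p)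
  have "matching E (p ` M')" unfolding matching_def pairwise_def disjnt_def
  proof (intro conjI ballI impI)
    show "p ` M' \<subseteq> E" using p by auto
    fix x y assume xy: "x \<in> p ` M'" "y \<in> p ` M'" "x \<noteq> y"
    then obtain a b where ab: "a \<in> M'" "b \<in> M'" "x = p a" "y = p b" by auto
    show "x \<inter> y = {}"
    proof (rule ccontr)
      assume "x \<inter> y \<noteq> {}"
      then obtain v where "v \<in> x" "v \<in> y" by auto
      then have "h v \<in> a" "h v \<in> b" using p ab by auto
      then have "a = b" using matching_unique[OF M'] ab by blast
      then show False using xy ab by simp
    qed
  qed
  then have "card (p ` M') \<le> mu E" by (rule mu_ge[OF assms])
  then show "card M' \<le> mu E" using card_image[OF inj] by simp
qed

text \<open>Of several colliding vertices all but the least are counted, so that \<open>h\<close> is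
  injective on the rest of \<open>W\<close>. The order allows the hash values to be revealed one
  vertex at a time.\<close>

definition bad :: "(nat \<Rightarrow> nat) \<Rightarrow> nat set \<Rightarrow> nat set" where
  "bad h W = {v \<in> W. \<exists>u\<in>W. u < v \<and> h u = h v}"

text \<open>Each vertex in \<open>bad\<close> spoils at most one edge of \<open>M\<close>, and
  \<open>h\<close> is injective on the vertices of the other edges.\<close>

lemma mu_himg_ge:
  assumes g: "graph_on V E" and V: "finite V" and M: "matching E M"
  shows "card M \<le> mu (himg h E) + card (bad h (\<Union>M))"
proof -
  have fE: "finite E" by (rule graph_on_finite[OF V g])
  have ME: "M \<subseteq> E" using M unfolding matching_def by auto
  have fM: "finite M" using ME fE finite_subset by blast
  let ?B = "bad h (\<Union>M)"
  have fB: "finite ?B" using ME g V finite_subset[of "?B" V] unfolding bad_def graph_on_def by blast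
  define G where "G = {e \<in> M. e \<inter> ?B = {}}"
  have GE: "G \<subseteq> E" using ME unfolding G_def by auto
  have "card (M - G) \<le> card ?B"
    by (rule card_le_if_hit[OF fB]) (use matching_unique[OF M] in \<open>auto simp: G_def\<close>)
  moreover have "card M = card G + card (M - G)" using fM unfolding G_def 
    by (subst card_Un_disjoint[symmetric]) (auto intro: arg_cong[of _ _ card])
  moreover have "card G \<le> mu (himg h E)"
  proof -
    have sep: "u = v" if "u \<in> \<Union>G" "v \<in> \<Union>G" "h u = h v" for u v
    proof (rule ccontr)
      assume "u \<noteq> v"
      then have "u < v \<or> v < u" by auto
      then have "u \<in> ?B \<or> v \<in> ?B" using that unfolding bad_def G_def by (auto intro: sym)
      then show False using that unfolding G_def by blast
    qed
    have inj: "inj_on h e" if "e \<in> G" for e by (rule inj_onI) (use sep that in blast)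
    have c2: "card e = 2" if "e \<in> G" for e using that GE g unfolding graph_on_def by auto
    have m: "matching (himg h E) ((`) h ` G)" unfolding matching_def pairwise_def disjnt_def
    proof (intro conjI ballI impI)
      show "(`) h ` G \<subseteq> himg h E" using GE inj c2 unfolding himg_def by (auto simp: card_image)
      fix x y assume xy: "x \<in> (`) h ` G" "y \<in> (`) h ` G" "x \<noteq> y"
      then obtain a b where ab: "a \<in> G" "b \<in> G" "x = h ` a" "y = h ` b" by auto
      show "x \<inter> y = {}"
      proof (rule ccontr)
        assume "x \<inter> y \<noteq> {}"
        then obtain u v where uv: "u \<in> a" "v \<in> b" "h u = h v" using ab by blast
        then have "u = v" using sep ab by blast
        then have "a = b" using matching_unique[OF M] uv ab unfolding G_def by blast
        then show False using xy ab by simp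
      qed
    qed
    have "inj_on ((`) h) G"
    proof (rule inj_onI)
      fix a b assume ab: "a \<in> G" "b \<in> G" "h ` a = h ` b"
      then show "a = b" using sep by blast
    qed
    then have "card ((`) h ` G) = card G" by (rule card_image)
    moreover have "finite (himg h E)" using fE unfolding himg_def by simp
    ultimately show ?thesis using mu_ge[OF _ m] by simp
  qed
  ultimately show ?thesis by linarith
qed

section \<open>Hash functions as digit strings, and the moments of their collisions\<close>

definition dg :: "nat \<Rightarrow> nat \<Rightarrow> nat \<Rightarrow> nat" where
  "dg b x i = x div b ^ i mod b"

lemma dg_low: assumes "v < n" "0 < b" shows "dg b (x + d * b ^ n) v = dg b x v"
proof -
  have "b ^ n = b ^ v * (b * b ^ (n - Suc v))" using assms by (simp add: power_add[symmetric] power_Suc[symmetric] del: power_Suc)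
  then have "x + d * b ^ n = x + (d * b ^ (n - Suc v) * b) * b ^ v" by simp
  then have "(x + d * b ^ n) div b ^ v = (x + (d * b ^ (n - Suc v) * b) * b ^ v) div b ^ v" by (rule arg_cong)
  also have "\<dots> = d * b ^ (n - Suc v) * b + x div b ^ v" using assms by (intro div_mult_self1) simp
  finally have "(x + d * b ^ n) div b ^ v = x div b ^ v + d * b ^ (n - Suc v) * b" by simp
  then show ?thesis unfolding dg_def by simp
qed

lemma dg_top: "x < b ^ n \<Longrightarrow> d < b \<Longrightarrow> dg b (x + d * b ^ n) n = d"
  unfolding dg_def by simp

lemma dg_exists:
  assumes "0 < b" "\<And>i. i < n \<Longrightarrow> \<delta> i < b"
  shows "\<exists>x<b ^ n. \<forall>i<n. dg b x i = \<delta> i"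
  using assms(2)
proof (induction n)
  case (Suc n)
  then obtain x where x: "x < b ^ n" "\<forall>i<n. dg b x i = \<delta> i" by fastforce
  have d: "\<delta> n < b" using Suc.prems by simp
  have "x + \<delta> n * b ^ n < b ^ n + \<delta> n * b ^ n" using x by simp
  also have "\<dots> = (\<delta> n + 1) * b ^ n" by simp
  also have "\<dots> \<le> b * b ^ n" using d by (intro mult_right_mono) auto
  finally have "x + \<delta> n * b ^ n < b ^ Suc n" by simp
  moreover have "dg b (x + \<delta> n * b ^ n) i = \<delta> i" if "i < Suc n" for i
    using that x dg_low[OF _ assms(1)] dg_top[OF x(1) d] by (cases "i = n") auto
  ultimately show ?case by blast
qed simp

lemma card_residue_le:
  assumes "i dvd M" "0 < i" shows "card {d. d < M \<and> d mod i = c} \<le> M div i"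
proof -
  have "{d. d < M \<and> d mod i = c} \<subseteq> (\<lambda>q. q * i + c) ` {..<M div i}"
  proof
    fix d assume "d \<in> {d. d < M \<and> d mod i = c}"
    then have d: "d < M" "d mod i = c" by auto
    then have "d = d div i * i + c" by (metis div_mult_mod_eq)
    moreover have "d div i < M div i" using d assms by (metis dvd_mult_div_cancel less_mult_imp_div_less mult.commute)
    ultimately show "d \<in> (\<lambda>q. q * i + c) ` {..<M div i}" by blast
  qed
  then have "card {d. d < M \<and> d mod i = c} \<le> card ((\<lambda>q. q * i + c) ` {..<M div i})" by (intro card_mono) auto
  also have "\<dots> \<le> M div i" using card_image_le[of "{..<M div i}" "\<lambda>q. q * i + c"] by simp
  finally show ?thesis .
qed

text \<open>The value \<open>dg M H v mod i\<close> is uniform because \<open>i\<close> divides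
  \<open>M\<close>. Given the values of the smaller vertices, \<open>v\<close> becomes bad with
  probability at most \<open>card W / i\<close>, which multiplies the moment by at most
  \<open>1 + card W / i\<close>.\<close>

lemma hash_bad_moment:
  fixes W :: "nat set"
  assumes W: "finite W" and iM: "i dvd M" "0 < i" "0 < M"
  shows "(\<Sum>H<M ^ n. 2 ^ card (bad (\<lambda>v. dg M H v mod i) (W \<inter> {..<n}))) \<le> real (M ^ n) * (1 + card W / i) ^ card (W \<inter> {..<n})"
proof (induction n)
  case 0
  have "bad h {} = {}" for h unfolding bad_def by simp
  then show ?case by simp
next
  case (Suc n)
  define h where "h H v = dg M H v mod i" for H v
  define q where "q = 1 + real (card W) / i"
  have q0: "0 \<le> q" unfolding q_def by simp
  \<comment> \<open>The seeds below \<open>M ^ Suc n\<close> are the numbers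
    \<open>H + d * M ^ n\<close>: the top digit \<open>d\<close> determines the hash value of vertex
    \<open>n\<close>, and the smaller vertices depend on \<open>H\<close> only.\<close>
  have "(\<Sum>H<M ^ Suc n. (2::real) ^ card (bad (h H) (W \<inter> {..<Suc n})))
     = (\<Sum>d<M. \<Sum>H<M ^ n. 2 ^ card (bad (h (H + d * M ^ n)) (W \<inter> {..<Suc n})))"
  proof -
    have "(\<Sum>H<M ^ Suc n. (2::real) ^ card (bad (h H) (W \<inter> {..<Suc n})))
      = (\<Sum>d<M. sum (\<lambda>H. 2 ^ card (bad (h H) (W \<inter> {..<Suc n}))) {d * M ^ n..<d * M ^ n + M ^ n})"
      by (simp add: sum.nat_group)
    moreover have "sum (\<lambda>H. (2::real) ^ card (bad (h H) (W \<inter> {..<Suc n}))) {d * M ^ n..<d * M ^ n + M ^ n}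
        = (\<Sum>H<M ^ n. 2 ^ card (bad (h (H + d * M ^ n)) (W \<inter> {..<Suc n})))" for d
      using sum.shift_bounds_nat_ivl[of "\<lambda>H. (2::real) ^ card (bad (h H) (W \<inter> {..<Suc n}))" 0 "d * M ^ n" "M ^ n"]
      by (simp add: add.commute lessThan_atLeast0)
    ultimately show ?thesis by (simp only:)
  qed
  also have "\<dots> = (\<Sum>H<M ^ n. \<Sum>d<M. 2 ^ card (bad (h (H + d * M ^ n)) (W \<inter> {..<Suc n})))" by (rule sum.swap)
  also have "\<dots> \<le> (\<Sum>H<M ^ n. 2 ^ card (bad (h H) (W \<inter> {..<n})) * (M * (if n \<in> W then q else 1)))"
  proof (rule sum_mono)
    fix H assume "H \<in> {..<M ^ n}"
    then have H: "H < M ^ n" by simp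
    have lo: "h (H + d * M ^ n) v = h H v" if "v < n" for d v unfolding h_def using dg_low[OF that iM(3)] by simp
    have hi: "h (H + d * M ^ n) n = d mod i" if "d < M" for d unfolding h_def using dg_top[OF H that] by simp
    have badlo: "bad (h (H + d * M ^ n)) (W \<inter> {..<n}) = bad (h H) (W \<inter> {..<n})" for d
      unfolding bad_def using lo by auto
    have fb: "finite (bad (h H) (W \<inter> {..<n}))" unfolding bad_def by simp
    let ?T = "{d. d < M \<and> d mod i \<in> h H ` (W \<inter> {..<n})}"
    show "(\<Sum>d<M. 2 ^ card (bad (h (H + d * M ^ n)) (W \<inter> {..<Suc n}))) \<le> 2 ^ card (bad (h H) (W \<inter> {..<n})) * (M * (if n \<in> W then q else 1))"
    proof (cases "n \<in> W")
      case False
      then have "W \<inter> {..<Suc n} = W \<inter> {..<n}" by (auto simp: less_Suc_eq)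
      then show ?thesis using False badlo by simp
    next
      case True
      then have W': "W \<inter> {..<Suc n} = insert n (W \<inter> {..<n})" by auto
      have "2 ^ card (bad (h (H + d * M ^ n)) (W \<inter> {..<Suc n})) \<le> 2 ^ card (bad (h H) (W \<inter> {..<n})) * (1 + of_bool (d \<in> ?T) :: real)"
        if d: "d < M" for d
      proof -
        have sub: "bad (h (H + d * M ^ n)) (W \<inter> {..<Suc n}) \<subseteq> bad (h H) (W \<inter> {..<n}) \<union> (if d \<in> ?T then {n} else {})"
        proof
          fix v assume "v \<in> bad (h (H + d * M ^ n)) (W \<inter> {..<Suc n})"
          then obtain u where u: "v \<in> W" "v < Suc n" "u \<in> W" "u < v" "h (H + d * M ^ n) u = h (H + d * M ^ n) v"
            unfolding bad_def by auto
          then have "h H u = h (H + d * M ^ n) v" using lo[of u d] by simp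
          moreover have "h (H + d * M ^ n) v = (if v = n then d mod i else h H v)" using lo[of v d] hi[OF d] u(2) by simp
          ultimately show "v \<in> bad (h H) (W \<inter> {..<n}) \<union> (if d \<in> ?T then {n} else {})"
            using u d unfolding bad_def by (cases "v = n") (auto simp: image_iff intro: bexI[of _ u])
        qed
        have "card (bad (h (H + d * M ^ n)) (W \<inter> {..<Suc n})) \<le> card (bad (h H) (W \<inter> {..<n})) + of_bool (d \<in> ?T)"
        proof -
          have "card (bad (h (H + d * M ^ n)) (W \<inter> {..<Suc n})) \<le> card (bad (h H) (W \<inter> {..<n}) \<union> (if d \<in> ?T then {n} else {}))"
            using sub fb by (intro card_mono) auto
          also have "\<dots> \<le> card (bad (h H) (W \<inter> {..<n})) + card (if d \<in> ?T then {n} else {})" by (rule card_Un_le)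
          finally show ?thesis by (auto split: if_splits)
        qed
        then have "(2::real) ^ card (bad (h (H + d * M ^ n)) (W \<inter> {..<Suc n})) \<le> 2 ^ (card (bad (h H) (W \<inter> {..<n})) + of_bool (d \<in> ?T))"
          by (intro power_increasing) auto
        then show ?thesis by (auto simp: power_add split: if_splits)
      qed
      then have "(\<Sum>d<M. 2 ^ card (bad (h (H + d * M ^ n)) (W \<inter> {..<Suc n})))
        \<le> (\<Sum>d<M. 2 ^ card (bad (h H) (W \<inter> {..<n})) * (1 + of_bool (d \<in> ?T) :: real))" by (intro sum_mono) simp
      also have "\<dots> = 2 ^ card (bad (h H) (W \<inter> {..<n})) * (real M + real (card ?T))"
        by (simp add: sum_distrib_left[symmetric] sum.distrib of_bool_def sum.If_cases Int_def)
      also have "real (card ?T) \<le> card W * (M / i)"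
      proof -
        have "?T = (\<Union>c\<in>h H ` (W \<inter> {..<n}). {d. d < M \<and> d mod i = c})" by auto
        then have "card ?T \<le> (\<Sum>c\<in>h H ` (W \<inter> {..<n}). card {d. d < M \<and> d mod i = c})" using card_UN_le[of "h H ` (W \<inter> {..<n})"] by simp
        also have "\<dots> \<le> (\<Sum>c\<in>h H ` (W \<inter> {..<n}). M div i)" using card_residue_le[OF iM(1,2)] by (intro sum_mono)
        also have "\<dots> = card (h H ` (W \<inter> {..<n})) * (M div i)" by simp
        also have "card (h H ` (W \<inter> {..<n})) \<le> card W"
          using card_image_le[of "W \<inter> {..<n}" "h H"] card_mono[OF W, of "W \<inter> {..<n}"] by simp
        finally have "card ?T \<le> card W * (M div i)" by simp
        then have "real (card ?T) \<le> real (card W * (M div i))" by (rule of_nat_mono)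
        also have "\<dots> = card W * (M / i)" using real_of_nat_div[OF iM(1)] by simp
        finally show ?thesis .
      qed
      finally show ?thesis using True unfolding q_def by (simp add: field_simps)
    qed
  qed
  also have "\<dots> = (\<Sum>H<M ^ n. 2 ^ card (bad (h H) (W \<inter> {..<n}))) * (M * (if n \<in> W then q else 1))"
    by (rule sum_distrib_right[symmetric])
  also have "\<dots> \<le> real (M ^ n) * q ^ card (W \<inter> {..<n}) * (M * (if n \<in> W then q else 1))"
    using Suc.IH q0 unfolding h_def q_def[symmetric] by (intro mult_right_mono) auto
  also have "\<dots> = real (M ^ Suc n) * q ^ card (W \<inter> {..<Suc n})"
  proof (cases "n \<in> W")
    case True
    then have "W \<inter> {..<Suc n} = insert n (W \<inter> {..<n})" by auto
    then show ?thesis using True by simp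
  next
    case False
    then have "W \<inter> {..<Suc n} = W \<inter> {..<n}" by (auto simp: less_Suc_eq)
    then show ?thesis using False by simp
  qed
  finally show ?case unfolding h_def q_def .
qed


section \<open>Total correctness of programs\<close>

definition safe :: "nat \<Rightarrow> config \<Rightarrow> bool" where
  "safe V s \<longleftrightarrow> (\<forall>x. regs s x \<le> V)"

text \<open>Worst case over the coins: every run halts within \<open>T\<close> steps in
  \<open>Q\<close>, and no register ever exceeds \<open>V\<close>. One derivation thus gives
  correctness, time and space.\<close>

inductive tc :: "real \<Rightarrow> nat \<Rightarrow> com \<Rightarrow> config \<Rightarrow> nat \<Rightarrow> (config \<Rightarrow> bool) \<Rightarrow> bool"
  for \<epsilon> :: real and V :: nat where
  tc_Skip: "safe V s \<Longrightarrow> Q s \<Longrightarrow> tc \<epsilon> V Skip s T Q"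
| tc_step: "p \<noteq> Skip \<Longrightarrow> safe V s \<Longrightarrow> (\<And>p' s'. (p', s') \<in> set_pmf (step \<epsilon> p s) \<Longrightarrow> tc \<epsilon> V p' s' T Q) \<Longrightarrow>
    tc \<epsilon> V p s (Suc T) Q"

lemma tc_weaken: "tc \<epsilon> V p s T Q \<Longrightarrow> (\<And>s. safe V s \<Longrightarrow> Q s \<Longrightarrow> Q' s) \<Longrightarrow> T \<le> T' \<Longrightarrow> tc \<epsilon> V p s T' Q'"
proof (induction arbitrary: T' rule: tc.induct)
  case (tc_Skip s Q T)
  then show ?case by (intro tc.tc_Skip) auto
next
  case (tc_step p s T Q)
  then obtain T'' where "T' = Suc T''" "T \<le> T''" by (cases T') auto
  then show ?case using tc_step by (auto intro!: tc.tc_step)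
qed

lemma tc_time: "tc \<epsilon> V p s T Q \<Longrightarrow> T \<le> T' \<Longrightarrow> tc \<epsilon> V p s T' Q"
  by (rule tc_weaken)

lemma tc_Seq:
  assumes "tc \<epsilon> V p s T1 Q1" "\<And>s'. safe V s' \<Longrightarrow> Q1 s' \<Longrightarrow> tc \<epsilon> V q s' T2 Q"
  shows "tc \<epsilon> V (Seq p q) s (Suc (T1 + T2)) Q"
  using assms
proof (induction rule: tc.induct)
  case (tc_Skip s Q1 T1)
  then have "tc \<epsilon> V q s T2 Q" by blast
  then have "tc \<epsilon> V q s (T1 + T2) Q" by (rule tc_time) simp
  then show ?case using tc_Skip by (intro tc_step) auto
next
  case (tc_step p s T1 Q1)
  have nx: "tc \<epsilon> V r s' (Suc (T1 + T2)) Q" if rs: "(r, s') \<in> set_pmf (step \<epsilon> (Seq p q) s)" for r s'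
  proof -
    obtain p' where "(p', s') \<in> set_pmf (step \<epsilon> p s)" "r = Seq p' q" using rs tc_step.hyps(1) by auto
    then show ?thesis using tc_step.IH tc_step.prems by blast
  qed
  have "tc \<epsilon> V (Seq p q) s (Suc (Suc (T1 + T2))) Q"
    by (rule tc.tc_step[OF _ tc_step.hyps(2) nx]) simp
  then show ?case by simp
qed

lemma tc_det:
  assumes "p \<noteq> Skip" "safe V s" "step \<epsilon> p s = return_pmf (p', s')" "tc \<epsilon> V p' s' T Q"
  shows "tc \<epsilon> V p s (Suc T) Q"
  using assms by (intro tc_step) auto

text \<open>\<open>run\<close> appends steps at the end, whereas induction on derivations of
  \<open>tc\<close> needs the first step split off; \<open>run_steps\<close> shows that both
  agree.\<close>

fun steps :: "real \<Rightarrow> com \<Rightarrow> config \<Rightarrow> nat \<Rightarrow> (com \<times> config) pmf" where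
  "steps \<epsilon> p s 0 = return_pmf (p, s)"
| "steps \<epsilon> p s (Suc t) = bind_pmf (step \<epsilon> p s) (\<lambda>(p', s'). steps \<epsilon> p' s' t)"

lemma steps_Suc': "steps \<epsilon> p s (Suc t) = bind_pmf (steps \<epsilon> p s t) (\<lambda>(p', s'). step \<epsilon> p' s')"
proof (induction t arbitrary: p s)
  case 0
  show ?case by (simp add: bind_return_pmf bind_return_pmf' case_prod_beta cong: bind_pmf_cong)
next
  case (Suc t)
  have "steps \<epsilon> p s (Suc (Suc t)) = bind_pmf (step \<epsilon> p s) (\<lambda>x. steps \<epsilon> (fst x) (snd x) (Suc t))"
    by (simp only: steps.simps(2) case_prod_unfold)
  also have "\<dots> = bind_pmf (step \<epsilon> p s) (\<lambda>x. bind_pmf (steps \<epsilon> (fst x) (snd x) t) (\<lambda>(p', s'). step \<epsilon> p' s'))"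
    by (simp only: Suc.IH)
  also have "\<dots> = bind_pmf (bind_pmf (step \<epsilon> p s) (\<lambda>x. steps \<epsilon> (fst x) (snd x) t)) (\<lambda>(p', s'). step \<epsilon> p' s')"
    by (simp only: bind_assoc_pmf)
  also have "\<dots> = bind_pmf (steps \<epsilon> p s (Suc t)) (\<lambda>(p', s'). step \<epsilon> p' s')"
    by (simp only: steps.simps(2) case_prod_unfold)
  finally show ?case .
qed

lemma run_steps: "run A n k \<epsilon> es t = steps \<epsilon> A (init_config n k es) t"
  by (induction t) (simp_all add: steps_Suc' del: steps.simps(2))

lemma steps_Skip: "steps \<epsilon> Skip s t = return_pmf (Skip, s)"
  by (induction t) (simp_all add: bind_return_pmf)

lemma tc_steps_final: "tc \<epsilon> V p s T Q \<Longrightarrow> (p', s') \<in> set_pmf (steps \<epsilon> p s T) \<Longrightarrow> p' = Skip \<and> Q s'"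
proof (induction arbitrary: p' s' rule: tc.induct)
  case (tc_Skip s Q T)
  then show ?case by (simp add: steps_Skip)
next
  case (tc_step p s T Q)
  then show ?case by fastforce
qed

lemma tc_steps_safe: "tc \<epsilon> V p s T Q \<Longrightarrow> (p', s') \<in> set_pmf (steps \<epsilon> p s t) \<Longrightarrow> safe V s'"
proof (induction arbitrary: t p' s' rule: tc.induct)
  case (tc_Skip s Q T)
  then show ?case by (simp add: steps_Skip)
next
  case (tc_step p s T Q)
  then show ?case by (cases t) fastforce+
qed

text \<open>Only the targets of instructions count: a register that is never written keeps its
  initial content, which is zero from register \<open>2\<close> on.\<close>

fun maxreg :: "com \<Rightarrow> nat" where
  "maxreg Skip = 0"
| "maxreg (Const x v) = Suc x"
| "maxreg (Op f x y z) = Suc x"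
| "maxreg (Eps x y) = Suc x"
| "maxreg (Flip x) = Suc x"
| "maxreg (Read x y) = max (Suc x) (Suc y)"
| "maxreg (Emit x y) = 0"
| "maxreg (Seq p q) = max (maxreg p) (maxreg q)"
| "maxreg (IfNZ x p q) = max (maxreg p) (maxreg q)"
| "maxreg (WhileNZ x p) = maxreg p"

lemma step_maxreg:
  "(p', s') \<in> set_pmf (step \<epsilon> p s) \<Longrightarrow> maxreg p' \<le> maxreg p \<and> (\<forall>x\<ge>maxreg p. regs s' x = regs s x)"
proof (induction p arbitrary: p' s')
  case (Read x y)
  then show ?case by (auto simp: set_reg_def split: list.splits)
next
  case (Seq p q)
  show ?case
  proof (cases "p = Skip")
    case True
    then show ?thesis using Seq.prems by auto
  next
    case False
    then obtain p1 where "(p1, s') \<in> set_pmf (step \<epsilon> p s)" "p' = Seq p1 q" using Seq.prems by auto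
    then show ?thesis using Seq.IH(1) by fastforce
  qed
qed (auto simp: set_reg_def split: if_splits)

lemma steps_maxreg:
  "(p', s') \<in> set_pmf (steps \<epsilon> p s t) \<Longrightarrow> x \<ge> maxreg p \<Longrightarrow> regs s' x = regs s x"
proof (induction t arbitrary: p s)
  case (Suc t)
  then obtain p1 s1 where 1: "(p1, s1) \<in> set_pmf (step \<epsilon> p s)" "(p', s') \<in> set_pmf (steps \<epsilon> p1 s1 t)" by auto
  from step_maxreg[OF 1(1)] have "maxreg p1 \<le> maxreg p" "regs s1 x = regs s x" using Suc.prems by auto
  then show ?case using Suc.IH[OF 1(2)] Suc.prems by simp
qed simp

lemma space_bits_le:
  assumes "safe V s" "\<forall>x\<ge>m. regs s x = 0" shows "space_bits s \<le> m * floorlog 2 V"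
proof -
  have "x < m" if "regs s x \<noteq> 0" for x using assms(2) that by (meson leI)
  then have sub: "{x. regs s x \<noteq> 0} \<subseteq> {..<m}" by blast
  then have fin: "finite {x. regs s x \<noteq> 0}" using finite_subset by blast
  have "space_bits s \<le> (\<Sum>x | regs s x \<noteq> 0. floorlog 2 V)" unfolding space_bits_def
    using assms(1) unfolding safe_def by (intro sum_mono floorlog_mono) auto
  also have "\<dots> = card {x. regs s x \<noteq> 0} * floorlog 2 V" by simp
  also have "\<dots> \<le> m * floorlog 2 V" using card_mono[OF _ sub] by (intro mult_right_mono) auto
  finally show ?thesis .
qed

text \<open>The running time is a fixed power of \<open>V + 2\<close>, whose exponent depends on the program only.\<close>

fun tau :: "com \<Rightarrow> nat" where
  "tau (Seq p q) = max (tau p) (tau q) + 2"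
| "tau (IfNZ x p q) = max (tau p) (tau q) + 1"
| "tau (WhileNZ x p) = tau p + 2"
| "tau _ = 1"

section \<open>Proof rules with a uniform time bound\<close>

definition ttc :: "real \<Rightarrow> nat \<Rightarrow> com \<Rightarrow> config \<Rightarrow> (config \<Rightarrow> bool) \<Rightarrow> bool" where
  "ttc \<epsilon> V p s Q \<longleftrightarrow> tc \<epsilon> V p s ((V + 2) ^ tau p) Q"

lemma ttcI: "tc \<epsilon> V p s T Q \<Longrightarrow> T \<le> (V + 2) ^ tau p \<Longrightarrow> ttc \<epsilon> V p s Q"
  unfolding ttc_def by (rule tc_time)

lemma ttc_weaken: "ttc \<epsilon> V p s Q \<Longrightarrow> (\<And>s. safe V s \<Longrightarrow> Q s \<Longrightarrow> Q' s) \<Longrightarrow> ttc \<epsilon> V p s Q'"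
  unfolding ttc_def by (rule tc_weaken) (assumption | rule order_refl | blast)+

lemma ttc_Skip: "safe V s \<Longrightarrow> Q s \<Longrightarrow> ttc \<epsilon> V Skip s Q"
  unfolding ttc_def by (rule tc_Skip)

lemma ttc_atom:
  assumes "step \<epsilon> p s = return_pmf (Skip, s')" "p \<noteq> Skip" "safe V s" "safe V s'" "Q s'"
  shows "ttc \<epsilon> V p s Q"
proof -
  have "tc \<epsilon> V Skip s' 0 Q" using assms(4,5) by (rule tc_Skip)
  then have "tc \<epsilon> V p s (Suc 0) Q" by (rule tc_det[OF assms(2,3,1)])
  then show ?thesis by (rule ttcI) (simp add: Suc_le_eq)
qed

lemma safe_set_reg: "safe V s \<Longrightarrow> v \<le> V \<Longrightarrow> safe V (set_reg x v s)"
  unfolding safe_def set_reg_def by auto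

lemma ttc_Const: "safe V s \<Longrightarrow> v \<le> V \<Longrightarrow> Q (set_reg x v s) \<Longrightarrow> ttc \<epsilon> V (Const x v) s Q"
  by (rule ttc_atom) (auto intro: safe_set_reg)

lemma ttc_Op: "safe V s \<Longrightarrow> apply_op f (regs s y) (regs s z) \<le> V \<Longrightarrow>
    Q (set_reg x (apply_op f (regs s y) (regs s z)) s) \<Longrightarrow> ttc \<epsilon> V (Op f x y z) s Q"
  by (rule ttc_atom) (auto intro: safe_set_reg)

lemma ttc_Eps: "safe V s \<Longrightarrow> nat \<lfloor>\<epsilon> * real (regs s y)\<rfloor> \<le> V \<Longrightarrow>
    Q (set_reg x (nat \<lfloor>\<epsilon> * real (regs s y)\<rfloor>) s) \<Longrightarrow> ttc \<epsilon> V (Eps x y) s Q"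
  by (rule ttc_atom) (auto intro: safe_set_reg)

lemma ttc_Read: "safe V s \<Longrightarrow> safe V (read_edge x y s) \<Longrightarrow> Q (read_edge x y s) \<Longrightarrow> ttc \<epsilon> V (Read x y) s Q"
  by (rule ttc_atom) (auto simp del: read_edge.simps)

lemma ttc_Emit: "safe V s \<Longrightarrow> Q (s\<lparr>stream_out := stream_out s @ [(regs s x, regs s y)]\<rparr>) \<Longrightarrow> ttc \<epsilon> V (Emit x y) s Q"
  by (rule ttc_atom) (auto simp: safe_def)

lemma ttc_Flip:
  assumes "safe V s" "1 \<le> V" "\<And>b. Q (set_reg x (of_bool b) s)" shows "ttc \<epsilon> V (Flip x) s Q"
proof -
  have "tc \<epsilon> V (Flip x) s (Suc 0) Q"
    by (rule tc_step) (use assms in \<open>auto intro!: tc_Skip safe_set_reg simp del: of_bool_eq_iff\<close>)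
  then show ?thesis by (rule ttcI) (simp add: Suc_le_eq)
qed

lemma ttc_Seq:
  assumes "ttc \<epsilon> V p s Q1" "\<And>s'. safe V s' \<Longrightarrow> Q1 s' \<Longrightarrow> ttc \<epsilon> V q s' Q"
  shows "ttc \<epsilon> V (Seq p q) s Q"
proof -
  let ?W = "(V + 2) ^ max (tau p) (tau q)"
  have "tc \<epsilon> V (Seq p q) s (Suc ((V + 2) ^ tau p + (V + 2) ^ tau q)) Q"
    using assms unfolding ttc_def by (rule tc_Seq)
  moreover have "Suc ((V + 2) ^ tau p + (V + 2) ^ tau q) \<le> (V + 2) ^ tau (Seq p q)"
  proof -
    have "(V + 2) ^ tau p \<le> ?W" "(V + 2) ^ tau q \<le> ?W" "1 \<le> ?W" by (auto intro: power_increasing)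
    then have "Suc ((V + 2) ^ tau p + (V + 2) ^ tau q) \<le> 2 * 2 * ?W" by linarith
    also have "\<dots> \<le> (V + 2) * (V + 2) * ?W" by (intro mult_right_mono mult_mono) auto
    also have "\<dots> = (V + 2) ^ tau (Seq p q)" by (simp add: power_add power2_eq_square mult.commute del: add_2_eq_Suc')
    finally show ?thesis .
  qed
  ultimately show ?thesis by (rule ttcI)
qed

lemma ttc_If:
  assumes "safe V s" "regs s x \<noteq> 0 \<Longrightarrow> ttc \<epsilon> V p s Q" "regs s x = 0 \<Longrightarrow> ttc \<epsilon> V q s Q"
  shows "ttc \<epsilon> V (IfNZ x p q) s Q"
proof -
  let ?W = "(V + 2) ^ max (tau p) (tau q)"
  have "tc \<epsilon> V p s ?W Q" if "regs s x \<noteq> 0"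
    using assms(2)[OF that] unfolding ttc_def by (rule tc_time) (simp add: power_increasing)
  moreover have "tc \<epsilon> V q s ?W Q" if "regs s x = 0"
    using assms(3)[OF that] unfolding ttc_def by (rule tc_time) (simp add: power_increasing)
  ultimately have "tc \<epsilon> V (IfNZ x p q) s (Suc ?W) Q" using assms(1) by (intro tc_step) auto
  moreover have "Suc ?W \<le> (V + 2) ^ tau (IfNZ x p q)"
  proof -
    have "1 \<le> ?W" by simp
    then have "Suc ?W \<le> 2 * ?W" by linarith
    also have "\<dots> \<le> (V + 2) * ?W" by (intro mult_right_mono) auto
    finally show ?thesis by simp
  qed
  ultimately show ?thesis by (rule ttcI)
qed

text \<open>The variant also bounds the number of rounds, so a loop costs about a factor
  \<open>V\<close> more than its body; \<open>tau\<close> accounts for this by adding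
  \<open>2\<close> to the exponent.\<close>

lemma ttc_While:
  assumes I: "I s" and s: "safe V s" and mV: "m s \<le> V"
    and body: "\<And>s. I s \<Longrightarrow> safe V s \<Longrightarrow> regs s x \<noteq> 0 \<Longrightarrow> ttc \<epsilon> V p s (\<lambda>s'. I s' \<and> m s' < m s)"
    and Q: "\<And>s. I s \<Longrightarrow> safe V s \<Longrightarrow> regs s x = 0 \<Longrightarrow> Q s"
  shows "ttc \<epsilon> V (WhileNZ x p) s Q"
proof -
  let ?W = "(V + 2) ^ tau p"
  have "tc \<epsilon> V (WhileNZ x p) s (m s * (?W + 2) + 1) Q" using I s
  proof (induction "m s" arbitrary: s rule: less_induct)
    case less
    show ?case
    proof (cases "regs s x = 0")
      case True
      then have "tc \<epsilon> V (WhileNZ x p) s (Suc 0) Q" using less.prems Q by (intro tc_step) (auto intro: tc_Skip)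
      then show ?thesis by (rule tc_time) simp
    next
      case False
      have b: "tc \<epsilon> V p s ?W (\<lambda>s'. I s' \<and> m s' < m s)" using body[OF less.prems False] unfolding ttc_def .
      have "tc \<epsilon> V (Seq p (WhileNZ x p)) s (Suc (?W + ((m s - 1) * (?W + 2) + 1))) Q"
      proof (rule tc_Seq[OF b])
        fix s' assume s': "safe V s'" "I s' \<and> m s' < m s"
        then have "tc \<epsilon> V (WhileNZ x p) s' (m s' * (?W + 2) + 1) Q" using less.hyps by blast
        moreover have "m s' \<le> m s - 1" using s' by linarith
        then have "m s' * (?W + 2) + 1 \<le> (m s - 1) * (?W + 2) + 1" by (intro add_mono mult_right_mono) auto
        ultimately show "tc \<epsilon> V (WhileNZ x p) s' ((m s - 1) * (?W + 2) + 1) Q" by (rule tc_time)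
      qed
      then have "tc \<epsilon> V (WhileNZ x p) s (Suc (Suc (?W + ((m s - 1) * (?W + 2) + 1)))) Q"
        using less.prems False by (intro tc_det[where p = "WhileNZ x p"]) simp_all
      \<comment> \<open>With \<open>m s = 0\<close> the body could not decrease the variant, yet
        some run of it does halt.\<close>
      moreover have "1 \<le> m s" 
      proof (rule ccontr)
        assume "\<not> 1 \<le> m s"
        then have f: "tc \<epsilon> V p s ?W (\<lambda>s'. False)" using tc_weaken[OF b, of "\<lambda>_. False" ?W] by simp
        obtain c where "c \<in> set_pmf (steps \<epsilon> p s ?W)" using set_pmf_not_empty by fast
        then show False using tc_steps_final[OF f] by (cases c) auto
      qed
      then have "Suc (Suc (?W + ((m s - 1) * (?W + 2) + 1))) = m s * (?W + 2) + 1" by (cases "m s") auto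
      ultimately show ?thesis by simp
    qed
  qed
  moreover have "m s * (?W + 2) + 1 \<le> (V + 2) ^ tau (WhileNZ x p)"
  proof -
    have W: "1 \<le> ?W" by simp
    have "m s * (?W + 2) + 1 \<le> V * (?W + 2) + 1" using mV by (intro add_mono mult_right_mono) auto
    also have "\<dots> \<le> V * (?W + 2) + (?W + 2)" by simp
    also have "\<dots> = (V + 1) * (?W + 2)" by simp
    also have "\<dots> \<le> (V + 1) * (3 * ?W)" using W by (intro mult_left_mono) auto
    also have "\<dots> = (3 * (V + 1)) * ?W" by (simp add: algebra_simps)
    also have "\<dots> \<le> ((V + 2) * (V + 2)) * ?W" by (intro mult_right_mono) (auto simp: algebra_simps)
    also have "\<dots> = (V + 2) ^ tau (WhileNZ x p)" by (simp add: power_add power2_eq_square mult.commute del: add_2_eq_Suc')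
    finally show ?thesis .
  qed
  ultimately show ?thesis by (rule ttcI)
qed


section \<open>Expressions\<close>

text \<open>An expression is compiled relative to a level \<open>d\<close>: it leaves its value in register \<open>d\<close> and may use
  the registers above \<open>d\<close>. Binders pass the numbers of their registers to the body.\<close>

type_synonym expr = "nat \<Rightarrow> com"

text \<open>There is no copy instruction, so the value is added to \<open>0\<close>.\<close>

definition vr :: "nat \<Rightarrow> expr" where
  "vr r d = Seq (Const d 0) (Op Add d d r)"

definition op :: "binop \<Rightarrow> expr \<Rightarrow> expr \<Rightarrow> expr" where
  "op f a b d = Seq (a d) (Seq (b (d + 1)) (Op f d d (d + 1)))"

definition fl :: "expr \<Rightarrow> expr" where
  "fl a d = Seq (a d) (Eps d d)"

abbreviation kn :: "nat \<Rightarrow> expr" where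
  "kn c \<equiv> \<lambda>d. Const d c"

text \<open>Register \<open>d\<close> accumulates, \<open>d + 1\<close> counts the rounds made and
  \<open>d + 2\<close> those left. The body receives the numbers of the counter and of the
  accumulator.\<close>

definition itr :: "expr \<Rightarrow> expr \<Rightarrow> (nat \<Rightarrow> nat \<Rightarrow> expr) \<Rightarrow> expr" where
  "itr b e0 e d = Seq (e0 d) (Seq (Const (d + 1) 0) (Seq (b (d + 2)) (WhileNZ (d + 2)
     (Seq (e (d + 1) d (d + 3)) (Seq (Const d 0) (Seq (Op Add d d (d + 3)) (Seq (Const (d + 4) 1)
       (Seq (Op Add (d + 1) (d + 1) (d + 4)) (Op Sub (d + 2) (d + 2) (d + 4))))))))))"

text \<open>Search for the least solution without an explicit bound; register \<open>d + 1\<close>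
  holds the negation of the current test. All codes that the algorithm stores are found in this
  way.\<close>

definition muq :: "(nat \<Rightarrow> expr) \<Rightarrow> expr" where
  "muq e d = Seq (Const d 0) (Seq (e d (d + 1)) (Seq (Const (d + 2) 1) (Seq (Op Sub (d + 1) (d + 2) (d + 1))
     (WhileNZ (d + 1) (Seq (Const (d + 2) 1) (Seq (Op Add d d (d + 2))
       (Seq (e d (d + 1)) (Seq (Const (d + 2) 1) (Op Sub (d + 1) (d + 2) (d + 1))))))))))"

definition sm :: "expr \<Rightarrow> (nat \<Rightarrow> expr) \<Rightarrow> expr" where
  "sm b e = itr b (kn 0) (\<lambda>x a. op Add (vr a) (e x))"

text \<open>Truth values are the numbers \<open>0\<close> and \<open>1\<close>. Subtraction is
  truncated, so \<open>1 - (a - b)\<close> tests \<open>a \<le> b\<close>, and disjunction goes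
  through negation to stay within these two values.\<close>

definition ng :: "expr \<Rightarrow> expr" where "ng e = op Sub (kn 1) e"
definition an :: "expr \<Rightarrow> expr \<Rightarrow> expr" where "an = op Mul"
definition dj :: "expr \<Rightarrow> expr \<Rightarrow> expr" where "dj a b = ng (an (ng a) (ng b))"
definition im :: "expr \<Rightarrow> expr \<Rightarrow> expr" where "im a b = ng (an a (ng b))"
definition le :: "expr \<Rightarrow> expr \<Rightarrow> expr" where "le a b = ng (op Sub a b)"
definition eq :: "expr \<Rightarrow> expr \<Rightarrow> expr" where "eq a b = an (le a b) (le b a)"
definition allq :: "expr \<Rightarrow> (nat \<Rightarrow> expr) \<Rightarrow> expr" where
  "allq b e = itr b (kn 1) (\<lambda>x a. an (vr a) (e x))"
definition exq :: "expr \<Rightarrow> (nat \<Rightarrow> expr) \<Rightarrow> expr" where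
  "exq b e = ng (allq b (\<lambda>x. ng (e x)))"

text \<open>Repeated division avoids the power \<open>g ^ j\<close>, which could exceed the space
  bound.\<close>

definition dig :: "expr \<Rightarrow> expr \<Rightarrow> expr \<Rightarrow> expr" where
  "dig g z j = op Rem (itr j z (\<lambda>x a. op Quo (vr a) g)) g"

locale machine =
  fixes \<epsilon> :: real and V :: nat
  assumes V1: "1 \<le> V" and \<epsilon>1: "\<epsilon> \<le> 1"
begin

text \<open>Quantifying over \<open>d'\<close> allows evaluation at every higher level of nesting.
  Safety is part of \<open>ttc\<close>, so \<open>ev\<close> also says that all intermediate values
  are at most \<open>V\<close>.\<close>

definition ev :: "(nat \<Rightarrow> nat) \<Rightarrow> nat \<Rightarrow> expr \<Rightarrow> nat \<Rightarrow> bool" where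
  "ev \<sigma> d e v \<longleftrightarrow> (\<forall>d' s. d \<le> d' \<and> safe V s \<and> (\<forall>x<d. regs s x = \<sigma> x) \<longrightarrow>
     ttc \<epsilon> V (e d') s (\<lambda>s'. regs s' d' = v \<and> (\<forall>x<d'. regs s' x = regs s x) \<and>
       stream_in s' = stream_in s \<and> stream_out s' = stream_out s))"

lemma evD: "ev \<sigma> d e v \<Longrightarrow> d \<le> d' \<Longrightarrow> safe V s \<Longrightarrow> (\<And>x. x < d \<Longrightarrow> regs s x = \<sigma> x) \<Longrightarrow>
    ttc \<epsilon> V (e d') s (\<lambda>s'. regs s' d' = v \<and> (\<forall>x<d'. regs s' x = regs s x) \<and>
       stream_in s' = stream_in s \<and> stream_out s' = stream_out s)"
  unfolding ev_def by blast

lemma ev_mono: "ev \<sigma> d e v \<Longrightarrow> d \<le> d' \<Longrightarrow> (\<And>x. x < d \<Longrightarrow> \<sigma>' x = \<sigma> x) \<Longrightarrow> ev \<sigma>' d' e v"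
  unfolding ev_def by auto

lemma Seq_Const: "safe V s \<Longrightarrow> v \<le> V \<Longrightarrow> (safe V (set_reg x v s) \<Longrightarrow> ttc \<epsilon> V q (set_reg x v s) Q) \<Longrightarrow> ttc \<epsilon> V (Seq (Const x v) q) s Q"
  by (rule ttc_Seq[of _ _ _ _ "\<lambda>s'. s' = set_reg x v s"]) (auto intro: ttc_Const)

lemma Seq_Op: "safe V s \<Longrightarrow> apply_op f (regs s y) (regs s z) \<le> V \<Longrightarrow>
    (safe V (set_reg x (apply_op f (regs s y) (regs s z)) s) \<Longrightarrow> ttc \<epsilon> V q (set_reg x (apply_op f (regs s y) (regs s z)) s) Q) \<Longrightarrow>
    ttc \<epsilon> V (Seq (Op f x y z) q) s Q"
  by (rule ttc_Seq[of _ _ _ _ "\<lambda>s'. s' = set_reg x (apply_op f (regs s y) (regs s z)) s"]) (auto intro: ttc_Op)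

lemma set_reg_simps [simp]:
  "regs (set_reg x v s) y = (if y = x then v else regs s y)"
  "stream_in (set_reg x v s) = stream_in s" "stream_out (set_reg x v s) = stream_out s"
  unfolding set_reg_def by auto

lemma safe_le: "safe V s \<Longrightarrow> regs s x \<le> V"
  unfolding safe_def by auto

lemma ev_var: assumes "r < d" "\<sigma> r = v" shows "ev \<sigma> d (vr r) v"
  unfolding ev_def vr_def
proof (intro allI impI)
  fix d' s assume a: "d \<le> d' \<and> safe V s \<and> (\<forall>x<d. regs s x = \<sigma> x)"
  then have "regs s r = v" "r \<noteq> d'" "v \<le> V" using assms safe_le[of s r] by auto
  then show "ttc \<epsilon> V (Seq (Const d' 0) (Op Add d' d' r)) s (\<lambda>s'. regs s' d' = v \<and> (\<forall>x<d'. regs s' x = regs s x) \<and>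
       stream_in s' = stream_in s \<and> stream_out s' = stream_out s)"
    using a by (intro Seq_Const ttc_Op) auto
qed

lemma ev_const: "c \<le> V \<Longrightarrow> ev \<sigma> d (kn c) c"
  unfolding ev_def by (auto intro!: ttc_Const)

lemma ev_op:
  assumes a: "ev \<sigma> d a va" and b: "ev \<sigma> d b vb" and le: "va \<le> V \<Longrightarrow> vb \<le> V \<Longrightarrow> apply_op f va vb \<le> V"
    and v: "v = apply_op f va vb"
  shows "ev \<sigma> d (op f a b) v"
  unfolding ev_def op_def
proof (intro allI impI)
  fix d' s assume s: "d \<le> d' \<and> safe V s \<and> (\<forall>x<d. regs s x = \<sigma> x)"
  show "ttc \<epsilon> V (Seq (a d') (Seq (b (d' + 1)) (Op f d' d' (d' + 1)))) s (\<lambda>s'. regs s' d' = v \<and> (\<forall>x<d'. regs s' x = regs s x) \<and>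
       stream_in s' = stream_in s \<and> stream_out s' = stream_out s)" (is "ttc _ _ _ _ ?Q")
  proof (rule ttc_Seq)
    show "ttc \<epsilon> V (a d') s (\<lambda>s'. regs s' d' = va \<and> (\<forall>x<d'. regs s' x = regs s x) \<and>
       stream_in s' = stream_in s \<and> stream_out s' = stream_out s)" by (rule evD[OF a]) (use s in auto)
    fix s1 assume s1: "safe V s1" "regs s1 d' = va \<and> (\<forall>x<d'. regs s1 x = regs s x) \<and>
       stream_in s1 = stream_in s \<and> stream_out s1 = stream_out s"
    show "ttc \<epsilon> V (Seq (b (d' + 1)) (Op f d' d' (d' + 1))) s1 ?Q"
    proof (rule ttc_Seq)
      show "ttc \<epsilon> V (b (d' + 1)) s1 (\<lambda>s'. regs s' (d' + 1) = vb \<and> (\<forall>x<d' + 1. regs s' x = regs s1 x) \<and>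
         stream_in s' = stream_in s1 \<and> stream_out s' = stream_out s1)" by (rule evD[OF b]) (use s s1 in auto)
      fix s2 assume s2: "safe V s2" "regs s2 (d' + 1) = vb \<and> (\<forall>x<d' + 1. regs s2 x = regs s1 x) \<and>
         stream_in s2 = stream_in s1 \<and> stream_out s2 = stream_out s1"
      have "va \<le> V" "vb \<le> V" using safe_le[OF s1(1), of d'] safe_le[OF s2(1), of "d' + 1"] s1(2) s2(2) by auto
      then have "v \<le> V" using le v by simp
      then show "ttc \<epsilon> V (Op f d' d' (d' + 1)) s2 ?Q" using s1 s2 v by (intro ttc_Op) auto
    qed
  qed
qed

lemma ev_fl:
  assumes a: "ev \<sigma> d a va" and v: "v = nat \<lfloor>\<epsilon> * real va\<rfloor>"
  shows "ev \<sigma> d (fl a) v"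
  unfolding ev_def fl_def
proof (intro allI impI)
  fix d' s assume s: "d \<le> d' \<and> safe V s \<and> (\<forall>x<d. regs s x = \<sigma> x)"
  show "ttc \<epsilon> V (Seq (a d') (Eps d' d')) s (\<lambda>s'. regs s' d' = v \<and> (\<forall>x<d'. regs s' x = regs s x) \<and>
       stream_in s' = stream_in s \<and> stream_out s' = stream_out s)" (is "ttc _ _ _ _ ?Q")
  proof (rule ttc_Seq)
    show "ttc \<epsilon> V (a d') s (\<lambda>s'. regs s' d' = va \<and> (\<forall>x<d'. regs s' x = regs s x) \<and>
       stream_in s' = stream_in s \<and> stream_out s' = stream_out s)" by (rule evD[OF a]) (use s in auto)
    fix s1 assume s1: "safe V s1" "regs s1 d' = va \<and> (\<forall>x<d'. regs s1 x = regs s x) \<and>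
       stream_in s1 = stream_in s \<and> stream_out s1 = stream_out s"
    have "\<epsilon> * real va \<le> 1 * real va" using \<epsilon>1 by (intro mult_right_mono) auto
    then have "v \<le> va" unfolding v by linarith
    then have "v \<le> V" using safe_le[OF s1(1), of d'] s1(2) by simp
    then show "ttc \<epsilon> V (Eps d' d') s1 ?Q" using s1 v by (intro ttc_Eps) auto
  qed
qed

text \<open>\<open>acc j\<close> is the accumulator after \<open>j\<close> rounds. The body may
  assume \<open>vb \<le> V\<close>, because the number of rounds has been evaluated safely into a
  register.\<close>

lemma ev_itr:
  assumes b: "ev \<sigma> d b vb" and e0: "ev \<sigma> d e0 (acc 0)"
    and e: "\<And>j r a \<sigma>'. j < vb \<Longrightarrow> vb \<le> V \<Longrightarrow> d \<le> a \<Longrightarrow> r = Suc a \<Longrightarrow> (\<And>y. y < d \<Longrightarrow> \<sigma>' y = \<sigma> y) \<Longrightarrow> \<sigma>' a = acc j \<Longrightarrow> \<sigma>' r = j \<Longrightarrow>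
       ev \<sigma>' (Suc r) (e r a) (acc (Suc j))"
    and v: "v = acc vb"
  shows "ev \<sigma> d (itr b e0 e) v"
  unfolding ev_def
proof (intro allI impI)
  fix d' s assume s: "d \<le> d' \<and> safe V s \<and> (\<forall>x<d. regs s x = \<sigma> x)"
  define eqs where "eqs t \<longleftrightarrow> (\<forall>x<d'. regs t x = regs s x) \<and> stream_in t = stream_in s \<and> stream_out t = stream_out s" for t :: config
  have eqsD: "eqs t \<Longrightarrow> x < d \<Longrightarrow> regs t x = \<sigma> x" for t x using s unfolding eqs_def by auto
  let ?Q = "\<lambda>s'. regs s' d' = v \<and> (\<forall>x<d'. regs s' x = regs s x) \<and> stream_in s' = stream_in s \<and> stream_out s' = stream_out s"
  show "ttc \<epsilon> V (itr b e0 e d') s ?Q" unfolding itr_def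
  proof (rule ttc_Seq)
    show "ttc \<epsilon> V (e0 d') s (\<lambda>s'. regs s' d' = acc 0 \<and> (\<forall>x<d'. regs s' x = regs s x) \<and>
       stream_in s' = stream_in s \<and> stream_out s' = stream_out s)" by (rule evD[OF e0]) (use s in auto)
    fix s1 assume s1: "safe V s1" "regs s1 d' = acc 0 \<and> (\<forall>x<d'. regs s1 x = regs s x) \<and>
       stream_in s1 = stream_in s \<and> stream_out s1 = stream_out s"
    let ?body = "Seq (e (d' + 1) d' (d' + 3)) (Seq (Const d' 0) (Seq (Op Add d' d' (d' + 3)) (Seq (Const (d' + 4) 1)
       (Seq (Op Add (d' + 1) (d' + 1) (d' + 4)) (Op Sub (d' + 2) (d' + 2) (d' + 4))))))"
    show "ttc \<epsilon> V (Seq (Const (d' + 1) 0) (Seq (b (d' + 2)) (WhileNZ (d' + 2) ?body))) s1 ?Q"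
    proof (rule Seq_Const[OF s1(1)])
      let ?s2 = "set_reg (d' + 1) 0 s1"
      assume s2: "safe V ?s2"
      show "ttc \<epsilon> V (Seq (b (d' + 2)) (WhileNZ (d' + 2) ?body)) ?s2 ?Q"
      proof (rule ttc_Seq)
        show "ttc \<epsilon> V (b (d' + 2)) ?s2 (\<lambda>s'. regs s' (d' + 2) = vb \<and> (\<forall>x<d' + 2. regs s' x = regs ?s2 x) \<and>
          stream_in s' = stream_in ?s2 \<and> stream_out s' = stream_out ?s2)"
          by (rule evD[OF b]) (use s s1 s2 in auto)
        fix s3 assume s3: "safe V s3" "regs s3 (d' + 2) = vb \<and> (\<forall>x<d' + 2. regs s3 x = regs ?s2 x) \<and>
          stream_in s3 = stream_in ?s2 \<and> stream_out s3 = stream_out ?s2"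
        have vbV: "vb \<le> V" using safe_le[OF s3(1), of "d' + 2"] s3(2) by simp
        define I where "I t \<longleftrightarrow> (\<exists>j\<le>vb. regs t d' = acc j \<and> regs t (d' + 1) = j \<and> regs t (d' + 2) = vb - j \<and> eqs t)" for t
        show "ttc \<epsilon> V (WhileNZ (d' + 2) ?body) s3 ?Q"
        proof (rule ttc_While[where I = I and m = "\<lambda>t. regs t (d' + 2)"])
          show "I s3" unfolding I_def eqs_def by (rule exI[of _ 0]) (use s1 s3 in auto)
          show "safe V s3" by fact
          show "regs s3 (d' + 2) \<le> V" using s3(1) by (rule safe_le)
          show "?Q t" if "I t" "regs t (d' + 2) = 0" for t
            using that v unfolding I_def eqs_def by auto
          fix t assume t: "I t" "safe V t" "regs t (d' + 2) \<noteq> 0"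
          then obtain j where j: "j < vb" "regs t d' = acc j" "regs t (d' + 1) = j" "regs t (d' + 2) = vb - j" "eqs t"
            unfolding I_def by auto
          have "ev (regs t) (Suc (d' + 1)) (e (d' + 1) d') (acc (Suc j))"
            by (rule e[OF j(1) vbV]) (use j s eqsD in auto)
          then have "ttc \<epsilon> V (e (d' + 1) d' (d' + 3)) t (\<lambda>s'. regs s' (d' + 3) = acc (Suc j) \<and> (\<forall>x<d' + 3. regs s' x = regs t x) \<and>
            stream_in s' = stream_in t \<and> stream_out s' = stream_out t)" by (rule evD) (use t in auto)
          then show "ttc \<epsilon> V ?body t (\<lambda>s'. I s' \<and> regs s' (d' + 2) < regs t (d' + 2))"
          proof (rule ttc_Seq)
            fix t1 assume t1: "safe V t1" "regs t1 (d' + 3) = acc (Suc j) \<and> (\<forall>x<d' + 3. regs t1 x = regs t x) \<and>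
            stream_in t1 = stream_in t \<and> stream_out t1 = stream_out t"
            have aV: "acc (Suc j) \<le> V" using safe_le[OF t1(1), of "d' + 3"] t1(2) by simp
            have r: "regs t1 (d' + 1) = j" "regs t1 (d' + 2) = vb - j" "eqs t1"
              using t1(2) j unfolding eqs_def by auto
            have fin: "I t' \<and> regs t' (d' + 2) < regs t (d' + 2)"
              if "regs t' d' = acc (Suc j)" "regs t' (d' + 1) = Suc j" "regs t' (d' + 2) = vb - Suc j" "eqs t'" for t'
              using that j unfolding I_def by auto
            show "ttc \<epsilon> V (Seq (Const d' 0) (Seq (Op Add d' d' (d' + 3)) (Seq (Const (d' + 4) 1)
              (Seq (Op Add (d' + 1) (d' + 1) (d' + 4)) (Op Sub (d' + 2) (d' + 2) (d' + 4)))))) t1 (\<lambda>s'. I s' \<and> regs s' (d' + 2) < regs t (d' + 2))"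
              using t1(1) V1 aV r j(1) vbV t1(2)
              by (intro Seq_Const Seq_Op ttc_Op fin) (auto simp: eqs_def)
          qed
        qed
      qed
    qed simp
  qed
qed

text \<open>The test is evaluated only up to its least solution \<open>v\<close>, so the candidates
  that are tried never exceed the one that is found.\<close>

lemma ev_muq:
  assumes e: "\<And>j r \<sigma>'. j \<le> v \<Longrightarrow> d \<le> r \<Longrightarrow> (\<And>y. y < d \<Longrightarrow> \<sigma>' y = \<sigma> y) \<Longrightarrow> \<sigma>' r = j \<Longrightarrow>
       ev \<sigma>' (Suc r) (e r) (of_bool (\<phi> j))"
    and \<phi>: "\<phi> v" "\<And>j. j < v \<Longrightarrow> \<not> \<phi> j" and vV: "v \<le> V"
  shows "ev \<sigma> d (muq e) v"
  unfolding ev_def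
proof (intro allI impI)
  fix d' s assume s: "d \<le> d' \<and> safe V s \<and> (\<forall>x<d. regs s x = \<sigma> x)"
  define eqs where "eqs t \<longleftrightarrow> (\<forall>x<d'. regs t x = regs s x) \<and> stream_in t = stream_in s \<and> stream_out t = stream_out s" for t :: config
  let ?Q = "\<lambda>s'. regs s' d' = v \<and> (\<forall>x<d'. regs s' x = regs s x) \<and> stream_in s' = stream_in s \<and> stream_out s' = stream_out s"
  define J where "J j t \<longleftrightarrow> regs t d' = j \<and> eqs t" for j and t :: config
  define I where "I t \<longleftrightarrow> (\<exists>j\<le>v. J j t \<and> regs t (d' + 1) = 1 - of_bool (\<phi> j))" for t
  have ev_e: "ttc \<epsilon> V (e d' (d' + 1)) t (\<lambda>t'. safe V t' \<and> J j t' \<and> regs t' (d' + 1) = of_bool (\<phi> j))"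
    if t: "safe V t" "J j t" "j \<le> v" for t j
  proof -
    have "ev (regs t) (Suc d') (e d') (of_bool (\<phi> j))"
      by (rule e[OF t(3)]) (use s t in \<open>auto simp: J_def eqs_def\<close>)
    then have "ttc \<epsilon> V (e d' (d' + 1)) t (\<lambda>s'. regs s' (d' + 1) = of_bool (\<phi> j) \<and> (\<forall>x<d' + 1. regs s' x = regs t x) \<and>
       stream_in s' = stream_in t \<and> stream_out s' = stream_out t)" by (rule evD) (use t in auto)
    then show ?thesis by (rule ttc_weaken) (use t in \<open>auto simp: J_def eqs_def\<close>)
  qed
  have rest: "ttc \<epsilon> V (Seq (Const (d' + 2) 1) (Op Sub (d' + 1) (d' + 2) (d' + 1))) t
     (\<lambda>t'. J j t' \<and> regs t' (d' + 1) = 1 - of_bool (\<phi> j))"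
    if t: "safe V t \<and> J j t \<and> regs t (d' + 1) = of_bool (\<phi> j)" for t j
    by (intro Seq_Const ttc_Op) (use t V1 in \<open>auto simp: J_def eqs_def\<close>)
  show "ttc \<epsilon> V (muq e d') s ?Q" unfolding muq_def
  proof (rule Seq_Const)
    let ?s1 = "set_reg d' 0 s"
    assume s1: "safe V ?s1"
    have J0: "J 0 ?s1" unfolding J_def eqs_def by auto
    show "ttc \<epsilon> V (Seq (e d' (d' + 1)) (Seq (Const (d' + 2) 1) (Seq (Op Sub (d' + 1) (d' + 2) (d' + 1))
     (WhileNZ (d' + 1) (Seq (Const (d' + 2) 1) (Seq (Op Add d' d' (d' + 2))
       (Seq (e d' (d' + 1)) (Seq (Const (d' + 2) 1) (Op Sub (d' + 1) (d' + 2) (d' + 1)))))))))) ?s1 ?Q" (is "ttc _ _ (Seq _ (Seq _ (Seq _ ?W))) _ _")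
    proof (rule ttc_Seq[OF ev_e[OF s1 J0]])
      fix t assume t: "safe V t \<and> J 0 t \<and> regs t (d' + 1) = of_bool (\<phi> 0)"
      have W: "ttc \<epsilon> V ?W t ?Q" if "I t" "safe V t" for t
      proof (rule ttc_While[where I = I and m = "\<lambda>t. v - regs t d'"])
        show "I t" "safe V t" using that by auto
        show "v - regs t d' \<le> V" using vV by simp
        show "?Q t" if "I t" "regs t (d' + 1) = 0" for t
        proof -
          obtain j where j: "j \<le> v" "J j t" "regs t (d' + 1) = 1 - of_bool (\<phi> j)" using \<open>I t\<close> unfolding I_def by auto
          then have "\<phi> j" using that(2) by (cases "\<phi> j") auto
          then have "j = v" using \<phi>(2)[of j] j(1) by (cases "j = v") auto
          then show ?thesis using j(2) unfolding J_def eqs_def by auto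
        qed
        fix t assume t: "I t" "safe V t" "regs t (d' + 1) \<noteq> 0"
        obtain j where j: "j \<le> v" "J j t" "regs t (d' + 1) = 1 - of_bool (\<phi> j)" using \<open>I t\<close> unfolding I_def by auto
        then have "\<not> \<phi> j" using t(3) by (cases "\<phi> j") auto
        then have jv: "j < v" using \<phi>(1) j(1) by (cases "j = v") auto
        show "ttc \<epsilon> V (Seq (Const (d' + 2) 1) (Seq (Op Add d' d' (d' + 2))
           (Seq (e d' (d' + 1)) (Seq (Const (d' + 2) 1) (Op Sub (d' + 1) (d' + 2) (d' + 1)))))) t (\<lambda>s'. I s' \<and> v - regs s' d' < v - regs t d')"
        proof (intro Seq_Const Seq_Op)
          let ?t2 = "set_reg d' (apply_op Add (regs (set_reg (d' + 2) 1 t) d') (regs (set_reg (d' + 2) 1 t) (d' + 2))) (set_reg (d' + 2) 1 t)"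
          assume t2: "safe V ?t2"
          have J2: "J (Suc j) ?t2" using j(2) unfolding J_def eqs_def by auto
          show "ttc \<epsilon> V (Seq (e d' (d' + 1)) (Seq (Const (d' + 2) 1) (Op Sub (d' + 1) (d' + 2) (d' + 1)))) ?t2 (\<lambda>s'. I s' \<and> v - regs s' d' < v - regs t d')"
          proof (rule ttc_Seq[OF ev_e[OF t2 J2]])
            show "Suc j \<le> v" using jv by simp
            fix t3 assume t3: "safe V t3 \<and> J (Suc j) t3 \<and> regs t3 (d' + 1) = of_bool (\<phi> (Suc j))"
            show "ttc \<epsilon> V (Seq (Const (d' + 2) 1) (Op Sub (d' + 1) (d' + 2) (d' + 1))) t3 (\<lambda>s'. I s' \<and> v - regs s' d' < v - regs t d')"
              using rest[OF t3]
            proof (rule ttc_weaken)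
              fix t4 assume "J (Suc j) t4 \<and> regs t4 (d' + 1) = 1 - of_bool (\<phi> (Suc j))"
              then show "I t4 \<and> v - regs t4 d' < v - regs t d'" using jv j(2) unfolding I_def J_def by auto
            qed
          qed
        qed (use t j jv vV V1 in \<open>auto simp: J_def\<close>)
      qed
      have I2: "I (set_reg (d' + 1) (1 - of_bool (\<phi> 0)) (set_reg (d' + 2) 1 t))"
        unfolding I_def by (rule exI[of _ 0]) (use t in \<open>auto simp: J_def eqs_def\<close>)
      show "ttc \<epsilon> V (Seq (Const (d' + 2) 1) (Seq (Op Sub (d' + 1) (d' + 2) (d' + 1)) ?W)) t ?Q"
        by (intro Seq_Const Seq_Op W) (use t V1 I2 in auto)
    qed simp
  qed (use s in auto)
qed

lemma ev_sm:
  assumes b: "ev \<sigma> d b vb"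
    and e: "\<And>j r \<sigma>'. j < vb \<Longrightarrow> d \<le> r \<Longrightarrow> (\<And>y. y < d \<Longrightarrow> \<sigma>' y = \<sigma> y) \<Longrightarrow> \<sigma>' r = j \<Longrightarrow> ev \<sigma>' (Suc r) (e r) (f j)"
    and le: "vb \<le> V \<Longrightarrow> (\<Sum>j<vb. f j) \<le> V" and v: "v = (\<Sum>j<vb. f j)"
  shows "ev \<sigma> d (sm b e) v"
  unfolding sm_def
proof (rule ev_itr[OF b, where acc = "\<lambda>j. \<Sum>i<j. f i"])
  show "ev \<sigma> d (kn 0) (\<Sum>i<0. f i)" using ev_const[of 0] by simp
  fix j r a \<sigma>' assume h: "j < vb" "vb \<le> V" "d \<le> a" "r = Suc a" "\<And>y. y < d \<Longrightarrow> \<sigma>' y = \<sigma> y" "\<sigma>' a = (\<Sum>i<j. f i)" "\<sigma>' r = j"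
  have "(\<Sum>i<Suc j. f i) \<le> (\<Sum>j<vb. f j)" using h(1) by (intro sum_mono2) auto
  then have "(\<Sum>i<j. f i) + f j \<le> V" using le h(2) by simp
  then show "ev \<sigma>' (Suc r) (op Add (vr a) (e r)) (\<Sum>i<Suc j. f i)"
    by (intro ev_op[OF ev_var e]) (use h in auto)
qed (rule v)

lemma ev_ng: "ev \<sigma> d e (of_bool \<phi>) \<Longrightarrow> ev \<sigma> d (ng e) (of_bool (\<not> \<phi>))"
  unfolding ng_def by (rule ev_op[OF ev_const]) (use V1 in auto)

lemma ev_an: "ev \<sigma> d a (of_bool \<phi>) \<Longrightarrow> ev \<sigma> d b (of_bool \<psi>) \<Longrightarrow> ev \<sigma> d (an a b) (of_bool (\<phi> \<and> \<psi>))"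
  unfolding an_def by (rule ev_op) (use V1 in auto)

lemma ev_dj: "ev \<sigma> d a (of_bool \<phi>) \<Longrightarrow> ev \<sigma> d b (of_bool \<psi>) \<Longrightarrow> ev \<sigma> d (dj a b) (of_bool (\<phi> \<or> \<psi>))"
  unfolding dj_def using ev_ng[OF ev_an[OF ev_ng ev_ng]] by simp

lemma ev_im: "ev \<sigma> d a (of_bool \<phi>) \<Longrightarrow> ev \<sigma> d b (of_bool \<psi>) \<Longrightarrow> ev \<sigma> d (im a b) (of_bool (\<phi> \<longrightarrow> \<psi>))"
  unfolding im_def using ev_ng[OF ev_an[OF _ ev_ng]] by simp

lemma ev_le: "ev \<sigma> d a x \<Longrightarrow> ev \<sigma> d b y \<Longrightarrow> ev \<sigma> d (le a b) (of_bool (x \<le> y))"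
  unfolding le_def ng_def by (rule ev_op[OF ev_const ev_op]) (use V1 in auto)

lemma ev_eq: "ev \<sigma> d a x \<Longrightarrow> ev \<sigma> d b y \<Longrightarrow> ev \<sigma> d (eq a b) (of_bool (x = y))"
  unfolding eq_def using ev_an[OF ev_le ev_le, of \<sigma> d a x b y b y a x] by (simp add: eq_iff)

lemma ev_allq:
  assumes b: "ev \<sigma> d b vb"
    and e: "\<And>j r \<sigma>'. j < vb \<Longrightarrow> d \<le> r \<Longrightarrow> (\<And>y. y < d \<Longrightarrow> \<sigma>' y = \<sigma> y) \<Longrightarrow> \<sigma>' r = j \<Longrightarrow> ev \<sigma>' (Suc r) (e r) (of_bool (\<phi> j))"
  shows "ev \<sigma> d (allq b e) (of_bool (\<forall>j<vb. \<phi> j))"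
  unfolding allq_def
proof (rule ev_itr[OF b, where acc = "\<lambda>j. of_bool (\<forall>i<j. \<phi> i)"])
  show "ev \<sigma> d (kn 1) (of_bool (\<forall>i<0. \<phi> i))" using ev_const[OF V1] by simp
  fix j r a \<sigma>' assume h: "j < vb" "vb \<le> V" "d \<le> a" "r = Suc a" "\<And>y. y < d \<Longrightarrow> \<sigma>' y = \<sigma> y" "\<sigma>' a = of_bool (\<forall>i<j. \<phi> i)" "\<sigma>' r = j"
  have "ev \<sigma>' (Suc r) (an (vr a) (e r)) (of_bool ((\<forall>i<j. \<phi> i) \<and> \<phi> j))"
    by (intro ev_an ev_var e) (use h in auto)
  moreover have "((\<forall>i<j. \<phi> i) \<and> \<phi> j) = (\<forall>i<Suc j. \<phi> i)" by (auto simp: less_Suc_eq)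
  ultimately show "ev \<sigma>' (Suc r) (an (vr a) (e r)) (of_bool (\<forall>i<Suc j. \<phi> i))" by simp
qed simp

lemma ev_exq:
  assumes b: "ev \<sigma> d b vb"
    and e: "\<And>j r \<sigma>'. j < vb \<Longrightarrow> d \<le> r \<Longrightarrow> (\<And>y. y < d \<Longrightarrow> \<sigma>' y = \<sigma> y) \<Longrightarrow> \<sigma>' r = j \<Longrightarrow> ev \<sigma>' (Suc r) (e r) (of_bool (\<phi> j))"
  shows "ev \<sigma> d (exq b e) (of_bool (\<exists>j<vb. \<phi> j))"
  using ev_ng[OF ev_allq[OF b, of "\<lambda>x. ng (e x)" "\<lambda>j. \<not> \<phi> j"]] ev_ng[OF e] unfolding exq_def by simp

lemma ev_dig:
  assumes g: "ev \<sigma> d g vg" and z: "ev \<sigma> d z vz" and j: "ev \<sigma> d j vj"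
  shows "ev \<sigma> d (dig g z j) (dg vg vz vj)"
  unfolding dig_def
proof (rule ev_op[OF ev_itr[OF j, where acc = "\<lambda>i. vz div vg ^ i"] g])
  show "ev \<sigma> d z (vz div vg ^ 0)" using z by simp
  fix i r a \<sigma>' assume h: "d \<le> a" "r = Suc a" "\<And>y. y < d \<Longrightarrow> \<sigma>' y = \<sigma> y" "\<sigma>' a = vz div vg ^ i"
  have gr: "ev \<sigma>' (Suc r) g vg" by (rule ev_mono[OF g]) (use h in auto)
  show "ev \<sigma>' (Suc r) (op Quo (vr a) g) (vz div vg ^ Suc i)"
    by (rule ev_op[OF ev_var[of a _ _ "vz div vg ^ i"] gr]) (use h in \<open>auto simp: div_mult2_eq power_Suc2 simp del: power_Suc intro: le_trans[OF div_le_dividend]\<close>)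
qed (auto simp: dg_def intro: le_trans[OF mod_less_eq_dividend])

end


section \<open>Encodings\<close>

text \<open>A code \<open>z\<close> of a subset of \<open>{..<nn}\<close> consists of a base \<open>g = z mod (nn + 1) + 2\<close> and of base-\<open>g\<close> digits
  that move a cursor: digit \<open>0\<close> skips \<open>g - 1\<close> positions, and digit \<open>d > 0\<close> advances by \<open>d\<close> and emits the
  position just passed. Sets of size \<open>m\<close> have codes of about \<open>2 m log (nn / m)\<close> bits.\<close>

definition wt :: "nat \<Rightarrow> nat \<Rightarrow> nat" where
  "wt g d = (if d = 0 then g - 1 else d)"

definition mem :: "nat \<Rightarrow> nat \<Rightarrow> nat \<Rightarrow> bool" where
  "mem nn z e \<longleftrightarrow> (\<exists>j<nn. dg (z mod (nn + 1) + 2) (z div (nn + 1)) j \<noteq> 0 \<and>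
     (\<Sum>i<Suc j. wt (z mod (nn + 1) + 2) (dg (z mod (nn + 1) + 2) (z div (nn + 1)) i)) = Suc e)"

definition codes :: "nat \<Rightarrow> nat \<Rightarrow> nat set" where
  "codes nn z = {e. e < nn \<and> mem nn z e}"

text \<open>The elements are appended in increasing order. A gap
  \<open>e - p = q * (g - 1) + r\<close> is written as \<open>q\<close> skips and the digit
  \<open>r + 1\<close>. Skips are charged to the distance they cover and the other digits to the
  elements, which gives the bound on \<open>L\<close>.\<close>

lemma gap_digits:
  fixes g :: nat
  assumes g: "2 \<le> g" and S: "finite S"
  shows "\<exists>L \<delta>. (\<forall>i. \<delta> i < g) \<and> {e. \<exists>j<L. \<delta> j \<noteq> 0 \<and> (\<Sum>i<Suc j. wt g (\<delta> i)) = Suc e} = S \<and>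
     L * (g - 1) \<le> card S * (g - 1) + (\<Sum>i<L. wt g (\<delta> i)) \<and> (\<forall>B. S \<subseteq> {..<B} \<longrightarrow> (\<Sum>i<L. wt g (\<delta> i)) \<le> B)"
  using S
proof (induction S rule: finite_linorder_max_induct)
  case empty
  show ?case by (intro exI[of _ 0] exI[of _ "\<lambda>_. 0"]) (use g in auto)
next
  case (insert e S)
  then obtain L \<delta> where L: "\<forall>i. \<delta> i < g" "{e. \<exists>j<L. \<delta> j \<noteq> 0 \<and> (\<Sum>i<Suc j. wt g (\<delta> i)) = Suc e} = S"
     "L * (g - 1) \<le> card S * (g - 1) + (\<Sum>i<L. wt g (\<delta> i))" "\<forall>B. S \<subseteq> {..<B} \<longrightarrow> (\<Sum>i<L. wt g (\<delta> i)) \<le> B" by blast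
  define p where "p = (\<Sum>i<L. wt g (\<delta> i))"
  have "S \<subseteq> {..<e}" using insert.hyps by auto
  then have pe: "p \<le> e" using L(4) unfolding p_def by blast
  define q r where "q = (e - p) div (g - 1)" and "r = (e - p) mod (g - 1)"
  have qr: "q * (g - 1) + r = e - p" unfolding q_def r_def by (rule div_mult_mod_eq)
  have rg: "r < g - 1" unfolding r_def using g by simp
  define \<delta>' where "\<delta>' i = (if i < L then \<delta> i else if i < L + q then 0 else r + 1)" for i
  have low: "(\<Sum>i<j. wt g (\<delta>' i)) = (\<Sum>i<j. wt g (\<delta> i))" if "j \<le> L" for j
    unfolding \<delta>'_def using that by (intro sum.cong) auto
  have "(\<Sum>i<L + j. wt g (\<delta>' i)) = p + j * (g - 1)" if "j \<le> q" for j
    using that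
  proof (induction j)
    case 0 then show ?case using low[of L] unfolding p_def by simp
  next
    case (Suc j) then show ?case unfolding \<delta>'_def by (simp add: wt_def)
  qed
  from this[of q] have mid: "(\<Sum>i<L + q. wt g (\<delta>' i)) = p + q * (g - 1)" by simp
  have top: "(\<Sum>i<Suc (L + q). wt g (\<delta>' i)) = Suc e"
    using mid qr pe unfolding \<delta>'_def by (simp add: wt_def)
  have em: "{x. \<exists>j<Suc (L + q). \<delta>' j \<noteq> 0 \<and> (\<Sum>i<Suc j. wt g (\<delta>' i)) = Suc x} = insert e S" (is "?E = _")
  proof (intro equalityI subsetI)
    fix x assume "x \<in> ?E"
    then obtain j where j: "j < Suc (L + q)" "\<delta>' j \<noteq> 0" "(\<Sum>i<Suc j. wt g (\<delta>' i)) = Suc x" by blast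
    show "x \<in> insert e S"
    proof (cases "j < L")
      case True
      then have "\<delta> j \<noteq> 0" "(\<Sum>i<Suc j. wt g (\<delta> i)) = Suc x" using j(2,3) low[of "Suc j"] by (auto simp: \<delta>'_def)
      then show ?thesis using L(2) True by blast
    next
      case False
      then have "j = L + q" using j(1,2) unfolding \<delta>'_def by (auto split: if_splits)
      then have "Suc x = Suc e" using top j(3) by simp
      then show ?thesis by simp
    qed
  next
    fix x assume "x \<in> insert e S"
    then consider "x = e" | "x \<in> S" by blast
    then show "x \<in> ?E"
    proof cases
      case 1
      have "\<delta>' (L + q) \<noteq> 0" unfolding \<delta>'_def by simp
      then show ?thesis using top 1 by blast
    next
      case 2
      then obtain j where j: "j < L" "\<delta> j \<noteq> 0" "(\<Sum>i<Suc j. wt g (\<delta> i)) = Suc x" using L(2) by blast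
      then have "\<delta>' j \<noteq> 0" "(\<Sum>i<Suc j. wt g (\<delta>' i)) = Suc x" "j < Suc (L + q)" using low[of "Suc j"] by (auto simp: \<delta>'_def)
      then show ?thesis by blast
    qed
  qed
  have "card (insert e S) = Suc (card S)" using insert.hyps by (subst card_insert_disjoint) auto
  then have len: "Suc (L + q) * (g - 1) \<le> card (insert e S) * (g - 1) + (\<Sum>i<Suc (L + q). wt g (\<delta>' i))"
  proof -
    define h where "h = g - 1"
    have "L * h \<le> card S * h + p" "q * h + r = e - p" using L(3) qr unfolding h_def p_def by auto
    moreover have "Suc (L + q) * h = h + L * h + q * h" "Suc (card S) * h = h + card S * h" by (simp_all add: algebra_simps)
    ultimately show ?thesis using pe unfolding top h_def[symmetric] \<open>card (insert e S) = Suc (card S)\<close> by linarith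
  qed
  have bd: "\<forall>B. insert e S \<subseteq> {..<B} \<longrightarrow> (\<Sum>i<Suc (L + q). wt g (\<delta>' i)) \<le> B" unfolding top by auto
  have "\<forall>i. \<delta>' i < g" using L(1) rg g unfolding \<delta>'_def by auto
  then show ?case using em len bd by blast
qed

text \<open>The base \<open>nn div m + 2\<close> makes each skip longer than \<open>nn / m\<close>,
  so that at most \<open>m\<close> skips fit besides the at most \<open>m\<close> digits that emit
  an element.\<close>

lemma code_exists:
  assumes S: "S \<subseteq> {..<nn}" "card S \<le> m" and m: "1 \<le> m" "m \<le> nn"
  shows "\<exists>z. z < (nn + 1) * (nn div m + 2) ^ (2 * m + 1) \<and> codes nn z = S"
proof -
  define g where "g = nn div m + 2"
  have g2: "2 \<le> g" unfolding g_def by simp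
  have fS: "finite S" using S finite_subset by blast
  obtain L \<delta> where L: "\<forall>i. \<delta> i < g" "{e. \<exists>j<L. \<delta> j \<noteq> 0 \<and> (\<Sum>i<Suc j. wt g (\<delta> i)) = Suc e} = S"
     "L * (g - 1) \<le> card S * (g - 1) + (\<Sum>i<L. wt g (\<delta> i))" "\<forall>B. S \<subseteq> {..<B} \<longrightarrow> (\<Sum>i<L. wt g (\<delta> i)) \<le> B"
    using gap_digits[OF g2 fS] by blast
  have "L \<le> 2 * m"
  proof (rule ccontr)
    assume "\<not> L \<le> 2 * m"
    then have "(m + card S) * (g - 1) \<le> L * (g - 1)" using S(2) by (intro mult_right_mono) auto
    also have "\<dots> \<le> card S * (g - 1) + nn" using L(3) L(4)[rule_format, OF S(1)] by linarith
    finally have "m * (g - 1) \<le> nn" by (simp add: algebra_simps)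
    moreover have "nn < m * (nn div m + 1)" using m(1) dividend_less_times_div[of m nn] by simp
    ultimately show False unfolding g_def by simp
  qed
  obtain x where x: "x < g ^ L" "\<forall>i<L. dg g x i = \<delta> i" using dg_exists[of g L \<delta>] L(1) g2 by auto
  \<comment> \<open>Leading zeros are skips and never emit.\<close>
  have hi: "dg g x i = 0" if "L \<le> i" for i
  proof -
    have "x < g ^ i" using x(1) power_increasing[OF that, of g] g2 by linarith
    then show ?thesis unfolding dg_def by simp
  qed
  define z where "z = (nn + 1) * x + (g - 2)"
  have "nn div m \<le> nn" by simp
  then have gn: "g - 2 < nn + 1" unfolding g_def by linarith
  have z1: "z mod (nn + 1) + 2 = g" unfolding z_def using gn g2 by (metis add.commute le_add_diff_inverse mod_less mod_mult_self2)
  have "z = (g - 2) + (nn + 1) * x" unfolding z_def by (rule add.commute)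
  then have "z div (nn + 1) = x + (g - 2) div (nn + 1)" using div_mult_self2[of "nn + 1" "g - 2" x] by simp
  then have z2: "z div (nn + 1) = x" using gn by simp
  have sums: "(\<Sum>i<Suc j. wt g (dg g x i)) = (\<Sum>i<Suc j. wt g (\<delta> i))" if "j < L" for j
    using that x(2) by (intro sum.cong) auto
  have wt1: "1 \<le> wt g d" for d unfolding wt_def using g2 by auto
  have "codes nn z = S"
  proof (intro equalityI subsetI)
    fix e assume "e \<in> codes nn z"
    then obtain j where j: "dg g x j \<noteq> 0" "(\<Sum>i<Suc j. wt g (dg g x i)) = Suc e"
      unfolding codes_def mem_def z1 z2 by blast
    then have "j < L" using hi[of j] by (meson not_le)
    then show "e \<in> S" using j sums x(2) L(2) by auto
  next
    fix e assume e: "e \<in> S"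
    then obtain j where j: "j < L" "\<delta> j \<noteq> 0" "(\<Sum>i<Suc j. wt g (\<delta> i)) = Suc e" using L(2) by blast
    \<comment> \<open>Every digit advances the cursor, so \<open>e\<close> is emitted by digit
      \<open>e\<close> at the latest; this justifies the bound \<open>j < nn\<close> in
      \<open>mem\<close>.\<close>
    have "(\<Sum>i<Suc j. 1) \<le> (\<Sum>i<Suc j. wt g (\<delta> i))" using wt1 by (intro sum_mono)
    then have "j \<le> e" using j(3) by simp
    then have "j < nn" "e < nn" using e S by auto
    then show "e \<in> codes nn z" unfolding codes_def mem_def z1 z2 using j sums[OF j(1)] x(2) by auto
  qed
  moreover have "z < (nn + 1) * g ^ (2 * m + 1)"
  proof -
    have "z < (nn + 1) * x + (nn + 1)" unfolding z_def using gn by simp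
    also have "\<dots> = (nn + 1) * (x + 1)" by (simp add: algebra_simps)
    also have "\<dots> \<le> (nn + 1) * g ^ L" using x(1) by (intro mult_left_mono) auto
    also have "\<dots> \<le> (nn + 1) * g ^ (2 * m + 1)" using \<open>L \<le> 2 * m\<close> g2 by (intro mult_left_mono power_increasing) auto
    finally show ?thesis .
  qed
  ultimately show ?thesis unfolding g_def by blast
qed

lemma codes_0: "codes nn 0 = {}"
  unfolding codes_def mem_def dg_def by auto

section \<open>Codes of graphs, labellings, vertex sets and matchings\<close>

definition gr :: "nat \<Rightarrow> nat set \<Rightarrow> nat set set" where
  "gr n Z = (\<lambda>e. {e div n, e mod n}) ` Z"

text \<open>The number \<open>u * n + v\<close> is the edge between \<open>u\<close> and
  \<open>v\<close> in the orientation of the stream; the other orientation is a different number for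
  the same edge.\<close>

definition arcs :: "nat \<Rightarrow> nat set" where
  "arcs n = {e. e < n * n \<and> e div n \<noteq> e mod n}"

lemma arcsD: "e \<in> arcs n \<Longrightarrow> e div n < n \<and> e mod n < n \<and> e div n \<noteq> e mod n"
proof -
  assume e: "e \<in> arcs n"
  then have "0 < n" unfolding arcs_def by (cases n) auto
  then show ?thesis using e unfolding arcs_def by (auto simp: less_mult_imp_div_less)
qed

lemma gr_graph_on: "Z \<subseteq> arcs n \<Longrightarrow> graph_on {..<n} (gr n Z)"
  unfolding gr_def graph_on_def using arcsD by fastforce

lemma gr_Un: "gr n (Z \<union> Z') = gr n Z \<union> gr n Z'"
  unfolding gr_def by auto

text \<open>Functions \<open>{..<n} \<rightarrow> {..n}\<close> are coded by \<open>n\<close> digits in base \<open>n + 1\<close>, and sets by functions that are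
  nonzero exactly there.\<close>

definition fd :: "nat \<Rightarrow> nat \<Rightarrow> nat \<Rightarrow> nat" where
  "fd n y v = dg (n + 1) y v"

definition cnt :: "nat \<Rightarrow> nat \<Rightarrow> nat" where
  "cnt n y = (\<Sum>v<n. of_bool (fd n y v \<noteq> 0))"

lemma cnt_card: "cnt n y = card {v. v < n \<and> fd n y v \<noteq> 0}"
  unfolding cnt_def by (simp add: of_bool_def sum.If_cases Int_def lessThan_def)

lemma fd_le: "fd n y v \<le> n"
  unfolding fd_def dg_def by (simp add: less_Suc_eq_le[symmetric] del: less_Suc_eq_le)

lemma fd_exists: "(\<And>v. v < n \<Longrightarrow> f v \<le> n) \<Longrightarrow> \<exists>y<(n + 1) ^ n. \<forall>v<n. fd n y v = f v"
  unfolding fd_def by (intro dg_exists) (auto simp: less_Suc_eq_le)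

definition hv :: "nat \<Rightarrow> nat \<Rightarrow> nat \<Rightarrow> nat \<Rightarrow> nat" where
  "hv M H i v = (if i = 0 then v else dg M H v mod i)"

definition lev :: "nat \<Rightarrow> nat \<Rightarrow> nat" where
  "lev n i = (if i = 0 then n else i)"

lemma hv_less: "v < n \<Longrightarrow> hv M H i v < lev n i"
  unfolding hv_def lev_def by auto

definition vio :: "nat \<Rightarrow> nat \<Rightarrow> bool" where
  "vio a b \<longleftrightarrow> a \<noteq> 0 \<and> b \<noteq> 0 \<and> a \<noteq> b"

lemma viol_himg:
  assumes "\<not> viol f {h a, h b} \<or> {h a, h b} \<notin> himg h E" "{a, b} \<in> E"
  shows "\<not> vio (f (h a)) (f (h b))"
proof
  assume v: "vio (f (h a)) (f (h b))"
  then have "h a \<noteq> h b" unfolding vio_def by auto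
  then have "{h a, h b} \<in> himg h E" using assms(2) unfolding himg_def by (auto intro!: exI[of _ "{a, b}"])
  moreover have "viol f {h a, h b}" using v unfolding vio_def viol_def by auto
  ultimately show False using assms(1) by blast
qed

text \<open>Level \<open>0\<close> is the graph itself, and level \<open>i > 0\<close> its image under the hash function modulo \<open>i\<close>.\<close>

definition level :: "nat \<Rightarrow> nat \<Rightarrow> nat \<Rightarrow> bool" where
  "level s0 M i \<longleftrightarrow> i = 0 \<or> s0 \<le> i \<and> M mod i = 0"

text \<open>\<open>covers\<close> over numbers: labellings and vertex sets are replaced by their
  codes below \<open>(n + 1) ^ n\<close>, which a program can enumerate. Digits in base
  \<open>n + 1\<close> correspond to the label bound \<open>n\<close>.\<close>

definition coverN :: "nat \<Rightarrow> nat \<Rightarrow> nat \<Rightarrow> nat \<Rightarrow> nat \<Rightarrow> nat set \<Rightarrow> nat set \<Rightarrow> bool" where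
  "coverN n M H i Q W Z \<longleftrightarrow> (\<forall>f<(n + 1) ^ n.
     (\<forall>e<n * n. e \<in> W \<longrightarrow> \<not> vio (fd n f (hv M H i (e div n))) (fd n f (hv M H i (e mod n)))) \<longrightarrow>
     (\<exists>C<(n + 1) ^ n. cnt n C \<le> Q \<and> (\<forall>e<n * n. e \<in> Z \<and> vio (fd n f (hv M H i (e div n))) (fd n f (hv M H i (e mod n))) \<longrightarrow>
        fd n C (hv M H i (e div n)) \<noteq> 0 \<or> fd n C (hv M H i (e mod n)) \<noteq> 0)))"

lemma coverN_iff:
  assumes Z: "Z \<subseteq> arcs n" and W: "W \<subseteq> Z" and i: "i \<le> n"
  shows "coverN n M H i Q W Z \<longleftrightarrow> covers n (lev n i) Q (himg (hv M H i) (gr n W)) (himg (hv M H i) (gr n Z))"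
proof -
  let ?h = "hv M H i" and ?N = "lev n i"
  have Nn: "?N \<le> n" using i unfolding lev_def by auto
  have nn: "e < n * n" if "e \<in> Z" for e using that Z unfolding arcs_def by auto
  have hN: "?h (e div n) < ?N" "?h (e mod n) < ?N" if "e \<in> Z" for e using hv_less arcsD that Z by blast+
  have ed: "{e div n, e mod n} \<in> gr n Y" if "e \<in> Y" for e Y using that unfolding gr_def by auto
  have himgD: "\<exists>e\<in>Y. x = {?h (e div n), ?h (e mod n)}" if "x \<in> himg ?h (gr n Y)" for x Y
    using that unfolding himg_def gr_def by auto
  show ?thesis
  proof
    assume c: "coverN n M H i Q W Z"
    show "covers n ?N Q (himg ?h (gr n W)) (himg ?h (gr n Z))" unfolding covers_def
    proof (intro allI impI)
      fix f assume f: "(\<forall>v<?N. f v \<le> n) \<and> (\<forall>e\<in>himg ?h (gr n W). \<not> viol f e)"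
      have "\<exists>y<(n + 1) ^ n. \<forall>v<n. fd n y v = (if v < ?N then f v else 0)"
        by (rule fd_exists) (use f in auto)
      then obtain y where y: "y < (n + 1) ^ n" "\<forall>v<n. fd n y v = (if v < ?N then f v else 0)" by blast
      have yf: "fd n y v = f v" if "v < ?N" for v using y(2) that Nn by auto
      have "\<forall>e<n * n. e \<in> W \<longrightarrow> \<not> vio (fd n y (?h (e div n))) (fd n y (?h (e mod n)))"
      proof (intro allI impI)
        fix e assume e: "e \<in> W"
        then have "\<not> vio (f (?h (e div n))) (f (?h (e mod n)))" using viol_himg[OF _ ed[OF e]] f by blast
        then show "\<not> vio (fd n y (?h (e div n))) (fd n y (?h (e mod n)))" using yf hN e W by auto
      qed
      then obtain C where C: "C < (n + 1) ^ n" "cnt n C \<le> Q" "\<forall>e<n * n. e \<in> Z \<and> vio (fd n y (?h (e div n))) (fd n y (?h (e mod n))) \<longrightarrow>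
        fd n C (?h (e div n)) \<noteq> 0 \<or> fd n C (?h (e mod n)) \<noteq> 0" using c y(1) unfolding coverN_def by blast
      define C' where "C' = {v. v < ?N \<and> fd n C v \<noteq> 0}"
      have "card C' \<le> cnt n C" unfolding cnt_card C'_def using Nn by (intro card_mono) auto
      moreover have "x \<inter> C' \<noteq> {}" if x: "x \<in> himg ?h (gr n Z)" "viol f x" for x
      proof -
        obtain e where e: "e \<in> Z" "x = {?h (e div n), ?h (e mod n)}" using himgD[OF x(1)] by blast
        then have "vio (f (?h (e div n))) (f (?h (e mod n)))" using x(2) unfolding viol_def vio_def by auto
        then have "vio (fd n y (?h (e div n))) (fd n y (?h (e mod n)))" using yf hN e(1) by auto
        then have "fd n C (?h (e div n)) \<noteq> 0 \<or> fd n C (?h (e mod n)) \<noteq> 0" using C(3) e(1) nn by blast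
        then show ?thesis using hN[OF e(1)] e(2) unfolding C'_def by auto
      qed
      ultimately show "\<exists>C. C \<subseteq> {..<?N} \<and> card C \<le> Q \<and> (\<forall>e\<in>himg ?h (gr n Z). viol f e \<longrightarrow> e \<inter> C \<noteq> {})"
        using C(2) by (intro exI[of _ C']) (auto simp: C'_def)
    qed
  next
    assume c: "covers n ?N Q (himg ?h (gr n W)) (himg ?h (gr n Z))"
    show "coverN n M H i Q W Z" unfolding coverN_def
    proof (intro allI impI)
      fix y assume y: "y < (n + 1) ^ n" "\<forall>e<n * n. e \<in> W \<longrightarrow> \<not> vio (fd n y (?h (e div n))) (fd n y (?h (e mod n)))"
      have "\<not> viol (fd n y) x" if x: "x \<in> himg ?h (gr n W)" for x
      proof -
        obtain e where e: "e \<in> W" "x = {?h (e div n), ?h (e mod n)}" using himgD[OF x] by blast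
        then have "\<not> vio (fd n y (?h (e div n))) (fd n y (?h (e mod n)))" using y(2) nn W by blast
        then show ?thesis unfolding e(2) viol_def vio_def by auto
      qed
      then have "(\<forall>v<?N. fd n y v \<le> n) \<and> (\<forall>e\<in>himg ?h (gr n W). \<not> viol (fd n y) e)" using fd_le by blast
      from c[unfolded covers_def, THEN spec[of _ "fd n y"], THEN mp, OF this]
      obtain C where C: "C \<subseteq> {..<?N}" "card C \<le> Q" "\<forall>e\<in>himg ?h (gr n Z). viol (fd n y) e \<longrightarrow> e \<inter> C \<noteq> {}" by (elim exE conjE)
      have "\<exists>y<(n + 1) ^ n. \<forall>v<n. fd n y v = of_bool (v \<in> C)" by (rule fd_exists) (auto simp: of_bool_def)
      then obtain C' where C': "C' < (n + 1) ^ n" "\<forall>v<n. fd n C' v = of_bool (v \<in> C)" by blast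
      have "{v. v < n \<and> fd n C' v \<noteq> 0} = C" using C' C(1) Nn by (auto split: if_splits)
      then have "cnt n C' \<le> Q" unfolding cnt_card using C(2) by simp
      moreover have "fd n C' (?h (e div n)) \<noteq> 0 \<or> fd n C' (?h (e mod n)) \<noteq> 0"
        if e: "e \<in> Z" "vio (fd n y (?h (e div n))) (fd n y (?h (e mod n)))" for e
      proof -
        let ?x = "{?h (e div n), ?h (e mod n)}"
        have "viol (fd n y) ?x \<and> ?x \<in> himg ?h (gr n Z)" using viol_himg[OF _ ed[OF e(1)]] e(2) by blast
        then have "?x \<inter> C \<noteq> {}" using C(3) by blast
        then have "?h (e div n) \<in> C \<or> ?h (e mod n) \<in> C" by auto
        moreover have "?h (e div n) < n" "?h (e mod n) < n" using hN[OF e(1)] Nn by auto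
        ultimately show ?thesis using C'(2) by auto
      qed
      ultimately show "\<exists>C<(n + 1) ^ n. cnt n C \<le> Q \<and> (\<forall>e<n * n. e \<in> Z \<and> vio (fd n y (?h (e div n))) (fd n y (?h (e mod n))) \<longrightarrow>
        fd n C (?h (e div n)) \<noteq> 0 \<or> fd n C (?h (e mod n)) \<noteq> 0)" using C'(1) by blast
    qed
  qed
qed

definition kernN :: "nat \<Rightarrow> nat \<Rightarrow> nat set \<Rightarrow> nat set \<Rightarrow> bool" where
  "kernN n s W Z \<longleftrightarrow> (\<forall>A<(n + 1) ^ n. cnt n A \<le> 2 * s \<and> (\<exists>e<n * n. e \<in> Z \<and> fd n A (e div n) = 0 \<and> fd n A (e mod n) = 0) \<longrightarrow>
     (\<exists>e<n * n. e \<in> W \<and> fd n A (e div n) = 0 \<and> fd n A (e mod n) = 0))"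

lemma kernN_iff:
  assumes Z: "Z \<subseteq> arcs n" and W: "W \<subseteq> Z"
  shows "kernN n s W Z \<longleftrightarrow> kern n s (gr n W) (gr n Z)"
proof -
  have nn: "e < n * n" "e div n < n" "e mod n < n" if "e \<in> Z" for e
  proof -
    have "e \<in> arcs n" using that Z by blast
    then show "e < n * n" "e div n < n" "e mod n < n" using arcsD[of e n] unfolding arcs_def by simp_all
  qed
  have trans: "(\<exists>e<n * n. e \<in> Y \<and> fd n a (e div n) = 0 \<and> fd n a (e mod n) = 0) \<longleftrightarrow> (\<exists>x\<in>gr n Y. x \<inter> A = {})"
    if YZ: "Y \<subseteq> Z" and fA: "\<And>v. v < n \<Longrightarrow> fd n a v = 0 \<longleftrightarrow> v \<notin> A" for a A Y
  proof -
    have r: "e < n * n \<and> (fd n a (e div n) = 0) = (e div n \<notin> A) \<and> (fd n a (e mod n) = 0) = (e mod n \<notin> A)" if e: "e \<in> Y" for e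
    proof -
      have "e \<in> Z" using e YZ by blast
      then have "e < n * n" "e div n < n" "e mod n < n" by (rule nn)+
      with fA[of "e div n"] fA[of "e mod n"] show ?thesis by metis
    qed
    have "(\<exists>x\<in>gr n Y. x \<inter> A = {}) \<longleftrightarrow> (\<exists>e\<in>Y. e div n \<notin> A \<and> e mod n \<notin> A)" unfolding gr_def by auto
    also have "\<dots> \<longleftrightarrow> (\<exists>e<n * n. e \<in> Y \<and> fd n a (e div n) = 0 \<and> fd n a (e mod n) = 0)" using r by blast
    finally show ?thesis by simp
  qed
  show ?thesis
  proof
    assume k: "kernN n s W Z"
    show "kern n s (gr n W) (gr n Z)" unfolding kern_def
    proof (intro allI impI)
      fix A assume A: "A \<subseteq> {..<n} \<and> card A \<le> 2 * s \<and> (\<exists>e\<in>gr n Z. e \<inter> A = {})"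
      have "\<exists>y<(n + 1) ^ n. \<forall>v<n. fd n y v = of_bool (v \<in> A)" by (rule fd_exists) (auto simp: of_bool_def)
      then obtain a where a: "a < (n + 1) ^ n" "\<forall>v<n. fd n a v = of_bool (v \<in> A)" by blast
      have aA: "fd n a v = 0 \<longleftrightarrow> v \<notin> A" if "v < n" for v using a(2) that by auto
      have "{v. v < n \<and> fd n a v \<noteq> 0} = A"
      proof (intro equalityI subsetI)
        fix v assume "v \<in> {v. v < n \<and> fd n a v \<noteq> 0}"
        then show "v \<in> A" using aA[of v] by auto
      next
        fix v assume v: "v \<in> A"
        then have "v < n" using A by blast
        then show "v \<in> {v. v < n \<and> fd n a v \<noteq> 0}" using aA[of v] v by blast
      qed
      then have "cnt n a \<le> 2 * s" unfolding cnt_card using A by simp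
      then show "\<exists>e\<in>gr n W. e \<inter> A = {}"
        using k a(1) A trans[of Z a A] trans[of W a A] aA W unfolding kernN_def by blast
    qed
  next
    assume k: "kern n s (gr n W) (gr n Z)"
    show "kernN n s W Z" unfolding kernN_def
    proof (intro allI impI)
      fix a assume a: "a < (n + 1) ^ n" "cnt n a \<le> 2 * s \<and> (\<exists>e<n * n. e \<in> Z \<and> fd n a (e div n) = 0 \<and> fd n a (e mod n) = 0)"
      let ?A = "{v. v < n \<and> fd n a v \<noteq> 0}"
      have aA: "fd n a v = 0 \<longleftrightarrow> v \<notin> ?A" if "v < n" for v using that by auto
      have "?A \<subseteq> {..<n} \<and> card ?A \<le> 2 * s" using a(2) unfolding cnt_card by auto
      then show "\<exists>e<n * n. e \<in> W \<and> fd n a (e div n) = 0 \<and> fd n a (e mod n) = 0"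
        using k a(2) trans[of Z a ?A] trans[of W a ?A] aA W unfolding kern_def by blast
    qed
  qed
qed

text \<open>The digit \<open>u + 1\<close> at \<open>v\<close> codes the edge between
  \<open>v\<close> and \<open>u\<close>. The second condition also forbids storing an edge at both
  ends, so that \<open>cnt\<close> is the number of edges; the first accepts either orientation in
  \<open>Z\<close>.\<close>

definition isM :: "nat \<Rightarrow> nat set \<Rightarrow> nat \<Rightarrow> bool" where
  "isM n Z y \<longleftrightarrow> (\<forall>v<n. fd n y v \<noteq> 0 \<longrightarrow> v * n + (fd n y v - 1) \<in> Z \<or> (fd n y v - 1) * n + v \<in> Z) \<and>
     (\<forall>v<n. \<forall>v'<n. v \<noteq> v' \<and> fd n y v \<noteq> 0 \<and> fd n y v' \<noteq> 0 \<longrightarrow> fd n y v \<noteq> fd n y v' \<and> v \<noteq> fd n y v' - 1)"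

definition bst :: "nat \<Rightarrow> nat set \<Rightarrow> nat \<Rightarrow> bool" where
  "bst n Z y \<longleftrightarrow> isM n Z y \<and> (\<forall>y'<(n + 1) ^ n. isM n Z y' \<longrightarrow> cnt n y' \<le> cnt n y)"

definition medges :: "nat \<Rightarrow> nat \<Rightarrow> nat set set" where
  "medges n y = (\<lambda>v. {v, fd n y v - 1}) ` {v. v < n \<and> fd n y v \<noteq> 0}"

lemma isM_medges:
  assumes Z: "Z \<subseteq> arcs n" and y: "isM n Z y"
  shows "matching (gr n Z) (medges n y) \<and> card (medges n y) = cnt n y"
proof -
  let ?D = "{v. v < n \<and> fd n y v \<noteq> 0}"
  have un: "fd n y v - 1 < n" if "v \<in> ?D" for v using fd_le[of n y v] that by auto
  have sep: "{v, fd n y v - 1} \<inter> {v', fd n y v' - 1} = {}" if "v \<in> ?D" "v' \<in> ?D" "v \<noteq> v'" for v v'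
  proof -
    have "fd n y v \<noteq> fd n y v'" "v \<noteq> fd n y v' - 1" "v' \<noteq> fd n y v - 1" using y that unfolding isM_def by auto
    moreover have "fd n y v \<noteq> 0" "fd n y v' \<noteq> 0" using that by auto
    ultimately show ?thesis using that(3) by auto
  qed
  have "{v, fd n y v - 1} \<in> gr n Z" if v: "v \<in> ?D" for v
  proof -
    define u where "u = fd n y v - 1"
    have un': "u < n" "v < n" using un[OF v] v unfolding u_def by auto
    have "v * n + u \<in> Z \<or> u * n + v \<in> Z" using y v unfolding isM_def u_def by blast
    then have "\<exists>e\<in>Z. {v, u} = {e div n, e mod n}"
    proof
      assume "v * n + u \<in> Z"
      then show ?thesis by (rule bexI[rotated]) (use un' in simp)
    next
      assume "u * n + v \<in> Z"
      then show ?thesis by (rule bexI[rotated]) (use un' in \<open>simp add: insert_commute\<close>)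
    qed
    then show ?thesis unfolding gr_def u_def by blast
  qed
  then have "medges n y \<subseteq> gr n Z" unfolding medges_def by blast
  moreover have "disjoint (medges n y)" unfolding pairwise_def disjnt_def
  proof (intro ballI impI)
    fix a b assume ab: "a \<in> medges n y" "b \<in> medges n y" "a \<noteq> b"
    then obtain v v' where v: "v \<in> ?D" "v' \<in> ?D" "a = {v, fd n y v - 1}" "b = {v', fd n y v' - 1}" unfolding medges_def by blast
    then have "v \<noteq> v'" using ab(3) by blast
    then show "a \<inter> b = {}" using sep[OF v(1,2)] v(3,4) by simp
  qed
  ultimately have "matching (gr n Z) (medges n y)" unfolding matching_def by simp
  moreover have "inj_on (\<lambda>v. {v, fd n y v - 1}) ?D" by (rule inj_onI) (use sep in blast)
  then have "card (medges n y) = cnt n y" unfolding medges_def cnt_card by (rule card_image)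
  ultimately show ?thesis by simp
qed

lemma isM_exists:
  assumes Z: "Z \<subseteq> arcs n" and M: "matching (gr n Z) M"
  shows "\<exists>y<(n + 1) ^ n. isM n Z y \<and> cnt n y = card M"
proof -
  have g: "graph_on {..<n} (gr n Z)" by (rule gr_graph_on[OF Z])
  have ME: "M \<subseteq> gr n Z" using M unfolding matching_def by auto
  have edge: "\<exists>a b. x = {a, b} \<and> a < b \<and> a < n \<and> b < n" if x: "x \<in> M" for x
  proof -
    obtain a b where ab: "x = {a, b}" "a \<noteq> b" "a \<in> {..<n}" "b \<in> {..<n}" using graph_on_edge[OF g subsetD[OF ME x]] by blast
    show ?thesis
    proof (cases "a < b")
      case True
      then have "x = {a, b} \<and> a < b \<and> a < n \<and> b < n" using ab by auto
      then show ?thesis by blast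
    next
      case False
      then have "x = {b, a} \<and> b < a \<and> b < n \<and> a < n" using ab by auto
      then show ?thesis by blast
    qed
  qed
  \<comment> \<open>Each edge is stored at its smaller end.\<close>
  define P where "P v u \<longleftrightarrow> {v, u} \<in> M \<and> v < u" for v u
  have Pu: "u = u'" if "P v u" "P v u'" for v u u'
    using matching_unique[OF M, of "{v, u}" "{v, u'}" v] that unfolding P_def by (auto simp: doubleton_eq_iff)
  define \<delta> where "\<delta> v = (if \<exists>u. P v u then Suc (THE u. P v u) else 0)" for v
  have \<delta>P: "\<delta> v = Suc u" if "P v u" for v u
  proof -
    have "(THE u. P v u) = u" using Pu that by (intro the_equality) auto
    then show ?thesis using that unfolding \<delta>_def by auto
  qed
  have \<delta>0: "\<exists>u. P v u \<and> \<delta> v = Suc u" if "\<delta> v \<noteq> 0" for v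
  proof -
    have "\<exists>u. P v u"
    proof (rule ccontr)
      assume "\<nexists>u. P v u"
      then have "\<delta> v = 0" unfolding \<delta>_def by simp
      then show False using that by simp
    qed
    then show ?thesis using \<delta>P by blast
  qed
  have Pn: "v < n \<and> u < n" if "P v u" for v u
    using edge[of "{v, u}"] that unfolding P_def by (auto simp: doubleton_eq_iff)
  have "\<delta> v \<le> n" for v
  proof (cases "\<delta> v = 0")
    case False
    then obtain u where u: "P v u" "\<delta> v = Suc u" using \<delta>0 by blast
    then show ?thesis using Pn[OF u(1)] by simp
  qed simp
  then obtain y where y: "y < (n + 1) ^ n" "\<forall>v<n. fd n y v = \<delta> v" using fd_exists[of n \<delta>] by blast
  have "isM n Z y" unfolding isM_def
  proof (intro conjI allI impI)
    fix v assume v: "v < n" "fd n y v \<noteq> 0"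
    then obtain u where u: "P v u" "\<delta> v = Suc u" using \<delta>0[of v] y(2) by auto
    then have "{v, u} \<in> gr n Z" using ME unfolding P_def by auto
    then obtain e where e: "e \<in> Z" "{v, u} = {e div n, e mod n}" unfolding gr_def by auto
    have "e = (e div n) * n + e mod n" by simp
    then have "e = v * n + u \<or> e = u * n + v" using e(2) by (auto simp: doubleton_eq_iff)
    then show "v * n + (fd n y v - 1) \<in> Z \<or> (fd n y v - 1) * n + v \<in> Z" using e(1) u(2) y(2) v(1) by auto
  next
    fix v v' assume v: "v < n" "v' < n" "v \<noteq> v' \<and> fd n y v \<noteq> 0 \<and> fd n y v' \<noteq> 0"
    then obtain u u' where u: "P v u" "\<delta> v = Suc u" "P v' u'" "\<delta> v' = Suc u'" using \<delta>0[of v] \<delta>0[of v'] y(2) by auto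
    have ne: "{v, u} \<noteq> {v', u'}" using v(3) u(1,3) unfolding P_def by (auto simp: doubleton_eq_iff)
    have "u \<noteq> u'" using matching_unique[OF M, of "{v, u}" "{v', u'}" u] ne u(1,3) unfolding P_def by auto
    then show "fd n y v \<noteq> fd n y v'" using u(2,4) y(2) v by auto
    have "v \<noteq> u'" using matching_unique[OF M, of "{v, u}" "{v', u'}" v] ne u(1,3) unfolding P_def by auto
    then show "v \<noteq> fd n y v' - 1" using u(4) y(2) v by auto
  qed
  moreover have "cnt n y = card M"
  proof -
    let ?D = "{v. v < n \<and> fd n y v \<noteq> 0}"
    have "medges n y = M"
    proof (intro equalityI subsetI)
      fix x assume "x \<in> medges n y"
      then obtain v where v: "v < n" "fd n y v \<noteq> 0" "x = {v, fd n y v - 1}" unfolding medges_def by auto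
      then obtain u where "P v u" "\<delta> v = Suc u" using \<delta>0[of v] y(2) by auto
      then show "x \<in> M" using v y(2) unfolding P_def by auto
    next
      fix x assume x: "x \<in> M"
      then obtain a b where ab: "x = {a, b}" "a < b" "a < n" using edge by blast
      then have "P a b" using x unfolding P_def by simp
      then have "\<delta> a = Suc b" by (rule \<delta>P)
      then show "x \<in> medges n y" unfolding medges_def using ab y(2) by auto
    qed
    then show ?thesis using isM_medges[OF Z \<open>isM n Z y\<close>] by simp
  qed
  ultimately show ?thesis using y(1) by blast
qed

lemma bst_max_matching:
  assumes Z: "Z \<subseteq> arcs n" and y: "bst n Z y"
  shows "matching (gr n Z) (medges n y) \<and> card (medges n y) = mu (gr n Z)"
proof -
  have m: "matching (gr n Z) (medges n y)" "card (medges n y) = cnt n y" using isM_medges[OF Z] y unfolding bst_def by auto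
  have fin: "finite (gr n Z)" using graph_on_finite[OF _ gr_graph_on[OF Z]] by simp
  obtain M where M: "matching (gr n Z) M" "card M = mu (gr n Z)" using mu_attained[OF fin] .
  obtain y' where "y' < (n + 1) ^ n" "isM n Z y'" "cnt n y' = card M" using isM_exists[OF Z M(1)] by blast
  then have "mu (gr n Z) \<le> card (medges n y)" using y M(2) m(2) unfolding bst_def by auto
  then show ?thesis using m mu_ge[OF fin m(1)] by simp
qed

lemma bst_exists:
  assumes Z: "Z \<subseteq> arcs n" shows "\<exists>y<(n + 1) ^ n. bst n Z y"
proof -
  have fin: "finite (gr n Z)" using graph_on_finite[OF _ gr_graph_on[OF Z]] by simp
  obtain M where M: "matching (gr n Z) M" "card M = mu (gr n Z)" using mu_attained[OF fin] .
  obtain y where y: "y < (n + 1) ^ n" "isM n Z y" "cnt n y = card M" using isM_exists[OF Z M(1)] by blast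
  have "cnt n y' \<le> cnt n y" if "isM n Z y'" for y'
    using isM_medges[OF Z that] mu_ge[OF fin, of "medges n y'"] y(3) M(2) by simp
  then show ?thesis using y unfolding bst_def by blast
qed


section \<open>Formulas\<close>

abbreviation ez :: "expr \<Rightarrow> expr" where "ez a \<equiv> eq a (kn 0)"
abbreviation nz :: "expr \<Rightarrow> expr" where "nz a \<equiv> ng (eq a (kn 0))"

text \<open>From here on each expression computes one of the numerical functions or predicates on
  codes; a case distinction becomes a sum of products with truth values.\<close>

definition gq :: "expr \<Rightarrow> expr \<Rightarrow> expr" where
  "gq nn z = op Add (op Rem z (op Add nn (kn 1))) (kn 2)"
definition xq :: "expr \<Rightarrow> expr \<Rightarrow> expr" where
  "xq nn z = op Quo z (op Add nn (kn 1))"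
definition wtq :: "expr \<Rightarrow> expr \<Rightarrow> expr" where
  "wtq g d = op Add d (op Mul (ez d) (op Sub g (kn 1)))"
definition memq :: "expr \<Rightarrow> expr \<Rightarrow> expr \<Rightarrow> expr" where
  "memq nn z e = exq nn (\<lambda>j. an (nz (dig (gq nn z) (xq nn z) (vr j)))
     (eq (sm (op Add (vr j) (kn 1)) (\<lambda>i. wtq (gq nn z) (dig (gq nn z) (xq nn z) (vr i)))) (op Add e (kn 1))))"
definition hvq :: "expr \<Rightarrow> expr \<Rightarrow> expr \<Rightarrow> expr \<Rightarrow> expr" where
  "hvq M H i v = op Add (op Mul (ez i) v) (op Mul (nz i) (op Rem (dig M H v) i))"
definition fdq :: "expr \<Rightarrow> expr \<Rightarrow> expr \<Rightarrow> expr" where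
  "fdq n y v = dig (op Add n (kn 1)) y v"
definition viq :: "expr \<Rightarrow> expr \<Rightarrow> expr" where
  "viq a b = an (nz a) (an (nz b) (ng (eq a b)))"
definition cntq :: "expr \<Rightarrow> expr \<Rightarrow> expr" where
  "cntq n y = sm n (\<lambda>v. nz (fdq n y (vr v)))"
definition kernq :: "expr \<Rightarrow> expr \<Rightarrow> expr \<Rightarrow> expr \<Rightarrow>
    (expr \<Rightarrow> expr) \<Rightarrow> (expr \<Rightarrow> expr) \<Rightarrow> expr" where
  "kernq n P nn s W Z = allq P (\<lambda>A. im (an (le (cntq n (vr A)) (op Add s s))
      (exq nn (\<lambda>e. an (Z (vr e)) (an (ez (fdq n (vr A) (op Quo (vr e) n))) (ez (fdq n (vr A) (op Rem (vr e) n)))))))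
      (exq nn (\<lambda>e. an (W (vr e)) (an (ez (fdq n (vr A) (op Quo (vr e) n))) (ez (fdq n (vr A) (op Rem (vr e) n)))))))"
definition covq :: "expr \<Rightarrow> expr \<Rightarrow> expr \<Rightarrow> (expr \<Rightarrow> expr) \<Rightarrow> expr \<Rightarrow>
    (expr \<Rightarrow> expr) \<Rightarrow> (expr \<Rightarrow> expr) \<Rightarrow> expr" where
  "covq n P nn h Q W Z = allq P (\<lambda>f. im
      (allq nn (\<lambda>e. im (W (vr e)) (ng (viq (fdq n (vr f) (h (op Quo (vr e) n))) (fdq n (vr f) (h (op Rem (vr e) n)))))))
      (exq P (\<lambda>C. an (le (cntq n (vr C)) Q) (allq nn (\<lambda>e. im
         (an (Z (vr e)) (viq (fdq n (vr f) (h (op Quo (vr e) n))) (fdq n (vr f) (h (op Rem (vr e) n)))))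
         (dj (nz (fdq n (vr C) (h (op Quo (vr e) n)))) (nz (fdq n (vr C) (h (op Rem (vr e) n))))))))))"
definition qqq :: "expr \<Rightarrow> expr \<Rightarrow> expr \<Rightarrow> expr \<Rightarrow> expr" where
  "qqq n k X i = op Quo (fl (op Quo (op Mul (op Add i (op Mul (ez i) n)) X) n)) k"
definition goodq :: "expr \<Rightarrow> expr \<Rightarrow> expr \<Rightarrow> expr \<Rightarrow> expr \<Rightarrow> expr \<Rightarrow>
    expr \<Rightarrow> expr \<Rightarrow> expr \<Rightarrow> (expr \<Rightarrow> expr) \<Rightarrow> (expr \<Rightarrow> expr) \<Rightarrow> expr" where
  "goodq n k P nn s s0 M H X W Z = an (allq nn (\<lambda>e. im (W (vr e)) (Z (vr e)))) (an (kernq n P nn s W Z)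
     (allq (op Add n (kn 1)) (\<lambda>i. im (dj (ez (vr i)) (an (le s0 (vr i)) (ez (op Rem M (vr i)))))
        (covq n P nn (hvq M H (vr i)) (qqq n k X (vr i)) W Z))))"
definition isMq :: "expr \<Rightarrow> (expr \<Rightarrow> expr) \<Rightarrow> expr \<Rightarrow> expr" where
  "isMq n Z y = an
     (allq n (\<lambda>v. im (nz (fdq n y (vr v))) (dj (Z (op Add (op Mul (vr v) n) (op Sub (fdq n y (vr v)) (kn 1))))
        (Z (op Add (op Mul (op Sub (fdq n y (vr v)) (kn 1)) n) (vr v))))))
     (allq n (\<lambda>v. allq n (\<lambda>v'. im (an (ng (eq (vr v) (vr v'))) (an (nz (fdq n y (vr v))) (nz (fdq n y (vr v')))))
        (an (ng (eq (fdq n y (vr v)) (fdq n y (vr v')))) (ng (eq (vr v) (op Sub (fdq n y (vr v')) (kn 1))))))))"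
definition bstq :: "expr \<Rightarrow> expr \<Rightarrow> (expr \<Rightarrow> expr) \<Rightarrow> expr \<Rightarrow> expr" where
  "bstq n P Z y = an (isMq n Z y) (allq P (\<lambda>y'. im (isMq n Z (vr y')) (le (cntq n (vr y')) (cntq n y))))"

text \<open>The error allowed to one reduction at level \<open>i\<close>:
  \<open>\<epsilon> * lev n i * X / (n * k)\<close>, rounded down on the way because a program can
  only form floors of multiples of \<open>\<epsilon>\<close>. \<open>X\<close> is
  \<open>32 * n\<close> in the deterministic and \<open>\<lfloor>\<epsilon> * n\<rfloor>\<close> in
  the randomized algorithm.\<close>

definition qq :: "real \<Rightarrow> nat \<Rightarrow> nat \<Rightarrow> nat \<Rightarrow> nat \<Rightarrow> nat" where
  "qq \<epsilon> n k X i = nat \<lfloor>\<epsilon> * real (lev n i * X div n)\<rfloor> div k"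

definition goodN :: "real \<Rightarrow> nat \<Rightarrow> nat \<Rightarrow> nat \<Rightarrow> nat \<Rightarrow> nat \<Rightarrow> nat \<Rightarrow> nat \<Rightarrow> nat set \<Rightarrow> nat set \<Rightarrow> bool" where
  "goodN \<epsilon> n k s s0 M H X W Z \<longleftrightarrow> (\<forall>e<n * n. e \<in> W \<longrightarrow> e \<in> Z) \<and> kernN n s W Z \<and>
     (\<forall>i<n + 1. level s0 M i \<longrightarrow> coverN n M H i (qq \<epsilon> n k X i) W Z)"

section \<open>Evaluation of the formulas\<close>

context machine
begin

text \<open>A set is passed to a formula as a membership test \<open>Y\<close>, which must stay
  correct under the variables that quantifiers bind later.\<close>

definition evs :: "(nat \<Rightarrow> nat) \<Rightarrow> nat \<Rightarrow> (expr \<Rightarrow> expr) \<Rightarrow> nat \<Rightarrow> nat set \<Rightarrow> bool" where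
  "evs \<sigma> d Y m S \<longleftrightarrow> (\<forall>d' \<sigma>' e v. d \<le> d' \<and> (\<forall>x<d. \<sigma>' x = \<sigma> x) \<and> v < m \<and> ev \<sigma>' d' e v \<longrightarrow> ev \<sigma>' d' (Y e) (of_bool (v \<in> S)))"

lemma evsD: "evs \<sigma> d Y m S \<Longrightarrow> ev \<sigma> d e v \<Longrightarrow> v < m \<Longrightarrow> ev \<sigma> d (Y e) (of_bool (v \<in> S))"
  unfolding evs_def by blast

lemma evs_mono: "evs \<sigma> d Y m S \<Longrightarrow> d \<le> d' \<Longrightarrow> (\<And>x. x < d \<Longrightarrow> \<sigma>' x = \<sigma> x) \<Longrightarrow> evs \<sigma>' d' Y m S"
  unfolding evs_def by auto

lemma ev_wtq: "ev \<sigma> d g vg \<Longrightarrow> ev \<sigma> d e x \<Longrightarrow> x < vg \<Longrightarrow> ev \<sigma> d (wtq g e) (wt vg x)"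
  unfolding wtq_def
  by (rule ev_op[where vb = "of_bool (x = 0) * (vg - 1)", OF _ ev_op[OF ev_eq[OF _ ev_const] ev_op[OF _ ev_const _ refl]]])
    (use V1 in \<open>auto simp: wt_def\<close>)

lemma wt_le: "x < g \<Longrightarrow> g \<le> m + 2 \<Longrightarrow> wt g x \<le> m + 1"
  unfolding wt_def by auto

lemma ev_memq:
  assumes nn: "ev \<sigma> d nn m" and z: "ev \<sigma> d z vz" and e: "ev \<sigma> d e ve" and mV: "(m + 2) * (m + 2) \<le> V" and ve: "ve < m"
  shows "ev \<sigma> d (memq nn z e) (of_bool (mem m vz ve))"
proof -
  let ?g = "vz mod (m + 1) + 2" and ?x = "vz div (m + 1)"
  have gm: "?g \<le> m + 2" using mod_less_divisor[of "m + 1" vz] by simp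
  have mV2: "m + 2 \<le> V" using mV by (simp add: algebra_simps)
  have gV: "?g \<le> V" using gm mV2 by linarith
  have G: "ev \<sigma> d (gq nn z) ?g" unfolding gq_def
    by (rule ev_op[OF ev_op[OF z ev_op[OF nn ev_const _ refl] _ refl] ev_const])
      (use mV2 gV in \<open>auto intro: le_trans[OF mod_less_eq_dividend]\<close>)
  have X: "ev \<sigma> d (xq nn z) ?x" unfolding xq_def
    by (rule ev_op[OF z ev_op[OF nn ev_const _ refl]]) (use mV2 in \<open>auto intro: le_trans[OF div_le_dividend]\<close>)
  show ?thesis unfolding memq_def mem_def
  proof (rule ev_exq[OF nn])
    fix j r \<sigma>' assume h: "j < m" "d \<le> r" "\<And>y. y < d \<Longrightarrow> \<sigma>' y = \<sigma> y" "\<sigma>' r = j"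
    have up: "ev \<sigma> d a v \<Longrightarrow> ev \<sigma>' (Suc r) a v" for a v using ev_mono[of \<sigma> d a v "Suc r" \<sigma>'] h by auto
    have J: "ev \<sigma>' (Suc r) (vr r) j" by (rule ev_var) (use h in auto)
    \<comment> \<open>The cursor makes at most \<open>m\<close> moves of at most
      \<open>m + 1\<close> each; \<open>mV\<close> provides room for its position.\<close>
    have sum_le: "(\<Sum>i<Suc j. wt ?g (dg ?g ?x i)) \<le> V"
    proof -
      have "wt ?g (dg ?g ?x i) \<le> m + 1" for i
      proof -
        have "dg ?g ?x i < ?g" unfolding dg_def by (rule mod_less_divisor) simp
        then show ?thesis using gm by (rule wt_le)
      qed
      then have "(\<Sum>i<Suc j. wt ?g (dg ?g ?x i)) \<le> (\<Sum>i<Suc j. m + 1)" by (intro sum_mono)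
      also have "\<dots> = Suc j * (m + 1)" by (simp only: sum_constant card_lessThan of_nat_id)
      also have "\<dots> \<le> m * (m + 1)" using h(1) by (intro mult_right_mono) auto
      also have "\<dots> \<le> (m + 2) * (m + 2)" by (simp add: algebra_simps)
      finally show ?thesis using mV by simp
    qed
    have S: "ev \<sigma>' (Suc r) (sm (op Add (vr r) (kn 1)) (\<lambda>i. wtq (gq nn z) (dig (gq nn z) (xq nn z) (vr i))))
       (\<Sum>i<Suc j. wt ?g (dg ?g ?x i))"
    proof (rule ev_sm[OF ev_op[OF J ev_const]])
      fix i r2 \<sigma>2 assume h2: "i < Suc j" "Suc r \<le> r2" "\<And>y. y < Suc r \<Longrightarrow> \<sigma>2 y = \<sigma>' y" "\<sigma>2 r2 = i"
      have up2: "ev \<sigma>' (Suc r) a v \<Longrightarrow> ev \<sigma>2 (Suc r2) a v" for a v using ev_mono[of \<sigma>' "Suc r" a v "Suc r2" \<sigma>2] h2 by auto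
      show "ev \<sigma>2 (Suc r2) (wtq (gq nn z) (dig (gq nn z) (xq nn z) (vr r2))) (wt ?g (dg ?g ?x i))"
      proof (rule ev_wtq[OF up2[OF up[OF G]] ev_dig[OF up2[OF up[OF G]] up2[OF up[OF X]] ev_var]])
        show "dg ?g ?x i < ?g" unfolding dg_def by (rule mod_less_divisor) simp
      qed (use h2 in auto)
    qed (use V1 h(1) mV2 sum_le in auto)
    show "ev \<sigma>' (Suc r) (an (nz (dig (gq nn z) (xq nn z) (vr r)))
     (eq (sm (op Add (vr r) (kn 1)) (\<lambda>i. wtq (gq nn z) (dig (gq nn z) (xq nn z) (vr i)))) (op Add e (kn 1))))
      (of_bool (dg ?g ?x j \<noteq> 0 \<and> (\<Sum>i<Suc j. wt ?g (dg ?g ?x i)) = Suc ve))"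
      by (intro ev_an ev_ng ev_eq ev_dig ev_const up[OF G] up[OF X] J S ev_op[OF up[OF e] ev_const])
        (use V1 ve mV2 in auto)
  qed
qed

lemma evs_memq: "ev \<sigma> d nn m \<Longrightarrow> ev \<sigma> d z vz \<Longrightarrow> (m + 2) * (m + 2) \<le> V \<Longrightarrow> evs \<sigma> d (memq nn z) m (codes m vz)"
  unfolding evs_def
proof (intro allI impI)
  fix d' \<sigma>' e v
  assume h: "ev \<sigma> d nn m" "ev \<sigma> d z vz" "(m + 2) * (m + 2) \<le> V" "d \<le> d' \<and> (\<forall>x<d. \<sigma>' x = \<sigma> x) \<and> v < m \<and> ev \<sigma>' d' e v"
  have "ev \<sigma>' d' nn m" "ev \<sigma>' d' z vz" using h by (auto intro: ev_mono)
  then have "ev \<sigma>' d' (memq nn z e) (of_bool (mem m vz v))" by (rule ev_memq) (use h in auto)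
  then show "ev \<sigma>' d' (memq nn z e) (of_bool (v \<in> codes m vz))" using h unfolding codes_def by simp
qed

lemma evs_dj: "evs \<sigma> d Y m S \<Longrightarrow> evs \<sigma> d Y' m S' \<Longrightarrow> evs \<sigma> d (\<lambda>e. dj (Y e) (Y' e)) m (S \<union> S')"
  unfolding evs_def Un_iff by (blast intro: ev_dj)

lemma ev_hvq:
  assumes "ev \<sigma> d M vM" "ev \<sigma> d H vH" "ev \<sigma> d i vi" "ev \<sigma> d v vv"
  shows "ev \<sigma> d (hvq M H i v) (hv vM vH vi vv)"
  unfolding hvq_def
  by (rule ev_op[where va = "of_bool (vi = 0) * vv" and vb = "of_bool (vi \<noteq> 0) * (dg vM vH vv mod vi)",
      OF ev_op[OF ev_eq[OF assms(3) ev_const] assms(4)] ev_op[OF ev_ng[OF ev_eq[OF assms(3) ev_const]] ev_op[OF ev_dig[OF assms(1,2,4)] assms(3) _ refl]]])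
    (use V1 in \<open>auto simp: hv_def intro: le_trans[OF mod_less_eq_dividend]\<close>)

lemma ev_fdq:
  assumes "ev \<sigma> d n vn" "vn < V" "ev \<sigma> d y vy" "ev \<sigma> d v vv"
  shows "ev \<sigma> d (fdq n y v) (fd vn vy vv)"
  unfolding fdq_def fd_def by (rule ev_dig[OF ev_op[OF assms(1) ev_const] assms(3,4)]) (use V1 assms(2) in auto)

lemma ev_viq: "ev \<sigma> d a x \<Longrightarrow> ev \<sigma> d b y \<Longrightarrow> ev \<sigma> d (viq a b) (of_bool (vio x y))"
  unfolding viq_def vio_def by (intro ev_an ev_ng ev_eq ev_const) auto

lemma ev_cntq:
  assumes n: "ev \<sigma> d n vn" and nV: "vn < V" and y: "ev \<sigma> d y vy"
  shows "ev \<sigma> d (cntq n y) (cnt vn vy)"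
  unfolding cntq_def cnt_def
proof (rule ev_sm[OF n])
  fix j r \<sigma>' assume h: "j < vn" "d \<le> r" "\<And>y. y < d \<Longrightarrow> \<sigma>' y = \<sigma> y" "\<sigma>' r = j"
  have up: "ev \<sigma> d a v \<Longrightarrow> ev \<sigma>' (Suc r) a v" for a v using ev_mono[of \<sigma> d a v "Suc r" \<sigma>'] h by auto
  show "ev \<sigma>' (Suc r) (nz (fdq n y (vr r))) (of_bool (fd vn vy j \<noteq> 0))"
    by (intro ev_ng ev_eq ev_const ev_fdq up[OF n] up[OF y] nV ev_var) (use h in auto)
next
  have "(\<Sum>j<vn. of_bool (fd vn vy j \<noteq> 0)) \<le> (\<Sum>j<vn. 1 :: nat)" by (intro sum_mono) auto
  then show "(\<Sum>j<vn. of_bool (fd vn vy j \<noteq> 0)) \<le> V" using nV by simp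
qed simp

lemma ev_kernq:
  assumes n: "ev \<sigma> d n vn" and P: "ev \<sigma> d P ((vn + 1) ^ vn)" and nn: "ev \<sigma> d nn (vn * vn)" and s: "ev \<sigma> d s vs"
    and W: "evs \<sigma> d W (vn * vn) SW" and Z: "evs \<sigma> d Z (vn * vn) SZ" and nV: "vn < V" and sV: "2 * vs \<le> V"
  shows "ev \<sigma> d (kernq n P nn s W Z) (of_bool (kernN vn vs SW SZ))"
  unfolding kernq_def kernN_def
proof (rule ev_allq[OF P])
  fix A r \<sigma>' assume h: "A < (vn + 1) ^ vn" "d \<le> r" "\<And>y. y < d \<Longrightarrow> \<sigma>' y = \<sigma> y" "\<sigma>' r = A"
  have up: "ev \<sigma> d a v \<Longrightarrow> ev \<sigma>' (Suc r) a v" for a v using ev_mono[of \<sigma> d a v "Suc r" \<sigma>'] h by auto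
  have ups: "evs \<sigma> d a m v \<Longrightarrow> evs \<sigma>' (Suc r) a m v" for a m v using evs_mono[of \<sigma> d a m v "Suc r" \<sigma>'] h by auto
  have J: "ev \<sigma>' (Suc r) (vr r) A" by (rule ev_var) (use h in auto)
  have X: "ev \<sigma>' (Suc r) (exq nn (\<lambda>e. an (Y (vr e)) (an (ez (fdq n (vr r) (op Quo (vr e) n))) (ez (fdq n (vr r) (op Rem (vr e) n))))))
     (of_bool (\<exists>e<vn * vn. e \<in> SY \<and> fd vn A (e div vn) = 0 \<and> fd vn A (e mod vn) = 0))"
    if Y: "evs \<sigma>' (Suc r) Y (vn * vn) SY" for Y SY
  proof (rule ev_exq[OF up[OF nn]])
    fix e r2 \<sigma>2 assume h2: "e < vn * vn" "Suc r \<le> r2" "\<And>y. y < Suc r \<Longrightarrow> \<sigma>2 y = \<sigma>' y" "\<sigma>2 r2 = e"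
    have up2: "ev \<sigma>' (Suc r) a v \<Longrightarrow> ev \<sigma>2 (Suc r2) a v" for a v using ev_mono[of \<sigma>' "Suc r" a v "Suc r2" \<sigma>2] h2 by auto
    have ups2: "evs \<sigma>' (Suc r) a m v \<Longrightarrow> evs \<sigma>2 (Suc r2) a m v" for a m v using evs_mono[of \<sigma>' "Suc r" a m v "Suc r2" \<sigma>2] h2 by auto
    have E: "ev \<sigma>2 (Suc r2) (vr r2) e" by (rule ev_var) (use h2 in auto)
    note N = up2[OF up[OF n]]
    have Q: "ev \<sigma>2 (Suc r2) (op Quo (vr r2) n) (e div vn)" by (rule ev_op[OF E N]) (auto intro: le_trans[OF div_le_dividend])
    have R: "ev \<sigma>2 (Suc r2) (op Rem (vr r2) n) (e mod vn)" by (rule ev_op[OF E N]) (auto intro: le_trans[OF mod_less_eq_dividend])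
    show "ev \<sigma>2 (Suc r2) (an (Y (vr r2)) (an (ez (fdq n (vr r) (op Quo (vr r2) n))) (ez (fdq n (vr r) (op Rem (vr r2) n)))))
     (of_bool (e \<in> SY \<and> fd vn A (e div vn) = 0 \<and> fd vn A (e mod vn) = 0))"
      by (intro ev_an ev_eq ev_const evsD[OF ups2[OF Y] E h2(1)] ev_fdq N nV up2[OF J] Q R) simp_all
  qed
  show "ev \<sigma>' (Suc r) (im (an (le (cntq n (vr r)) (op Add s s))
      (exq nn (\<lambda>e. an (Z (vr e)) (an (ez (fdq n (vr r) (op Quo (vr e) n))) (ez (fdq n (vr r) (op Rem (vr e) n)))))))
      (exq nn (\<lambda>e. an (W (vr e)) (an (ez (fdq n (vr r) (op Quo (vr e) n))) (ez (fdq n (vr r) (op Rem (vr e) n)))))))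
     (of_bool (cnt vn A \<le> 2 * vs \<and> (\<exists>e<vn * vn. e \<in> SZ \<and> fd vn A (e div vn) = 0 \<and> fd vn A (e mod vn) = 0) \<longrightarrow>
     (\<exists>e<vn * vn. e \<in> SW \<and> fd vn A (e div vn) = 0 \<and> fd vn A (e mod vn) = 0)))"
    by (intro ev_im ev_an ev_le ev_cntq up[OF n] nV J X ups[OF W] ups[OF Z] ev_op[OF up[OF s] up[OF s]]) (use sV in auto)
qed

lemma ev_covq:
  assumes n: "ev \<sigma> d n vn" and P: "ev \<sigma> d P ((vn + 1) ^ vn)" and nn: "ev \<sigma> d nn (vn * vn)" and Q: "ev \<sigma> d Q vQ"
    and M: "ev \<sigma> d M vM" and H: "ev \<sigma> d H vH" and i: "ev \<sigma> d i vi"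
    and W: "evs \<sigma> d W (vn * vn) SW" and Z: "evs \<sigma> d Z (vn * vn) SZ" and nV: "vn < V"
  shows "ev \<sigma> d (covq n P nn (hvq M H i) Q W Z) (of_bool (coverN vn vM vH vi vQ SW SZ))"
  unfolding covq_def coverN_def
proof (rule ev_allq[OF P])
  fix f r \<sigma>' assume h: "f < (vn + 1) ^ vn" "d \<le> r" "\<And>y. y < d \<Longrightarrow> \<sigma>' y = \<sigma> y" "\<sigma>' r = f"
  have up: "ev \<sigma> d a v \<Longrightarrow> ev \<sigma>' (Suc r) a v" for a v using ev_mono[of \<sigma> d a v "Suc r" \<sigma>'] h by auto
  have ups: "evs \<sigma> d a m v \<Longrightarrow> evs \<sigma>' (Suc r) a m v" for a m v using evs_mono[of \<sigma> d a m v "Suc r" \<sigma>'] h by auto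
  have F: "ev \<sigma>' (Suc r) (vr r) f" by (rule ev_var) (use h in auto)
  have A: "ev \<sigma>' (Suc r) (allq nn (\<lambda>e. im (W (vr e)) (ng (viq (fdq n (vr r) (hvq M H i (op Quo (vr e) n))) (fdq n (vr r) (hvq M H i (op Rem (vr e) n)))))))
     (of_bool (\<forall>e<vn * vn. e \<in> SW \<longrightarrow> \<not> vio (fd vn f (hv vM vH vi (e div vn))) (fd vn f (hv vM vH vi (e mod vn)))))"
  proof (rule ev_allq[OF up[OF nn]])
    fix e r2 \<sigma>2 assume h2: "e < vn * vn" "Suc r \<le> r2" "\<And>y. y < Suc r \<Longrightarrow> \<sigma>2 y = \<sigma>' y" "\<sigma>2 r2 = e"
    have up2: "ev \<sigma>' (Suc r) a v \<Longrightarrow> ev \<sigma>2 (Suc r2) a v" for a v using ev_mono[of \<sigma>' "Suc r" a v "Suc r2" \<sigma>2] h2 by auto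
    have ups2: "evs \<sigma>' (Suc r) a m v \<Longrightarrow> evs \<sigma>2 (Suc r2) a m v" for a m v using evs_mono[of \<sigma>' "Suc r" a m v "Suc r2" \<sigma>2] h2 by auto
    have E: "ev \<sigma>2 (Suc r2) (vr r2) e" by (rule ev_var) (use h2 in auto)
    note N = up2[OF up[OF n]]
    have Qu: "ev \<sigma>2 (Suc r2) (op Quo (vr r2) n) (e div vn)" by (rule ev_op[OF E N]) (auto intro: le_trans[OF div_le_dividend])
    have R: "ev \<sigma>2 (Suc r2) (op Rem (vr r2) n) (e mod vn)" by (rule ev_op[OF E N]) (auto intro: le_trans[OF mod_less_eq_dividend])
    show "ev \<sigma>2 (Suc r2) (im (W (vr r2)) (ng (viq (fdq n (vr r) (hvq M H i (op Quo (vr r2) n))) (fdq n (vr r) (hvq M H i (op Rem (vr r2) n))))))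
      (of_bool (e \<in> SW \<longrightarrow> \<not> vio (fd vn f (hv vM vH vi (e div vn))) (fd vn f (hv vM vH vi (e mod vn)))))"
      by (intro ev_im ev_ng ev_viq evsD[OF ups2[OF ups[OF W]] E h2(1)] ev_fdq N nV up2[OF F] ev_hvq Qu R
        up2[OF up[OF M]] up2[OF up[OF H]] up2[OF up[OF i]])
  qed
  have B: "ev \<sigma>' (Suc r) (exq P (\<lambda>C. an (le (cntq n (vr C)) Q) (allq nn (\<lambda>e. im
         (an (Z (vr e)) (viq (fdq n (vr r) (hvq M H i (op Quo (vr e) n))) (fdq n (vr r) (hvq M H i (op Rem (vr e) n)))))
         (dj (nz (fdq n (vr C) (hvq M H i (op Quo (vr e) n)))) (nz (fdq n (vr C) (hvq M H i (op Rem (vr e) n)))))))))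
     (of_bool (\<exists>C<(vn + 1) ^ vn. cnt vn C \<le> vQ \<and> (\<forall>e<vn * vn. e \<in> SZ \<and> vio (fd vn f (hv vM vH vi (e div vn))) (fd vn f (hv vM vH vi (e mod vn))) \<longrightarrow>
        fd vn C (hv vM vH vi (e div vn)) \<noteq> 0 \<or> fd vn C (hv vM vH vi (e mod vn)) \<noteq> 0)))"
  proof (rule ev_exq[OF up[OF P]])
    fix C r2 \<sigma>2 assume h2: "C < (vn + 1) ^ vn" "Suc r \<le> r2" "\<And>y. y < Suc r \<Longrightarrow> \<sigma>2 y = \<sigma>' y" "\<sigma>2 r2 = C"
    have up2: "ev \<sigma>' (Suc r) a v \<Longrightarrow> ev \<sigma>2 (Suc r2) a v" for a v using ev_mono[of \<sigma>' "Suc r" a v "Suc r2" \<sigma>2] h2 by auto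
    have ups2: "evs \<sigma>' (Suc r) a m v \<Longrightarrow> evs \<sigma>2 (Suc r2) a m v" for a m v using evs_mono[of \<sigma>' "Suc r" a m v "Suc r2" \<sigma>2] h2 by auto
    have C: "ev \<sigma>2 (Suc r2) (vr r2) C" by (rule ev_var) (use h2 in auto)
    have D: "ev \<sigma>2 (Suc r2) (allq nn (\<lambda>e. im
         (an (Z (vr e)) (viq (fdq n (vr r) (hvq M H i (op Quo (vr e) n))) (fdq n (vr r) (hvq M H i (op Rem (vr e) n)))))
         (dj (nz (fdq n (vr r2) (hvq M H i (op Quo (vr e) n)))) (nz (fdq n (vr r2) (hvq M H i (op Rem (vr e) n)))))))
     (of_bool (\<forall>e<vn * vn. e \<in> SZ \<and> vio (fd vn f (hv vM vH vi (e div vn))) (fd vn f (hv vM vH vi (e mod vn))) \<longrightarrow>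
        fd vn C (hv vM vH vi (e div vn)) \<noteq> 0 \<or> fd vn C (hv vM vH vi (e mod vn)) \<noteq> 0))"
    proof (rule ev_allq[OF up2[OF up[OF nn]]])
      fix e r3 \<sigma>3 assume h3: "e < vn * vn" "Suc r2 \<le> r3" "\<And>y. y < Suc r2 \<Longrightarrow> \<sigma>3 y = \<sigma>2 y" "\<sigma>3 r3 = e"
      have up3: "ev \<sigma>2 (Suc r2) a v \<Longrightarrow> ev \<sigma>3 (Suc r3) a v" for a v using ev_mono[of \<sigma>2 "Suc r2" a v "Suc r3" \<sigma>3] h3 by auto
      have ups3: "evs \<sigma>2 (Suc r2) a m v \<Longrightarrow> evs \<sigma>3 (Suc r3) a m v" for a m v using evs_mono[of \<sigma>2 "Suc r2" a m v "Suc r3" \<sigma>3] h3 by auto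
      have E: "ev \<sigma>3 (Suc r3) (vr r3) e" by (rule ev_var) (use h3 in auto)
      note N = up3[OF up2[OF up[OF n]]]
      have Qu: "ev \<sigma>3 (Suc r3) (op Quo (vr r3) n) (e div vn)" by (rule ev_op[OF E N]) (auto intro: le_trans[OF div_le_dividend])
      have R: "ev \<sigma>3 (Suc r3) (op Rem (vr r3) n) (e mod vn)" by (rule ev_op[OF E N]) (auto intro: le_trans[OF mod_less_eq_dividend])
      show "ev \<sigma>3 (Suc r3) (im
         (an (Z (vr r3)) (viq (fdq n (vr r) (hvq M H i (op Quo (vr r3) n))) (fdq n (vr r) (hvq M H i (op Rem (vr r3) n)))))
         (dj (nz (fdq n (vr r2) (hvq M H i (op Quo (vr r3) n)))) (nz (fdq n (vr r2) (hvq M H i (op Rem (vr r3) n))))))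
       (of_bool (e \<in> SZ \<and> vio (fd vn f (hv vM vH vi (e div vn))) (fd vn f (hv vM vH vi (e mod vn))) \<longrightarrow>
        fd vn C (hv vM vH vi (e div vn)) \<noteq> 0 \<or> fd vn C (hv vM vH vi (e mod vn)) \<noteq> 0))"
        by (intro ev_im ev_an ev_dj ev_eq ev_const ev_ng ev_viq evsD[OF ups3[OF ups2[OF ups[OF Z]]] E h3(1)] ev_fdq N nV up3[OF up2[OF F]] up3[OF C] ev_hvq Qu R
          up3[OF up2[OF up[OF M]]] up3[OF up2[OF up[OF H]]] up3[OF up2[OF up[OF i]]]) simp_all
    qed
    show "ev \<sigma>2 (Suc r2) (an (le (cntq n (vr r2)) Q) (allq nn (\<lambda>e. im
         (an (Z (vr e)) (viq (fdq n (vr r) (hvq M H i (op Quo (vr e) n))) (fdq n (vr r) (hvq M H i (op Rem (vr e) n)))))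
         (dj (nz (fdq n (vr r2) (hvq M H i (op Quo (vr e) n)))) (nz (fdq n (vr r2) (hvq M H i (op Rem (vr e) n))))))))
     (of_bool (cnt vn C \<le> vQ \<and> (\<forall>e<vn * vn. e \<in> SZ \<and> vio (fd vn f (hv vM vH vi (e div vn))) (fd vn f (hv vM vH vi (e mod vn))) \<longrightarrow>
        fd vn C (hv vM vH vi (e div vn)) \<noteq> 0 \<or> fd vn C (hv vM vH vi (e mod vn)) \<noteq> 0)))"
      by (rule ev_an[OF ev_le[OF ev_cntq[OF up2[OF up[OF n]] nV C] up2[OF up[OF Q]]] D])
  qed
  show "ev \<sigma>' (Suc r) (im
      (allq nn (\<lambda>e. im (W (vr e)) (ng (viq (fdq n (vr r) (hvq M H i (op Quo (vr e) n))) (fdq n (vr r) (hvq M H i (op Rem (vr e) n)))))))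
      (exq P (\<lambda>C. an (le (cntq n (vr C)) Q) (allq nn (\<lambda>e. im
         (an (Z (vr e)) (viq (fdq n (vr r) (hvq M H i (op Quo (vr e) n))) (fdq n (vr r) (hvq M H i (op Rem (vr e) n)))))
         (dj (nz (fdq n (vr C) (hvq M H i (op Quo (vr e) n)))) (nz (fdq n (vr C) (hvq M H i (op Rem (vr e) n))))))))))
    (of_bool ((\<forall>e<vn * vn. e \<in> SW \<longrightarrow> \<not> vio (fd vn f (hv vM vH vi (e div vn))) (fd vn f (hv vM vH vi (e mod vn)))) \<longrightarrow>
     (\<exists>C<(vn + 1) ^ vn. cnt vn C \<le> vQ \<and> (\<forall>e<vn * vn. e \<in> SZ \<and> vio (fd vn f (hv vM vH vi (e div vn))) (fd vn f (hv vM vH vi (e mod vn))) \<longrightarrow>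
        fd vn C (hv vM vH vi (e div vn)) \<noteq> 0 \<or> fd vn C (hv vM vH vi (e mod vn)) \<noteq> 0))))"
    by (rule ev_im[OF A B])
qed

lemma ev_qqq:
  assumes n: "ev \<sigma> d n vn" and k: "ev \<sigma> d k vk" and X: "ev \<sigma> d X vX" and i: "ev \<sigma> d i vi" and le: "vi \<le> vn" "vn * vX \<le> V"
  shows "ev \<sigma> d (qqq n k X i) (qq \<epsilon> vn vk vX vi)"
proof -
  have L: "ev \<sigma> d (op Add i (op Mul (ez i) n)) (lev vn vi)"
    by (rule ev_op[where vb = "of_bool (vi = 0) * vn", OF i ev_op[OF ev_eq[OF i ev_const] n]]) (auto simp: lev_def)
  have "lev vn vi * vX \<le> vn * vX" using le(1) unfolding lev_def by auto
  then have LX: "ev \<sigma> d (op Mul (op Add i (op Mul (ez i) n)) X) (lev vn vi * vX)"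
    by (intro ev_op[OF L X]) (use le_trans[OF \<open>lev vn vi * vX \<le> vn * vX\<close> le(2)] in auto)
  show ?thesis unfolding qqq_def qq_def
    by (rule ev_op[OF ev_fl[OF ev_op[OF LX n _ refl] refl] k]) (auto intro: le_trans[OF div_le_dividend])
qed

lemma ev_goodq:
  assumes n: "ev \<sigma> d n vn" and P: "ev \<sigma> d P ((vn + 1) ^ vn)" and nn: "ev \<sigma> d nn (vn * vn)" and s: "ev \<sigma> d s vs"
    and k: "ev \<sigma> d k vk" and X: "ev \<sigma> d X vX" and s0: "ev \<sigma> d s0 vs0"
    and M: "ev \<sigma> d M vM" and H: "ev \<sigma> d H vH"
    and W: "evs \<sigma> d W (vn * vn) SW" and Z: "evs \<sigma> d Z (vn * vn) SZ" and nV: "vn < V" and sV: "2 * vs \<le> V" and XV: "vn * vX \<le> V"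
  shows "ev \<sigma> d (goodq n k P nn s s0 M H X W Z) (of_bool (goodN \<epsilon> vn vk vs vs0 vM vH vX SW SZ))"
  unfolding goodq_def goodN_def
proof (intro ev_an ev_kernq n P nn s W Z nV sV)
  show "ev \<sigma> d (allq nn (\<lambda>e. im (W (vr e)) (Z (vr e)))) (of_bool (\<forall>e<vn * vn. e \<in> SW \<longrightarrow> e \<in> SZ))"
  proof (rule ev_allq[OF nn])
    fix e r \<sigma>' assume h: "e < vn * vn" "d \<le> r" "\<And>y. y < d \<Longrightarrow> \<sigma>' y = \<sigma> y" "\<sigma>' r = e"
    have ups: "evs \<sigma> d a m v \<Longrightarrow> evs \<sigma>' (Suc r) a m v" for a m v using evs_mono[of \<sigma> d a m v "Suc r" \<sigma>'] h by auto
    have E: "ev \<sigma>' (Suc r) (vr r) e" by (rule ev_var) (use h in auto)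
    show "ev \<sigma>' (Suc r) (im (W (vr r)) (Z (vr r))) (of_bool (e \<in> SW \<longrightarrow> e \<in> SZ))"
      by (rule ev_im[OF evsD[OF ups[OF W] E h(1)] evsD[OF ups[OF Z] E h(1)]])
  qed
  show "ev \<sigma> d (allq (op Add n (kn 1)) (\<lambda>i. im (dj (ez (vr i)) (an (le s0 (vr i)) (ez (op Rem M (vr i)))))
        (covq n P nn (hvq M H (vr i)) (qqq n k X (vr i)) W Z)))
      (of_bool (\<forall>i<vn + 1. level vs0 vM i \<longrightarrow> coverN vn vM vH i (qq \<epsilon> vn vk vX i) SW SZ))"
  proof (rule ev_allq[OF ev_op[OF n ev_const]])
    fix i r \<sigma>' assume h: "i < vn + 1" "d \<le> r" "\<And>y. y < d \<Longrightarrow> \<sigma>' y = \<sigma> y" "\<sigma>' r = i"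
    have up: "ev \<sigma> d a v \<Longrightarrow> ev \<sigma>' (Suc r) a v" for a v using ev_mono[of \<sigma> d a v "Suc r" \<sigma>'] h by auto
    have ups: "evs \<sigma> d a m v \<Longrightarrow> evs \<sigma>' (Suc r) a m v" for a m v using evs_mono[of \<sigma> d a m v "Suc r" \<sigma>'] h by auto
    have I: "ev \<sigma>' (Suc r) (vr r) i" by (rule ev_var) (use h in auto)
    have R: "ev \<sigma>' (Suc r) (op Rem M (vr r)) (vM mod i)" by (rule ev_op[OF up[OF M] I]) (auto intro: le_trans[OF mod_less_eq_dividend])
    show "ev \<sigma>' (Suc r) (im (dj (ez (vr r)) (an (le s0 (vr r)) (ez (op Rem M (vr r)))))
        (covq n P nn (hvq M H (vr r)) (qqq n k X (vr r)) W Z)) (of_bool (level vs0 vM i \<longrightarrow> coverN vn vM vH i (qq \<epsilon> vn vk vX i) SW SZ))"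
      unfolding level_def
      by (intro ev_im ev_dj ev_an ev_le ev_eq ev_const I R ev_covq ev_qqq up[OF n] up[OF P] up[OF nn] up[OF k] up[OF X] up[OF M] up[OF H] up[OF s0]
        ups[OF W] ups[OF Z] nV XV) (use h in auto)
  qed (use V1 nV in auto)
qed

lemma ev_isMq:
  assumes n: "ev \<sigma> d n vn" and Z: "evs \<sigma> d Z (vn * vn) SZ" and y: "ev \<sigma> d y vy" and nV: "vn < V" "vn * vn \<le> V"
  shows "ev \<sigma> d (isMq n Z y) (of_bool (isM vn SZ vy))"
  unfolding isMq_def isM_def
proof (rule ev_an)
  show "ev \<sigma> d (allq n (\<lambda>v. im (nz (fdq n y (vr v))) (dj (Z (op Add (op Mul (vr v) n) (op Sub (fdq n y (vr v)) (kn 1))))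
        (Z (op Add (op Mul (op Sub (fdq n y (vr v)) (kn 1)) n) (vr v))))))
     (of_bool (\<forall>v<vn. fd vn vy v \<noteq> 0 \<longrightarrow> v * vn + (fd vn vy v - 1) \<in> SZ \<or> (fd vn vy v - 1) * vn + v \<in> SZ))"
  proof (rule ev_allq[OF n])
    fix v r \<sigma>' assume h: "v < vn" "d \<le> r" "\<And>y. y < d \<Longrightarrow> \<sigma>' y = \<sigma> y" "\<sigma>' r = v"
    have up: "ev \<sigma> d a v \<Longrightarrow> ev \<sigma>' (Suc r) a v" for a v using ev_mono[of \<sigma> d a v "Suc r" \<sigma>'] h by auto
    have ups: "evs \<sigma> d a m v \<Longrightarrow> evs \<sigma>' (Suc r) a m v" for a m v using evs_mono[of \<sigma> d a m v "Suc r" \<sigma>'] h by auto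
    have I: "ev \<sigma>' (Suc r) (vr r) v" by (rule ev_var) (use h in auto)
    define u where "u = fd vn vy v - 1"
    have un: "u < vn" unfolding u_def using fd_le[of vn vy v] h(1) by linarith
    have pair: "a * vn + b < vn * vn" if "a < vn" "b < vn" for a b
    proof -
      have "a * vn + b < (a + 1) * vn" using that by simp
      also have "\<dots> \<le> vn * vn" using that by (intro mult_right_mono) auto
      finally show ?thesis .
    qed
    have F: "ev \<sigma>' (Suc r) (fdq n y (vr r)) (fd vn vy v)" by (rule ev_fdq[OF up[OF n] nV(1) up[OF y] I])
    have U: "ev \<sigma>' (Suc r) (op Sub (fdq n y (vr r)) (kn 1)) u" unfolding u_def by (rule ev_op[OF F ev_const]) (use V1 in auto)
    have le1: "a * vn \<le> V" if "a < vn" for a using pair[OF that, of 0] nV(2) h(1) by linarith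
    have A: "ev \<sigma>' (Suc r) (op Add (op Mul (vr r) n) (op Sub (fdq n y (vr r)) (kn 1))) (v * vn + u)"
      by (rule ev_op[OF ev_op[OF I up[OF n] _ refl] U]) (use pair[OF h(1) un] nV(2) le1[OF h(1)] in auto)
    have B: "ev \<sigma>' (Suc r) (op Add (op Mul (op Sub (fdq n y (vr r)) (kn 1)) n) (vr r)) (u * vn + v)"
      by (rule ev_op[OF ev_op[OF U up[OF n] _ refl] I]) (use pair[OF un h(1)] nV(2) le1[OF un] in auto)
    show "ev \<sigma>' (Suc r) (im (nz (fdq n y (vr r))) (dj (Z (op Add (op Mul (vr r) n) (op Sub (fdq n y (vr r)) (kn 1))))
        (Z (op Add (op Mul (op Sub (fdq n y (vr r)) (kn 1)) n) (vr r)))))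
      (of_bool (fd vn vy v \<noteq> 0 \<longrightarrow> v * vn + (fd vn vy v - 1) \<in> SZ \<or> (fd vn vy v - 1) * vn + v \<in> SZ))"
      unfolding u_def[symmetric]
      by (intro ev_im ev_ng ev_eq ev_const ev_dj F evsD[OF ups[OF Z] A pair[OF h(1) un]] evsD[OF ups[OF Z] B pair[OF un h(1)]]) simp
  qed
  show "ev \<sigma> d (allq n (\<lambda>v. allq n (\<lambda>v'. im (an (ng (eq (vr v) (vr v'))) (an (nz (fdq n y (vr v))) (nz (fdq n y (vr v')))))
        (an (ng (eq (fdq n y (vr v)) (fdq n y (vr v')))) (ng (eq (vr v) (op Sub (fdq n y (vr v')) (kn 1))))))))
     (of_bool (\<forall>v<vn. \<forall>v'<vn. v \<noteq> v' \<and> fd vn vy v \<noteq> 0 \<and> fd vn vy v' \<noteq> 0 \<longrightarrow> fd vn vy v \<noteq> fd vn vy v' \<and> v \<noteq> fd vn vy v' - 1))"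
  proof (rule ev_allq[OF n])
    fix v r \<sigma>' assume h: "v < vn" "d \<le> r" "\<And>y. y < d \<Longrightarrow> \<sigma>' y = \<sigma> y" "\<sigma>' r = v"
    have up: "ev \<sigma> d a v \<Longrightarrow> ev \<sigma>' (Suc r) a v" for a v using ev_mono[of \<sigma> d a v "Suc r" \<sigma>'] h by auto
    have I: "ev \<sigma>' (Suc r) (vr r) v" by (rule ev_var) (use h in auto)
    show "ev \<sigma>' (Suc r) (allq n (\<lambda>v'. im (an (ng (eq (vr r) (vr v'))) (an (nz (fdq n y (vr r))) (nz (fdq n y (vr v')))))
        (an (ng (eq (fdq n y (vr r)) (fdq n y (vr v')))) (ng (eq (vr r) (op Sub (fdq n y (vr v')) (kn 1)))))))
      (of_bool (\<forall>v'<vn. v \<noteq> v' \<and> fd vn vy v \<noteq> 0 \<and> fd vn vy v' \<noteq> 0 \<longrightarrow> fd vn vy v \<noteq> fd vn vy v' \<and> v \<noteq> fd vn vy v' - 1))"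
    proof (rule ev_allq[OF up[OF n]])
      fix v' r2 \<sigma>2 assume h2: "v' < vn" "Suc r \<le> r2" "\<And>y. y < Suc r \<Longrightarrow> \<sigma>2 y = \<sigma>' y" "\<sigma>2 r2 = v'"
      have up2: "ev \<sigma>' (Suc r) a v \<Longrightarrow> ev \<sigma>2 (Suc r2) a v" for a v using ev_mono[of \<sigma>' "Suc r" a v "Suc r2" \<sigma>2] h2 by auto
      have I': "ev \<sigma>2 (Suc r2) (vr r2) v'" by (rule ev_var) (use h2 in auto)
      have F: "ev \<sigma>2 (Suc r2) (fdq n y (vr r)) (fd vn vy v)" by (rule ev_fdq[OF up2[OF up[OF n]] nV(1) up2[OF up[OF y]] up2[OF I]])
      have F': "ev \<sigma>2 (Suc r2) (fdq n y (vr r2)) (fd vn vy v')" by (rule ev_fdq[OF up2[OF up[OF n]] nV(1) up2[OF up[OF y]] I'])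
      have U: "ev \<sigma>2 (Suc r2) (op Sub (fdq n y (vr r2)) (kn 1)) (fd vn vy v' - 1)" by (rule ev_op[OF F' ev_const]) (use V1 in auto)
      show "ev \<sigma>2 (Suc r2) (im (an (ng (eq (vr r) (vr r2))) (an (nz (fdq n y (vr r))) (nz (fdq n y (vr r2)))))
        (an (ng (eq (fdq n y (vr r)) (fdq n y (vr r2)))) (ng (eq (vr r) (op Sub (fdq n y (vr r2)) (kn 1))))))
        (of_bool (v \<noteq> v' \<and> fd vn vy v \<noteq> 0 \<and> fd vn vy v' \<noteq> 0 \<longrightarrow> fd vn vy v \<noteq> fd vn vy v' \<and> v \<noteq> fd vn vy v' - 1))"
        by (intro ev_im ev_an ev_ng ev_eq ev_const F F' U up2[OF I] I') simp_all
    qed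
  qed
qed

lemma ev_bstq:
  assumes n: "ev \<sigma> d n vn" and P: "ev \<sigma> d P ((vn + 1) ^ vn)" and Z: "evs \<sigma> d Z (vn * vn) SZ" and y: "ev \<sigma> d y vy" and nV: "vn < V" "vn * vn \<le> V"
  shows "ev \<sigma> d (bstq n P Z y) (of_bool (bst vn SZ vy))"
  unfolding bstq_def bst_def
proof (rule ev_an[OF ev_isMq[OF n Z y nV] ev_allq[OF P]])
  fix y' r \<sigma>' assume h: "y' < (vn + 1) ^ vn" "d \<le> r" "\<And>y. y < d \<Longrightarrow> \<sigma>' y = \<sigma> y" "\<sigma>' r = y'"
  have up: "ev \<sigma> d a v \<Longrightarrow> ev \<sigma>' (Suc r) a v" for a v using ev_mono[of \<sigma> d a v "Suc r" \<sigma>'] h by auto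
  have ups: "evs \<sigma> d a m v \<Longrightarrow> evs \<sigma>' (Suc r) a m v" for a m v using evs_mono[of \<sigma> d a m v "Suc r" \<sigma>'] h by auto
  have I: "ev \<sigma>' (Suc r) (vr r) y'" by (rule ev_var) (use h in auto)
  show "ev \<sigma>' (Suc r) (im (isMq n Z (vr r)) (le (cntq n (vr r)) (cntq n y))) (of_bool (isM vn SZ y' \<longrightarrow> cnt vn y' \<le> cnt vn vy))"
    by (intro ev_im ev_isMq ev_le ev_cntq up[OF n] ups[OF Z] I nV up[OF y])
qed

end


section \<open>The streaming loop\<close>

text \<open>Registers: \<open>0\<close> and \<open>1\<close> hold \<open>n\<close> and \<open>k\<close>; \<open>2\<close> and \<open>3\<close> the codes of the reduced part and of the
  buffer; \<open>4\<close> the number of edges in the buffer and \<open>5\<close> its capacity \<open>b\<close>; \<open>6, ..., 10\<close> the parameters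
  \<open>s\<close>, \<open>s0\<close>, \<open>M\<close>, \<open>H\<close>, \<open>X\<close>; \<open>11\<close> and \<open>12\<close> the numbers \<open>(n + 1)^n\<close> and \<open>n^2\<close>; \<open>13\<close> and \<open>14\<close> the current
  edge. Expressions use registers from \<open>20\<close> on.\<close>

definition asg :: "nat \<Rightarrow> expr \<Rightarrow> com" where
  "asg r e = Seq (e 20) (Seq (Const r 0) (Op Add r r 20))"

definition Zq :: "expr \<Rightarrow> expr" where
  "Zq = (\<lambda>e. dj (memq (vr 12) (vr 2) e) (memq (vr 12) (vr 3) e))"

text \<open>No encoder is programmed: the new code of the buffer is the least one with the right set
  of members.\<close>

definition insert_com :: com where
  "insert_com = Seq (asg 3 (muq (\<lambda>w. allq (vr 12) (\<lambda>e. eq (memq (vr 12) (vr w) (vr e))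
      (dj (memq (vr 12) (vr 3) (vr e)) (eq (vr e) (op Add (op Mul (vr 13) (vr 0)) (vr 14))))))))
    (asg 4 (op Add (vr 4) (kn 1)))"

definition reduce_com :: com where
  "reduce_com = Seq (asg 15 (le (vr 5) (vr 4))) (IfNZ 15
     (Seq (asg 2 (muq (\<lambda>w. goodq (vr 0) (vr 1) (vr 11) (vr 12) (vr 6) (vr 7) (vr 8) (vr 9) (vr 10) (memq (vr 12) (vr w)) Zq)))
       (Seq (asg 3 (kn 0)) (asg 4 (kn 0)))) Skip)"

text \<open>The end points of an edge are distinct, so their sum in register \<open>15\<close>
  vanishes at the end of the stream only.\<close>

definition next_com :: com where
  "next_com = Seq (Read 13 14) (asg 15 (op Add (vr 13) (vr 14)))"

definition loop_com :: com where
  "loop_com = Seq next_com (WhileNZ 15 (Seq insert_com (Seq reduce_com next_com)))"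

definition out_com :: com where
  "out_com = Seq (asg 4 (kn 0)) (Seq (asg 15 (vr 0)) (WhileNZ 15 (Seq (asg 13 (fdq (vr 0) (vr 16) (vr 4)))
     (Seq (IfNZ 13 (Seq (asg 13 (op Sub (vr 13) (kn 1))) (Emit 4 13)) Skip)
       (Seq (asg 4 (op Add (vr 4) (kn 1))) (asg 15 (op Sub (vr 0) (vr 4))))))))"

definition core_com :: com where
  "core_com = Seq loop_com (Seq (asg 16 (muq (\<lambda>y. bstq (vr 0) (vr 11) Zq (vr y)))) out_com)"

section \<open>The invariant of the streaming loop\<close>

definition arcset :: "nat \<Rightarrow> (nat \<times> nat) list \<Rightarrow> nat set" where
  "arcset n es = (\<lambda>(u, v). u * n + v) ` set es"

text \<open>After \<open>t\<close> reductions, whatever edges \<open>Y\<close> follow, the stored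
  set \<open>Z\<close> replaces all edges \<open>T\<close> read so far: without loss up to matching
  size \<open>s + 1\<close>, and with \<open>t\<close> times the allowed error at every level.
  Quantifying over \<open>Y\<close> makes the property survive later insertions.\<close>

definition faithful :: "real \<Rightarrow> nat \<Rightarrow> nat \<Rightarrow> nat \<Rightarrow> nat \<Rightarrow> nat \<Rightarrow> nat \<Rightarrow> nat \<Rightarrow> nat set \<Rightarrow> nat set \<Rightarrow> nat \<Rightarrow> bool" where
  "faithful \<epsilon> n k s s0 M H X T Z t \<longleftrightarrow> Z \<subseteq> T \<and> T \<subseteq> arcs n \<and> (\<forall>Y\<subseteq>arcs n.
     min (mu (gr n (T \<union> Y))) (s + 1) \<le> mu (gr n (Z \<union> Y)) \<and>
     (\<forall>i\<le>n. level s0 M i \<longrightarrow> mu (himg (hv M H i) (gr n (T \<union> Y))) \<le> mu (himg (hv M H i) (gr n (Z \<union> Y))) + t * qq \<epsilon> n k X i))"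

lemma faithful_empty: "faithful \<epsilon> n k s s0 M H X {} {} 0"
  unfolding faithful_def by auto

lemma faithful_insert:
  assumes "faithful \<epsilon> n k s s0 M H X T Z t" "a \<in> arcs n"
  shows "faithful \<epsilon> n k s s0 M H X (insert a T) (insert a Z) t"
  unfolding faithful_def
proof (intro conjI allI impI)
  show "insert a Z \<subseteq> insert a T" "insert a T \<subseteq> arcs n" using assms unfolding faithful_def by auto
  fix Y assume Y: "Y \<subseteq> arcs n"
  have e: "insert a T \<union> Y = T \<union> insert a Y" "insert a Z \<union> Y = Z \<union> insert a Y" by auto
  have aY: "insert a Y \<subseteq> arcs n" using assms(2) Y by auto
  show "min (mu (gr n (insert a T \<union> Y))) (s + 1) \<le> mu (gr n (insert a Z \<union> Y))"
    using assms(1) aY unfolding faithful_def e by blast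
  fix i assume "i \<le> n" "level s0 M i"
  then show "mu (himg (hv M H i) (gr n (insert a T \<union> Y))) \<le> mu (himg (hv M H i) (gr n (insert a Z \<union> Y))) + t * qq \<epsilon> n k X i"
    using assms(1) aY unfolding faithful_def e by blast
qed

text \<open>The errors of successive reductions add up at each level, whereas the kernel property
  composes without loss, because the truncation at \<open>s + 1\<close> is the same in every
  round.\<close>

lemma faithful_reduce:
  assumes f: "faithful \<epsilon> n k s s0 M H X T Z t" and W: "goodN \<epsilon> n k s s0 M H X W Z" "W \<subseteq> {..<n * n}"
  shows "faithful \<epsilon> n k s s0 M H X T W (Suc t) \<and> W \<subseteq> Z"
proof
  show WZ: "W \<subseteq> Z" using W unfolding goodN_def by blast
  have ZT: "Z \<subseteq> T" "T \<subseteq> arcs n" using f unfolding faithful_def by auto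
  then have Za: "Z \<subseteq> arcs n" by auto
  show "faithful \<epsilon> n k s s0 M H X T W (Suc t)" unfolding faithful_def
  proof (intro conjI allI impI)
    show "W \<subseteq> T" "T \<subseteq> arcs n" using ZT WZ by auto
    fix Y assume Y: "Y \<subseteq> arcs n"
    have gZ: "graph_on {..<n} (gr n Z \<union> gr n Y)" and gW: "graph_on {..<n} (gr n W \<union> gr n Y)"
      using gr_graph_on[of "Z \<union> Y" n] gr_graph_on[of "W \<union> Y" n] Za WZ Y unfolding gr_Un by auto
    have gWZ: "gr n W \<subseteq> gr n Z" using WZ unfolding gr_def by (rule image_mono)
    have "kern n s (gr n W) (gr n Z)" using W kernN_iff[OF Za WZ] unfolding goodN_def by auto
    then have "min (mu (gr n Z \<union> gr n Y)) (s + 1) \<le> mu (gr n W \<union> gr n Y)"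
      by (rule kern_mu[OF gZ gWZ])
    moreover have "min (mu (gr n (T \<union> Y))) (s + 1) \<le> mu (gr n (Z \<union> Y))" using f Y unfolding faithful_def by blast
    ultimately show "min (mu (gr n (T \<union> Y))) (s + 1) \<le> mu (gr n (W \<union> Y))" unfolding gr_Un by linarith
    fix i assume i: "i \<le> n" "level s0 M i"
    let ?h = "hv M H i"
    have "coverN n M H i (qq \<epsilon> n k X i) W Z" using W(1) i unfolding goodN_def by auto
    then have c: "covers n (lev n i) (qq \<epsilon> n k X i) (himg ?h (gr n W)) (himg ?h (gr n Z))" using coverN_iff[OF Za WZ i(1)] by blast
    have "graph_on {..<lev n i} (himg ?h (gr n Z \<union> gr n Y))" "graph_on {..<lev n i} (himg ?h (gr n W \<union> gr n Y))"
      using himg_graph_on[OF gZ, of ?h "lev n i"] himg_graph_on[OF gW, of ?h "lev n i"] hv_less by auto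
    moreover have "lev n i \<le> n" using i(1) unfolding lev_def by auto
    ultimately have "mu (himg ?h (gr n Z \<union> gr n Y)) \<le> mu (himg ?h (gr n W \<union> gr n Y)) + qq \<epsilon> n k X i"
      using covers_mu[OF c] unfolding himg_Un by blast
    moreover have "mu (himg ?h (gr n (T \<union> Y))) \<le> mu (himg ?h (gr n (Z \<union> Y))) + t * qq \<epsilon> n k X i"
      using f Y i unfolding faithful_def by blast
    ultimately show "mu (himg ?h (gr n (T \<union> Y))) \<le> mu (himg ?h (gr n (W \<union> Y))) + Suc t * qq \<epsilon> n k X i"
      unfolding gr_Un by simp
  qed
qed

lemma ev_allq_muq_aux: "(\<exists>w\<le>V. \<phi> w) \<Longrightarrow> \<phi> (LEAST w. \<phi> w) \<and> (LEAST w. \<phi> w) \<le> V \<and> (\<forall>j<(LEAST w. \<phi> w). \<not> \<phi> j)"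
  for V :: nat
proof -
  assume "\<exists>w\<le>V. \<phi> w"
  then obtain w where w: "w \<le> V" "\<phi> w" by blast
  have "(LEAST w. \<phi> w) \<le> V" using Least_le[of \<phi> w, OF w(2)] w(1) by (rule le_trans)
  with LeastI[of \<phi> w, OF w(2)] not_less_Least[of _ \<phi>] show ?thesis by blast
qed

section \<open>Verification of the loop and of the output\<close>

context machine
begin

lemma ttc_asg:
  assumes s: "safe V s" and e: "ev (regs s) 20 e v" and r: "r < 20"
    and Q: "\<And>s'. safe V s' \<Longrightarrow> (\<And>x. x < 20 \<Longrightarrow> regs s' x = (if x = r then v else regs s x)) \<Longrightarrow>
      stream_in s' = stream_in s \<Longrightarrow> stream_out s' = stream_out s \<Longrightarrow> Q s'"
  shows "ttc \<epsilon> V (asg r e) s Q"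
  unfolding asg_def
proof (rule ttc_Seq)
  show "ttc \<epsilon> V (e 20) s (\<lambda>s'. regs s' 20 = v \<and> (\<forall>x<20. regs s' x = regs s x) \<and>
       stream_in s' = stream_in s \<and> stream_out s' = stream_out s)" by (rule evD[OF e]) (use s in auto)
  fix s1 assume s1: "safe V s1" "regs s1 20 = v \<and> (\<forall>x<20. regs s1 x = regs s x) \<and>
       stream_in s1 = stream_in s \<and> stream_out s1 = stream_out s"
  have "v \<le> V" using safe_le[OF s1(1), of 20] s1(2) by simp
  then have v': "safe V (set_reg r v (set_reg r 0 s1))" using s1(1) by (intro safe_set_reg) auto
  show "ttc \<epsilon> V (Seq (Const r 0) (Op Add r r 20)) s1 Q"
    by (intro Seq_Const ttc_Op) (use s1 r \<open>v \<le> V\<close> v' in \<open>auto intro!: Q\<close>)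
qed

lemma Seq_asg:
  assumes "safe V s" "ev (regs s) 20 e v" "r < 20"
    and "\<And>s'. safe V s' \<Longrightarrow> (\<And>x. x < 20 \<Longrightarrow> regs s' x = (if x = r then v else regs s x)) \<Longrightarrow>
      stream_in s' = stream_in s \<Longrightarrow> stream_out s' = stream_out s \<Longrightarrow> ttc \<epsilon> V q s' Q"
  shows "ttc \<epsilon> V (Seq (asg r e) q) s Q"
  by (rule ttc_Seq[of _ _ _ _ "\<lambda>s'. safe V s' \<and> (\<forall>x<20. regs s' x = (if x = r then v else regs s x)) \<and>
      stream_in s' = stream_in s \<and> stream_out s' = stream_out s"], rule ttc_asg[OF assms(1-3)]) (use assms(4) in auto)

lemma ev_reg: "r < 20 \<Longrightarrow> regs s r = v \<Longrightarrow> ev (regs s) 20 (vr r) v"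
  by (rule ev_var)

end

text \<open>What the loop requires of \<open>V\<close>: room for the arithmetic, and a code of at
  most \<open>V\<close> for the reduced part (\<open>red\<close>), for the buffer
  (\<open>buf\<close>) and for a matching (\<open>mat\<close>).\<close>

locale core = machine +
  fixes n k b s s0 M H X :: nat
  assumes nV: "(n * n + 2) * (n * n + 2) \<le> V" and sV: "2 * s \<le> V" and XV: "n * X \<le> V" and b1: "1 \<le> b" and bV: "b \<le> V"
    and red: "\<And>Z. Z \<subseteq> arcs n \<Longrightarrow> \<exists>w\<le>V. goodN \<epsilon> n k s s0 M H X (codes (n * n) w) Z"
    and buf: "\<And>S. S \<subseteq> arcs n \<Longrightarrow> card S \<le> b \<Longrightarrow> \<exists>w\<le>V. codes (n * n) w = S"
    and mat: "(n + 1) ^ n \<le> V"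
begin

definition env :: "config \<Rightarrow> bool" where
  "env t \<longleftrightarrow> regs t 0 = n \<and> regs t 1 = k \<and> regs t 5 = b \<and> regs t 6 = s \<and> regs t 7 = s0 \<and> regs t 8 = M \<and> regs t 9 = H \<and>
     regs t 10 = X \<and> regs t 11 = (n + 1) ^ n \<and> regs t 12 = n * n"

definition cur :: "config \<Rightarrow> nat set" where
  "cur t = codes (n * n) (regs t 2) \<union> codes (n * n) (regs t 3)"

text \<open>Each reduction consumes a full buffer of \<open>b\<close> edges, so the last inequality
  bounds the number \<open>r\<close> of reductions by the length of the stream.\<close>

definition J :: "(nat \<times> nat) list \<Rightarrow> config \<Rightarrow> bool" where
  "J pre t \<longleftrightarrow> env t \<and> stream_out t = [] \<and> card (codes (n * n) (regs t 3)) \<le> regs t 4 \<and> regs t 4 \<le> b \<and>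
     (\<exists>r. faithful \<epsilon> n k s s0 M H X (arcset n pre) (cur t) r \<and> r * b + regs t 4 \<le> length pre)"

lemma nV': "n < V" "n * n \<le> V" "n * n < V" "2 * n \<le> V"
proof -
  have a: "n \<le> n * n" by (cases n) auto
  have c: "(n * n + 2) * (n * n + 2) = n * n * (n * n) + 4 * (n * n) + 4" by (simp add: algebra_simps)
  show "n < V" "n * n \<le> V" "n * n < V" "2 * n \<le> V" using nV a unfolding c by linarith+
qed

lemma fin_codes: "finite (codes m z)" unfolding codes_def by simp

lemma codes_sub: "codes m z \<subseteq> {..<m}" unfolding codes_def by auto

lemma evs_Zq: "env t \<Longrightarrow> evs (regs t) 20 Zq (n * n) (cur t)"
  unfolding Zq_def cur_def by (intro evs_dj evs_memq nV ev_reg) (auto simp: env_def)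

lemma cur_arcs: "J pre t \<Longrightarrow> cur t \<subseteq> arcs n"
  unfolding J_def faithful_def by auto

lemma ttc_insert:
  assumes t: "safe V t" "J pre t" "regs t 4 < b" and uv: "regs t 13 < n" "regs t 14 < n" "regs t 13 \<noteq> regs t 14"
  shows "ttc \<epsilon> V insert_com t (\<lambda>t'. J (pre @ [(regs t 13, regs t 14)]) t' \<and> stream_in t' = stream_in t)"
proof -
  define a where "a = regs t 13 * n + regs t 14"
  have a: "a \<in> arcs n"
  proof -
    have "a < (regs t 13 + 1) * n" unfolding a_def using uv by simp
    also have "\<dots> \<le> n * n" using uv by (intro mult_right_mono) auto
    finally show ?thesis using uv unfolding arcs_def a_def by simp
  qed
  then have an: "a < n * n" unfolding arcs_def by simp
  have e: "env t" using t(2) unfolding J_def by simp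
  let ?S = "insert a (codes (n * n) (regs t 3))"
  have Sa: "?S \<subseteq> arcs n" using a cur_arcs[OF t(2)] unfolding cur_def by auto
  have cS: "card ?S \<le> Suc (regs t 4)" using t(2) card_insert_le_m1[of "Suc (regs t 4)"] fin_codes[of "n * n" "regs t 3"]
    unfolding J_def by (simp add: card_insert_if)
  define \<phi> where "\<phi> w \<longleftrightarrow> (\<forall>x<n * n. (mem (n * n) w x) = (mem (n * n) (regs t 3) x \<or> x = a))" for w
  have \<phi>S: "\<phi> w \<longleftrightarrow> codes (n * n) w = ?S" for w unfolding \<phi>_def codes_def using an by auto
  obtain w0 where "w0 \<le> V" "codes (n * n) w0 = ?S" using buf[OF Sa] cS t(3) by auto
  then have "\<exists>w\<le>V. \<phi> w" using \<phi>S by blast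
  then obtain w where w: "\<phi> w" "w \<le> V" "\<And>j. j < w \<Longrightarrow> \<not> \<phi> j" using ev_allq_muq_aux by blast
  have ev3: "ev (regs t) 20 (muq (\<lambda>w. allq (vr 12) (\<lambda>e. eq (memq (vr 12) (vr w) (vr e))
      (dj (memq (vr 12) (vr 3) (vr e)) (eq (vr e) (op Add (op Mul (vr 13) (vr 0)) (vr 14))))))) w"
  proof (rule ev_muq[where \<phi> = \<phi>])
    fix j r \<sigma>' assume h: "j \<le> w" "20 \<le> r" "\<And>y. y < 20 \<Longrightarrow> \<sigma>' y = regs t y" "\<sigma>' r = j"
    have V12: "ev \<sigma>' (Suc r) (vr 12) (n * n)" by (rule ev_var) (use h e in \<open>auto simp: env_def\<close>)
    show "ev \<sigma>' (Suc r) (allq (vr 12) (\<lambda>e. eq (memq (vr 12) (vr r) (vr e))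
      (dj (memq (vr 12) (vr 3) (vr e)) (eq (vr e) (op Add (op Mul (vr 13) (vr 0)) (vr 14)))))) (of_bool (\<phi> j))"
      unfolding \<phi>_def
    proof (rule ev_allq[OF V12])
      fix x r2 \<sigma>2 assume h2: "x < n * n" "Suc r \<le> r2" "\<And>y. y < Suc r \<Longrightarrow> \<sigma>2 y = \<sigma>' y" "\<sigma>2 r2 = x"
      have V: "ev \<sigma>2 (Suc r2) (vr y) (regs t y)" if "y < 20" for y by (rule ev_var) (use h h2 that in auto)
      have X: "ev \<sigma>2 (Suc r2) (vr r2) x" by (rule ev_var) (use h2 in auto)
      have R: "ev \<sigma>2 (Suc r2) (vr r) j" by (rule ev_var) (use h h2 in auto)
      have N: "ev \<sigma>2 (Suc r2) (vr 12) (n * n)" using V[of 12] e unfolding env_def by simp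
      have le: "regs t 13 * n \<le> V" using an nV' unfolding a_def by linarith
      have A: "ev \<sigma>2 (Suc r2) (op Add (op Mul (vr 13) (vr 0)) (vr 14)) a"
        by (rule ev_op[OF ev_op[OF V V _ refl] V]) (use e le an nV' in \<open>auto simp: env_def a_def\<close>)
      have "ev \<sigma>2 (Suc r2) (eq (memq (vr 12) (vr r) (vr r2))
        (dj (memq (vr 12) (vr 3) (vr r2)) (eq (vr r2) (op Add (op Mul (vr 13) (vr 0)) (vr 14)))))
        (of_bool (of_bool (mem (n * n) j x) = (of_bool (mem (n * n) (regs t 3) x \<or> x = a) :: nat)))"
        by (intro ev_eq ev_memq N R X ev_dj A nV h2(1) V) simp
      then show "ev \<sigma>2 (Suc r2) (eq (memq (vr 12) (vr r) (vr r2))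
        (dj (memq (vr 12) (vr 3) (vr r2)) (eq (vr r2) (op Add (op Mul (vr 13) (vr 0)) (vr 14)))))
        (of_bool ((mem (n * n) j x) = (mem (n * n) (regs t 3) x \<or> x = a)))" by (simp only: of_bool_eq_iff)
    qed
  qed (use w in auto)
  show ?thesis unfolding insert_com_def
  proof (rule Seq_asg[OF t(1) ev3])
    fix t1 assume t1: "safe V t1" "\<And>x. x < 20 \<Longrightarrow> regs t1 x = (if x = 3 then w else regs t x)"
      "stream_in t1 = stream_in t" "stream_out t1 = stream_out t"
    have r4: "ev (regs t1) 20 (op Add (vr 4) (kn 1)) (Suc (regs t 4))"
      by (rule ev_op[OF ev_reg[OF _ refl] ev_const]) (use t1(2) t(3) V1 bV in auto)
    show "ttc \<epsilon> V (asg 4 (op Add (vr 4) (kn 1))) t1 (\<lambda>t'. J (pre @ [(regs t 13, regs t 14)]) t' \<and> stream_in t' = stream_in t)"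
    proof (rule ttc_asg[OF t1(1) r4])
      fix t2 assume t2: "safe V t2" "\<And>x. x < 20 \<Longrightarrow> regs t2 x = (if x = 4 then Suc (regs t 4) else regs t1 x)"
        "stream_in t2 = stream_in t1" "stream_out t2 = stream_out t1"
      have rg: "regs t2 2 = regs t 2" "regs t2 3 = w" "regs t2 4 = Suc (regs t 4)" using t1 t2 by auto
      have "env t2" using e t1(2) t2(2) unfolding env_def by simp
      moreover have "cur t2 = insert a (cur t)" using \<phi>S w(1) unfolding cur_def rg by auto
      moreover have "arcset n (pre @ [(regs t 13, regs t 14)]) = insert a (arcset n pre)" unfolding arcset_def a_def by auto
      moreover obtain r where "faithful \<epsilon> n k s s0 M H X (arcset n pre) (cur t) r" "r * b + regs t 4 \<le> length pre"
        using t(2) unfolding J_def by blast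
      ultimately show "J (pre @ [(regs t 13, regs t 14)]) t2 \<and> stream_in t2 = stream_in t"
        using faithful_insert[OF _ a] t1 t2 rg t(2,3) cS \<phi>S w(1) unfolding J_def by (auto intro!: exI[of _ r])
    qed simp
  qed simp
qed

lemma ttc_reduce:
  assumes t: "safe V t" "J pre t"
  shows "ttc \<epsilon> V reduce_com t (\<lambda>t'. J pre t' \<and> regs t' 4 < b \<and> stream_in t' = stream_in t)"
proof -
  have e: "env t" using t(2) unfolding J_def by simp
  have ev15: "ev (regs t) 20 (le (vr 5) (vr 4)) (of_bool (b \<le> regs t 4))"
    by (intro ev_le ev_reg) (use e in \<open>auto simp: env_def\<close>)
  show ?thesis unfolding reduce_com_def
  proof (rule Seq_asg[OF t(1) ev15])
    fix t1 assume t1: "safe V t1" "\<And>x. x < 20 \<Longrightarrow> regs t1 x = (if x = 15 then of_bool (b \<le> regs t 4) else regs t x)"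
      "stream_in t1 = stream_in t" "stream_out t1 = stream_out t"
    have J1: "J pre t1" using t(2) t1 unfolding J_def env_def cur_def by simp
    have e1: "env t1" using J1 unfolding J_def by simp
    show "ttc \<epsilon> V (IfNZ 15 (Seq (asg 2 (muq (\<lambda>w. goodq (vr 0) (vr 1) (vr 11) (vr 12) (vr 6) (vr 7) (vr 8) (vr 9) (vr 10) (memq (vr 12) (vr w)) Zq)))
       (Seq (asg 3 (kn 0)) (asg 4 (kn 0)))) Skip) t1 (\<lambda>t'. J pre t' \<and> regs t' 4 < b \<and> stream_in t' = stream_in t)"
    proof (rule ttc_If[OF t1(1)])
      assume "regs t1 15 = 0"
      then have "regs t 4 < b" using t1(2)[of 15] by (simp split: if_splits)
      then show "ttc \<epsilon> V Skip t1 (\<lambda>t'. J pre t' \<and> regs t' 4 < b \<and> stream_in t' = stream_in t)"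
        using J1 t1 by (intro ttc_Skip) auto
    next
      assume "regs t1 15 \<noteq> 0"
      define \<phi> where "\<phi> w \<longleftrightarrow> goodN \<epsilon> n k s s0 M H X (codes (n * n) w) (cur t1)" for w
      have "\<exists>w\<le>V. \<phi> w" unfolding \<phi>_def by (rule red[OF cur_arcs[OF J1]])
      then obtain w where w: "\<phi> w" "w \<le> V" "\<And>j. j < w \<Longrightarrow> \<not> \<phi> j" using ev_allq_muq_aux by blast
      have ev2: "ev (regs t1) 20 (muq (\<lambda>w. goodq (vr 0) (vr 1) (vr 11) (vr 12) (vr 6) (vr 7) (vr 8) (vr 9) (vr 10) (memq (vr 12) (vr w)) Zq)) w"
      proof (rule ev_muq[where \<phi> = \<phi>])
        fix j r \<sigma>' assume h: "j \<le> w" "20 \<le> r" "\<And>y. y < 20 \<Longrightarrow> \<sigma>' y = regs t1 y" "\<sigma>' r = j"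
        have V: "ev \<sigma>' (Suc r) (vr y) v" if "y < 20" "regs t1 y = v" for y v by (rule ev_var) (use h that in auto)
        have R: "ev \<sigma>' (Suc r) (vr r) j" by (rule ev_var) (use h in auto)
        have N: "ev \<sigma>' (Suc r) (vr 12) (n * n)" by (rule V) (use e1 in \<open>auto simp: env_def\<close>)
        have Z: "evs \<sigma>' (Suc r) Zq (n * n) (cur t1)" by (rule evs_mono[OF evs_Zq[OF e1]]) (use h in auto)
        show "ev \<sigma>' (Suc r) (goodq (vr 0) (vr 1) (vr 11) (vr 12) (vr 6) (vr 7) (vr 8) (vr 9) (vr 10) (memq (vr 12) (vr r)) Zq) (of_bool (\<phi> j))"
          unfolding \<phi>_def
          by (intro ev_goodq N Z evs_memq[OF N R nV] nV'(1) sV XV V) (use e1 in \<open>auto simp: env_def\<close>)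
      qed (use w in auto)
      show "ttc \<epsilon> V (Seq (asg 2 (muq (\<lambda>w. goodq (vr 0) (vr 1) (vr 11) (vr 12) (vr 6) (vr 7) (vr 8) (vr 9) (vr 10) (memq (vr 12) (vr w)) Zq)))
       (Seq (asg 3 (kn 0)) (asg 4 (kn 0)))) t1 (\<lambda>t'. J pre t' \<and> regs t' 4 < b \<and> stream_in t' = stream_in t)"
      proof (rule Seq_asg[OF t1(1) ev2])
        fix t2 assume t2: "safe V t2" "\<And>x. x < 20 \<Longrightarrow> regs t2 x = (if x = 2 then w else regs t1 x)"
          "stream_in t2 = stream_in t1" "stream_out t2 = stream_out t1"
        show "ttc \<epsilon> V (Seq (asg 3 (kn 0)) (asg 4 (kn 0))) t2 (\<lambda>t'. J pre t' \<and> regs t' 4 < b \<and> stream_in t' = stream_in t)"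
        proof (rule Seq_asg[OF t2(1) ev_const[of 0]])
          fix t3 assume t3: "safe V t3" "\<And>x. x < 20 \<Longrightarrow> regs t3 x = (if x = 3 then 0 else regs t2 x)"
            "stream_in t3 = stream_in t2" "stream_out t3 = stream_out t2"
          show "ttc \<epsilon> V (asg 4 (kn 0)) t3 (\<lambda>t'. J pre t' \<and> regs t' 4 < b \<and> stream_in t' = stream_in t)"
          proof (rule ttc_asg[OF t3(1) ev_const[of 0]])
            fix t4 assume t4: "safe V t4" "\<And>x. x < 20 \<Longrightarrow> regs t4 x = (if x = 4 then 0 else regs t3 x)"
              "stream_in t4 = stream_in t3" "stream_out t4 = stream_out t3"
            have rg: "regs t4 2 = w" "regs t4 3 = 0" "regs t4 4 = 0" using t2 t3 t4 by auto
            have "env t4" using e1 t2(2) t3(2) t4(2) unfolding env_def by simp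
            moreover have "cur t4 = codes (n * n) w" unfolding cur_def rg codes_0 by simp
            moreover obtain r where "faithful \<epsilon> n k s s0 M H X (arcset n pre) (cur t1) r" "r * b + regs t1 4 \<le> length pre"
              using J1 unfolding J_def by blast
            moreover have "b \<le> regs t1 4" using \<open>regs t1 15 \<noteq> 0\<close> t1(2)[of 15] t1(2)[of 4] by (simp split: if_splits)
            ultimately show "J pre t4 \<and> regs t4 4 < b \<and> stream_in t4 = stream_in t"
              using faithful_reduce[OF _ w(1)[unfolded \<phi>_def] codes_sub] rg b1 t1 t2 t3 t4 J1 codes_0 unfolding J_def
              by (auto intro!: exI[of _ "Suc r"])
          qed simp_all
        qed simp_all
      qed simp
    qed
  qed simp
qed

text \<open>At the head of the loop one edge has been read into registers \<open>13\<close> and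
  \<open>14\<close> but not yet inserted; a zero in register \<open>15\<close> signals that the
  stream has ended.\<close>

definition L :: "(nat \<times> nat) list \<Rightarrow> config \<Rightarrow> bool" where
  "L es t \<longleftrightarrow> (\<exists>pre. J pre t \<and> regs t 4 < b \<and> (if regs t 15 = 0 then pre = es
     else es = pre @ (regs t 13, regs t 14) # stream_in t))"

lemma ttc_next:
  assumes t: "safe V t" "J pre t" "regs t 4 < b" and es: "es = pre @ stream_in t"
    and edges: "\<And>u v. (u, v) \<in> set es \<Longrightarrow> u < n \<and> v < n \<and> u \<noteq> v"
  shows "ttc \<epsilon> V next_com t (\<lambda>t'. L es t' \<and> (regs t' 15 \<noteq> 0 \<longrightarrow> length (stream_in t') < length (stream_in t)))"
  unfolding next_com_def
proof (rule ttc_Seq)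
  define u v where "u = (case stream_in t of [] \<Rightarrow> 0 | (u, v) # _ \<Rightarrow> u)" and "v = (case stream_in t of [] \<Rightarrow> 0 | (u, v) # _ \<Rightarrow> v)"
  have uvn: "u + v \<le> V" "u \<le> V" "v \<le> V"
  proof -
    have "u \<le> n \<and> v \<le> n \<and> u + v \<le> 2 * n"
    proof (cases "stream_in t")
      case Nil
      then show ?thesis unfolding u_def v_def by simp
    next
      case (Cons p rest)
      obtain u' v' where p: "p = (u', v')" by (cases p)
      have "u' < n" "v' < n" using edges[of u' v'] es unfolding Cons p by auto
      then show ?thesis unfolding u_def v_def Cons p by simp
    qed
    with nV'(4) nV'(1) show "u + v \<le> V" "u \<le> V" "v \<le> V" by auto
  qed
  let ?t1 = "read_edge 13 14 t"
  have t1: "regs ?t1 x = (if x = 14 then v else if x = 13 then u else regs t x)" "stream_in ?t1 = tl (stream_in t)" "stream_out ?t1 = stream_out t" for x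
    unfolding u_def v_def by (auto split: list.splits prod.splits simp: set_reg_def)
  have s1: "safe V ?t1" using t(1) uvn unfolding safe_def t1 by auto
  show "ttc \<epsilon> V (Read 13 14) t (\<lambda>t'. t' = ?t1)" by (rule ttc_Read[OF t(1) s1]) simp
  fix t' assume "t' = ?t1"
  moreover have ev15: "ev (regs ?t1) 20 (op Add (vr 13) (vr 14)) (u + v)"
    by (rule ev_op[OF ev_reg[OF _ refl] ev_reg[OF _ refl]]) (use t1 uvn in auto)
  moreover have "ttc \<epsilon> V (asg 15 (op Add (vr 13) (vr 14))) ?t1 (\<lambda>t'. L es t' \<and> (regs t' 15 \<noteq> 0 \<longrightarrow> length (stream_in t') < length (stream_in t)))"
  proof (rule ttc_asg[OF s1 ev15])
    fix t2 assume t2: "safe V t2" "\<And>x. x < 20 \<Longrightarrow> regs t2 x = (if x = 15 then u + v else regs ?t1 x)"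
      "stream_in t2 = stream_in ?t1" "stream_out t2 = stream_out ?t1"
    have J2: "J pre t2" "regs t2 4 < b" using t t2 t1 unfolding J_def env_def cur_def by simp_all
    show "L es t2 \<and> (regs t2 15 \<noteq> 0 \<longrightarrow> length (stream_in t2) < length (stream_in t))"
    proof (cases "stream_in t")
      case Nil
      then have "regs t2 15 = 0" "es = pre" using t2(2)[of 15] es unfolding u_def v_def by auto
      then show ?thesis using J2 unfolding L_def by auto
    next
      case (Cons p rest)
      obtain u' v' where p: "p = (u', v')" by (cases p)
      have uv: "u = u'" "v = v'" unfolding u_def v_def Cons p by auto
      have "u \<noteq> v" using edges[of u' v'] es uv unfolding Cons p by auto
      then have "regs t2 15 \<noteq> 0" using t2(2)[of 15] by auto
      moreover have "es = pre @ (regs t2 13, regs t2 14) # stream_in t2" using t2 t1 es uv unfolding Cons p by simp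
      moreover have "length (stream_in t2) < length (stream_in t)" using t2(3) t1(2) unfolding Cons by simp
      ultimately show ?thesis using J2 unfolding L_def by auto
    qed
  qed simp
  ultimately show "ttc \<epsilon> V (asg 15 (op Add (vr 13) (vr 14))) t' (\<lambda>t'. L es t' \<and> (regs t' 15 \<noteq> 0 \<longrightarrow> length (stream_in t') < length (stream_in t)))" by simp
qed

lemma ttc_loop:
  assumes t: "safe V t" "env t" "regs t 2 = 0" "regs t 3 = 0" "regs t 4 = 0" "stream_in t = es" "stream_out t = []"
    and edges: "\<And>u v. (u, v) \<in> set es \<Longrightarrow> u < n \<and> v < n \<and> u \<noteq> v" and len: "length es < V"
  shows "ttc \<epsilon> V loop_com t (J es)"
  unfolding loop_com_def
proof (rule ttc_Seq)
  have "cur t = {}" unfolding cur_def using t codes_0 by simp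
  then have J0: "J [] t" unfolding J_def arcset_def using t codes_0 faithful_empty by (auto intro!: exI[of _ 0])
  show "ttc \<epsilon> V next_com t (\<lambda>t'. L es t' \<and> (regs t' 15 \<noteq> 0 \<longrightarrow> length (stream_in t') < length (stream_in t)))"
    by (rule ttc_next[OF t(1) J0]) (use t b1 edges in auto)
  fix t1 assume t1: "safe V t1" "L es t1 \<and> (regs t1 15 \<noteq> 0 \<longrightarrow> length (stream_in t1) < length (stream_in t))"
  \<comment> \<open>The successor lets the read that meets the end of the stream decrease the
    variant as well.\<close>
  define m where "m t' = (if regs t' 15 = 0 then 0 else Suc (length (stream_in t')))" for t' :: config
  show "ttc \<epsilon> V (WhileNZ 15 (Seq insert_com (Seq reduce_com next_com))) t1 (J es)"
  proof (rule ttc_While[where I = "L es" and m = m])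
    show "L es t1" "safe V t1" using t1 by auto
    show "m t1 \<le> V" using t1(2) t(6) len unfolding m_def by auto
    show "J es t'" if "L es t'" "regs t' 15 = 0" for t' using that unfolding L_def by auto
    fix t2 assume t2: "L es t2" "safe V t2" "regs t2 15 \<noteq> 0"
    then obtain pre where pre: "J pre t2" "regs t2 4 < b" "es = pre @ (regs t2 13, regs t2 14) # stream_in t2" unfolding L_def by auto
    have uv: "regs t2 13 < n" "regs t2 14 < n" "regs t2 13 \<noteq> regs t2 14" using edges[of "regs t2 13" "regs t2 14"] pre(3) by auto
    show "ttc \<epsilon> V (Seq insert_com (Seq reduce_com next_com)) t2 (\<lambda>t'. L es t' \<and> m t' < m t2)"
    proof (rule ttc_Seq[OF ttc_insert[OF t2(2) pre(1,2) uv]])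
      fix t3 assume t3: "safe V t3" "J (pre @ [(regs t2 13, regs t2 14)]) t3 \<and> stream_in t3 = stream_in t2"
      show "ttc \<epsilon> V (Seq reduce_com next_com) t3 (\<lambda>t'. L es t' \<and> m t' < m t2)"
      proof (rule ttc_Seq[OF ttc_reduce[OF t3(1)]])
        show "J (pre @ [(regs t2 13, regs t2 14)]) t3" using t3 by simp
        fix t4 assume t4: "safe V t4" "J (pre @ [(regs t2 13, regs t2 14)]) t4 \<and> regs t4 4 < b \<and> stream_in t4 = stream_in t3"
        have es4: "es = (pre @ [(regs t2 13, regs t2 14)]) @ stream_in t4" using pre(3) t3 t4 by simp
        show "ttc \<epsilon> V next_com t4 (\<lambda>t'. L es t' \<and> m t' < m t2)"
          by (rule ttc_weaken[OF ttc_next[OF t4(1) _ _ es4 edges]]) (use t4 t3 t2(3) in \<open>auto simp: m_def\<close>)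
      qed
    qed
  qed
qed

lemma ttc_out:
  assumes t: "safe V t" "regs t 0 = n" "stream_out t = []"
  shows "ttc \<epsilon> V out_com t (\<lambda>t'. edges_of (stream_out t') = medges n (regs t 16))"
proof -
  define y where "y = regs t 16"
  define O' where "O' j = map (\<lambda>v. (v, fd n y v - 1)) (filter (\<lambda>v. fd n y v \<noteq> 0) [0..<j])" for j
  define I where "I t' \<longleftrightarrow> regs t' 0 = n \<and> regs t' 16 = y \<and> regs t' 4 \<le> n \<and> regs t' 15 = n - regs t' 4 \<and> stream_out t' = O' (regs t' 4)" for t' :: config
  have fin: "edges_of (O' n) = medges n y"
    unfolding O'_def edges_of_def medges_def by (auto simp: image_iff)
  show ?thesis unfolding out_com_def
  proof (rule Seq_asg[OF t(1) ev_const[of 0]])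
    fix t1 assume t1: "safe V t1" "\<And>x. x < 20 \<Longrightarrow> regs t1 x = (if x = 4 then 0 else regs t x)"
      "stream_in t1 = stream_in t" "stream_out t1 = stream_out t"
    have ev15: "ev (regs t1) 20 (vr 0) n" by (rule ev_reg) (use t1 t in auto)
    show "ttc \<epsilon> V (Seq (asg 15 (vr 0)) (WhileNZ 15 (Seq (asg 13 (fdq (vr 0) (vr 16) (vr 4)))
     (Seq (IfNZ 13 (Seq (asg 13 (op Sub (vr 13) (kn 1))) (Emit 4 13)) Skip)
       (Seq (asg 4 (op Add (vr 4) (kn 1))) (asg 15 (op Sub (vr 0) (vr 4)))))))) t1 (\<lambda>t'. edges_of (stream_out t') = medges n (regs t 16))"
    proof (rule Seq_asg[OF t1(1) ev15])
      fix t2 assume t2: "safe V t2" "\<And>x. x < 20 \<Longrightarrow> regs t2 x = (if x = 15 then n else regs t1 x)"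
        "stream_in t2 = stream_in t1" "stream_out t2 = stream_out t1"
      show "ttc \<epsilon> V (WhileNZ 15 (Seq (asg 13 (fdq (vr 0) (vr 16) (vr 4)))
     (Seq (IfNZ 13 (Seq (asg 13 (op Sub (vr 13) (kn 1))) (Emit 4 13)) Skip)
       (Seq (asg 4 (op Add (vr 4) (kn 1))) (asg 15 (op Sub (vr 0) (vr 4))))))) t2 (\<lambda>t'. edges_of (stream_out t') = medges n (regs t 16))"
      proof (rule ttc_While[where I = I and m = "\<lambda>t'. n - regs t' 4"])
        show "I t2" unfolding I_def O'_def y_def using t t1 t2 by simp
        show "safe V t2" by fact
        show "n - regs t2 4 \<le> V" using nV'(1) by simp
        show "edges_of (stream_out t') = medges n (regs t 16)" if "I t'" "regs t' 15 = 0" for t'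
        proof -
          have "regs t' 4 = n" using that unfolding I_def by linarith
          then show ?thesis using that fin unfolding I_def y_def by simp
        qed
        fix t3 assume t3: "I t3" "safe V t3" "regs t3 15 \<noteq> 0"
        define j where "j = regs t3 4"
        have i3: "regs t3 0 = n" "regs t3 16 = y" "j < n" "stream_out t3 = O' j" using t3 unfolding I_def j_def by auto
        have O'S: "O' (Suc j) = O' j @ (if fd n y j \<noteq> 0 then [(j, fd n y j - 1)] else [])" unfolding O'_def by simp
        have ev13: "ev (regs t3) 20 (fdq (vr 0) (vr 16) (vr 4)) (fd n y j)"
          by (intro ev_fdq ev_reg nV'(1)) (use i3 in \<open>auto simp: j_def\<close>)
        show "ttc \<epsilon> V (Seq (asg 13 (fdq (vr 0) (vr 16) (vr 4)))
     (Seq (IfNZ 13 (Seq (asg 13 (op Sub (vr 13) (kn 1))) (Emit 4 13)) Skip)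
       (Seq (asg 4 (op Add (vr 4) (kn 1))) (asg 15 (op Sub (vr 0) (vr 4)))))) t3 (\<lambda>t'. I t' \<and> n - regs t' 4 < n - regs t3 4)"
        proof (rule Seq_asg[OF t3(2) ev13])
          fix t4 assume t4: "safe V t4" "\<And>x. x < 20 \<Longrightarrow> regs t4 x = (if x = 13 then fd n y j else regs t3 x)"
            "stream_in t4 = stream_in t3" "stream_out t4 = stream_out t3"
          let ?R = "\<lambda>t'. (\<forall>x<13. regs t' x = regs t3 x) \<and> regs t' 16 = y \<and> stream_out t' = O' (Suc j)"
          show "ttc \<epsilon> V (Seq (IfNZ 13 (Seq (asg 13 (op Sub (vr 13) (kn 1))) (Emit 4 13)) Skip)
            (Seq (asg 4 (op Add (vr 4) (kn 1))) (asg 15 (op Sub (vr 0) (vr 4))))) t4 (\<lambda>t'. I t' \<and> n - regs t' 4 < n - regs t3 4)"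
          proof (rule ttc_Seq)
            show "ttc \<epsilon> V (IfNZ 13 (Seq (asg 13 (op Sub (vr 13) (kn 1))) (Emit 4 13)) Skip) t4 ?R"
            proof (rule ttc_If[OF t4(1)])
              assume "regs t4 13 = 0"
              then show "ttc \<epsilon> V Skip t4 ?R" using t4 i3 O'S by (intro ttc_Skip) auto
            next
              assume nz: "regs t4 13 \<noteq> 0"
              have ev: "ev (regs t4) 20 (op Sub (vr 13) (kn 1)) (fd n y j - 1)"
                by (rule ev_op[OF ev_reg[OF _ refl] ev_const]) (use t4 V1 in auto)
              show "ttc \<epsilon> V (Seq (asg 13 (op Sub (vr 13) (kn 1))) (Emit 4 13)) t4 ?R"
              proof (rule Seq_asg[OF t4(1) ev])
                fix t5 assume t5: "safe V t5" "\<And>x. x < 20 \<Longrightarrow> regs t5 x = (if x = 13 then fd n y j - 1 else regs t4 x)"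
                  "stream_in t5 = stream_in t4" "stream_out t5 = stream_out t4"
                show "ttc \<epsilon> V (Emit 4 13) t5 ?R"
                  using t5 t4 i3 O'S nz by (intro ttc_Emit) (auto simp: j_def)
              qed simp
            qed
            fix t6 assume t6: "safe V t6" "?R t6"
            have ev4: "ev (regs t6) 20 (op Add (vr 4) (kn 1)) (Suc j)"
              by (rule ev_op[OF ev_reg[OF _ refl] ev_const]) (use t6 V1 i3 nV' in \<open>auto simp: j_def\<close>)
            show "ttc \<epsilon> V (Seq (asg 4 (op Add (vr 4) (kn 1))) (asg 15 (op Sub (vr 0) (vr 4)))) t6 (\<lambda>t'. I t' \<and> n - regs t' 4 < n - regs t3 4)"
            proof (rule Seq_asg[OF t6(1) ev4])
              fix t7 assume t7: "safe V t7" "\<And>x. x < 20 \<Longrightarrow> regs t7 x = (if x = 4 then Suc j else regs t6 x)"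
                "stream_in t7 = stream_in t6" "stream_out t7 = stream_out t6"
              have ev15: "ev (regs t7) 20 (op Sub (vr 0) (vr 4)) (n - Suc j)"
                by (rule ev_op[OF ev_reg[OF _ refl] ev_reg[OF _ refl]]) (use t7 t6 i3 nV' in auto)
              show "ttc \<epsilon> V (asg 15 (op Sub (vr 0) (vr 4))) t7 (\<lambda>t'. I t' \<and> n - regs t' 4 < n - regs t3 4)"
                by (rule ttc_asg[OF t7(1) ev15]) (use t7 t6 i3 in \<open>auto simp: I_def j_def\<close>)
            qed simp
          qed
        qed simp
      qed
    qed simp
  qed simp_all
qed

theorem ttc_core:
  assumes t: "safe V t" "env t" "regs t 2 = 0" "regs t 3 = 0" "regs t 4 = 0" "stream_in t = es" "stream_out t = []"
    and edges: "\<And>u v. (u, v) \<in> set es \<Longrightarrow> u < n \<and> v < n \<and> u \<noteq> v" and len: "length es < V"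
  shows "ttc \<epsilon> V core_com t (\<lambda>t'. \<exists>Z r. faithful \<epsilon> n k s s0 M H X (arcset n es) Z r \<and> r * b \<le> length es \<and>
     matching (gr n Z) (edges_of (stream_out t')) \<and> card (edges_of (stream_out t')) = mu (gr n Z))"
  unfolding core_com_def
proof (rule ttc_Seq[OF ttc_loop[OF t edges len]])
  fix t1 assume t1: "safe V t1" "J es t1"
  have e1: "env t1" "stream_out t1 = []" using t1 unfolding J_def by auto
  obtain r where r: "faithful \<epsilon> n k s s0 M H X (arcset n es) (cur t1) r" "r * b + regs t1 4 \<le> length es" using t1 unfolding J_def by auto
  define \<phi> where "\<phi> y \<longleftrightarrow> bst n (cur t1) y" for y
  obtain y0 where "y0 < (n + 1) ^ n" "\<phi> y0" using bst_exists[OF cur_arcs[OF t1(2)]] unfolding \<phi>_def by blast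
  then have "\<exists>y\<le>V. \<phi> y" using mat by (intro exI[of _ y0]) auto
  then obtain y where y: "\<phi> y" "y \<le> V" "\<And>j. j < y \<Longrightarrow> \<not> \<phi> j" using ev_allq_muq_aux by blast
  have ev16: "ev (regs t1) 20 (muq (\<lambda>y. bstq (vr 0) (vr 11) Zq (vr y))) y"
  proof (rule ev_muq[where \<phi> = \<phi>])
    fix j r \<sigma>' assume h: "j \<le> y" "20 \<le> r" "\<And>y. y < 20 \<Longrightarrow> \<sigma>' y = regs t1 y" "\<sigma>' r = j"
    have V: "ev \<sigma>' (Suc r) (vr y) v" if "y < 20" "regs t1 y = v" for y v by (rule ev_var) (use h that in auto)
    have R: "ev \<sigma>' (Suc r) (vr r) j" by (rule ev_var) (use h in auto)
    have Z: "evs \<sigma>' (Suc r) Zq (n * n) (cur t1)" by (rule evs_mono[OF evs_Zq[OF e1(1)]]) (use h in auto)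
    show "ev \<sigma>' (Suc r) (bstq (vr 0) (vr 11) Zq (vr r)) (of_bool (\<phi> j))" unfolding \<phi>_def
      by (intro ev_bstq Z R nV'(1,2) V) (use e1 in \<open>auto simp: env_def\<close>)
  qed (use y in auto)
  show "ttc \<epsilon> V (Seq (asg 16 (muq (\<lambda>y. bstq (vr 0) (vr 11) Zq (vr y)))) out_com) t1
     (\<lambda>t'. \<exists>Z r. faithful \<epsilon> n k s s0 M H X (arcset n es) Z r \<and> r * b \<le> length es \<and>
     matching (gr n Z) (edges_of (stream_out t')) \<and> card (edges_of (stream_out t')) = mu (gr n Z))"
  proof (rule Seq_asg[OF t1(1) ev16])
    fix t2 assume t2: "safe V t2" "\<And>x. x < 20 \<Longrightarrow> regs t2 x = (if x = 16 then y else regs t1 x)"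
      "stream_in t2 = stream_in t1" "stream_out t2 = stream_out t1"
    have mm: "matching (gr n (cur t1)) (medges n y) \<and> card (medges n y) = mu (gr n (cur t1))"
      using bst_max_matching[OF cur_arcs[OF t1(2)]] y(1) unfolding \<phi>_def by blast
    show "ttc \<epsilon> V out_com t2 (\<lambda>t'. \<exists>Z r. faithful \<epsilon> n k s s0 M H X (arcset n es) Z r \<and> r * b \<le> length es \<and>
     matching (gr n Z) (edges_of (stream_out t')) \<and> card (edges_of (stream_out t')) = mu (gr n Z))"
    proof (rule ttc_weaken[OF ttc_out[OF t2(1)]])
      fix t' assume "edges_of (stream_out t') = medges n (regs t2 16)"
      moreover have "regs t2 16 = y" using t2(2)[of 16] by simp
      ultimately show "\<exists>Z r. faithful \<epsilon> n k s s0 M H X (arcset n es) Z r \<and> r * b \<le> length es \<and>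
        matching (gr n Z) (edges_of (stream_out t')) \<and> card (edges_of (stream_out t')) = mu (gr n Z)"
        using mm r by (intro exI[of _ "cur t1"] exI[of _ r]) auto
    qed (use t2 e1 in \<open>auto simp: env_def\<close>)
  qed simp
qed

end


section \<open>Sizes and errors of the reductions\<close>

lemma covers_mono: "covers L N Q w G \<Longrightarrow> w \<subseteq> w' \<Longrightarrow> covers L N Q w' G"
proof -
  assume c: "covers L N Q w G" and s: "w \<subseteq> w'"
  show ?thesis unfolding covers_def
  proof (intro allI impI)
    fix f assume "(\<forall>v<N. f v \<le> L) \<and> (\<forall>e\<in>w'. \<not> viol f e)"
    then have "(\<forall>v<N. f v \<le> L) \<and> (\<forall>e\<in>w. \<not> viol f e)" using s by blast
    from c[unfolded covers_def, THEN spec[of _ f], THEN mp, OF this]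
    show "\<exists>C. C \<subseteq> {..<N} \<and> card C \<le> Q \<and> (\<forall>e\<in>G. viol f e \<longrightarrow> e \<inter> C \<noteq> {})" .
  qed
qed

lemma kern_mono: "kern n s w G \<Longrightarrow> w \<subseteq> w' \<Longrightarrow> kern n s w' G"
  unfolding kern_def by (meson subsetD)

lemma himg_hv_0: "graph_on V G \<Longrightarrow> himg (hv M H 0) G = G"
  unfolding himg_def hv_def graph_on_def by auto

text \<open>The largest matching size that a tolerance of \<open>Q\<close> permits in
  \<open>cover_exists\<close>, and \<open>1\<close> for \<open>Q < 128\<close>, where all edges are
  kept.\<close>

definition prt :: "nat \<Rightarrow> nat" where
  "prt Q = max 1 (Q div 128)"

definition lcost :: "nat \<Rightarrow> nat \<Rightarrow> real" where
  "lcost N Q = 128 * real (RSn N (prt Q)) * (1 + ln (1 + real N / real (prt Q))) + 1"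

text \<open>\<open>W\<close> is the union of a kernel and of one lifted cover for each level. Both
  properties persist when the set grows, so one set serves all levels at once.\<close>

lemma goodN_exists:
  fixes K :: real
  assumes Z: "Z \<subseteq> arcs n"
    and K: "\<And>i. i \<le> n \<Longrightarrow> level s0 M i \<Longrightarrow> lcost (lev n i) (qq \<epsilon> n k X i) \<le> K"
  shows "\<exists>W\<subseteq>Z. goodN \<epsilon> n k s s0 M H X W Z \<and> real (card W) \<le> 16 * (real s + 1)^2 + card {i. i \<le> n \<and> level s0 M i} * K"
proof -
  let ?Lv = "{i. i \<le> n \<and> level s0 M i}"
  have fLv: "finite ?Lv" by (rule finite_subset[of _ "{..n}"]) auto
  have gZ: "graph_on {..<n} (gr n Z)" by (rule gr_graph_on[OF Z])
  have fZ: "finite (gr n Z)" using graph_on_finite[OF _ gZ] by simp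
  obtain w0 where w0: "w0 \<subseteq> gr n Z" "kern n s w0 (gr n Z)" "card w0 \<le> 16 * (s + 1)^2" using kern_exists[OF gZ] by blast
  have "\<forall>i\<in>?Lv. \<exists>w. w \<subseteq> gr n Z \<and> real (card w) \<le> K \<and> covers n (lev n i) (qq \<epsilon> n k X i) (himg (hv M H i) w) (himg (hv M H i) (gr n Z))"
  proof
    fix i assume i: "i \<in> ?Lv"
    let ?h = "hv M H i" and ?N = "lev n i" and ?Q = "qq \<epsilon> n k X i"
    have "graph_on {..<?N} (himg ?h (gr n Z))" using himg_graph_on[OF gZ, of ?h ?N] hv_less by auto
    from cover_exists_all[OF this, of ?Q n] obtain w' where w': "w' \<subseteq> himg ?h (gr n Z)" "real (card w') \<le> lcost ?N ?Q"
      "covers n ?N ?Q w' (himg ?h (gr n Z))" unfolding lcost_def prt_def by auto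
    obtain w where w: "w \<subseteq> gr n Z" "card w \<le> card w'" "w' \<subseteq> himg ?h w" using himg_preimage[OF fZ w'(1)] by blast
    have "real (card w) \<le> K" using w(2) w'(2) K[of i] i by simp
    then show "\<exists>w. w \<subseteq> gr n Z \<and> real (card w) \<le> K \<and> covers n ?N ?Q (himg ?h w) (himg ?h (gr n Z))"
      using w(1) covers_mono[OF w'(3) w(3)] by blast
  qed
  from bchoice[OF this] obtain wi where wi: "\<forall>i\<in>?Lv. wi i \<subseteq> gr n Z \<and> real (card (wi i)) \<le> K \<and>
    covers n (lev n i) (qq \<epsilon> n k X i) (himg (hv M H i) (wi i)) (himg (hv M H i) (gr n Z))" by (elim exE)
  define w where "w = w0 \<union> (\<Union>i\<in>?Lv. wi i)"
  have wZ: "w \<subseteq> gr n Z" using w0 wi unfolding w_def by blast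
  \<comment> \<open>One arc is selected for each edge, so that \<open>W\<close> is no larger than
    \<open>w\<close>.\<close>
  then obtain W where W: "W \<subseteq> Z" "inj_on (\<lambda>e. {e div n, e mod n}) W" "w = (\<lambda>e. {e div n, e mod n}) ` W"
    unfolding gr_def subset_image_inj by blast
  have grW: "gr n W = w" using W(3) unfolding gr_def by simp
  have "card W = card w" using W(2,3) by (simp add: card_image)
  moreover have "card w \<le> card w0 + card (\<Union>i\<in>?Lv. wi i)" unfolding w_def by (rule card_Un_le)
  moreover have "card (\<Union>i\<in>?Lv. wi i) \<le> (\<Sum>i\<in>?Lv. card (wi i))" by (rule card_UN_le[OF fLv])
  ultimately have "real (card W) \<le> real (card w0) + (\<Sum>i\<in>?Lv. real (card (wi i)))" by (simp flip: of_nat_sum of_nat_add)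
  also have "(\<Sum>i\<in>?Lv. real (card (wi i))) \<le> (\<Sum>i\<in>?Lv. K)" using wi by (intro sum_mono) blast
  also have "real (card w0) \<le> real (16 * (s + 1)^2)" using w0(3) by (rule of_nat_mono)
  finally have c: "real (card W) \<le> 16 * (real s + 1)^2 + card ?Lv * K" by (simp add: add.commute)
  have "goodN \<epsilon> n k s s0 M H X W Z" unfolding goodN_def
  proof (intro conjI allI impI)
    show "e \<in> W \<Longrightarrow> e \<in> Z" for e using W(1) by blast
    show "kernN n s W Z" unfolding kernN_iff[OF Z W(1)] grW by (rule kern_mono[OF w0(2)]) (auto simp: w_def)
    fix i assume i: "i < n + 1" "level s0 M i"
    then have iL: "i \<in> ?Lv" by auto
    have "wi i \<subseteq> w" using iL unfolding w_def by blast
    then have "himg (hv M H i) (wi i) \<subseteq> himg (hv M H i) w" by (rule himg_mono)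
    moreover have "i \<le> n" using i by simp
    ultimately show "coverN n M H i (qq \<epsilon> n k X i) W Z"
      unfolding coverN_iff[OF Z W(1) \<open>i \<le> n\<close>] grW using wi iL covers_mono by blast
  qed
  then show ?thesis using W(1) c by blast
qed

text \<open>\<open>n div N\<close> copies move an RS graph from \<open>N\<close> to \<open>n\<close>
  vertices, with matchings large enough by assumption \<open>a\<close>. The number \<open>x\<close>
  stands for \<open>k / \<epsilon>\<close>; being at least \<open>100\<close>, it absorbs the
  constants under the logarithm.\<close>

lemma lcost_le:
  fixes \<beta> x :: real
  assumes N: "1 \<le> N" "N \<le> n" and \<beta>: "0 < \<beta>" and a: "\<beta> * n \<le> real (n div N) * real (prt Q)"
    and x: "100 \<le> x" "real N / real (prt Q) \<le> 260 * x^2" and R: "1 \<le> RSn n (nat \<lceil>\<beta> * n\<rceil>)"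
  shows "lcost N Q \<le> 1300 * real (RSn n (nat \<lceil>\<beta> * n\<rceil>)) * log 2 x"
proof -
  define a where "a = prt Q"
  define r where "r = nat \<lceil>\<beta> * n\<rceil>"
  have a1: "1 \<le> a" unfolding a_def prt_def by simp
  have m1: "1 \<le> n div N" using N div_le_mono[of N n N] by simp
  have "0 < \<beta> * n" using \<beta> N by simp
  then have r1: "1 \<le> r" unfolding r_def by linarith
  have "\<beta> * n \<le> real (n div N * a)" using a unfolding a_def by simp
  then have "\<lceil>\<beta> * n\<rceil> \<le> int (n div N * a)" by (simp add: ceiling_le_iff)
  then have "r \<le> n div N * a" unfolding r_def by linarith
  moreover have "n div N * N \<le> n" by simp
  ultimately have "n div N * RSn N a \<le> 2 * RSn n r" by (intro RSn_copies[OF a1 r1])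
  moreover have "1 * RSn N a \<le> n div N * RSn N a" by (rule mult_right_mono[OF m1]) simp
  ultimately have "RSn N a \<le> 2 * RSn n r" by linarith
  then have R2: "real (RSn N a) \<le> 2 * real (RSn n r)" by linarith
  have "(2::real) powr 6 \<le> x" using x by simp
  then have lx: "6 \<le> log 2 x" using x by (subst le_log_iff) auto
  have "1 + real N / a \<le> x ^ 4"
  proof -
    have "1 + real N / a \<le> 1 + 260 * x^2" using x(2) unfolding a_def by simp
    also have "\<dots> \<le> 261 * x^2" using x(1) one_le_power[of x 2] by simp
    also have "\<dots> \<le> x^2 * x^2" using mult_mono[of 100 x 100 x] x(1) by (intro mult_right_mono) (auto simp: power2_eq_square)
    finally show ?thesis by (simp add: power2_eq_square power4_eq_xxxx)
  qed
  then have "ln (1 + real N / a) \<le> ln (x ^ 4)" using N a1 by (intro ln_mono) (auto intro: add_pos_nonneg)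
  also have "\<dots> = 4 * ln x" using x(1) by (simp add: ln_realpow)
  also have "ln x \<le> log 2 x"
  proof -
    have "ln 2 \<le> (1 :: real)" using ln_2_less_1 by simp
    then show ?thesis using x(1) by (simp add: log_def le_divide_eq mult_left_le)
  qed
  finally have l: "1 + ln (1 + real N / a) \<le> 5 * log 2 x" using lx by linarith
  have ln0: "0 \<le> ln (1 + real N / a)" using a1 by (intro ln_ge_zero) simp
  have "lcost N Q = 128 * real (RSn N a) * (1 + ln (1 + real N / a)) + 1" unfolding lcost_def a_def ..
  \<comment> \<open>In \<open>128 * 2 * 5 = 1280\<close> the \<open>2\<close> is lost by the copies
    and the \<open>5\<close> by the logarithm; a further \<open>20\<close> absorbs the summand
    \<open>1\<close>.\<close>
  also have "\<dots> \<le> 128 * (2 * real (RSn n r)) * (5 * log 2 x) + 1" using R2 l ln0 by (intro add_right_mono mult_mono) auto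
  also have "\<dots> \<le> 1280 * real (RSn n r) * log 2 x + 20 * (real (RSn n r) * log 2 x)"
  proof -
    have "1 * 1 \<le> real (RSn n r) * log 2 x" using R lx unfolding r_def by (intro mult_mono) auto
    then show ?thesis by simp
  qed
  also have "\<dots> = 1300 * real (RSn n r) * log 2 x" by simp
  finally show ?thesis unfolding r_def .
qed

text \<open>The positive levels are powers of two between \<open>s0\<close> and \<open>n\<close>,
  and \<open>n / s0\<close> is at most the square root of \<open>k\<close>. The RS term of the
  randomized space bound owes a factor \<open>log k\<close> to the number of levels.\<close>

lemma card_levels:
  assumes k: "1 \<le> k" and s0: "1 \<le> s0" "n^2 \<le> k * s0^2" and M: "M = 2 ^ J"
  shows "real (card {i. i \<le> n \<and> level s0 M i}) \<le> 3 * lg k"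
proof -
  define P where "P = {l. s0 \<le> 2 ^ l \<and> 2 ^ l \<le> n}"
  have lP: "l < n" if "l \<in> P" for l using that less_le_trans[OF less_exp[of l], of n] unfolding P_def by auto
  then have fP: "finite P" using finite_subset[of P "{..<n}"] by auto
  have "{i. i \<le> n \<and> level s0 M i} \<subseteq> insert 0 ((^) (2::nat) ` P)"
  proof
    fix i assume "i \<in> {i. i \<le> n \<and> level s0 M i}"
    then have i: "i \<le> n" "i = 0 \<or> s0 \<le> i \<and> M mod i = 0" unfolding level_def by auto
    show "i \<in> insert 0 ((^) (2::nat) ` P)"
    proof (cases "i = 0")
      case False
      then have "i dvd 2 ^ J" "s0 \<le> i" using i(2) M by auto
      then obtain l where "i = 2 ^ l" using divides_primepow_nat[OF two_is_prime_nat] by blast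
      then show ?thesis using i(1) \<open>s0 \<le> i\<close> unfolding P_def by auto
    qed simp
  qed
  then have "card {i. i \<le> n \<and> level s0 M i} \<le> card (insert 0 ((^) (2::nat) ` P))" using fP by (intro card_mono) auto
  also have "\<dots> \<le> Suc (card P)" using card_image_le[OF fP, of "(^) (2::nat)"] fP by (simp add: card_insert_if)
  finally have 1: "card {i. i \<le> n \<and> level s0 M i} \<le> Suc (card P)" .
  have "real (card P) \<le> 1 + lg k"
  proof (cases "P = {}")
    case True
    then show ?thesis unfolding lg_def by simp
  next
    case False
    define u v where "u = Min P" and "v = Max P"
    have uv: "u \<in> P" "v \<in> P" "u \<le> v" unfolding u_def v_def using fP False by (auto intro: Min_le)
    have "P \<subseteq> {u..v}" unfolding u_def v_def using fP by auto
    then have cP: "card P \<le> Suc v - u" using card_mono[of "{u..v}" P] by simp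
    have "s0 * 2 ^ (v - u) \<le> 2 ^ u * 2 ^ (v - u)" using uv(1) unfolding P_def by (intro mult_right_mono) auto
    also have "\<dots> = 2 ^ v" using uv(3) by (simp add: power_add[symmetric])
    also have "\<dots> \<le> n" using uv(2) unfolding P_def by simp
    finally have "(s0 * 2 ^ (v - u))^2 \<le> k * s0^2" using s0(2) power_mono[of "s0 * 2 ^ (v - u)" n 2] by linarith
    then have "(2 ^ (v - u))^2 * s0^2 \<le> k * s0^2" by (simp add: power_mult_distrib mult.commute)
    then have "(2 ^ (v - u))^2 \<le> k" using s0(1) by simp
    moreover have "(2::nat) ^ (v - u) \<le> (2 ^ (v - u))^2" by (simp add: power2_eq_square)
    ultimately have "2 ^ (v - u) \<le> k" by linarith
    then have "real (2 ^ (v - u)) \<le> k" by (rule of_nat_mono)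
    then have "log 2 (2 ^ (v - u)) \<le> log 2 k" using k by (subst log_le_cancel_iff) auto
    then have "real (v - u) \<le> lg k" unfolding lg_def by (simp add: log_nat_power)
    then show ?thesis using cP uv(3) by (simp add: of_nat_diff) 
  qed
  moreover have "1 \<le> lg k" unfolding lg_def by simp
  ultimately show ?thesis using 1 by linarith
qed

section \<open>Number of rounds, rounding errors and the cost of one reduction\<close>

lemma div_ge_half: assumes "0 < d" "d \<le> m" shows "real m / (2 * d) \<le> real (m div d)"
proof -
  have "1 \<le> m div d" using assms div_le_mono[of d m d] by simp
  moreover have "real m / d < real (m div d) + 1"
  proof -
    have "m < (m div d + 1) * d" using dividend_less_div_times[of d m] assms(1) by (simp add: algebra_simps)
    then have "real m < real ((m div d + 1) * d)" by (simp only: of_nat_less_iff)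
    then show ?thesis using assms(1) by (simp add: divide_less_eq algebra_simps)
  qed
  ultimately show ?thesis by (simp add: field_simps)
qed

text \<open>Despite rounding, a buffer holds at least half of \<open>Cb * n\<^sup>2 / k\<close>
  edges, and the stream has at most \<open>n\<^sup>2 / 2\<close> edges; the two halves
  cancel.\<close>

lemma rounds_le:
  fixes n k Cb b r l :: nat
  assumes nk: "1 \<le> k" "k \<le> n" and Cb: "0 < Cb" and b: "b = Cb * (n * n div k)" and r: "r * b \<le> l" "2 * l \<le> n * n"
  shows "real r \<le> k / Cb"
proof -
  have "n * 1 \<le> n * n" using nk by (intro mult_left_mono) auto
  then have kn: "k \<le> n * n" using nk by linarith
  have "real n * n / (2 * k) \<le> real (n * n div k)" using div_ge_half[of k "n * n"] kn nk by simp
  then have "real r * (Cb * (real n * n / (2 * k))) \<le> real r * (Cb * real (n * n div k))" using Cb by (intro mult_left_mono) auto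
  also have "\<dots> = real (r * b)" unfolding b by simp
  also have "\<dots> \<le> real l" using r(1) by (rule of_nat_mono)
  also have "\<dots> \<le> real n * n / 2" using of_nat_mono[OF r(2), where 'a = real] by simp
  finally have "real r * (Cb * (real n * n / (2 * k))) \<le> real n * n / 2" .
  moreover have "0 < real n * n" using nk by simp
  ultimately show ?thesis using nk Cb by (simp add: field_simps)
qed

lemma real_div_le: "real (m div d) \<le> real m / d"
proof (cases "d = 0")
  case False
  have "real (m div d * d) \<le> real m" by (rule of_nat_mono) simp
  then show ?thesis using False by (simp add: le_divide_eq)
qed simp

lemma qq_le:
  assumes "1 \<le> k" "1 \<le> n" "0 < \<epsilon>"
  shows "real (qq \<epsilon> n k X i) \<le> \<epsilon> * (real (lev n i) * X / n) / k"
proof -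
  have "real (qq \<epsilon> n k X i) \<le> real (nat \<lfloor>\<epsilon> * real (lev n i * X div n)\<rfloor>) / k" unfolding qq_def by (rule real_div_le)
  also have "real (nat \<lfloor>\<epsilon> * real (lev n i * X div n)\<rfloor>) \<le> \<epsilon> * real (lev n i * X div n)" using assms(3) by (simp add: of_nat_nat)
  also have "real (lev n i * X div n) \<le> real (lev n i * X) / n" by (rule real_div_le)
  finally show ?thesis using assms by (simp add: divide_right_mono mult_left_mono)
qed

lemma real_div_gt: "0 < d \<Longrightarrow> real m / d - 1 < real (m div d)"
proof -
  assume d: "0 < d"
  have "m < (m div d + 1) * d" using dividend_less_div_times[of d m] d by (simp add: algebra_simps)
  then have "real m < real ((m div d + 1) * d)" by (simp only: of_nat_less_iff)
  then show ?thesis using d by (simp add: field_simps)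
qed

text \<open>Each of the three roundings costs at most one, as \<open>\<epsilon> \<le> 1\<close> and
  \<open>1 \<le> k\<close>.\<close>

lemma qq_ge:
  assumes "1 \<le> k" "1 \<le> n" "0 < \<epsilon>" "\<epsilon> \<le> 1"
  shows "\<epsilon> * (real (lev n i) * X / n) / k - 3 \<le> real (qq \<epsilon> n k X i)"
proof -
  have "\<epsilon> * (real (lev n i) * X / n) - 2 \<le> \<epsilon> * (real (lev n i * X) / n - 1) - 1"
    using assms(4) by (simp add: algebra_simps)
  also have "\<dots> \<le> \<epsilon> * real (lev n i * X div n) - 1"
    using real_div_gt[of n "lev n i * X"] assms by simp
  also have "\<dots> \<le> real (nat \<lfloor>\<epsilon> * real (lev n i * X div n)\<rfloor>)" using assms(3) by linarith
  finally have "(\<epsilon> * (real (lev n i) * X / n) - 2) / k \<le> real (nat \<lfloor>\<epsilon> * real (lev n i * X div n)\<rfloor>) / k"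
    using assms by (intro divide_right_mono) auto
  also have "\<dots> \<le> real (qq \<epsilon> n k X i) + 1" unfolding qq_def using real_div_gt[of k "nat \<lfloor>\<epsilon> * real (lev n i * X div n)\<rfloor>"] assms(1) by linarith
  finally have "\<epsilon> * (real (lev n i) * X / n) / k - 2 / k \<le> real (qq \<epsilon> n k X i) + 1" by (simp add: diff_divide_distrib)
  moreover have "2 / real k \<le> 2" using assms by (simp add: divide_le_eq)
  ultimately show ?thesis by linarith
qed

text \<open>\<open>255 = 128 + 127\<close>: the remainder modulo \<open>128\<close> is absorbed by
  \<open>1 \<le> prt Q\<close>.\<close>

lemma parts_ge: "real Q \<le> 255 * real (prt Q)"
proof -
  have "Q = 128 * (Q div 128) + Q mod 128" by simp
  moreover have "Q mod 128 \<le> 127" using mod_less_divisor[of 128 Q] by linarith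
  ultimately have "Q \<le> 255 * max 1 (Q div 128)" by linarith
  then have "real Q \<le> real (255 * max 1 (Q div 128))" by (rule of_nat_mono)
  then show ?thesis unfolding prt_def by simp
qed

lemma RSn_pos:
  fixes \<beta> :: real
  assumes "2 \<le> n" "0 < \<beta>" "\<beta> \<le> 1 / 4" shows "1 \<le> RSn n (nat \<lceil>\<beta> * n\<rceil>)"
proof -
  define r where "r = nat \<lceil>\<beta> * n\<rceil>"
  have "0 < \<beta> * n" using assms by simp
  then have r1: "1 \<le> r" unfolding r_def by linarith
  have "\<beta> * n \<le> 1 / 4 * n" using assms(3) by (intro mult_right_mono) auto
  then have h: "2 * r \<le> n"
  proof (cases "n < 4")
    case True
    then have "\<beta> * n \<le> 1" using \<open>\<beta> * n \<le> 1 / 4 * n\<close> by simp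
    then have "r \<le> 1" unfolding r_def by linarith
    then show ?thesis using assms(1) by linarith
  next
    case False
    have "real r \<le> \<beta> * n + 1" unfolding r_def using \<open>0 < \<beta> * n\<close> by linarith
    then have "2 * real r \<le> n" using \<open>\<beta> * n \<le> 1 / 4 * n\<close> False by linarith
    then show ?thesis by linarith
  qed
  have "r \<le> RSn n r" by (rule RSn_ge_single[OF r1 h])
  then show ?thesis using r1 unfolding r_def by linarith
qed

text \<open>With \<open>X = 32 * n\<close> the tolerance is about
  \<open>32 * \<epsilon> * n / k\<close>, and the matching size is smaller by a factor of at most
  \<open>258 = 255 + 3\<close>. As \<open>258 / 32 < 16\<close>, it is at least
  \<open>\<epsilon> * n / (16 * k)\<close>.\<close>

lemma lcost_det:
  assumes nk: "1 \<le> k" "k \<le> n" "2 \<le> n" and \<epsilon>: "0 < \<epsilon>" "\<epsilon> < 1 / 100"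
  shows "lcost n (qq \<epsilon> n k (32 * n) 0) \<le> 1300 * real (RS n (\<epsilon> / (16 * real k))) * log 2 (k / \<epsilon>)"
proof -
  let ?Q = "qq \<epsilon> n k (32 * n) 0" and ?\<beta> = "\<epsilon> / (16 * real k)"
  let ?a = "real (prt ?Q)"
  have "\<epsilon> * (real n * (32 * n) / n) / k - 3 \<le> ?Q" using qq_ge[of k n \<epsilon> 0 "32 * n"] nk \<epsilon> unfolding lev_def by simp
  moreover have "\<epsilon> * (real n * (32 * n) / n) / k = 32 * \<epsilon> * n / k" using nk by simp
  ultimately have "32 * \<epsilon> * n / k - 3 \<le> 255 * ?a" using parts_ge[of ?Q] by linarith
  moreover have a1: "1 \<le> ?a" unfolding prt_def by simp
  ultimately have a: "32 * \<epsilon> * n / k \<le> 258 * ?a" by linarith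
  define t where "t = \<epsilon> * n / k"
  have "0 < t" unfolding t_def using nk \<epsilon> by simp
  moreover have "?\<beta> * n = t / 16" unfolding t_def by simp
  moreover have "32 * t \<le> 258 * ?a" using a unfolding t_def by simp
  ultimately have b: "?\<beta> * n \<le> ?a" using a1 by linarith
  have x: "100 \<le> k / \<epsilon>"
  proof -
    have "100 * \<epsilon> \<le> 1" using \<epsilon> by simp
    also have "1 \<le> real k" using nk by simp
    finally show ?thesis using \<epsilon> by (simp add: le_divide_eq)
  qed
  have "real n / ?a \<le> 16 * (k / \<epsilon>)"
  proof -
    have "n * \<epsilon> \<le> 16 * k * ?a" using b nk by (simp add: field_simps)
    moreover have "0 < ?a" using a1 by linarith
    ultimately show ?thesis using \<epsilon> by (simp only: divide_le_eq) (simp add: field_simps)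
  qed
  also have "\<dots> \<le> 260 * (k / \<epsilon>)^2"
  proof -
    have "16 * (k / \<epsilon>) \<le> (260 * (k / \<epsilon>)) * (k / \<epsilon>)" using x by (intro mult_right_mono) auto
    then show ?thesis by (simp add: power2_eq_square)
  qed
  finally have c: "real n / ?a \<le> 260 * (k / \<epsilon>)^2" .
  have \<beta>: "0 < ?\<beta>" "?\<beta> \<le> 1 / 4" using nk \<epsilon> by (auto simp: field_simps)
  show ?thesis unfolding RS_RSn
    by (rule lcost_le[where x = "k / \<epsilon>"]) (use nk \<beta> b c x RSn_pos[OF nk(3) \<beta>] in auto)
qed

text \<open>Origin of \<open>1 / 1000\<close>: the roundings cost a factor
  \<open>259 = 255 + 4\<close> in the matching size, and rounding \<open>n / lev n i\<close> down to
  a whole number of copies a factor \<open>2\<close>, together \<open>518\<close>.\<close>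

lemma lcost_rand:
  assumes nk: "1 \<le> k" "k \<le> n" "2 \<le> n" and \<epsilon>: "0 < \<epsilon>" "\<epsilon> < 1 / 100" and i: "i \<le> n"
  shows "lcost (lev n i) (qq \<epsilon> n k (nat \<lfloor>\<epsilon> * n\<rfloor>) i) \<le> 1300 * real (RS n (1 / 1000 * \<epsilon>^2 / real k)) * log 2 (k / \<epsilon>)"
proof -
  let ?X = "nat \<lfloor>\<epsilon> * n\<rfloor>"
  let ?Q = "qq \<epsilon> n k ?X i" and ?\<beta> = "1 / 1000 * \<epsilon>^2 / real k" and ?N = "lev n i"
  let ?a = "real (prt ?Q)"
  have N: "1 \<le> ?N" "?N \<le> n" using nk i unfolding lev_def by auto
  have X: "\<epsilon> * n - 1 \<le> ?X" using \<epsilon> by linarith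
  have Nn: "real ?N / n \<le> 1" using N nk by simp
  have "\<epsilon>^2 * ?N / k - 1 \<le> \<epsilon> * (real ?N * ?X / n) / k"
  proof -
    have "\<epsilon> * (real ?N * (\<epsilon> * n - 1) / n) \<le> \<epsilon> * (real ?N * ?X / n)"
      using X \<epsilon> by (intro mult_left_mono divide_right_mono) auto
    moreover have "\<epsilon> * (real ?N * (\<epsilon> * n - 1) / n) = \<epsilon>^2 * ?N - \<epsilon> * (real ?N / n)" using nk by (simp add: field_simps power2_eq_square)
    moreover have "\<epsilon> * (real ?N / n) \<le> 1 * 1" using \<epsilon> Nn by (intro mult_mono) auto
    ultimately have "\<epsilon>^2 * ?N - 1 \<le> \<epsilon> * (real ?N * ?X / n)" by linarith
    then have "(\<epsilon>^2 * ?N - 1) / k \<le> \<epsilon> * (real ?N * ?X / n) / k" by (intro divide_right_mono) auto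
    moreover have "1 / real k \<le> 1" using nk by simp
    ultimately show ?thesis by (simp add: diff_divide_distrib)
  qed
  then have "\<epsilon>^2 * ?N / k - 4 \<le> ?Q" using qq_ge[of k n \<epsilon> i ?X] nk \<epsilon> by linarith
  then have "\<epsilon>^2 * ?N / k - 4 \<le> 255 * ?a" using parts_ge[of ?Q] by linarith
  moreover have a1: "1 \<le> ?a" unfolding prt_def by simp
  ultimately have a: "\<epsilon>^2 * ?N / k \<le> 259 * ?a" by linarith
  have a0: "0 < ?a" using a1 by linarith
  have Na: "\<epsilon>^2 * ?N \<le> 259 * real k * ?a" using a nk by (simp add: divide_le_eq mult.commute mult.left_commute)
  have b: "?\<beta> * n \<le> real (n div ?N) * ?a"
  proof -
    have "real n / (2 * ?N) * (\<epsilon>^2 * ?N / k / 259) \<le> real (n div ?N) * ?a"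
      using div_ge_half[of ?N n] N a by (intro mult_mono) auto
    moreover have "real n / (2 * ?N) * (\<epsilon>^2 * ?N / k / 259) = 1 / 518 * (\<epsilon>^2 / k * n)" using N by (simp add: field_simps)
    moreover have "1 / 1000 * (\<epsilon>^2 / k * n) \<le> 1 / 518 * (\<epsilon>^2 / k * n)" by (intro mult_right_mono) auto
    ultimately show ?thesis by simp
  qed
  have x: "100 \<le> k / \<epsilon>"
  proof -
    have "100 * \<epsilon> \<le> 1" using \<epsilon> by simp
    also have "1 \<le> real k" using nk by simp
    finally show ?thesis using \<epsilon> by (simp add: le_divide_eq)
  qed
  have "real ?N / ?a \<le> 259 * real k / \<epsilon>^2"
  proof -
    have "real ?N * \<epsilon>^2 \<le> 259 * real k * ?a" using Na by (simp add: mult.commute)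
    then have "real ?N \<le> 259 * real k * ?a / \<epsilon>^2" using \<epsilon> by (simp add: le_divide_eq)
    then show ?thesis using a0 by (simp add: divide_le_eq)
  qed
  also have "\<dots> \<le> 260 * (k / \<epsilon>)^2"
  proof -
    have "259 * real k \<le> 260 * real k ^ 2" using nk by (intro mult_mono) (auto simp: power2_eq_square)
    then have "259 * real k / \<epsilon>^2 \<le> 260 * real k ^ 2 / \<epsilon>^2" by (rule divide_right_mono) simp
    then show ?thesis by (simp add: power_divide)
  qed
  finally have c: "real ?N / ?a \<le> 260 * (k / \<epsilon>)^2" .
  have "\<epsilon>^2 \<le> 1^2" using \<epsilon> by (intro power_mono) auto
  then have \<beta>: "0 < ?\<beta>" "?\<beta> \<le> 1 / 4" using nk \<epsilon> by (auto simp: field_simps)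
  show ?thesis unfolding RS_RSn
    by (rule lcost_le[where x = "k / \<epsilon>"]) (use nk N \<beta> b c x RSn_pos[OF nk(3) \<beta>] in auto)
qed

text \<open>If \<open>k * k \<le> n\<close> then \<open>n / k\<close> is at least the square root of
  \<open>n\<close>, which dominates \<open>log n\<close>; otherwise \<open>log n\<close> is at most
  \<open>2 * log k\<close>. Multiplied by \<open>n\<close>, the estimate shows that labellings and
  hash functions, of \<open>O(n log n)\<close> bits, fit into the space.\<close>

lemma nlogn_le:
  assumes "1 \<le> k" "k \<le> n" shows "log 2 (real n + 1) \<le> 4 * (real n / k) * lg k"
proof -
  have k0: "0 < real k" "real k \<le> n" using assms by auto
  have lg1: "1 \<le> lg k" "log 2 k \<le> lg k" unfolding lg_def by auto
  have nk: "1 \<le> real n / k" using k0 by simp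
  show ?thesis
  proof (cases "k * k \<le> n")
    case True
    have "ln (real n + 1) = 2 * ln (sqrt (real n + 1))" by (simp add: ln_sqrt)
    also have "\<dots> \<le> 2 * (sqrt (real n + 1) - 1)" by (intro mult_left_mono ln_le_minus_one) auto
    also have "sqrt (real n + 1) \<le> sqrt n + 1" using sqrt_add_le_add_sqrt[of n 1] by simp
    finally have "ln (real n + 1) \<le> 2 * sqrt n" by simp
    moreover have "log 2 (real n + 1) = ln (real n + 1) / ln 2" by (simp add: log_def)
    moreover have "ln (real n + 1) / ln 2 \<le> ln (real n + 1) / (1 / 2)"
      using ln2_ge_two_thirds by (intro divide_left_mono) auto
    ultimately have 1: "log 2 (real n + 1) \<le> 4 * sqrt n" by simp
    have "real k * real k \<le> n" using True by (metis of_nat_le_iff of_nat_mult)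
    then have "real k \<le> sqrt n" by (intro real_le_rsqrt) (simp add: power2_eq_square)
    then have "real k * sqrt n \<le> sqrt n * sqrt n" by (intro mult_right_mono) auto
    then have "sqrt n \<le> real n / k" using k0 by (simp add: le_divide_eq mult.commute)
    then have "4 * sqrt n \<le> 4 * (real n / k) * 1" by simp
    also have "\<dots> \<le> 4 * (real n / k) * lg k" using lg1 k0 by (intro mult_left_mono) auto
    finally show ?thesis using 1 by linarith
  next
    case False
    then have "n + 1 \<le> k * k" by simp
    then have "real (n + 1) \<le> real (k * k)" by (rule of_nat_mono)
    then have "log 2 (real n + 1) \<le> log 2 (real k ^ 2)" by (subst log_le_cancel_iff) (auto simp: power2_eq_square)
    also have "\<dots> = 2 * log 2 k" using k0 by (simp add: log_nat_power)
    also have "\<dots> \<le> 4 * 1 * lg k" using lg1 by linarith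
    also have "\<dots> \<le> 4 * (real n / k) * lg k" using nk lg1 by (intro mult_right_mono) auto
    finally show ?thesis .
  qed
qed

text \<open>Markov's inequality for \<open>2 ^ card (bad (hv M H i) W)\<close>. Since
  \<open>i \<ge> 32 * m / \<epsilon>\<close>, the average of this power over all seeds is at most
  \<open>exp (\<epsilon> * m / 8)\<close>.\<close>

lemma hash_failure:
  assumes W: "finite W" "W \<subseteq> {..<n}" "card W = 2 * m" and \<epsilon>: "0 < \<epsilon>" "\<epsilon> \<le> 1"
    and i: "0 < i" "i dvd M" "0 < M" "32 * m / \<epsilon> \<le> i"
  shows "real (card {H. H < M ^ n \<and> \<epsilon> * m / 2 < card (bad (hv M H i) W)}) \<le> exp (- (\<epsilon> * m / 5)) * M ^ n"
proof -
  let ?B = "{H. H < M ^ n \<and> \<epsilon> * m / 2 < card (bad (hv M H i) W)}"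
  have Wn: "W \<inter> {..<n} = W" using W by auto
  have hv: "hv M H i = (\<lambda>v. dg M H v mod i)" for H unfolding hv_def using i by auto
  have "real (card ?B) * 2 powr (\<epsilon> * m / 2) = (\<Sum>H\<in>?B. 2 powr (\<epsilon> * m / 2))" by simp
  also have "\<dots> \<le> (\<Sum>H\<in>?B. 2 ^ card (bad (hv M H i) W))"
    by (intro sum_mono) (auto simp: powr_realpow[symmetric])
  also have "\<dots> \<le> (\<Sum>H<M ^ n. 2 ^ card (bad (hv M H i) W))" by (intro sum_mono2) auto
  also have "\<dots> \<le> real (M ^ n) * (1 + card W / i) ^ card W"
    using hash_bad_moment[OF W(1) i(2,1,3), of n] unfolding Wn hv .
  also have "(1 + card W / i) ^ card W \<le> exp (card W / i) ^ card W"
    by (intro power_mono) (use i in \<open>auto intro: add_nonneg_nonneg\<close>)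
  also have "\<dots> = exp (real (card W) * (card W / i))" by (rule exp_of_nat_mult[symmetric])
  also have "real (card W) * (card W / i) \<le> \<epsilon> * m / 8"
  proof -
    have "32 * real m \<le> i * \<epsilon>" using i \<epsilon> by (simp add: divide_le_eq)
    then have "32 * real m * m \<le> i * \<epsilon> * m" by (intro mult_right_mono) auto
    then have "4 * real m * m / i \<le> \<epsilon> * m / 8" using i(1) by (simp add: field_simps)
    then show ?thesis unfolding W(3) by (simp add: field_simps)
  qed
  finally have 1: "real (card ?B) * 2 powr (\<epsilon> * m / 2) \<le> real (M ^ n) * exp (\<epsilon> * m / 8)" by (simp add: mult_left_mono)
  have "exp (\<epsilon> * m / 8) \<le> exp (- (\<epsilon> * m / 5)) * 2 powr (\<epsilon> * m / 2)"
  proof -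
    \<comment> \<open>\<open>13 / 40 = 1 / 8 + 1 / 5\<close>, and \<open>ln 2 / 2\<close> is at
      least \<open>1 / 3\<close>.\<close>
    have "\<epsilon> * m * (13 / 40) \<le> \<epsilon> * m * (ln 2 / 2)" using ln2_ge_two_thirds \<epsilon> by (intro mult_left_mono) auto
    then have "\<epsilon> * m / 8 \<le> - (\<epsilon> * m / 5) + \<epsilon> * m / 2 * ln 2" by (simp add: field_simps)
    then show ?thesis unfolding powr_def by (simp add: exp_add[symmetric])
  qed
  then have "real (card ?B) * 2 powr (\<epsilon> * m / 2) \<le> real (M ^ n) * (exp (- (\<epsilon> * m / 5)) * 2 powr (\<epsilon> * m / 2))"
    using 1 by (smt (verit) mult_left_mono of_nat_0_le_iff)
  then have "real (card ?B) * 2 powr (\<epsilon> * m / 2) \<le> (real (M ^ n) * exp (- (\<epsilon> * m / 5))) * 2 powr (\<epsilon> * m / 2)" by (simp add: mult.assoc)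
  then have "real (card ?B) \<le> real (M ^ n) * exp (- (\<epsilon> * m / 5))"
    by (rule mult_right_le_imp_le) simp
  then show ?thesis by (simp add: mult.commute)
qed


section \<open>The two algorithms\<close>

definition powq :: "expr \<Rightarrow> expr" where
  "powq e = itr e (kn 1) (\<lambda>x a. op Mul (vr a) (kn 2))"

text \<open>The type \<open>expr\<close> is used only as \<open>nat \<Rightarrow> com\<close> here:
  the argument is a constant of the program, the buffer factor, and not a register level.\<close>

definition base_com :: "expr" where
  "base_com Cb = Seq (asg 12 (op Mul (vr 0) (vr 0)))
    (Seq (asg 11 (itr (vr 0) (kn 1) (\<lambda>x a. op Mul (vr a) (op Add (vr 0) (kn 1)))))
      (asg 5 (op Mul (kn Cb) (op Quo (vr 12) (vr 1)))))"

text \<open>The threshold \<open>n + 1\<close> switches off all hashed levels. Registers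
  \<open>6\<close>, \<open>8\<close> and \<open>9\<close> keep their initial zeros, that is,
  \<open>s = 0\<close> and a trivial hash function.\<close>

definition det_com :: com where
  "det_com = Seq (base_com 32) (Seq (asg 7 (op Add (vr 0) (kn 1))) (Seq (asg 10 (op Mul (kn 32) (vr 0))) core_com))"

text \<open>Register \<open>17\<close> receives the bit length of \<open>k\<close>, \<open>6\<close>
  and \<open>7\<close> the kernel size, a square root found by search, \<open>8\<close> a power of
  two above \<open>n\<close> as the base of the hash digits, and \<open>19\<close> the number of
  coins to toss.\<close>

definition param_com :: "expr" where
  "param_com Cs = Seq (asg 10 (fl (vr 0)))
    (Seq (asg 17 (muq (\<lambda>L. ng (le (powq (vr L)) (vr 1)))))
    (Seq (asg 6 (muq (\<lambda>s. le (op Mul (op Mul (kn Cs) (vr 12)) (vr 17)) (op Mul (op Mul (vr 1) (vr s)) (vr s)))))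
    (Seq (asg 7 (vr 6))
    (Seq (asg 18 (muq (\<lambda>J. ng (le (powq (vr J)) (vr 0)))))
    (Seq (asg 8 (powq (vr 18))) (asg 19 (op Mul (vr 0) (vr 18))))))))"

definition flip_com :: com where
  "flip_com = Seq (Flip 15) (Seq (Op Add 9 9 9) (Seq (Op Add 9 9 15) (Seq (Const 15 1) (Op Sub 19 19 15))))"

definition rand_com :: "expr" where
  "rand_com Cs = Seq (Seq (base_com 128) (param_com Cs)) (Seq (WhileNZ 19 flip_com) core_com)"

definition bits :: "nat \<Rightarrow> nat" where
  "bits k = (LEAST L. k < 2 ^ L)"

text \<open>Of order \<open>n * sqrt (Cs * log k / k)\<close>. The kernel has about the square of
  this many edges, which fits into the space, and beyond this size the failure bound for hashing is
  small enough.\<close>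

definition svl :: "nat \<Rightarrow> nat \<Rightarrow> nat \<Rightarrow> nat" where
  "svl Cs n k = (LEAST s. Cs * (n * n) * bits k \<le> k * s * s)"

lemma bits: "k < 2 ^ bits k" "j < bits k \<Longrightarrow> 2 ^ j \<le> k" "bits k \<le> k" "1 \<le> k \<Longrightarrow> 2 ^ bits k \<le> 2 * k" "1 \<le> k \<Longrightarrow> 1 \<le> bits k"
proof -
  show a: "k < 2 ^ bits k" unfolding bits_def by (rule LeastI[of _ k]) (rule less_exp)
  show b: "j < bits k \<Longrightarrow> 2 ^ j \<le> k" for j using not_less_Least[of j "\<lambda>L. k < 2 ^ L"] unfolding bits_def by simp
  show "bits k \<le> k" unfolding bits_def by (rule Least_le) (rule less_exp)
  show c: "1 \<le> bits k" if "1 \<le> k" using a that by (cases "bits k") auto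
  show "2 ^ bits k \<le> 2 * k" if "1 \<le> k" using b[of "bits k - 1"] c[OF that] by (cases "bits k") auto
qed

lemma svl:
  assumes "1 \<le> k"
  shows "Cs * (n * n) * bits k \<le> k * svl Cs n k * svl Cs n k" "j < svl Cs n k \<Longrightarrow> k * j * j < Cs * (n * n) * bits k"
    "svl Cs n k \<le> Cs * (n * n) * bits k"
proof -
  let ?A = "Cs * (n * n) * bits k"
  have A: "?A \<le> k * ?A * ?A"
  proof (cases "?A = 0")
    case False
    then have "1 * 1 \<le> k * ?A" using assms by (intro mult_mono) auto
    then show ?thesis using mult_right_mono[of 1 "k * ?A" ?A] by simp
  qed (simp only: le0)
  show "?A \<le> k * svl Cs n k * svl Cs n k" unfolding svl_def by (rule LeastI[of _ ?A]) (rule A)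
  show "j < svl Cs n k \<Longrightarrow> k * j * j < ?A" for j
    using not_less_Least[of j "\<lambda>s. ?A \<le> k * s * s"] unfolding svl_def by (simp add: not_le)
  show "svl Cs n k \<le> ?A" unfolding svl_def by (rule Least_le) (rule A)
qed

definition same :: "config \<Rightarrow> config \<Rightarrow> bool" where
  "same t t' \<longleftrightarrow> (\<forall>x<20. x \<notin> {9, 15, 19} \<longrightarrow> regs t' x = regs t x) \<and> stream_in t' = stream_in t \<and> stream_out t' = stream_out t"

section \<open>Initialization and coin tosses\<close>

context machine
begin

lemma ev_powq:
  assumes e: "ev \<sigma> d e v" and V: "2 ^ v \<le> V" shows "ev \<sigma> d (powq e) (2 ^ v)"
  unfolding powq_def
proof (rule ev_itr[OF e, where acc = "\<lambda>j. (2::nat) ^ j"])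
  show "ev \<sigma> d (kn 1) (2 ^ 0)" using ev_const[OF V1] by simp
  fix j r a and \<sigma>' :: "nat \<Rightarrow> nat" assume h: "j < v" "d \<le> a" "r = Suc a" "\<sigma>' a = 2 ^ j"
  have le: "(2::nat) ^ Suc j \<le> V" using h(1) V power_increasing[of "Suc j" v "2::nat"] by linarith
  moreover have "(2::nat) \<le> 2 ^ Suc j" by simp
  ultimately have "2 \<le> V" by linarith
  then show "ev \<sigma>' (Suc r) (op Mul (vr a) (kn 2)) (2 ^ Suc j)"
    by (intro ev_op[OF ev_var[of a _ _ "2 ^ j"] ev_const]) (use h le in auto)
qed simp

lemma ttc_base:
  assumes t: "safe V t" "regs t 0 = n" "regs t 1 = k" and le: "n * n \<le> V" "(n + 1) ^ n \<le> V" "Cb \<le> V" "Cb * (n * n) \<le> V" "n < V"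
  shows "ttc \<epsilon> V (base_com Cb) t (\<lambda>t'. (\<forall>x<20. regs t' x = (if x = 12 then n * n else if x = 11 then (n + 1) ^ n
    else if x = 5 then Cb * (n * n div k) else regs t x)) \<and> stream_in t' = stream_in t \<and> stream_out t' = stream_out t)" (is "ttc _ _ _ _ ?Q")
  unfolding base_com_def
proof (rule Seq_asg[OF t(1)])
  show "ev (regs t) 20 (op Mul (vr 0) (vr 0)) (n * n)"
    by (rule ev_op[OF ev_reg[OF _ t(2)] ev_reg[OF _ t(2)]]) (use le in auto)
  fix t1 assume t1: "safe V t1" "\<And>x. x < 20 \<Longrightarrow> regs t1 x = (if x = 12 then n * n else regs t x)"
      "stream_in t1 = stream_in t" "stream_out t1 = stream_out t"
  have n1: "regs t1 0 = n" "regs t1 1 = k" using t1 t by auto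
  show "ttc \<epsilon> V (Seq (asg 11 (itr (vr 0) (kn 1) (\<lambda>x a. op Mul (vr a) (op Add (vr 0) (kn 1)))))
      (asg 5 (op Mul (kn Cb) (op Quo (vr 12) (vr 1))))) t1 ?Q"
  proof (rule Seq_asg[OF t1(1)])
    show "ev (regs t1) 20 (itr (vr 0) (kn 1) (\<lambda>x a. op Mul (vr a) (op Add (vr 0) (kn 1)))) ((n + 1) ^ n)"
    proof (rule ev_itr[OF ev_reg[OF _ n1(1)], where acc = "\<lambda>j. (n + 1) ^ j"])
      show "ev (regs t1) 20 (kn 1) ((n + 1) ^ 0)" using ev_const[OF V1] by simp
      fix j r a \<sigma>' assume h: "j < n" "20 \<le> a" "r = Suc a" "\<And>y. y < 20 \<Longrightarrow> \<sigma>' y = regs t1 y" "\<sigma>' a = (n + 1) ^ j"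
      have "(n + 1) ^ Suc j \<le> (n + 1) ^ n" using h(1) by (intro power_increasing) auto
      then have "(n + 1) ^ j * (n + 1) \<le> V" using le(2) by (simp add: mult.commute)
      then show "ev \<sigma>' (Suc r) (op Mul (vr a) (op Add (vr 0) (kn 1))) ((n + 1) ^ Suc j)"
        by (intro ev_op[OF ev_var[of a _ _ "(n + 1) ^ j"] ev_op[OF ev_var[of 0 _ _ n] ev_const _ refl]])
          (use h n1 V1 le in \<open>auto simp: mult.commute\<close>)
    qed simp_all
    fix t2 assume t2: "safe V t2" "\<And>x. x < 20 \<Longrightarrow> regs t2 x = (if x = 11 then (n + 1) ^ n else regs t1 x)"
      "stream_in t2 = stream_in t1" "stream_out t2 = stream_out t1"
    have n2: "regs t2 12 = n * n" "regs t2 1 = k" using t1 t2 n1 by auto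
    show "ttc \<epsilon> V (asg 5 (op Mul (kn Cb) (op Quo (vr 12) (vr 1)))) t2 ?Q"
    proof (rule ttc_asg[OF t2(1)])
      have "Cb * (n * n div k) \<le> Cb * (n * n)" by (intro mult_left_mono) auto
      then have c: "Cb * (n * n div k) \<le> V" using le(4) by linarith
      then show "ev (regs t2) 20 (op Mul (kn Cb) (op Quo (vr 12) (vr 1))) (Cb * (n * n div k))"
        by (intro ev_op[OF ev_const ev_op[OF ev_reg[OF _ n2(1)] ev_reg[OF _ n2(2)] _ refl]])
          (use le c in \<open>auto intro: le_trans[OF div_le_dividend]\<close>)
    qed (use t1 t2 in auto)
  qed simp
qed simp

lemma ttc_param:
  assumes t: "safe V t" "regs t 0 = n" "regs t 1 = k" "regs t 12 = n * n" and nk: "1 \<le> k" "1 \<le> n"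
    and le: "2 * k \<le> V" "2 * n \<le> V" "Cs \<le> V" "Cs * (n * n) \<le> V" "Cs * (n * n) * bits k \<le> V"
      "k * svl Cs n k * svl Cs n k \<le> V" "n * bits n \<le> V"
  shows "ttc \<epsilon> V (param_com Cs) t (\<lambda>t'. (\<forall>x<17. regs t' x = (if x = 10 then nat \<lfloor>\<epsilon> * n\<rfloor> else if x = 6 then svl Cs n k
    else if x = 7 then svl Cs n k else if x = 8 then 2 ^ bits n else regs t x)) \<and> regs t' 19 = n * bits n \<and>
    stream_in t' = stream_in t \<and> stream_out t' = stream_out t)" (is "ttc _ _ _ _ ?Q")
proof -
  have pk: "2 ^ j \<le> V" if "j \<le> bits k" for j
    using power_increasing[OF that, of "2::nat"] bits(4)[OF nk(1)] le(1) by linarith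
  have pn: "2 ^ j \<le> V" if "j \<le> bits n" for j
    using power_increasing[OF that, of "2::nat"] bits(4)[OF nk(2)] le(2) by linarith
  show ?thesis unfolding param_com_def
  proof (rule Seq_asg[OF t(1) ev_fl[OF ev_reg[OF _ t(2)] refl]])
    fix t1 assume t1: "safe V t1" "\<And>x. x < 20 \<Longrightarrow> regs t1 x = (if x = 10 then nat \<lfloor>\<epsilon> * n\<rfloor> else regs t x)"
      "stream_in t1 = stream_in t" "stream_out t1 = stream_out t"
    have e17: "ev (regs t1) 20 (muq (\<lambda>L. ng (le (powq (vr L)) (vr 1)))) (bits k)"
    proof (rule ev_muq[where \<phi> = "\<lambda>L. \<not> 2 ^ L \<le> k"])
      fix j r \<sigma>' assume h: "j \<le> bits k" "20 \<le> r" "\<And>y. y < 20 \<Longrightarrow> \<sigma>' y = regs t1 y" "\<sigma>' r = j"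
      show "ev \<sigma>' (Suc r) (ng (le (powq (vr r)) (vr 1))) (of_bool (\<not> 2 ^ j \<le> k))"
        by (intro ev_ng ev_le ev_powq ev_var pk) (use h t1 t in auto)
    qed (use bits(1,3)[of k] bits(2)[of _ k] le(1) in auto)
    show "ttc \<epsilon> V (Seq (asg 17 (muq (\<lambda>L. ng (le (powq (vr L)) (vr 1)))))
      (Seq (asg 6 (muq (\<lambda>s. le (op Mul (op Mul (kn Cs) (vr 12)) (vr 17)) (op Mul (op Mul (vr 1) (vr s)) (vr s)))))
      (Seq (asg 7 (vr 6)) (Seq (asg 18 (muq (\<lambda>J. ng (le (powq (vr J)) (vr 0)))))
      (Seq (asg 8 (powq (vr 18))) (asg 19 (op Mul (vr 0) (vr 18)))))))) t1 ?Q"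
    proof (rule Seq_asg[OF t1(1) e17])
      fix t2 assume t2: "safe V t2" "\<And>x. x < 20 \<Longrightarrow> regs t2 x = (if x = 17 then bits k else regs t1 x)"
        "stream_in t2 = stream_in t1" "stream_out t2 = stream_out t1"
      have e6: "ev (regs t2) 20 (muq (\<lambda>s. le (op Mul (op Mul (kn Cs) (vr 12)) (vr 17)) (op Mul (op Mul (vr 1) (vr s)) (vr s)))) (svl Cs n k)"
      proof (rule ev_muq[where \<phi> = "\<lambda>s. Cs * (n * n) * bits k \<le> k * s * s"])
        fix j r \<sigma>' assume h: "j \<le> svl Cs n k" "20 \<le> r" "\<And>y. y < 20 \<Longrightarrow> \<sigma>' y = regs t2 y" "\<sigma>' r = j"
        have "k * j * j \<le> k * svl Cs n k * svl Cs n k" using h(1) by (intro mult_mono) auto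
        then have kj: "k * j * j \<le> V" using le(6) by linarith
        have kj': "k * j \<le> V"
        proof (cases "j = 0")
          case False
          then have "k * j * 1 \<le> k * j * j" by (intro mult_left_mono) auto
          then show ?thesis using kj by linarith
        qed simp
        have v: "ev \<sigma>' (Suc r) (vr 12) (n * n)" "ev \<sigma>' (Suc r) (vr 17) (bits k)" "ev \<sigma>' (Suc r) (vr 1) k" "ev \<sigma>' (Suc r) (vr r) j"
          using h t2 t1 t by (auto intro!: ev_var)
        show "ev \<sigma>' (Suc r) (le (op Mul (op Mul (kn Cs) (vr 12)) (vr 17)) (op Mul (op Mul (vr 1) (vr r)) (vr r))) (of_bool (Cs * (n * n) * bits k \<le> k * j * j))"
          by (intro ev_le ev_op[OF ev_op[OF ev_const v(1) _ refl] v(2)] ev_op[OF ev_op[OF v(3,4) _ refl] v(4)])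
            (use le kj kj' in auto)
      next
        have "svl Cs n k \<le> V" using svl(3)[OF nk(1), of Cs n] le(5) by linarith
        then show "svl Cs n k \<le> V" .
        show "Cs * (n * n) * bits k \<le> k * svl Cs n k * svl Cs n k" by (rule svl(1)[OF nk(1)])
        show "\<not> Cs * (n * n) * bits k \<le> k * j * j" if "j < svl Cs n k" for j using svl(2)[OF nk(1) that] by simp
      qed
      show "ttc \<epsilon> V (Seq (asg 6 (muq (\<lambda>s. le (op Mul (op Mul (kn Cs) (vr 12)) (vr 17)) (op Mul (op Mul (vr 1) (vr s)) (vr s)))))
        (Seq (asg 7 (vr 6)) (Seq (asg 18 (muq (\<lambda>J. ng (le (powq (vr J)) (vr 0)))))
        (Seq (asg 8 (powq (vr 18))) (asg 19 (op Mul (vr 0) (vr 18))))))) t2 ?Q"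
      proof (rule Seq_asg[OF t2(1) e6])
        fix t3 assume t3: "safe V t3" "\<And>x. x < 20 \<Longrightarrow> regs t3 x = (if x = 6 then svl Cs n k else regs t2 x)"
          "stream_in t3 = stream_in t2" "stream_out t3 = stream_out t2"
        have e7: "ev (regs t3) 20 (vr 6) (svl Cs n k)" by (rule ev_reg) (use t3 in auto)
        show "ttc \<epsilon> V (Seq (asg 7 (vr 6)) (Seq (asg 18 (muq (\<lambda>J. ng (le (powq (vr J)) (vr 0)))))
          (Seq (asg 8 (powq (vr 18))) (asg 19 (op Mul (vr 0) (vr 18)))))) t3 ?Q"
        proof (rule Seq_asg[OF t3(1) e7])
          fix t4 assume t4: "safe V t4" "\<And>x. x < 20 \<Longrightarrow> regs t4 x = (if x = 7 then svl Cs n k else regs t3 x)"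
            "stream_in t4 = stream_in t3" "stream_out t4 = stream_out t3"
          have e18: "ev (regs t4) 20 (muq (\<lambda>L. ng (le (powq (vr L)) (vr 0)))) (bits n)"
          proof (rule ev_muq[where \<phi> = "\<lambda>L. \<not> 2 ^ L \<le> n"])
            fix j r \<sigma>' assume h: "j \<le> bits n" "20 \<le> r" "\<And>y. y < 20 \<Longrightarrow> \<sigma>' y = regs t4 y" "\<sigma>' r = j"
            show "ev \<sigma>' (Suc r) (ng (le (powq (vr r)) (vr 0))) (of_bool (\<not> 2 ^ j \<le> n))"
              by (intro ev_ng ev_le ev_powq ev_var pn) (use h t4 t3 t2 t1 t in auto)
          qed (use bits(1,3)[of n] bits(2)[of _ n] le(2) in auto)
          show "ttc \<epsilon> V (Seq (asg 18 (muq (\<lambda>J. ng (le (powq (vr J)) (vr 0)))))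
            (Seq (asg 8 (powq (vr 18))) (asg 19 (op Mul (vr 0) (vr 18))))) t4 ?Q"
          proof (rule Seq_asg[OF t4(1) e18])
            fix t5 assume t5: "safe V t5" "\<And>x. x < 20 \<Longrightarrow> regs t5 x = (if x = 18 then bits n else regs t4 x)"
              "stream_in t5 = stream_in t4" "stream_out t5 = stream_out t4"
            have e8: "ev (regs t5) 20 (powq (vr 18)) (2 ^ bits n)"
              by (intro ev_powq ev_reg pn) (use t5 in auto)
            show "ttc \<epsilon> V (Seq (asg 8 (powq (vr 18))) (asg 19 (op Mul (vr 0) (vr 18)))) t5 ?Q"
            proof (rule Seq_asg[OF t5(1) e8])
              fix t6 assume t6: "safe V t6" "\<And>x. x < 20 \<Longrightarrow> regs t6 x = (if x = 8 then 2 ^ bits n else regs t5 x)"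
                "stream_in t6 = stream_in t5" "stream_out t6 = stream_out t5"
              have r6: "regs t6 0 = n" "regs t6 18 = bits n" using t1 t2 t3 t4 t5 t6 t by auto
              have e19: "ev (regs t6) 20 (op Mul (vr 0) (vr 18)) (n * bits n)"
                by (rule ev_op[OF ev_reg[OF _ r6(1)] ev_reg[OF _ r6(2)]]) (use le in auto)
              show "ttc \<epsilon> V (asg 19 (op Mul (vr 0) (vr 18))) t6 ?Q"
              proof (rule ttc_asg[OF t6(1) e19])
                fix t7 assume t7: "safe V t7" "\<And>x. x < 20 \<Longrightarrow> regs t7 x = (if x = 19 then n * bits n else regs t6 x)"
                  "stream_in t7 = stream_in t6" "stream_out t7 = stream_out t6"
                show "?Q t7" using t1(2-) t2(2-) t3(2-) t4(2-) t5(2-) t6(2-) t7(2-) by simp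
              qed simp
            qed simp
          qed simp
        qed simp
      qed simp
    qed simp
  qed simp_all
qed

lemma ttc_flips:
  assumes t: "safe V t" "regs t 9 = 0" "regs t 19 = m" and le: "2 ^ m \<le> V"
  shows "ttc \<epsilon> V (WhileNZ 19 flip_com) t (\<lambda>t'. same t t' \<and> regs t' 9 < 2 ^ m)"
proof -
  define I where "I t' \<longleftrightarrow> same t t' \<and> regs t' 19 \<le> m \<and> regs t' 9 < 2 ^ (m - regs t' 19)" for t'
  show ?thesis
  proof (rule ttc_While[where I = I and m = "\<lambda>t'. regs t' 19"])
    show "I t" unfolding I_def same_def using t by simp
    show "safe V t" "regs t 19 \<le> V" using t safe_le by auto
    show "same t t' \<and> regs t' 9 < 2 ^ m" if "I t'" "regs t' 19 = 0" for t' using that unfolding I_def by simp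
    fix t1 assume t1: "I t1" "safe V t1" "regs t1 19 \<noteq> 0"
    define j where "j = regs t1 19 - 1"
    have j: "regs t1 19 = Suc j" "Suc j \<le> m" using t1 unfolding I_def j_def by auto
    have h: "regs t1 9 < 2 ^ (m - Suc j)" using t1(1) unfolding I_def j by simp
    have p: "2 ^ (m - j) = 2 * (2::nat) ^ (m - Suc j)" using j(2) by (simp add: Suc_diff_Suc flip: power_Suc)
    have "(2::nat) ^ (m - j) \<le> 2 ^ m" by (intro power_increasing) auto
    then have hV: "2 * regs t1 9 + 1 < V \<or> 2 * regs t1 9 + 1 \<le> V" "2 * regs t1 9 + 2 \<le> 2 ^ (m - j)" using h p le by linarith+
    show "ttc \<epsilon> V flip_com t1 (\<lambda>t'. I t' \<and> regs t' 19 < regs t1 19)" unfolding flip_com_def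
    proof (rule ttc_Seq[of _ _ _ _ "\<lambda>t'. \<exists>b. t' = set_reg 15 (of_bool b) t1"])
      show "ttc \<epsilon> V (Flip 15) t1 (\<lambda>t'. \<exists>b. t' = set_reg 15 (of_bool b) t1)" by (rule ttc_Flip[OF t1(2) V1]) blast
      fix t2 assume t2: "safe V t2" "\<exists>b. t2 = set_reg 15 (of_bool b) t1"
      then obtain b where b: "t2 = set_reg 15 (of_bool b) t1" by blast
      have ob: "of_bool b \<le> (1::nat)" by simp
      have "2 * regs t1 9 + of_bool b < 2 ^ (m - j)" using hV(2) ob by linarith
      moreover have "2 * regs t1 9 \<le> V" "2 * regs t1 9 + of_bool b \<le> V" using hV(1) ob by linarith+
      moreover have "j \<le> V" using safe_le[OF t1(2), of 19] j by simp
      ultimately show "ttc \<epsilon> V (Seq (Op Add 9 9 9) (Seq (Op Add 9 9 15) (Seq (Const 15 1) (Op Sub 19 19 15)))) t2 (\<lambda>t'. I t' \<and> regs t' 19 < regs t1 19)"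
        using t1(1) j V1 t2(1) unfolding b I_def same_def
        by (intro Seq_Op Seq_Const ttc_Op) (auto simp: mult_2[symmetric])
    qed
  qed
qed

end

section \<open>Success probabilities of runs\<close>

lemma prob_bind:
  "measure_pmf.prob (bind_pmf M f) A = (\<integral>y. measure_pmf.prob (f y) A \<partial>measure_pmf M)"
proof -
  have int: "integrable (measure_pmf M) (\<lambda>y. measure_pmf.prob (f y) A)"
    by (rule measure_pmf.integrable_const_bound[where B = 1]) auto
  have "ennreal (measure_pmf.prob (bind_pmf M f) A) = (\<integral>\<^sup>+y. ennreal (measure_pmf.prob (f y) A) \<partial>measure_pmf M)"
    unfolding measure_pmf.emeasure_eq_measure[symmetric] by simp
  also have "\<dots> = ennreal (\<integral>y. measure_pmf.prob (f y) A \<partial>measure_pmf M)"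
    by (rule nn_integral_eq_integral[OF int]) simp
  finally show ?thesis by (subst (asm) ennreal_inj) (auto intro: integral_nonneg_AE)
qed

lemma prob_bind_ge:
  assumes "\<And>y. y \<in> set_pmf M \<Longrightarrow> x \<le> measure_pmf.prob (f y) A"
  shows "x \<le> measure_pmf.prob (bind_pmf M f) A"
  unfolding prob_bind
proof (rule measure_pmf.integral_ge_const)
  show "integrable (measure_pmf M) (\<lambda>y. measure_pmf.prob (f y) A)"
    by (rule measure_pmf.integrable_const_bound[where B = 1]) auto
qed (use assms in \<open>auto simp: AE_measure_pmf_iff\<close>)

definition halted :: "(config \<Rightarrow> bool) \<Rightarrow> (com \<times> config) set" where
  "halted E = {c. fst c = Skip \<and> E (snd c)}"

lemma halted_mono: "t \<le> t' \<Longrightarrow> measure_pmf.prob (steps \<epsilon> p s t) (halted E) \<le> measure_pmf.prob (steps \<epsilon> p s t') (halted E)"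
proof (induction t' arbitrary: t)
  case (Suc t')
  have "measure_pmf.prob (steps \<epsilon> p s t') (halted E) \<le> measure_pmf.prob (steps \<epsilon> p s (Suc t')) (halted E)"
  proof -
    have "measure_pmf.prob (steps \<epsilon> p s t') (halted E) = (\<integral>y. indicat_real (halted E) y \<partial>measure_pmf (steps \<epsilon> p s t'))" by simp
    also have "\<dots> \<le> (\<integral>y. measure_pmf.prob ((\<lambda>(p', s'). step \<epsilon> p' s') y) (halted E) \<partial>measure_pmf (steps \<epsilon> p s t'))"
    proof (rule integral_mono)
      show "integrable (measure_pmf (steps \<epsilon> p s t')) (indicat_real (halted E))"
        by (rule measure_pmf.integrable_const_bound[where B = 1]) (auto simp: indicator_def)
      show "integrable (measure_pmf (steps \<epsilon> p s t')) (\<lambda>y. measure_pmf.prob ((\<lambda>(p', s'). step \<epsilon> p' s') y) (halted E))"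
        by (rule measure_pmf.integrable_const_bound[where B = 1]) auto
      show "indicat_real (halted E) y \<le> measure_pmf.prob ((\<lambda>(p', s'). step \<epsilon> p' s') y) (halted E)" for y
        by (cases y) (auto simp: halted_def indicator_def)
    qed
    also have "\<dots> = measure_pmf.prob (steps \<epsilon> p s (Suc t')) (halted E)" unfolding steps_Suc' prob_bind ..
    finally show ?thesis .
  qed
  then show ?case using order_trans[OF Suc.IH[of t]] Suc.prems by (cases "t = Suc t'") (auto simp del: steps.simps)
qed simp

lemma steps_Seq_Skip: "steps \<epsilon> (Seq Skip q) s (Suc t) = steps \<epsilon> q s t"
  by (simp add: bind_return_pmf)

text \<open>A prefix that ends in \<open>Q\<close> on every run preserves the lower bound. Runs that
  finish it early have time to spare, which is harmless by \<open>halted_mono\<close>.\<close>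

lemma tc_prefix_prob:
  assumes "tc \<epsilon> V p s T1 Q" "\<And>s'. Q s' \<Longrightarrow> x \<le> measure_pmf.prob (steps \<epsilon> q s' T2) (halted E)"
  shows "x \<le> measure_pmf.prob (steps \<epsilon> (Seq p q) s (Suc (T1 + T2))) (halted E)"
  using assms
proof (induction rule: tc.induct)
  case (tc_Skip s Q T1)
  then have "x \<le> measure_pmf.prob (steps \<epsilon> q s T2) (halted E)" by blast
  also have "\<dots> \<le> measure_pmf.prob (steps \<epsilon> q s (T1 + T2)) (halted E)" by (rule halted_mono) simp
  finally show ?case unfolding steps_Seq_Skip .
next
  case (tc_step p s T1 Q)
  have "steps \<epsilon> (Seq p q) s (Suc (Suc T1 + T2)) = bind_pmf (step \<epsilon> p s) (\<lambda>y. steps \<epsilon> (Seq (fst y) q) (snd y) (Suc (T1 + T2)))"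
    using tc_step.hyps(1) by (simp add: bind_map_pmf case_prod_unfold del: steps.simps(2)) (simp add: bind_map_pmf case_prod_unfold)
  then show ?case using tc_step by (auto intro!: prob_bind_ge simp del: steps.simps)
qed

lemma tc_prob_1:
  assumes "tc \<epsilon> V p s T Q" "\<And>s'. Q s' \<Longrightarrow> E s'" "T \<le> T'"
  shows "measure_pmf.prob (steps \<epsilon> p s T') (halted E) = 1"
proof -
  have "tc \<epsilon> V p s T' Q" using tc_time[OF assms(1,3)] .
  then have "set_pmf (steps \<epsilon> p s T') \<subseteq> halted E" using tc_steps_final assms(2) unfolding halted_def by fastforce
  then show ?thesis by (simp add: measure_pmf.prob_eq_1 AE_measure_pmf_iff subset_eq)
qed

text \<open>One round takes eleven machine steps: the loop test, and for each of the five
  instructions its execution and the removal of the \<open>Skip\<close> that it leaves.\<close>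

lemma flip_unroll:
  assumes "regs s 19 = Suc m"
  shows "steps \<epsilon> (Seq (WhileNZ 19 flip_com) q) s (11 + t) = bind_pmf (bernoulli_pmf (1/2)) (\<lambda>b.
    steps \<epsilon> (Seq (WhileNZ 19 flip_com) q) (set_reg 19 m (set_reg 15 1 (set_reg 9 (2 * regs s 9 + of_bool b) s))) t)"
proof -
  have r: "set_reg 19 m (set_reg 15 w (set_reg 9 x (set_reg 9 y (set_reg 15 z s)))) = set_reg 19 m (set_reg 15 w (set_reg 9 x s))" for w x y z
    unfolding set_reg_def by (simp add: fun_upd_twist)
  have sr: "regs (set_reg x v t) y = (if y = x then v else regs t y)" for x v t y by (simp add: set_reg_def)
  have e: "11 + t = Suc (Suc (Suc (Suc (Suc (Suc (Suc (Suc (Suc (Suc (Suc t))))))))))" by simp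
  show ?thesis unfolding flip_com_def e
    by (simp add: assms bind_return_pmf bind_map_pmf sr r mult_2)
qed

text \<open>Induction on the number \<open>m\<close> of coins left, with the bits tossed so far as a
  prefix \<open>h\<close>: the final seed is uniform among the numbers \<open>h * 2 ^ m + g\<close>,
  and every good seed leads to success with certainty.\<close>

lemma flips_prob:
  assumes "regs s 19 = m" "regs s 9 = h" and safe: "safe V s" "(h + 1) * 2 ^ m \<le> V"
    and q: "\<And>s'. safe V s' \<Longrightarrow> same s s' \<Longrightarrow> regs s' 19 = 0 \<Longrightarrow> Good (regs s' 9) \<Longrightarrow> measure_pmf.prob (steps \<epsilon> q s' T) (halted E) = 1"
  shows "real (card {g. g < 2 ^ m \<and> Good (h * 2 ^ m + g)}) / 2 ^ m \<le> measure_pmf.prob (steps \<epsilon> (Seq (WhileNZ 19 flip_com) q) s (11 * m + (2 + T))) (halted E)"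
  using assms
proof (induction m arbitrary: s h)
  case 0
  have "steps \<epsilon> (Seq (WhileNZ 19 flip_com) q) s (2 + T) = steps \<epsilon> q s T"
    using 0 by (simp add: add_2_eq_Suc bind_return_pmf)
  moreover have "measure_pmf.prob (steps \<epsilon> q s T) (halted E) = 1" if "Good h"
    using 0 that by (intro "0.prems"(5)) (auto simp: same_def)
  moreover have "{g. g < 1 \<and> Good (h * 1 + g)} = (if Good h then {0} else {})" by auto
  ultimately show ?case by auto
next
  case (Suc m)
  define s' where "s' b = set_reg 19 m (set_reg 15 1 (set_reg 9 (2 * h + of_bool b) s))" for b
  let ?P = "\<lambda>b. measure_pmf.prob (steps \<epsilon> (Seq (WhileNZ 19 flip_com) q) (s' b) (11 * m + (2 + T))) (halted E)"
  let ?C = "\<lambda>b. {g. g < 2 ^ m \<and> Good ((2 * h + of_bool b) * 2 ^ m + g)}"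
  have IH: "real (card (?C b)) / 2 ^ m \<le> ?P b" for b
  proof (rule Suc.IH)
    show "regs (s' b) 19 = m" "regs (s' b) 9 = 2 * h + of_bool b" unfolding s'_def by (auto simp: set_reg_def)
    have "(2 * h + of_bool b + 1) * 2 ^ m \<le> (2 * h + 2) * 2 ^ m" by (intro mult_right_mono) auto
    also have "\<dots> = (h + 1) * 2 ^ Suc m" by simp
    finally show V: "(2 * h + of_bool b + 1) * 2 ^ m \<le> V" using Suc.prems(4) by linarith
    have "(2 * h + of_bool b + 1) * 1 \<le> (2 * h + of_bool b + 1) * 2 ^ m" by (intro mult_left_mono) auto
    also note V
    finally have "2 * h + of_bool b + 1 \<le> V" by simp
    moreover have "m \<le> V" using Suc.prems(1,3) unfolding safe_def by (metis Suc_leD)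
    ultimately show "safe V (s' b)" using Suc.prems(3) unfolding safe_def s'_def set_reg_def by auto
    fix s1 assume s1: "safe V s1" "same (s' b) s1" "regs s1 19 = 0" "Good (regs s1 9)"
    have "same s s1" using s1(2) unfolding same_def s'_def by (auto simp: set_reg_def)
    then show "measure_pmf.prob (steps \<epsilon> q s1 T) (halted E) = 1" using Suc.prems(5) s1 by blast
  qed
  have "measure_pmf.prob (steps \<epsilon> (Seq (WhileNZ 19 flip_com) q) s (11 * Suc m + (2 + T))) (halted E) = ?P True * (1 / 2) + ?P False * (1 / 2)"
    using flip_unroll[OF Suc.prems(1), of \<epsilon> q "11 * m + (2 + T)"] Suc.prems(2) unfolding s'_def by (simp add: prob_bind add.assoc del: steps.simps)
  moreover have "card {g. g < 2 ^ Suc m \<and> Good (h * 2 ^ Suc m + g)} = card (?C False) + card (?C True)"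
  proof -
    \<comment> \<open>The next coin is the leading bit of \<open>g\<close>.\<close>
    have "{g. g < 2 ^ Suc m \<and> Good (h * 2 ^ Suc m + g)} = ?C False \<union> (\<lambda>g. 2 ^ m + g) ` ?C True" (is "?L = ?R")
    proof (intro equalityI subsetI)
      fix g assume g: "g \<in> ?L"
      show "g \<in> ?R"
      proof (cases "g < 2 ^ m")
        case True
        have e: "(2 * h + of_bool False) * 2 ^ m + g = h * 2 ^ Suc m + g" by (simp add: algebra_simps)
        have "g \<in> ?C False" using g True unfolding mem_Collect_eq e by blast
        then show ?thesis by blast
      next
        case False
        then have "g = 2 ^ m + (g - 2 ^ m)" and lt: "g - 2 ^ m < 2 ^ m" using g by auto
        have e: "(2 * h + of_bool True) * 2 ^ m + (g - 2 ^ m) = h * 2 ^ Suc m + g" using False by (simp add: algebra_simps)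
        have "g - 2 ^ m \<in> ?C True" using g lt unfolding mem_Collect_eq e by blast
        then show ?thesis using \<open>g = 2 ^ m + (g - 2 ^ m)\<close> by blast
      qed
    qed (auto simp: algebra_simps)
    moreover have "card ((\<lambda>g. 2 ^ m + g) ` ?C True) = card (?C True)" by (intro card_image) (auto intro: inj_onI)
    moreover have "?C False \<inter> (\<lambda>g. 2 ^ m + g) ` ?C True = {}" by auto
    ultimately show ?thesis by (simp add: card_Un_disjoint)
  qed
  moreover have "(real (card (?C True)) / 2 ^ m) * (1 / 2) + (real (card (?C False)) / 2 ^ m) * (1 / 2) \<le> ?P True * (1 / 2) + ?P False * (1 / 2)"
    by (intro add_mono mult_right_mono IH) auto
  moreover have "real (a + b) / 2 ^ Suc m = (real b / 2 ^ m) * (1 / 2) + (real a / 2 ^ m) * (1 / 2)" for a b :: nat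
    by (simp add: field_simps)
  ultimately show ?case by (simp only:)
qed


section \<open>Space and time\<close>

definition codeb :: "nat \<Rightarrow> nat \<Rightarrow> nat" where
  "codeb n m = (n * n + 1) * (n * n div m + 2) ^ (2 * m + 1)"

text \<open>One product that dominates all register contents: the first factors for polynomial
  quantities, then labellings, then hash seeds, then the codes of the buffer and of the reduced
  part. Each of these quantities is bounded by a divisor of the product, and its logarithm is the
  sum of their contributions.\<close>

definition VV :: "nat \<Rightarrow> nat \<Rightarrow> nat \<Rightarrow> nat \<Rightarrow> nat" where
  "VV c n m1 m2 = c * (n + 1) ^ 9 * (n + 1) ^ n * (2 * n) ^ n * codeb n m1 * codeb n m2"

lemma codeb_pos: "0 < codeb n m" unfolding codeb_def by simp

lemma VV_ge:
  assumes "1 \<le> n" "1 \<le> c"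
  shows "c * (n + 1) ^ 9 \<le> VV c n m1 m2" "(n + 1) ^ n \<le> VV c n m1 m2" "(2 * n) ^ n \<le> VV c n m1 m2"
    "codeb n m1 \<le> VV c n m1 m2" "codeb n m2 \<le> VV c n m1 m2"
proof -
  have "0 < VV c n m1 m2" unfolding VV_def using assms codeb_pos by simp
  then have d: "x dvd VV c n m1 m2 \<Longrightarrow> x \<le> VV c n m1 m2" for x by (rule dvd_imp_le[rotated])
  show "c * (n + 1) ^ 9 \<le> VV c n m1 m2" "(n + 1) ^ n \<le> VV c n m1 m2" "(2 * n) ^ n \<le> VV c n m1 m2"
    "codeb n m1 \<le> VV c n m1 m2" "codeb n m2 \<le> VV c n m1 m2"
    by (intro d; simp add: VV_def)+
qed

lemma VV_poly:
  assumes "1 \<le> n" "1 \<le> c" "x \<le> c' * (n + 1) ^ j" "c' \<le> c" "j \<le> 9" shows "x \<le> VV c n m1 m2"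
proof -
  have "c' * (n + 1) ^ j \<le> c * (n + 1) ^ 9" using assms by (intro mult_mono power_increasing) auto
  then show ?thesis using VV_ge(1)[OF assms(1,2), of m1 m2] assms(3) by linarith
qed

lemma codeb_le_exp:
  assumes "1 \<le> n" "1 \<le> m" "m \<le> n * n" shows "codeb n m \<le> 2 ^ (8 * n ^ 4)"
proof -
  let ?N = "n * n"
  have N: "1 \<le> ?N" using assms by simp
  have "?N + 2 \<le> 2 ^ (?N + 1)" using less_exp[of "?N + 1"] by linarith
  then have e: "(?N + 2) ^ (2 * ?N + 2) \<le> (2 ^ (?N + 1)) ^ (2 * ?N + 2)" by (intro power_mono) auto
  have "codeb n m \<le> (?N + 2) * (?N + 2) ^ (2 * ?N + 1)"
    unfolding codeb_def using assms by (intro mult_mono order_trans[OF power_mono power_increasing]) auto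
  also have "\<dots> = (?N + 2) ^ (2 * ?N + 2)" by simp
  also note e
  also have "((2::nat) ^ (?N + 1)) ^ (2 * ?N + 2) = 2 ^ ((?N + 1) * (2 * ?N + 2))" by (rule power_mult[symmetric])
  also have "\<dots> \<le> 2 ^ (8 * n ^ 4)"
  proof (rule power_increasing)
    have "(?N + 1) * (2 * ?N + 2) \<le> (2 * ?N) * (4 * ?N)" using N by (intro mult_mono) auto
    also have "\<dots> = 8 * n ^ 4" by (simp add: power4_eq_xxxx)
    finally show "(?N + 1) * (2 * ?N + 2) \<le> 8 * n ^ 4" .
  qed simp
  finally show ?thesis .
qed

text \<open>Every factor of \<open>VV\<close> is at most two to the power of a constant times
  \<open>n ^ 4\<close>.\<close>

lemma VV_time:
  assumes n: "1 \<le> n" and c: "1 \<le> c" and m: "1 \<le> m1" "m1 \<le> n * n" "1 \<le> m2" "m2 \<le> n * n"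
  shows "(VV c n m1 m2 + 2) ^ t \<le> exp_time (t * (c + 30) + 4) n"
proof -
  have n4: "n \<le> n ^ 4" "1 \<le> n ^ 4" "n * n \<le> n ^ 4"
  proof -
    show "n \<le> n ^ 4" using power_increasing[of 1 4 n] n by simp
    show "1 \<le> n ^ 4" using n by simp
    show "n * n \<le> n ^ 4" using power_increasing[of 2 4 n] n by (simp add: power2_eq_square)
  qed
  have e: "n + 1 \<le> 2 ^ n" using less_exp[of n] by linarith
  have 1: "c \<le> 2 ^ (c * n ^ 4)"
  proof -
    have "c \<le> 2 ^ c" using less_exp[of c] by linarith
    also have "\<dots> \<le> 2 ^ (c * n ^ 4)" using n4(2) by (intro power_increasing) auto
    finally show ?thesis .
  qed
  have 2: "(n + 1) ^ 9 \<le> 2 ^ (9 * n ^ 4)"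
  proof -
    have "(n + 1) ^ 9 \<le> (2 ^ n) ^ 9" using e by (intro power_mono) auto
    also have "\<dots> = 2 ^ (n * 9)" by (rule power_mult[symmetric])
    also have "\<dots> \<le> 2 ^ (9 * n ^ 4)" using n4(1) by (intro power_increasing) auto
    finally show ?thesis .
  qed
  have 3: "(n + 1) ^ n \<le> 2 ^ (n ^ 4)"
  proof -
    have "(n + 1) ^ n \<le> (2 ^ n) ^ n" using e by (intro power_mono) auto
    also have "\<dots> = 2 ^ (n * n)" by (rule power_mult[symmetric])
    also have "\<dots> \<le> 2 ^ (n ^ 4)" using n4(3) by (intro power_increasing) auto
    finally show ?thesis .
  qed
  have 4: "(2 * n) ^ n \<le> 2 ^ (2 * n ^ 4)"
  proof -
    have "2 * n \<le> 2 ^ (2 * n)" using less_exp[of "2 * n"] by linarith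
    then have "(2 * n) ^ n \<le> (2 ^ (2 * n)) ^ n" by (intro power_mono) auto
    also have "\<dots> = 2 ^ (2 * n * n)" by (rule power_mult[symmetric])
    also have "\<dots> \<le> 2 ^ (2 * n ^ 4)" using n4(3) by (intro power_increasing) auto
    finally show ?thesis .
  qed
  have "VV c n m1 m2 \<le> 2 ^ (c * n ^ 4) * 2 ^ (9 * n ^ 4) * 2 ^ (n ^ 4) * 2 ^ (2 * n ^ 4) * 2 ^ (8 * n ^ 4) * 2 ^ (8 * n ^ 4)"
    unfolding VV_def by (intro mult_mono 1 2 3 4 codeb_le_exp n m) auto
  also have "\<dots> = 2 ^ ((c + 28) * n ^ 4)" by (simp add: power_add[symmetric] algebra_simps)
  finally have "VV c n m1 m2 + 2 \<le> 4 * 2 ^ ((c + 28) * n ^ 4)"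
    using one_le_power[of "2::nat" "(c + 28) * n ^ 4"] by linarith
  also have "\<dots> = 2 ^ ((c + 28) * n ^ 4 + 2)" by simp
  also have "\<dots> \<le> 2 ^ ((c + 30) * n ^ 4)" using n4(2) by (intro power_increasing) (auto simp: algebra_simps)
  finally have "(VV c n m1 m2 + 2) ^ t \<le> (2 ^ ((c + 30) * n ^ 4)) ^ t" by (rule power_mono) simp
  also have "\<dots> = 2 ^ ((c + 30) * n ^ 4 * t)" by (rule power_mult[symmetric])
  also have "\<dots> \<le> exp_time (t * (c + 30) + 4) n"
    unfolding exp_time_def
  proof (rule power_increasing)
    have "n ^ 4 \<le> n ^ (t * (c + 30) + 4)" using n by (intro power_increasing) auto
    then have "(t * (c + 30)) * n ^ 4 \<le> (t * (c + 30) + 4) * n ^ (t * (c + 30) + 4)" by (intro mult_mono) auto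
    then show "(c + 30) * n ^ 4 * t \<le> (t * (c + 30) + 4) * n ^ (t * (c + 30) + 4)" by (simp only: ac_simps)
  qed simp
  finally show ?thesis .
qed

lemma log_codeb:
  assumes "1 \<le> n" "1 \<le> m" "m \<le> n * n"
  shows "log 2 (codeb n m) \<le> 2 * log 2 (real n + 1) + 3 * (m * log 2 (real n^2 / m + 2))"
proof -
  have d: "real (n * n div m + 2) \<le> real n^2 / m + 2" using real_div_le[of "n * n" m] by (simp add: power2_eq_square)
  have l0: "0 \<le> log 2 (real n^2 / m + 2)" by (subst zero_le_log_cancel_iff) (auto intro: add_nonneg_pos)
  have "log 2 (codeb n m) = log 2 (real (n * n + 1) * real (n * n div m + 2) ^ (2 * m + 1))" unfolding codeb_def by (simp only: of_nat_mult of_nat_power)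
  also have "\<dots> = log 2 (real (n * n + 1)) + log 2 (real (n * n div m + 2) ^ (2 * m + 1))"
    by (rule log_mult_pos) (simp_all only: of_nat_0_less_iff zero_less_power)
  also have "log 2 (real (n * n div m + 2) ^ (2 * m + 1)) = real (2 * m + 1) * log 2 (real (n * n div m + 2))"
    by (rule log_nat_power) (simp del: of_nat_add)
  also have "log 2 (real (n * n + 1)) \<le> log 2 ((real n + 1)^2)"
  proof -
    have "0 < real (n * n + 1)" by linarith
    moreover have "real (n * n + 1) \<le> (real n + 1)^2" by (simp add: power2_eq_square algebra_simps)
    ultimately show ?thesis by (subst log_le_cancel_iff) auto
  qed
  also have "log 2 ((real n + 1)^2) = 2 * log 2 (real n + 1)" by (simp add: log_nat_power)
  also have "log 2 (real (n * n div m + 2)) \<le> log 2 (real n^2 / m + 2)" using d by (subst log_le_cancel_iff) (auto intro: add_nonneg_pos simp del: of_nat_add)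
  also have "real (2 * m + 1) * log 2 (real n^2 / m + 2) \<le> (3 * real m) * log 2 (real n^2 / m + 2)" using l0 assms by (intro mult_right_mono) auto
  finally show ?thesis by (simp add: mult.assoc mult_left_mono)
qed

lemma lg1: "1 \<le> lg x" "log 2 x \<le> lg x" unfolding lg_def by auto

lemma log_k2: "1 \<le> k \<Longrightarrow> log 2 (real k + 2) \<le> 3 * lg k"
proof -
  assume k: "1 \<le> k"
  show ?thesis
  proof (cases "k = 1")
    case True
    have "log 2 3 \<le> (2::real)" by (subst log_le_iff) auto
    then show ?thesis using True lg1(1)[of 1] by simp
  next
    case False
    then have "2 \<le> real k" using k by simp
    then have "real k + 2 \<le> real k * real k" using mult_right_mono[of 2 "real k" "real k"] by linarith
    then have "log 2 (real k + 2) \<le> log 2 (real k ^ 2)" using k by (subst log_le_cancel_iff) (auto simp: power2_eq_square)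
    also have "\<dots> = 2 * log 2 k" using k by (simp add: log_nat_power)
    finally show ?thesis using lg1[of k] by linarith
  qed
qed

text \<open>The size is capped at \<open>n * n\<close>, the number of possible elements, as
  \<open>code_exists\<close> requires. If the cap is active then the logarithm is only
  \<open>log 2 3\<close>; otherwise it is monotone in the size.\<close>

lemma log_min_le:
  fixes B x y :: real
  assumes n: "1 \<le> n" and B: "1 \<le> B" and m: "m = min (n * n) (nat \<lceil>B\<rceil>)" and x: "2 \<le> x" "log 2 (real n^2 / B + 2) \<le> x"
  shows "m * log 2 (real n^2 / m + 2) \<le> 2 * B * x"
proof -
  have cB: "real (nat \<lceil>B\<rceil>) \<le> 2 * B" "B \<le> real (nat \<lceil>B\<rceil>)" using B by linarith+
  have N: "1 \<le> n * n" using n by simp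
  show ?thesis
  proof (cases "n * n \<le> nat \<lceil>B\<rceil>")
    case True
    then have mn: "m = n * n" using m by simp
    then have "real n^2 / m + 2 = 3" using n by (simp add: power2_eq_square)
    moreover have "log 2 3 \<le> (2::real)" by (subst log_le_iff) auto
    moreover have "real m \<le> 2 * B" using True mn cB(1) by linarith
    ultimately have "m * log 2 (real n^2 / m + 2) \<le> (2 * B) * 2" using B by (intro mult_mono) auto
    also have "\<dots> \<le> (2 * B) * x" using B x by (intro mult_left_mono) auto
    finally show ?thesis .
  next
    case False
    then have mB: "m = nat \<lceil>B\<rceil>" using m by simp
    have "real n^2 / m \<le> real n^2 / B" using mB cB B by (intro divide_left_mono) auto
    then have "log 2 (real n^2 / m + 2) \<le> log 2 (real n^2 / B + 2)" by (subst log_le_cancel_iff) (use B in \<open>auto intro!: add_nonneg_pos divide_nonneg_nonneg\<close>)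
    then have "log 2 (real n^2 / m + 2) \<le> x" using x by linarith
    moreover have "0 \<le> log 2 (real n^2 / m + 2)" by (subst zero_le_log_cancel_iff) (auto intro: add_nonneg_pos)
    ultimately show ?thesis using mB cB B by (intro mult_mono) auto
  qed
qed

text \<open>\<open>m1\<close> is the part of the stored edges that pays \<open>O(log k)\<close> bits
  for each edge, being at least \<open>n\<^sup>2 / k\<close>, and \<open>m2\<close> is the RS part,
  which pays \<open>L1\<close>. The other factors of \<open>VV\<close> are the code of the buffer
  and quantities of \<open>O(n log n)\<close> bits.\<close>

lemma log_VV:
  fixes n k c b Cb mb mz :: nat and m1 m2 L1 :: real
  assumes nk: "1 \<le> k" "k \<le> n" and c: "1 \<le> c" and b: "b = Cb * (n * n div k)" "2 \<le> Cb"
    and m1: "real n^2 / k \<le> m1" and m2: "0 \<le> m2" and L1: "0 < m2 \<Longrightarrow> 1 \<le> L1 \<and> log 2 (real n^2 / m2 + 2) \<le> 2 * L1"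
    and mb: "mb = min (n * n) (nat \<lceil>real b\<rceil>)" and mz: "mz = min (n * n) (nat \<lceil>m1 + m2\<rceil>)"
  shows "log 2 (VV c n mb mz) + 1 \<le> (70 + 18 * real Cb + log 2 c) * (real n^2 / k * lg k) + 18 * (m1 * lg k + m2 * L1)"
proof -
  define U where "U = real n^2 / k * lg k"
  have n: "1 \<le> n" using nk by simp
  have nk': "1 \<le> real n / k" using nk by simp
  have n2k: "real n^2 / k = real n * (real n / k)" by (simp add: power2_eq_square)
  have n2k1: "real n \<le> real n^2 / k" unfolding n2k using nk' mult_left_mono[OF nk', of "real n"] by simp
  have U1: "1 \<le> U"
  proof -
    have "1 * 1 \<le> real n^2 / k * lg k" using n2k1 n lg1[of k] by (intro mult_mono) auto
    then show ?thesis unfolding U_def by simp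
  qed
  have l: "log 2 (real n + 1) \<le> 4 * (real n / k) * lg k" by (rule nlogn_le[OF nk])
  have l0: "0 \<le> log 2 (real n + 1)" by simp
  have nl: "real n * log 2 (real n + 1) \<le> 4 * U"
  proof -
    have "real n * log 2 (real n + 1) \<le> real n * (4 * (real n / k) * lg k)" using l by (intro mult_left_mono) auto
    also have "\<dots> = 4 * U" unfolding U_def n2k by simp
    finally show ?thesis .
  qed
  have l4: "log 2 (real n + 1) \<le> 4 * U"
  proof -
    have "1 * log 2 (real n + 1) \<le> real n * log 2 (real n + 1)" using n l0 by (intro mult_right_mono) auto
    then show ?thesis using nl by linarith
  qed
  have lb: "mb * log 2 (real n^2 / mb + 2) \<le> 2 * real b * (3 * lg k)"
  proof (rule log_min_le[OF n _ mb])
    have kn: "k \<le> n * n" using mult_le_mono[of 1 n k n] nk by simp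
    have "1 \<le> n * n div k" using div_le_mono[OF kn, of k] nk by simp
    then show "1 \<le> real b" unfolding b(1) using b(2) mult_le_mono[of 1 Cb 1 "n * n div k"] by linarith
    have h: "real n^2 / (2 * k) \<le> real (n * n div k)" using div_ge_half[of k "n * n"] nk kn by (simp add: power2_eq_square)
    have "real n^2 / k \<le> 2 * real (n * n div k)" using h by simp
    also have "\<dots> \<le> real Cb * real (n * n div k)" using b(2) by (intro mult_right_mono) auto
    finally have "real n^2 / k \<le> real b" unfolding b(1) by simp
    then have "real n^2 \<le> real k * real b" using nk by (simp add: divide_le_eq mult.commute)
    then have "real n^2 / real b \<le> k" using \<open>1 \<le> real b\<close> by (simp add: divide_le_eq)
    then have "log 2 (real n^2 / real b + 2) \<le> log 2 (real k + 2)"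
      using \<open>1 \<le> real b\<close> by (subst log_le_cancel_iff) (auto intro: add_nonneg_pos)
    also note log_k2[OF nk(1)]
    finally show "log 2 (real n^2 / real b + 2) \<le> 3 * lg k" .
    show "2 \<le> 3 * lg k" using lg1(1)[of k] by linarith
  qed
  have bU: "2 * real b * (3 * lg k) \<le> 6 * Cb * U"
  proof -
    have "real b \<le> Cb * (real n^2 / k)" unfolding b(1) of_nat_mult[of Cb] using real_div_le[of "n * n" k]
      by (intro mult_left_mono) (auto simp: power2_eq_square)
    then have "2 * real b * (3 * lg k) \<le> 2 * (Cb * (real n^2 / k)) * (3 * lg k)" using lg1(1)[of k] by (intro mult_mono) auto
    then show ?thesis unfolding U_def by (simp add: algebra_simps)
  qed
  have B1: "1 \<le> m1 + m2" using m1 n2k1 n m2 by linarith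
  have m1p: "0 < m1" using m1 n2k1 n by linarith
  have lz: "mz * log 2 (real n^2 / mz + 2) \<le> 6 * (m1 * lg k + m2 * L1)"
  proof -
    \<comment> \<open>The logarithm decreases in the size. So at \<open>m1 + m2\<close> it is at
      most its values at \<open>m1\<close> and at \<open>m2\<close>, and each summand uses its own
      bound.\<close>
    let ?x = "max 2 (log 2 (real n^2 / (m1 + m2) + 2))"
    have "mz * log 2 (real n^2 / mz + 2) \<le> 2 * (m1 + m2) * ?x" by (rule log_min_le[OF n B1 mz]) auto
    moreover have "?x \<le> 3 * lg k"
    proof -
      have "real n^2 \<le> k * m1" using m1 nk by (simp add: divide_le_eq mult.commute)
      also have "\<dots> \<le> k * (m1 + m2)" using m2 by (intro mult_left_mono) auto
      finally have "real n^2 / (m1 + m2) \<le> k" using B1 by (simp add: divide_le_eq)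
      then have "log 2 (real n^2 / (m1 + m2) + 2) \<le> log 2 (real k + 2)" using B1 by (subst log_le_cancel_iff) (auto intro: add_nonneg_pos)
      then show ?thesis using log_k2[OF nk(1)] lg1(1)[of k] by auto
    qed
    moreover have "m2 * ?x \<le> m2 * (2 * L1)"
    proof (cases "m2 = 0")
      case False
      then have p: "0 < m2" using m2 by simp
      have "real n^2 / (m1 + m2) \<le> real n^2 / m2" using p m1p by (intro divide_left_mono) auto
      then have "log 2 (real n^2 / (m1 + m2) + 2) \<le> log 2 (real n^2 / m2 + 2)" using p m1p by (subst log_le_cancel_iff) (auto intro: add_nonneg_pos)
      then have "?x \<le> 2 * L1" using L1[OF p] by auto
      then show ?thesis using m2 by (rule mult_left_mono)
    qed simp
    moreover have "m1 * ?x \<le> m1 * (3 * lg k)" using calculation(2) m1p by (intro mult_left_mono) auto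
    moreover have "0 \<le> m2 * L1" using L1 m2 by (cases "m2 = 0") auto
    ultimately show ?thesis by (simp add: algebra_simps)
  qed
  have mb': "1 \<le> mb" "mb \<le> n * n" 
  proof -
    have kn: "k \<le> n * n" using mult_le_mono[of 1 n k n] nk by simp
    have "1 \<le> n * n div k" using div_le_mono[OF kn, of k] nk by simp
    then have "1 \<le> b" unfolding b(1) using b(2) by (simp add: Suc_le_eq)
    then show "1 \<le> mb" "mb \<le> n * n" unfolding mb using n by (auto simp: Suc_le_eq)
  qed
  have mz': "1 \<le> mz" "mz \<le> n * n" unfolding mz using n B1 by (auto simp: Suc_le_eq)
  have "log 2 (VV c n mb mz) = log 2 c + 9 * log 2 (real n + 1) + n * log 2 (real n + 1) + n * log 2 (2 * real n) + log 2 (codeb n mb) + log 2 (codeb n mz)"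
  proof -
    have p: "0 < real c" "0 < (real n + 1) ^ 9" "0 < (real n + 1) ^ n" "0 < (2 * real n) ^ n" "0 < real (codeb n mb)" "0 < real (codeb n mz)"
      using c n codeb_pos by auto
    have "real (VV c n mb mz) = real c * (real n + 1) ^ 9 * (real n + 1) ^ n * (2 * real n) ^ n * codeb n mb * codeb n mz"
      unfolding VV_def by (simp add: add.commute)
    then show ?thesis using p n by (simp add: log_mult_pos log_nat_power algebra_simps)
  qed
  also have "log 2 (2 * real n) \<le> 2 * log 2 (real n + 1)"
  proof -
    have "2 * real n \<le> (real n + 1)^2" by (simp add: power2_eq_square algebra_simps)
    then have "log 2 (2 * real n) \<le> log 2 ((real n + 1)^2)" using n by (subst log_le_cancel_iff) auto
    then show ?thesis by (simp add: log_nat_power)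
  qed
  finally have "log 2 (VV c n mb mz) \<le> log 2 c + 9 * log 2 (real n + 1) + n * log 2 (real n + 1) + n * (2 * log 2 (real n + 1)) + log 2 (codeb n mb) + log 2 (codeb n mz)"
    using n by (simp add: mult_left_mono)
  moreover have "log 2 (codeb n mb) \<le> 2 * log 2 (real n + 1) + 3 * (6 * Cb * U)" using log_codeb[OF n mb'] lb bU by linarith
  moreover have "log 2 (codeb n mz) \<le> 2 * log 2 (real n + 1) + 3 * (6 * (m1 * lg k + m2 * L1))" using log_codeb[OF n mz'] lz by linarith
  moreover have "log 2 c + 1 \<le> (log 2 c + 1) * U" using mult_left_mono[OF U1, of "log 2 c + 1"] c by simp
  ultimately have "log 2 (VV c n mb mz) + 1 \<le> (log 2 c + 1) * U + 13 * (4 * U) + 3 * (4 * U) + 3 * (6 * Cb * U) + 3 * (6 * (m1 * lg k + m2 * L1))"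
    using nl l4 by linarith
  also have "\<dots> \<le> (70 + 18 * real Cb + log 2 c) * U + 18 * (m1 * lg k + m2 * L1)" using U1 by (simp add: algebra_simps)
  finally show ?thesis unfolding U_def .
qed

lemma finish:
  assumes t: "ttc \<epsilon> V A (init_config n k es) Q" and T: "(V + 2) ^ tau A \<le> exp_time a n" and V: "1 \<le> V"
  shows "halts_within A n k \<epsilon> es (exp_time a n)"
    "\<And>r. r \<in> set_pmf (run A n k \<epsilon> es (exp_time a n)) \<Longrightarrow> Q (snd r)"
    "(maxreg A + 2) * (log 2 V + 1) \<le> S \<Longrightarrow> space_within A n k \<epsilon> es S"
proof -
  have tc: "tc \<epsilon> V A (init_config n k es) (exp_time a n) Q" using t T unfolding ttc_def by (rule tc_time)
  show "halts_within A n k \<epsilon> es (exp_time a n)" unfolding halts_within_def run_steps using tc_steps_final[OF tc] by blast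
  show "Q (snd r)" if "r \<in> set_pmf (run A n k \<epsilon> es (exp_time a n))" for r
    using that tc_steps_final[OF tc, of "fst r" "snd r"] unfolding run_steps by simp
  assume S: "(maxreg A + 2) * (log 2 V + 1) \<le> S"
  have fl: "real (floorlog 2 V) \<le> log 2 V + 1"
  proof -
    have "0 \<le> log 2 V" using V by simp
    then show ?thesis unfolding floorlog_def using V by auto
  qed
  show "space_within A n k \<epsilon> es S" unfolding space_within_def run_steps
  proof (intro allI ballI, clarify)
    fix t p s assume r: "(p, s) \<in> set_pmf (steps \<epsilon> A (init_config n k es) t)"
    have "safe V s" by (rule tc_steps_safe[OF tc r])
    moreover have "\<forall>x\<ge>maxreg A + 2. regs s x = 0" using steps_maxreg[OF r] unfolding init_config_def by auto
    ultimately have "space_bits s \<le> (maxreg A + 2) * floorlog 2 V" by (rule space_bits_le)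
    then have "real (space_bits s) \<le> real ((maxreg A + 2) * floorlog 2 V)" by (rule of_nat_mono)
    also have "\<dots> = real (maxreg A + 2) * real (floorlog 2 V)" by (rule of_nat_mult)
    also have "\<dots> \<le> real (maxreg A + 2) * (log 2 V + 1)" using fl by (rule mult_left_mono) simp
    finally show "real (space_bits s) \<le> S" using S by simp
  qed
qed

lemma core_intro:
  assumes nk: "1 \<le> k" "k \<le> n" and \<epsilon>: "\<epsilon> \<le> 1" and c: "1 \<le> c" and B: "1 \<le> B" and b: "1 \<le> b"
    and V: "V = VV c n (min (n * n) (nat \<lceil>real b\<rceil>)) (min (n * n) (nat \<lceil>B\<rceil>))"
    and le: "(n * n + 2) * (n * n + 2) \<le> V" "2 * s \<le> V" "n * X \<le> V" "b \<le> V"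
    and ex: "\<And>Z. Z \<subseteq> arcs n \<Longrightarrow> \<exists>W\<subseteq>Z. goodN \<epsilon> n k s s0 M H X W Z \<and> real (card W) \<le> B"
  shows "core \<epsilon> V n k b s s0 M H X"
proof
  have n: "1 \<le> n" using nk by simp
  have nn1: "1 \<le> n * n" using n by simp
  have a: "arcs n \<subseteq> {..<n * n}" unfolding arcs_def by auto
  have ca: "S \<subseteq> arcs n \<Longrightarrow> card S \<le> n * n" for S using card_mono[of "{..<n * n}" S] a by auto
  have code: "\<exists>w\<le>V. codes (n * n) w = S" if "S \<subseteq> arcs n" "card S \<le> m" "1 \<le> m" "m \<le> n * n" "codeb n m \<le> V" for S m
    using code_exists[of S "n * n" m] that a unfolding codeb_def by (meson less_imp_le order_trans)
  show "1 \<le> V" using le(4) b by linarith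
  show "\<epsilon> \<le> 1" by fact
  show "(n * n + 2) * (n * n + 2) \<le> V" "2 * s \<le> V" "n * X \<le> V" "1 \<le> b" "b \<le> V" by fact+
  show "(n + 1) ^ n \<le> V" unfolding V by (rule VV_ge[OF n c])
  show "\<exists>w\<le>V. codes (n * n) w = S" if "S \<subseteq> arcs n" "card S \<le> b" for S
  proof (rule code[OF that(1), of "min (n * n) (nat \<lceil>real b\<rceil>)"])
    show "codeb n (min (n * n) (nat \<lceil>real b\<rceil>)) \<le> V" unfolding V by (rule VV_ge[OF n c])
  qed (use that ca b nn1 in auto)
  show "\<exists>w\<le>V. goodN \<epsilon> n k s s0 M H X (codes (n * n) w) Z" if Z: "Z \<subseteq> arcs n" for Z
  proof -
    obtain W where W: "W \<subseteq> Z" "goodN \<epsilon> n k s s0 M H X W Z" "real (card W) \<le> B" using ex[OF Z] by blast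
    have "card W \<le> nat \<lceil>B\<rceil>" using W(3) by linarith
    moreover have "W \<subseteq> arcs n" using W(1) Z by blast
    moreover have "1 \<le> nat \<lceil>B\<rceil>" using B by linarith
    moreover have "codeb n (min (n * n) (nat \<lceil>B\<rceil>)) \<le> V" unfolding V by (rule VV_ge[OF n c])
    ultimately obtain w where "w \<le> V" "codes (n * n) w = W" using code[of W "min (n * n) (nat \<lceil>B\<rceil>)"] ca nn1 by auto
    then show ?thesis using W(2) by blast
  qed
qed

lemma stream_facts:
  assumes E: "simple_graph n E" and es: "edge_stream E es"
  shows "\<And>u v. (u, v) \<in> set es \<Longrightarrow> u < n \<and> v < n \<and> u \<noteq> v" "gr n (arcset n es) = E" "length es = card E" "2 * length es \<le> n * n"
proof -
  have e: "edges_of es = E" "distinct (map (\<lambda>(u, v). {u, v}) es)" using es unfolding edge_stream_def by auto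
  show uv: "u < n \<and> v < n \<and> u \<noteq> v" if "(u, v) \<in> set es" for u v
  proof -
    have "{u, v} \<in> E" using that e(1) unfolding edges_of_def by force
    then have "{u, v} \<subseteq> {..<n}" "card {u, v} = 2" using E unfolding simple_graph_def by auto
    then show ?thesis by auto
  qed
  have "{(u * n + v) div n, (u * n + v) mod n} = {u, v}" if "(u, v) \<in> set es" for u v
  proof -
    have "(u * n + v) div n = u" "(u * n + v) mod n = v" using uv[OF that] by auto
    then show ?thesis by (simp only:)
  qed
  then show "gr n (arcset n es) = E" unfolding gr_def arcset_def e(1)[symmetric] edges_of_def image_image
    by (intro image_cong) (auto simp del: div_mult_self3 mod_mult_self3)
  show l: "length es = card E" using distinct_card[OF e(2)] e(1) unfolding edges_of_def by simp
  have "E \<subseteq> {e. e \<subseteq> {..<n} \<and> card e = 2}" using E unfolding simple_graph_def .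
  then have "card E \<le> card {e. e \<subseteq> {..<n} \<and> card e = 2}" by (intro card_mono) auto
  also have "\<dots> = n choose 2" by (simp add: n_subsets)
  also have "\<dots> = n * (n - 1) div 2" by (rule choose_two)
  finally have "2 * card E \<le> n * (n - 1)" by linarith
  also have "\<dots> \<le> n * n" by (intro mult_left_mono) auto
  finally show "2 * length es \<le> n * n" using l by simp
qed

text \<open>So the logarithm of \<open>n\<^sup>2 / RS n \<beta>\<close> in the space bound is at
  least \<open>1\<close> whenever the RS number is positive.\<close>

lemma RS_le: "2 * RS n \<beta> \<le> n * n"
proof (cases "RS n \<beta> = 0")
  case False
  then obtain E t where "graph_on {..<n} E" "card E = RS n \<beta>" unfolding RS_RSn using RSn_attained by blast
  then have E: "E \<subseteq> {e. e \<subseteq> {..<n} \<and> card e = 2}" "card E = RS n \<beta>" unfolding graph_on_def by auto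
  then have "RS n \<beta> \<le> card {e. e \<subseteq> {..<n} \<and> card e = 2}" using card_mono[OF _ E(1)] by simp
  also have "\<dots> = n choose 2" by (simp add: n_subsets)
  also have "\<dots> = n * (n - 1) div 2" by (rule choose_two)
  finally have "2 * RS n \<beta> \<le> n * (n - 1)" by linarith
  also have "\<dots> \<le> n * n" by (intro mult_left_mono) auto
  finally show ?thesis .
qed simp

lemma RS_log:
  fixes m2 :: real
  assumes R: "R = real (RS n \<beta>)" and m2: "R \<le> m2" "0 < R"
  shows "1 \<le> log 2 (real n^2 / R)" "log 2 (real n^2 / m2 + 2) \<le> 2 * log 2 (real n^2 / R)"
proof -
  have "real (2 * RS n \<beta>) \<le> real (n * n)" by (intro of_nat_mono RS_le)
  then have x: "2 \<le> real n^2 / R" using m2 unfolding R by (simp add: le_divide_eq power2_eq_square)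
  then show "1 \<le> log 2 (real n^2 / R)" by (subst le_log_iff) auto
  have n: "0 < n" using x by (cases n) auto
  have "real n^2 / m2 \<le> real n^2 / R" using m2 by (intro divide_left_mono) auto
  then have "real n^2 / m2 + 2 \<le> (real n^2 / R)^2" using x mult_right_mono[of 2 "real n^2 / R" "real n^2 / R"] by (simp add: power2_eq_square)
  then have "log 2 (real n^2 / m2 + 2) \<le> log 2 ((real n^2 / R)^2)" using m2 x n by (subst log_le_cancel_iff) (auto intro!: add_nonneg_pos)
  also have "\<dots> = 2 * log 2 (real n^2 / R)" using x by (simp add: log_nat_power)
  finally show "log 2 (real n^2 / m2 + 2) \<le> 2 * log 2 (real n^2 / R)" .
qed


section \<open>The deterministic algorithm\<close>

definition cf :: "expr \<Rightarrow> bool" where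
  "cf e \<longleftrightarrow> (\<forall>d. coin_free (e d))"

lemma cf_basic:
  "cf (vr r)" "cf (kn c)" "cf a \<Longrightarrow> cf b \<Longrightarrow> cf (op f a b)" "cf a \<Longrightarrow> cf (fl a)"
  "cf b \<Longrightarrow> cf e0 \<Longrightarrow> (\<And>x y. cf (e x y)) \<Longrightarrow> cf (itr b e0 e)" "(\<And>x. cf (e' x)) \<Longrightarrow> cf (muq e')"
  unfolding cf_def vr_def op_def fl_def itr_def muq_def by auto

lemma cf_logic:
  "cf a \<Longrightarrow> cf (ng a)" "cf a \<Longrightarrow> cf b \<Longrightarrow> cf (an a b)" "cf a \<Longrightarrow> cf b \<Longrightarrow> cf (dj a b)" "cf a \<Longrightarrow> cf b \<Longrightarrow> cf (im a b)"
  "cf a \<Longrightarrow> cf b \<Longrightarrow> cf (le a b)" "cf a \<Longrightarrow> cf b \<Longrightarrow> cf (eq a b)" "cf b \<Longrightarrow> (\<And>x. cf (e x)) \<Longrightarrow> cf (allq b e)"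
  "cf b \<Longrightarrow> (\<And>x. cf (e x)) \<Longrightarrow> cf (exq b e)" "cf b \<Longrightarrow> (\<And>x. cf (e x)) \<Longrightarrow> cf (sm b e)" "cf a \<Longrightarrow> cf b \<Longrightarrow> cf c \<Longrightarrow> cf (dig a b c)"
  unfolding ng_def an_def dj_def im_def le_def eq_def allq_def exq_def sm_def dig_def
  by (auto intro!: cf_basic)

lemma cf_memq: "cf a \<Longrightarrow> cf b \<Longrightarrow> cf c \<Longrightarrow> cf (memq a b c)"
  unfolding memq_def gq_def xq_def wtq_def by (intro cf_basic cf_logic)

lemma cf_Zq: "cf e \<Longrightarrow> cf (Zq e)"
  unfolding Zq_def by (intro cf_basic cf_logic cf_memq)

lemma coin_free_asg: "cf e \<Longrightarrow> coin_free (asg r e)"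
  unfolding asg_def cf_def by simp

lemma coin_free_core_com: "coin_free core_com"
proof -
  have f: "cf (fdq a b c)" if "cf a" "cf b" "cf c" for a b c
    unfolding fdq_def using that by (intro cf_basic cf_logic)
  have g: "cf (goodq (vr 0) (vr 1) (vr 11) (vr 12) (vr 6) (vr 7) (vr 8) (vr 9) (vr 10) (memq (vr 12) (vr w)) Zq)" for w
    unfolding goodq_def kernq_def covq_def viq_def cntq_def hvq_def qqq_def by (intro cf_basic cf_logic cf_memq cf_Zq f)
  have b: "cf (bstq (vr 0) (vr 11) Zq (vr y))" for y
    unfolding bstq_def isMq_def cntq_def by (intro cf_basic cf_logic cf_memq cf_Zq f)
  show ?thesis
    unfolding core_com_def loop_com_def next_com_def insert_com_def reduce_com_def out_com_def
    by (simp only: coin_free.simps, intro conjI coin_free_asg) (auto simp del: One_nat_def intro!: cf_basic cf_logic cf_memq cf_Zq f g b)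
qed

lemma coin_free_det_com: "coin_free det_com"
  unfolding det_com_def base_com_def
  by (simp only: coin_free.simps, intro conjI coin_free_core_com coin_free_asg) (auto intro!: cf_basic)

lemma safe_init: "n \<le> V \<Longrightarrow> k \<le> V \<Longrightarrow> safe V (init_config n k es)"
  unfolding safe_def init_config_def by simp

lemma (in core) ttc_det:
  assumes p: "s = 0" "s0 = n + 1" "M = 0" "H = 0" "X = 32 * n" "b = 32 * (n * n div k)"
    and le: "n < V" "k \<le> V" "32 \<le> V" "32 * (n * n) \<le> V" "32 * n \<le> V" "length es < V"
    and edges: "\<And>u v. (u, v) \<in> set es \<Longrightarrow> u < n \<and> v < n \<and> u \<noteq> v"
  shows "ttc \<epsilon> V det_com (init_config n k es) (\<lambda>t'. \<exists>Z r. faithful \<epsilon> n k s s0 M H X (arcset n es) Z r \<and> r * b \<le> length es \<and>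
     matching (gr n Z) (edges_of (stream_out t')) \<and> card (edges_of (stream_out t')) = mu (gr n Z))" (is "ttc _ _ _ _ ?Q")
  unfolding det_com_def
proof (rule ttc_Seq[OF ttc_base])
  let ?t = "init_config n k es"
  show "safe V ?t" by (rule safe_init) (use le in auto)
  show "regs ?t 0 = n" "regs ?t 1 = k" unfolding init_config_def by auto
  show "n * n \<le> V" "(n + 1) ^ n \<le> V" using le mat by auto
  fix t1 assume t1: "safe V t1" "(\<forall>x<20. regs t1 x = (if x = 12 then n * n else if x = 11 then (n + 1) ^ n
    else if x = 5 then 32 * (n * n div k) else regs ?t x)) \<and> stream_in t1 = stream_in ?t \<and> stream_out t1 = stream_out ?t"
  have r1: "regs t1 0 = n" using t1 unfolding init_config_def by auto
  show "ttc \<epsilon> V (Seq (asg 7 (op Add (vr 0) (kn 1))) (Seq (asg 10 (op Mul (kn 32) (vr 0))) core_com)) t1 ?Q"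
  proof (rule Seq_asg[OF t1(1)])
    show "ev (regs t1) 20 (op Add (vr 0) (kn 1)) (n + 1)"
      by (rule ev_op[OF ev_reg[OF _ r1] ev_const]) (use le in auto)
    fix t2 assume t2: "safe V t2" "\<And>x. x < 20 \<Longrightarrow> regs t2 x = (if x = 7 then n + 1 else regs t1 x)"
      "stream_in t2 = stream_in t1" "stream_out t2 = stream_out t1"
    have r2: "regs t2 0 = n" using t2 r1 by auto
    show "ttc \<epsilon> V (Seq (asg 10 (op Mul (kn 32) (vr 0))) core_com) t2 ?Q"
    proof (rule Seq_asg[OF t2(1)])
      show "ev (regs t2) 20 (op Mul (kn 32) (vr 0)) (32 * n)"
        by (rule ev_op[OF ev_const ev_reg[OF _ r2]]) (use le in auto)
      fix t3 assume t3: "safe V t3" "\<And>x. x < 20 \<Longrightarrow> regs t3 x = (if x = 10 then 32 * n else regs t2 x)"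
        "stream_in t3 = stream_in t2" "stream_out t3 = stream_out t2"
      show "ttc \<epsilon> V core_com t3 ?Q"
      proof (rule ttc_core[OF t3(1)])
        show "env t3" unfolding env_def using t1(2) t2(2) t3(2) p unfolding init_config_def by simp
        show "regs t3 2 = 0" "regs t3 3 = 0" "regs t3 4 = 0" using t1(2) t2(2) t3(2) unfolding init_config_def by simp_all
        show "stream_in t3 = es" "stream_out t3 = []" using t1(2) t2 t3 unfolding init_config_def by simp_all
      qed (use edges le in auto)
    qed simp
  qed simp
qed (use le in auto)

text \<open>The stream has ended, so \<open>Y = {}\<close>; at the hashed levels a matching in the
  image of \<open>Z\<close> is lifted back by \<open>mu_himg_le\<close>.\<close>

lemma faithful_0:
  assumes "faithful \<epsilon> n k s s0 M H X T Z r"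
  shows "min (mu (gr n T)) (s + 1) \<le> mu (gr n Z)" "mu (gr n T) \<le> mu (gr n Z) + r * qq \<epsilon> n k X 0" "gr n Z \<subseteq> gr n T"
    "i \<le> n \<Longrightarrow> level s0 M i \<Longrightarrow> mu (himg (hv M H i) (gr n T)) \<le> mu (gr n Z) + r * qq \<epsilon> n k X i"
proof -
  have f: "Z \<subseteq> T" "T \<subseteq> arcs n" and a: "min (mu (gr n (T \<union> {}))) (s + 1) \<le> mu (gr n (Z \<union> {}))"
    "\<And>i. i \<le> n \<Longrightarrow> level s0 M i \<Longrightarrow> mu (himg (hv M H i) (gr n (T \<union> {}))) \<le> mu (himg (hv M H i) (gr n (Z \<union> {}))) + r * qq \<epsilon> n k X i"
    using assms empty_subsetI[of "arcs n"] unfolding faithful_def by blast+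
  have g: "graph_on {..<n} (gr n T)" "graph_on {..<n} (gr n Z)" using f by (auto intro!: gr_graph_on)
  show "min (mu (gr n T)) (s + 1) \<le> mu (gr n Z)" using a(1) by simp
  show "mu (gr n T) \<le> mu (gr n Z) + r * qq \<epsilon> n k X 0"
    using a(2)[of 0] himg_hv_0[OF g(1)] himg_hv_0[OF g(2)] unfolding level_def by simp
  show "gr n Z \<subseteq> gr n T" using f(1) unfolding gr_def by (rule image_mono)
  assume i: "i \<le> n" "level s0 M i"
  have "mu (himg (hv M H i) (gr n Z)) \<le> mu (gr n Z)" using graph_on_finite[OF _ g(2)] by (intro mu_himg_le) simp
  then show "mu (himg (hv M H i) (gr n T)) \<le> mu (gr n Z) + r * qq \<epsilon> n k X i" using a(2)[OF i] by simp
qed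

text \<open>There are at most \<open>k / 32\<close> rounds with an error of at most
  \<open>32 * \<epsilon> * n / k\<close> each.\<close>

lemma det_loss:
  assumes nk: "1 \<le> k" "k \<le> n" and \<epsilon>: "0 < \<epsilon>" and f: "faithful \<epsilon> n k s s0 M H (32 * n) T Z r"
    and r: "r * (32 * (n * n div k)) \<le> l" "2 * l \<le> n * n"
  shows "real (mu (gr n T)) - \<epsilon> * n \<le> mu (gr n Z)"
proof -
  let ?q = "qq \<epsilon> n k (32 * n) 0"
  have n: "1 \<le> n" using nk by simp
  have "real r \<le> k / 32" using rounds_le[OF nk _ refl r] by simp
  moreover have "real ?q \<le> 32 * \<epsilon> * n / k" using qq_le[OF nk(1) n \<epsilon>, of "32 * n" 0] n unfolding lev_def by (simp add: mult.assoc mult.left_commute)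
  ultimately have "real r * real ?q \<le> (k / 32) * (32 * \<epsilon> * n / k)" by (intro mult_mono) auto
  also have "\<dots> = \<epsilon> * n" using nk by simp
  finally have "real (r * ?q) \<le> \<epsilon> * n" by simp
  moreover have "real (mu (gr n T)) \<le> real (mu (gr n Z) + r * ?q)" using faithful_0(2)[OF f] by (rule of_nat_mono)
  ultimately show ?thesis by simp
qed

lemma log_k\<epsilon>: "1 \<le> k \<Longrightarrow> 0 < \<epsilon> \<Longrightarrow> \<epsilon> < 1 / 100 \<Longrightarrow> 1 \<le> log 2 (real k / \<epsilon>)"
proof -
  assume h: "1 \<le> k" "0 < \<epsilon>" "\<epsilon> < 1 / 100"
  have "2 * \<epsilon> \<le> real k" using h by linarith
  then have "2 \<le> real k / \<epsilon>" using h by (simp add: le_divide_eq)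
  then show ?thesis by (subst le_log_iff) auto
qed

lemma RS_L1:
  fixes K :: real
  assumes "R = real (RS n \<beta>)" "1 \<le> K" "0 < K * R"
  shows "1 \<le> log 2 (real n^2 / R) \<and> log 2 (real n^2 / (K * R) + 2) \<le> 2 * log 2 (real n^2 / R)"
proof -
  have R: "0 < R" using assms by (simp add: zero_less_mult_iff)
  have "R \<le> K * R" using mult_right_mono[OF assms(2), of R] R by simp
  then show ?thesis using RS_log[OF assms(1)] R by blast
qed

lemma RS_L0: "R = real (RS n \<beta>) \<Longrightarrow> 0 \<le> R * log 2 (real n^2 / R)"
  using RS_L1[of R n \<beta> 1] by (cases "R = 0") auto

theorem deterministic:
  assumes nk: "1 \<le> k" "k \<le> n" and \<epsilon>: "0 < \<epsilon>" "\<epsilon> < 1 / 100" and E: "simple_graph n E" "edge_stream E es"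
    and R: "R = real (RS n (\<epsilon> / (16 * real k)))" and a: "a = tau det_com * (32 + 30) + 4"
  shows "\<forall>r \<in> set_pmf (run det_com n k \<epsilon> es (exp_time a n)). matching E (output_edges r) \<and>
      real (card (output_edges r)) \<ge> real (mu E) - \<epsilon> * real n" (is ?A)
    "halts_within det_com n k \<epsilon> es (exp_time a n)" (is ?B)
    "space_within det_com n k \<epsilon> es (real (23400 * (maxreg det_com + 2)) * (real n^2 / real k * lg (real k)
       + R * log 2 (real n^2 / R) * lg (real k) * log 2 (real k / \<epsilon>)))" (is ?C)
proof -
  define L where "L = log 2 (real k / \<epsilon>)"
  define L1 where "L1 = log 2 (real n^2 / R)"
  define b where "b = 32 * (n * n div k)"
  \<comment> \<open>The factor \<open>16\<close> pays for the kernel with \<open>s = 0\<close>;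
    \<open>log_VV\<close> asks for at least \<open>n\<^sup>2 / k\<close>.\<close>
  define m1 where "m1 = 16 * (real n^2 / k)"
  define m2 where "m2 = (1300 * L) * R"
  define mb where "mb = min (n * n) (nat \<lceil>real b\<rceil>)"
  define mz where "mz = min (n * n) (nat \<lceil>m1 + m2\<rceil>)"
  define V where "V = VV 32 n mb mz"
  have n: "1 \<le> n" using nk by simp
  have L: "1 \<le> L" unfolding L_def using log_k\<epsilon> nk \<epsilon> by auto
  have R0: "0 \<le> R" unfolding R by simp
  have m2: "0 \<le> m2" unfolding m2_def using L R0 by simp
  have nk1: "1 \<le> real n^2 / k"
  proof -
    have "real k \<le> real n * 1" using nk by simp
    also have "\<dots> \<le> real n * real n" using n by (intro mult_left_mono) auto
    finally show ?thesis using nk by (simp add: power2_eq_square)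
  qed
  have kn: "k \<le> n * n" using mult_le_mono[of 1 n k n] nk by simp
  have d1: "1 \<le> n * n div k" using div_le_mono[OF kn, of k] nk by simp
  have b1: "1 \<le> b" unfolding b_def using d1 by linarith
  have mbz: "1 \<le> mb" "mb \<le> n * n" "1 \<le> mz" "mz \<le> n * n"
  proof -
    have "1 \<le> nat \<lceil>m1 + m2\<rceil>" "1 \<le> nat \<lceil>real b\<rceil>" using nk1 m2 b1 unfolding m1_def by linarith+
    moreover have "1 \<le> n * n" using n by simp
    ultimately show "1 \<le> mb" "mb \<le> n * n" "1 \<le> mz" "mz \<le> n * n" unfolding mb_def mz_def by auto
  qed
  note es = stream_facts[OF E]
  have poly: "x \<le> V" if "x \<le> c' * (n + 1) ^ j" "c' \<le> 32" "j \<le> 9" for x c' j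
    unfolding V_def using that by (intro VV_poly[OF n]) auto
  have le: "n < V" "k \<le> V" "32 \<le> V" "32 * (n * n) \<le> V" "32 * n \<le> V" "length es < V" "(n * n + 2) * (n * n + 2) \<le> V" "n * (32 * n) \<le> V"
  proof -
    have "n + 1 \<le> V" by (rule poly[of _ 1 1]) auto
    then show "n < V" "k \<le> V" using nk by auto
    show "32 \<le> V" by (rule poly[of _ 32 0]) auto
    show "32 * (n * n) \<le> V" by (rule poly[of _ 32 2]) (auto simp: power2_eq_square)
    then show "n * (32 * n) \<le> V" by (simp add: algebra_simps)
    show "32 * n \<le> V" by (rule poly[of _ 32 1]) auto
    have "length es + 1 \<le> V" by (rule poly[of _ 1 2]) (use es(4) in \<open>auto simp: power2_eq_square\<close>)
    then show "length es < V" by simp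
    have "n * n + 2 \<le> 2 * (n + 1)^2" by (simp add: power2_eq_square)
    then have "(n * n + 2) * (n * n + 2) \<le> (2 * (n + 1)^2) * (2 * (n + 1)^2)" by (intro mult_mono) auto
    also have "(2 * N^2) * (2 * N^2) = 4 * N ^ 4" for N :: nat by (simp add: power4_eq_xxxx power2_eq_square)
    finally show "(n * n + 2) * (n * n + 2) \<le> V" by (rule poly) auto
  qed
  have "b \<le> 32 * (n * n)" unfolding b_def by (intro mult_left_mono) auto
  then have bV: "b \<le> V" using le(4) by linarith
  have core: "core \<epsilon> V n k b 0 (n + 1) 0 0 (32 * n)"
  proof (rule core_intro[OF nk _ _ _ b1])
    show "\<epsilon> \<le> 1" using \<epsilon> by simp
    show "1 \<le> m1 + m2" using nk1 m2 unfolding m1_def by simp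
    show "V = VV 32 n (min (n * n) (nat \<lceil>real b\<rceil>)) (min (n * n) (nat \<lceil>m1 + m2\<rceil>))" unfolding V_def mb_def mz_def ..
    fix Z assume Z: "Z \<subseteq> arcs n"
    \<comment> \<open>\<open>M = 0\<close> is divisible by everything, so it is the threshold
      \<open>n + 1\<close> that excludes the levels from \<open>1\<close> to
      \<open>n\<close>.\<close>
    have lv: "i = 0" if "i \<le> n" "level (n + 1) 0 i" for i using that unfolding level_def by auto
    then have "{i. i \<le> n \<and> level (n + 1) 0 i} = {0}" unfolding level_def by auto
    then have c: "real (card {i. i \<le> n \<and> level (n + 1) 0 i}) = 1" by simp
    have "lcost (lev n i) (qq \<epsilon> n k (32 * n) i) \<le> lcost n (qq \<epsilon> n k (32 * n) 0)" if "i \<le> n" "level (n + 1) 0 i" for i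
      using lv[OF that] unfolding lev_def by simp
    from goodN_exists[OF Z, where ?s0.0 = "n + 1" and M = 0 and \<epsilon> = \<epsilon> and k = k and X = "32 * n" and s = 0 and H = 0, OF this] have "\<exists>W\<subseteq>Z. goodN \<epsilon> n k 0 (n + 1) 0 0 (32 * n) W Z \<and> real (card W) \<le> 16 + lcost n (qq \<epsilon> n k (32 * n) 0)"
      unfolding c by simp
    then obtain W where W: "W \<subseteq> Z" "goodN \<epsilon> n k 0 (n + 1) 0 0 (32 * n) W Z" "real (card W) \<le> 16 + lcost n (qq \<epsilon> n k (32 * n) 0)" by blast
    have "real (card W) \<le> m1 + m2"
    proof (cases "2 \<le> n")
      case True
      show ?thesis using W(3) lcost_det[OF nk True \<epsilon>] nk1 unfolding m1_def m2_def L_def R by (simp add: mult.commute mult.left_commute)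
    next
      \<comment> \<open>For \<open>n = 1\<close> there is no RS graph, but also no edge to
        store.\<close>
      case False
      then have "n = 1" using n by simp
      then have "arcs n = {}" unfolding arcs_def by auto
      then have "W = {}" using W Z by auto
      then show ?thesis using nk1 m2 unfolding m1_def by simp
    qed
    then show "\<exists>W\<subseteq>Z. goodN \<epsilon> n k 0 (n + 1) 0 0 (32 * n) W Z \<and> real (card W) \<le> m1 + m2" using W by blast
  qed (use le bV in auto)
  note t = core.ttc_det[OF core refl refl refl refl refl b_def le(1-6) es(1)]
  have T: "(V + 2) ^ tau det_com \<le> exp_time a n" unfolding V_def a by (rule VV_time[OF n _ mbz]) simp
  have V1: "1 \<le> V" using le(1) by simp
  show ?B by (rule finish(1)[OF t T V1])
  show ?A
  proof
    fix p assume p: "p \<in> set_pmf (run det_com n k \<epsilon> es (exp_time a n))"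
    obtain Z r where Z: "faithful \<epsilon> n k 0 (n + 1) 0 0 (32 * n) (arcset n es) Z r" "r * b \<le> length es"
      "matching (gr n Z) (output_edges p)" "card (output_edges p) = mu (gr n Z)"
      using finish(2)[OF t T V1 p] unfolding output_edges_def by blast
    have "matching E (output_edges p)" using Z(3) faithful_0(3)[OF Z(1)] es(2) unfolding matching_def by auto
    moreover have "real (mu E) - \<epsilon> * n \<le> mu (gr n Z)" using det_loss[OF nk \<epsilon>(1) Z(1) Z(2)[unfolded b_def] es(4)] es(2) by simp
    ultimately show "matching E (output_edges p) \<and> real (card (output_edges p)) \<ge> real (mu E) - \<epsilon> * real n" using Z(4) by simp
  qed
  show ?C
  proof (rule finish(3)[OF t T V1])
    let ?U = "real n^2 / k * lg k"
    have "log 2 V + 1 \<le> (70 + 18 * real 32 + log 2 (real 32)) * ?U + 18 * (m1 * lg k + m2 * L1)"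
      unfolding V_def
    proof (rule log_VV[OF nk _ b_def _ _ m2 _ mb_def mz_def])
      show "real n^2 / k \<le> m1" unfolding m1_def using nk1 by linarith
      show "1 \<le> L1 \<and> log 2 (real n^2 / m2 + 2) \<le> 2 * L1" if "0 < m2"
        using RS_L1[OF R, of "1300 * L"] that L unfolding m2_def L1_def by simp
    qed simp_all
    also have "log 2 (real 32) = 5" using log_pow_cancel[of 2 5] by simp
    \<comment> \<open>\<open>939 = 70 + 576 + 5 + 288\<close>, and
      \<open>23400 = 18 * 1300\<close>.\<close>
    also have "(70 + 18 * real 32 + 5) * ?U + 18 * (m1 * lg k + m2 * L1) = 939 * ?U + 23400 * (R * L1 * L)"
      unfolding m1_def m2_def by (simp add: algebra_simps)
    also have "\<dots> \<le> 23400 * ?U + 23400 * (R * L1 * L * lg k)"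
    proof -
      have "0 \<le> R * L1 * L" using RS_L0[OF R] L unfolding L1_def by simp
      then have "R * L1 * L * 1 \<le> R * L1 * L * lg k" using lg1(1)[of k] by (intro mult_left_mono) auto
      moreover have "0 \<le> ?U" using nk1 lg1(1)[of k] by simp
      ultimately show ?thesis by simp
    qed
    finally have "log 2 V + 1 \<le> 23400 * (?U + R * L1 * lg k * L)" by (simp add: algebra_simps)
    then have "real (maxreg det_com + 2) * (log 2 V + 1) \<le> real (maxreg det_com + 2) * (23400 * (?U + R * L1 * lg k * L))"
      by (rule mult_left_mono) simp
    then show "real (maxreg det_com + 2) * (log 2 V + 1) \<le> real (23400 * (maxreg det_com + 2)) * (?U + R * log 2 (real n^2 / R) * lg k * log 2 (k / \<epsilon>))"
      unfolding L1_def L_def by (simp only: of_nat_mult of_nat_numeral ac_simps)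
  qed
qed


section \<open>The randomized algorithm\<close>

lemma bits_lg: assumes "1 \<le> k" shows "lg k \<le> bits k" "real (bits k) \<le> 2 * lg k"
proof -
  have "real k \<le> 2 ^ bits k" using bits(1)[of k] by (metis less_imp_le of_nat_le_iff of_nat_numeral of_nat_power)
  then have "log 2 k \<le> log 2 (2 ^ bits k)" using assms by (subst log_le_cancel_iff) auto
  then have "log 2 k \<le> bits k" by simp
  then show "lg k \<le> bits k" using bits(5)[OF assms] unfolding lg_def by simp
  have "real (2 ^ bits k) \<le> real (2 * k)" using bits(4)[OF assms] by (rule of_nat_mono)
  then have "log 2 (2 ^ bits k) \<le> log 2 (2 * real k)" using assms by (subst log_le_cancel_iff) auto
  also have "\<dots> = 1 + log 2 k" using assms by (simp add: log_mult_pos)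
  finally show "real (bits k) \<le> 2 * lg k" using lg1[of k] by simp
qed

lemma two_power_between:
  fixes x :: real assumes "1 \<le> x" obtains l :: nat where "x \<le> 2 ^ l" "2 ^ l < 2 * x"
proof -
  obtain N :: nat where N: "x < 2 ^ N" using real_arch_pow[of 2 x] by auto
  define l where "l = (LEAST l::nat. x \<le> 2 ^ l)"
  have l: "x \<le> 2 ^ l" unfolding l_def by (rule LeastI[of _ N]) (use N in simp)
  have "2 ^ l < 2 * x"
  proof (cases l)
    case (Suc j)
    then have "\<not> x \<le> 2 ^ j" using not_less_Least[of j "\<lambda>l. x \<le> 2 ^ l"] unfolding l_def by simp
    then show ?thesis using Suc by simp
  qed (use assms in simp)
  then show ?thesis using that l by blast
qed

text \<open>At most \<open>k / 128\<close> rounds, each with an error of at most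
  \<open>\<epsilon>\<^sup>2 * lev n i / k\<close>. The constant \<open>128\<close> makes the total
  at most \<open>\<epsilon> * \<mu> / 2\<close> for a level of size at most
  \<open>64 * \<mu> / \<epsilon>\<close>.\<close>

lemma loss_le:
  assumes nk: "1 \<le> k" "k \<le> n" and \<epsilon>: "0 < \<epsilon>" and r: "r * (128 * (n * n div k)) \<le> l" "2 * l \<le> n * n"
  shows "real (r * qq \<epsilon> n k (nat \<lfloor>\<epsilon> * n\<rfloor>) i) \<le> \<epsilon>^2 * lev n i / 128"
proof -
  let ?X = "nat \<lfloor>\<epsilon> * n\<rfloor>"
  have n: "1 \<le> n" using nk by simp
  have X: "real ?X \<le> \<epsilon> * n" using \<epsilon> by (simp add: of_nat_nat)
  have "real (lev n i) * ?X / n \<le> real (lev n i) * (\<epsilon> * n) / n" using X by (intro divide_right_mono mult_left_mono) auto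
  also have "\<dots> = lev n i * \<epsilon>" using n by simp
  finally have "\<epsilon> * (real (lev n i) * ?X / n) / k \<le> \<epsilon> * (lev n i * \<epsilon>) / k" using \<epsilon> by (intro divide_right_mono mult_left_mono) auto
  then have "real (qq \<epsilon> n k ?X i) \<le> \<epsilon> * (lev n i * \<epsilon>) / k" using qq_le[OF nk(1) n \<epsilon>, of ?X i] by linarith
  moreover have "real r \<le> k / 128" using rounds_le[OF nk _ refl r] by simp
  ultimately have "real r * real (qq \<epsilon> n k ?X i) \<le> (k / 128) * (\<epsilon> * (lev n i * \<epsilon>) / k)" by (intro mult_mono) auto
  also have "\<dots> = \<epsilon>^2 * lev n i / 128" using nk by (simp add: power2_eq_square)
  finally show ?thesis by simp
qed

text \<open>A collision of two matched vertices under the hash function loses an edge of the matching.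
  Either the matching is so small that the kernel preserves it, or so large that the loss
  without hashing is negligible, or there is a power of two \<open>i\<close> between \<open>32 \<mu> / \<epsilon>\<close> and \<open>64 \<mu> / \<epsilon>\<close> such
  that hashing to \<open>i\<close> values loses few edges.\<close>

lemma few_bad_seeds:
  fixes c \<epsilon> :: real
  assumes nk: "1 \<le> k" "k \<le> n" and \<epsilon>: "0 < \<epsilon>" "\<epsilon> \<le> 1" and c: "c \<le> Cs" "0 < c" and T: "T \<subseteq> arcs n" and l: "2 * l \<le> n * n"
    and s: "s = svl Cs n k" and M: "M = 2 ^ bits n"
  shows "real (card {H. H < M ^ n \<and> \<not> (\<forall>Z r. faithful \<epsilon> n k s s M H (nat \<lfloor>\<epsilon> * n\<rfloor>) T Z r \<and> r * (128 * (n * n div k)) \<le> l \<longrightarrow>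
      (1 - \<epsilon>) * mu (gr n T) \<le> mu (gr n Z))}) \<le> 1 / real n powr c * M ^ n"
proof -
  let ?X = "nat \<lfloor>\<epsilon> * n\<rfloor>" and ?\<mu> = "mu (gr n T)"
  let ?G = "\<lambda>H. \<forall>Z r. faithful \<epsilon> n k s s M H ?X T Z r \<and> r * (128 * (n * n div k)) \<le> l \<longrightarrow> (1 - \<epsilon>) * ?\<mu> \<le> mu (gr n Z)"
  have n: "1 \<le> n" using nk by simp
  have rhs: "0 \<le> 1 / real n powr c * M ^ n" by simp
  have e0: "(1 - \<epsilon>) * x \<le> x" if "0 \<le> x" for x using that \<epsilon> by (simp add: algebra_simps)
  show ?thesis
  \<comment> \<open>In these two cases every seed succeeds: the kernel is exact up to
    \<open>s\<close>, and for \<open>n < 64 * \<mu> / \<epsilon>\<close> the loss at level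
    \<open>0\<close> is at most \<open>\<epsilon> * \<mu>\<close>.\<close>
  proof (cases "?\<mu> \<le> s \<or> n < 64 * ?\<mu> / \<epsilon>")
    case True
    have "?G H" for H
    proof (intro allI impI, elim conjE)
      fix Z r assume f: "faithful \<epsilon> n k s s M H ?X T Z r" and r: "r * (128 * (n * n div k)) \<le> l"
      from True show "(1 - \<epsilon>) * ?\<mu> \<le> mu (gr n Z)"
      proof
        assume "?\<mu> \<le> s"
        then have "?\<mu> \<le> mu (gr n Z)" using faithful_0(1)[OF f] by simp
        then show ?thesis using e0[of ?\<mu>] by linarith
      next
        assume "n < 64 * ?\<mu> / \<epsilon>"
        then have "n * \<epsilon> \<le> 64 * ?\<mu>" using \<epsilon> by (simp add: less_divide_eq)
        then have "\<epsilon> * (n * \<epsilon>) \<le> \<epsilon> * (64 * ?\<mu>)" using \<epsilon> by (intro mult_left_mono) auto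
        then have "\<epsilon>^2 * lev n 0 / 128 \<le> \<epsilon> * ?\<mu>" using \<epsilon> unfolding lev_def by (simp add: power2_eq_square mult_ac)
        moreover have "real ?\<mu> \<le> real (mu (gr n Z) + r * qq \<epsilon> n k ?X 0)" using faithful_0(2)[OF f] by (rule of_nat_mono)
        ultimately show ?thesis using loss_le[OF nk \<epsilon>(1) r l, of 0] by (simp add: algebra_simps)
      qed
    qed
    then show ?thesis using rhs by simp
  next
    case False
    then have \<mu>: "s < ?\<mu>" "64 * ?\<mu> / \<epsilon> \<le> n" by auto
    have "1 * 1 \<le> 32 * ?\<mu> / \<epsilon>" using \<mu>(1) \<epsilon> by (simp add: le_divide_eq)
    then obtain j where j: "32 * ?\<mu> / \<epsilon> \<le> 2 ^ j" "2 ^ j < 2 * (32 * ?\<mu> / \<epsilon>)" using two_power_between[of "32 * ?\<mu> / \<epsilon>"] by auto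
    define i :: nat where "i = 2 ^ j"
    have i: "32 * ?\<mu> / \<epsilon> \<le> i" "i * \<epsilon> \<le> 64 * ?\<mu>" "i \<le> n" "0 < i"
    proof -
      show "32 * ?\<mu> / \<epsilon> \<le> i" using j(1) unfolding i_def by simp
      have lt: "real i < 64 * ?\<mu> / \<epsilon>" using j(2) unfolding i_def by simp
      then show "i * \<epsilon> \<le> 64 * ?\<mu>" using \<epsilon> by (simp add: less_divide_eq)
      show "i \<le> n" using lt \<mu>(2) by linarith
      show "0 < i" unfolding i_def by simp
    qed
    have "(2::nat) ^ j < 2 ^ bits n" using i(3) bits(1)[of n] unfolding i_def by linarith
    then have iM: "i dvd M" unfolding i_def M by (intro le_imp_power_dvd) (simp add: less_imp_le)
    have "real ?\<mu> * 1 \<le> real i"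
    proof -
      have "real ?\<mu> * \<epsilon> \<le> 32 * ?\<mu>" using \<epsilon> mult_left_mono[OF \<epsilon>(2), of "real ?\<mu>"] by simp
      then have "real ?\<mu> \<le> 32 * ?\<mu> / \<epsilon>" using \<epsilon> by (simp add: le_divide_eq)
      then show ?thesis using i(1) by linarith
    qed
    then have lv: "level s M i" using \<mu>(1) iM unfolding level_def by auto
    have gT: "graph_on {..<n} (gr n T)" by (rule gr_graph_on[OF T])
    obtain N where N: "matching (gr n T) N" "card N = ?\<mu>" using mu_attained[OF graph_on_finite[OF _ gT]] by auto
    define W where "W = \<Union>N"
    have W: "W \<subseteq> {..<n}" using N gT unfolding W_def matching_def graph_on_def by auto
    have fW: "finite W" using W finite_subset by blast
    have cW: "card W = 2 * ?\<mu>" unfolding W_def using card_Union_matching[OF gT _ N(1)] N(2) by simp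
    have "{H. H < M ^ n \<and> \<not> ?G H} \<subseteq> {H. H < M ^ n \<and> \<epsilon> * ?\<mu> / 2 < card (bad (hv M H i) W)}"
    proof
      fix H assume "H \<in> {H. H < M ^ n \<and> \<not> ?G H}"
      then have H: "H < M ^ n" "\<not> ?G H" by blast+
      have "\<epsilon> * ?\<mu> / 2 < card (bad (hv M H i) W)"
      proof (rule ccontr)
        assume b: "\<not> \<epsilon> * ?\<mu> / 2 < card (bad (hv M H i) W)"
        \<comment> \<open>A seed with few collisions is good: half of the permitted loss
          \<open>\<epsilon> * \<mu>\<close> is left to collisions and the other half to the
          rounds.\<close>
        have "?G H"
        proof (intro allI impI, elim conjE)
          fix Z r assume f: "faithful \<epsilon> n k s s M H ?X T Z r" and r: "r * (128 * (n * n div k)) \<le> l"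
          have "?\<mu> \<le> mu (himg (hv M H i) (gr n T)) + card (bad (hv M H i) W)"
            using mu_himg_ge[OF gT _ N(1), of "hv M H i"] N(2) unfolding W_def by simp
          also have "mu (himg (hv M H i) (gr n T)) \<le> mu (gr n Z) + r * qq \<epsilon> n k ?X i" by (rule faithful_0(4)[OF f i(3) lv])
          finally have "?\<mu> \<le> mu (gr n Z) + r * qq \<epsilon> n k ?X i + card (bad (hv M H i) W)" by simp
          from of_nat_mono[OF this] have "real ?\<mu> \<le> mu (gr n Z) + real (r * qq \<epsilon> n k ?X i) + card (bad (hv M H i) W)"
            by (simp only: of_nat_add)
          moreover have "real (r * qq \<epsilon> n k ?X i) \<le> \<epsilon> * ?\<mu> / 2"
          proof -
            have "\<epsilon> * (i * \<epsilon>) \<le> \<epsilon> * (64 * ?\<mu>)" using i(2) \<epsilon> by (intro mult_left_mono) auto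
            then have "\<epsilon>^2 * lev n i / 128 \<le> \<epsilon> * ?\<mu> / 2" using i(4) unfolding lev_def by (simp add: power2_eq_square mult_ac)
            then show ?thesis using loss_le[OF nk \<epsilon>(1) r l, of i] by linarith
          qed
          ultimately show "(1 - \<epsilon>) * ?\<mu> \<le> mu (gr n Z)" using b by (simp add: algebra_simps)
        qed
        then show False using H(2) by blast
      qed
      then show "H \<in> {H. H < M ^ n \<and> \<epsilon> * ?\<mu> / 2 < card (bad (hv M H i) W)}" using H(1) by simp
    qed
    then have "card {H. H < M ^ n \<and> \<not> ?G H} \<le> card {H. H < M ^ n \<and> \<epsilon> * ?\<mu> / 2 < card (bad (hv M H i) W)}"
      by (rule card_mono[rotated]) simp
    then have "real (card {H. H < M ^ n \<and> \<not> ?G H}) \<le> real (card {H. H < M ^ n \<and> \<epsilon> * ?\<mu> / 2 < card (bad (hv M H i) W)})" by (rule of_nat_mono)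
    also have "\<dots> \<le> exp (- (\<epsilon> * ?\<mu> / 5)) * M ^ n"
      using hash_failure[OF fW W cW \<epsilon> i(4) iM _ i(1)] unfolding M by simp
    also have "\<dots> \<le> 1 / real n powr c * M ^ n"
    proof (rule mult_right_mono)
      \<comment> \<open>From \<open>64 * \<mu> \<le> \<epsilon> * n\<close> follows
        \<open>\<epsilon> * \<mu> \<ge> 64 * \<mu>\<^sup>2 / n\<close>. As \<open>\<mu> > s\<close>,
        this is at least \<open>64 * Cs * (n / k) * bits k\<close>, which is at least
        \<open>16 * c * ln n\<close> by \<open>nlogn_le\<close>.\<close>
      have "5 * (c * ln n) \<le> \<epsilon> * ?\<mu>"
      proof -
        have "64 * real ?\<mu> \<le> \<epsilon> * n" using \<mu>(2) \<epsilon> by (simp add: divide_le_eq mult.commute)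
        then have "64 * real ?\<mu> * ?\<mu> \<le> \<epsilon> * n * ?\<mu>" by (rule mult_right_mono) simp
        then have 1: "64 * (real ?\<mu> * ?\<mu>) \<le> n * (\<epsilon> * ?\<mu>)" by (simp only: mult_ac)
        have "k * s * s \<le> k * ?\<mu> * ?\<mu>" using \<mu>(1) by (intro mult_mono) auto
        then have "Cs * (n * n) * bits k \<le> k * ?\<mu> * ?\<mu>" using svl(1)[OF nk(1), of Cs n] unfolding s by linarith
        then have "real (Cs * (n * n) * bits k) \<le> real (k * ?\<mu> * ?\<mu>)" by (rule of_nat_mono)
        then have 2: "real Cs * (real n * real n) * bits k \<le> k * (real ?\<mu> * ?\<mu>)" by (simp add: mult.assoc)
        have "n * (64 * (Cs * (n * real (bits k)))) \<le> n * (k * (\<epsilon> * ?\<mu>))"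
        proof -
          have "n * (64 * (Cs * (n * real (bits k)))) = 64 * (real Cs * (real n * real n) * bits k)" by (simp add: mult_ac)
          also have "\<dots> \<le> k * (64 * (real ?\<mu> * ?\<mu>))" using 2 by simp
          also have "\<dots> \<le> k * (n * (\<epsilon> * ?\<mu>))" using 1 by (intro mult_left_mono) auto
          finally show ?thesis by (simp add: mult_ac)
        qed
        then have "64 * (Cs * (n * real (bits k))) \<le> k * (\<epsilon> * ?\<mu>)" using n by (simp add: mult_le_cancel_left)
        then have 3: "64 * (Cs * (real n / k * bits k)) \<le> \<epsilon> * ?\<mu>" using nk by (simp add: field_simps)
        have "ln (real n) \<le> log 2 (real n + 1)"
        proof -
          have "ln (real n) \<le> ln (real n + 1)" using n by simp
          also have "\<dots> \<le> ln (real n + 1) / ln 2" using ln_2_less_1 n by (simp add: le_divide_eq mult_left_le)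
          finally show ?thesis unfolding log_def .
        qed
        also have "\<dots> \<le> 4 * (real n / k) * lg k" by (rule nlogn_le[OF nk])
        also have "\<dots> \<le> 4 * (real n / k) * bits k" using bits_lg(1)[OF nk(1)] by (intro mult_left_mono) auto
        finally have "ln (real n) \<le> 4 * (real n / k) * bits k" .
        then have "c * ln n \<le> Cs * (4 * (real n / k) * bits k)" using c n by (intro mult_mono) auto
        then have "c * ln n \<le> 4 * (Cs * (real n / k * bits k))" by (simp only: mult_ac)
        moreover have "0 \<le> Cs * (real n / k * bits k)" by simp
        moreover have "5 * x \<le> z" if "x \<le> 4 * y" "0 \<le> y" "64 * y \<le> z" for x y z :: real using that by linarith
        ultimately show ?thesis using 3 by blast
      qed
      then have "exp (- (\<epsilon> * ?\<mu> / 5)) \<le> exp (- (c * ln n))" by simp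
      also have "\<dots> = 1 / real n powr c" using n by (simp add: powr_def exp_minus field_simps)
      finally show "exp (- (\<epsilon> * ?\<mu> / 5)) \<le> 1 / real n powr c" .
    qed simp
    finally show ?thesis by simp
  qed
qed


section \<open>Runs of the randomized program\<close>

definition ready :: "nat \<Rightarrow> nat \<Rightarrow> nat \<Rightarrow> real \<Rightarrow> (nat \<times> nat) list \<Rightarrow> config \<Rightarrow> bool" where
  "ready Cs n k \<epsilon> es t \<longleftrightarrow> regs t 0 = n \<and> regs t 1 = k \<and> regs t 2 = 0 \<and> regs t 3 = 0 \<and> regs t 4 = 0 \<and>
     regs t 5 = 128 * (n * n div k) \<and> regs t 6 = svl Cs n k \<and> regs t 7 = svl Cs n k \<and> regs t 8 = 2 ^ bits n \<and>
     regs t 10 = nat \<lfloor>\<epsilon> * n\<rfloor> \<and> regs t 11 = (n + 1) ^ n \<and> regs t 12 = n * n \<and> stream_in t = es \<and> stream_out t = []"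

lemma ready_same: "ready Cs n k \<epsilon> es t \<Longrightarrow> same t t' \<Longrightarrow> ready Cs n k \<epsilon> es t'"
  unfolding ready_def same_def by auto

context machine
begin

lemma ttc_ready:
  assumes nk: "1 \<le> k" "1 \<le> n"
    and le: "n * n \<le> V" "(n + 1) ^ n \<le> V" "128 \<le> V" "128 * (n * n) \<le> V" "n < V" "2 * k \<le> V" "2 * n \<le> V" "Cs \<le> V"
      "Cs * (n * n) \<le> V" "Cs * (n * n) * bits k \<le> V" "k * svl Cs n k * svl Cs n k \<le> V" "n * bits n \<le> V"
  shows "ttc \<epsilon> V (Seq (base_com 128) (param_com Cs)) (init_config n k es)
    (\<lambda>t. ready Cs n k \<epsilon> es t \<and> regs t 9 = 0 \<and> regs t 19 = n * bits n)"
proof (rule ttc_Seq[OF ttc_base])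
  let ?t = "init_config n k es"
  show "safe V ?t" by (rule safe_init) (use le in auto)
  show "regs ?t 0 = n" "regs ?t 1 = k" unfolding init_config_def by auto
  fix t1 assume t1: "safe V t1" "(\<forall>x<20. regs t1 x = (if x = 12 then n * n else if x = 11 then (n + 1) ^ n
    else if x = 5 then 128 * (n * n div k) else regs ?t x)) \<and> stream_in t1 = stream_in ?t \<and> stream_out t1 = stream_out ?t"
  have r: "regs t1 0 = n" "regs t1 1 = k" "regs t1 12 = n * n" using t1(2) unfolding init_config_def by auto
  show "ttc \<epsilon> V (param_com Cs) t1 (\<lambda>t. ready Cs n k \<epsilon> es t \<and> regs t 9 = 0 \<and> regs t 19 = n * bits n)"
    by (rule ttc_weaken[OF ttc_param[OF t1(1) r nk le(6-12)]]) (use t1(2) in \<open>auto simp: ready_def init_config_def\<close>)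
qed (use le in auto)

lemma ttc_core_ready:
  assumes t: "safe V t" "ready Cs n k \<epsilon> es t"
    and core: "core \<epsilon> V n k (128 * (n * n div k)) (svl Cs n k) (svl Cs n k) (2 ^ bits n) (regs t 9) (nat \<lfloor>\<epsilon> * n\<rfloor>)"
    and edges: "\<And>u v. (u, v) \<in> set es \<Longrightarrow> u < n \<and> v < n \<and> u \<noteq> v" and len: "length es < V"
  shows "ttc \<epsilon> V core_com t (\<lambda>t'. \<exists>Z r. faithful \<epsilon> n k (svl Cs n k) (svl Cs n k) (2 ^ bits n) (regs t 9) (nat \<lfloor>\<epsilon> * n\<rfloor>) (arcset n es) Z r \<and>
     r * (128 * (n * n div k)) \<le> length es \<and> matching (gr n Z) (edges_of (stream_out t')) \<and> card (edges_of (stream_out t')) = mu (gr n Z))"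
  by (rule core.ttc_core[OF core t(1)]) (use t(2) edges len in \<open>auto simp: core.env_def[OF core] ready_def\<close>)

lemma ttc_rand:
  assumes nk: "1 \<le> k" "1 \<le> n"
    and le: "n * n \<le> V" "(n + 1) ^ n \<le> V" "128 \<le> V" "128 * (n * n) \<le> V" "n < V" "2 * k \<le> V" "2 * n \<le> V" "Cs \<le> V"
      "Cs * (n * n) \<le> V" "Cs * (n * n) * bits k \<le> V" "k * svl Cs n k * svl Cs n k \<le> V" "n * bits n \<le> V" and m: "2 ^ (n * bits n) \<le> V"
    and core: "\<And>H. H < 2 ^ (n * bits n) \<Longrightarrow> core \<epsilon> V n k (128 * (n * n div k)) (svl Cs n k) (svl Cs n k) (2 ^ bits n) H (nat \<lfloor>\<epsilon> * n\<rfloor>)"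
    and edges: "\<And>u v. (u, v) \<in> set es \<Longrightarrow> u < n \<and> v < n \<and> u \<noteq> v" and len: "length es < V"
  shows "ttc \<epsilon> V (rand_com Cs) (init_config n k es) (\<lambda>_. True)"
  unfolding rand_com_def
proof (rule ttc_Seq[OF ttc_ready[OF nk le]])
  fix t assume t: "safe V t" "ready Cs n k \<epsilon> es t \<and> regs t 9 = 0 \<and> regs t 19 = n * bits n"
  show "ttc \<epsilon> V (Seq (WhileNZ 19 flip_com) core_com) t (\<lambda>_. True)"
  proof (rule ttc_Seq[OF ttc_flips[OF t(1) _ _ m]])
    fix t' assume t': "safe V t'" "same t t' \<and> regs t' 9 < 2 ^ (n * bits n)"
    show "ttc \<epsilon> V core_com t' (\<lambda>_. True)"
      by (rule ttc_weaken[OF ttc_core_ready[OF t'(1) ready_same core edges len]]) (use t t' in auto)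
  qed (use t in auto)
qed

text \<open>All coins are tossed before the first edge is read. For each good seed the rest of the
  run is certain to succeed, so the success probability is at least the fraction of good
  seeds.\<close>

lemma rand_prob:
  fixes Good :: "nat \<Rightarrow> bool"
  assumes nk: "1 \<le> k" "1 \<le> n"
    and le: "n * n \<le> V" "(n + 1) ^ n \<le> V" "128 \<le> V" "128 * (n * n) \<le> V" "n < V" "2 * k \<le> V" "2 * n \<le> V" "Cs \<le> V"
      "Cs * (n * n) \<le> V" "Cs * (n * n) * bits k \<le> V" "k * svl Cs n k * svl Cs n k \<le> V" "n * bits n \<le> V" and m: "2 ^ (n * bits n) \<le> V"
    and core: "\<And>H. H < 2 ^ (n * bits n) \<Longrightarrow> core \<epsilon> V n k (128 * (n * n div k)) (svl Cs n k) (svl Cs n k) (2 ^ bits n) H (nat \<lfloor>\<epsilon> * n\<rfloor>)"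
    and edges: "\<And>u v. (u, v) \<in> set es \<Longrightarrow> u < n \<and> v < n \<and> u \<noteq> v" and len: "length es < V"
    and good: "\<And>H Z r s'. H < 2 ^ (n * bits n) \<Longrightarrow> Good H \<Longrightarrow>
      faithful \<epsilon> n k (svl Cs n k) (svl Cs n k) (2 ^ bits n) H (nat \<lfloor>\<epsilon> * n\<rfloor>) (arcset n es) Z r \<Longrightarrow> r * (128 * (n * n div k)) \<le> length es \<Longrightarrow>
      matching (gr n Z) (edges_of (stream_out s')) \<Longrightarrow> card (edges_of (stream_out s')) = mu (gr n Z) \<Longrightarrow> P s'"
    and T: "(V + 2) ^ (tau (rand_com Cs) + 5) \<le> T"
  shows "real (card {H. H < 2 ^ (n * bits n) \<and> Good H}) / 2 ^ (n * bits n) \<le> measure_pmf.prob (run (rand_com Cs) n k \<epsilon> es T) (halted P)"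
proof -
  let ?m = "n * bits n"
  let ?p = "Seq (base_com 128) (param_com Cs)"
  let ?T1 = "(V + 2) ^ tau ?p" and ?T2 = "11 * ?m + (2 + (V + 2) ^ tau core_com)"
  have "tc \<epsilon> V ?p (init_config n k es) ?T1 (\<lambda>t. ready Cs n k \<epsilon> es t \<and> regs t 9 = 0 \<and> regs t 19 = ?m)"
    using ttc_ready[OF nk le] unfolding ttc_def .
  then have pre: "tc \<epsilon> V ?p (init_config n k es) ?T1 (\<lambda>t. safe V t \<and> ready Cs n k \<epsilon> es t \<and> regs t 9 = 0 \<and> regs t 19 = ?m)"
    by (rule tc_weaken) auto
  have "real (card {H. H < 2 ^ ?m \<and> Good H}) / 2 ^ ?m \<le>
    measure_pmf.prob (steps \<epsilon> (Seq ?p (Seq (WhileNZ 19 flip_com) core_com)) (init_config n k es) (Suc (?T1 + ?T2))) (halted P)"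
  proof (rule tc_prefix_prob[OF pre])
    fix t assume t: "safe V t \<and> ready Cs n k \<epsilon> es t \<and> regs t 9 = 0 \<and> regs t 19 = ?m"
    have "real (card {g. g < 2 ^ ?m \<and> (\<lambda>H. H < 2 ^ ?m \<and> Good H) (0 * 2 ^ ?m + g)}) / 2 ^ ?m \<le>
      measure_pmf.prob (steps \<epsilon> (Seq (WhileNZ 19 flip_com) core_com) t ?T2) (halted P)"
    proof (rule flips_prob[where V = V and Good = "\<lambda>H. H < 2 ^ ?m \<and> Good H"])
      show "regs t 19 = ?m" "regs t 9 = 0" "safe V t" "(0 + 1) * 2 ^ ?m \<le> V" using t m by auto
      fix s' assume s': "safe V s'" "same t s'" "regs s' 9 < 2 ^ ?m \<and> Good (regs s' 9)"
      have rd: "ready Cs n k \<epsilon> es s'" using ready_same t s'(2) by blast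
      have c: "core \<epsilon> V n k (128 * (n * n div k)) (svl Cs n k) (svl Cs n k) (2 ^ bits n) (regs s' 9) (nat \<lfloor>\<epsilon> * n\<rfloor>)" using core s'(3) by blast
      have "ttc \<epsilon> V core_com s' P"
        by (rule ttc_weaken[OF ttc_core_ready[OF s'(1) rd c edges len]]) (use good s'(3) in blast)+
      then show "measure_pmf.prob (steps \<epsilon> core_com s' ((V + 2) ^ tau core_com)) (halted P) = 1"
        unfolding ttc_def by (rule tc_prob_1) auto
    qed
    then show "real (card {H. H < 2 ^ ?m \<and> Good H}) / 2 ^ ?m \<le>
      measure_pmf.prob (steps \<epsilon> (Seq (WhileNZ 19 flip_com) core_com) t ?T2) (halted P)" by simp
  qed
  also have "\<dots> \<le> measure_pmf.prob (run (rand_com Cs) n k \<epsilon> es T) (halted P)"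
  proof -
    let ?\<tau> = "tau (rand_com Cs)"
    have W: "x \<le> (V + 2) ^ ?\<tau>" if "x = (V + 2) ^ j" "j \<le> ?\<tau>" for x j using that by (auto intro: power_increasing)
    have \<tau>: "tau ?p \<le> ?\<tau>" "tau core_com \<le> ?\<tau>" "1 \<le> ?\<tau>" unfolding rand_com_def by auto
    have "?T1 \<le> (V + 2) ^ ?\<tau>" "(V + 2) ^ tau core_com \<le> (V + 2) ^ ?\<tau>" "V + 2 \<le> (V + 2) ^ ?\<tau>"
      using W[OF refl \<tau>(1)] W[OF refl \<tau>(2)] W[of _ 1] \<tau>(3) by auto
    moreover have "?m \<le> V" by (rule le)
    \<comment> \<open>The factor \<open>32 = 2 ^ 5\<close> is the origin of the \<open>5\<close>
      added to the exponent of \<open>V + 2\<close>.\<close>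
    ultimately have "Suc (?T1 + ?T2) \<le> 32 * (V + 2) ^ ?\<tau>" by linarith
    also have "\<dots> \<le> (V + 2) ^ 5 * (V + 2) ^ ?\<tau>" using power_mono[of 2 "V + 2" 5] by (intro mult_right_mono) auto
    also have "\<dots> = (V + 2) ^ (?\<tau> + 5)" by (simp only: power_add mult.commute)
    also note T
    finally have "Suc (?T1 + ?T2) \<le> T" .
    then show ?thesis unfolding run_steps rand_com_def by (rule halted_mono)
  qed
  finally show ?thesis .
qed

end

lemma card_split_below: "card {x. x < N \<and> P x} + card {x. x < N \<and> \<not> P x} = N" for N :: nat
proof -
  have "card ({x. x < N \<and> P x} \<union> {x. x < N \<and> \<not> P x}) = card {x. x < N \<and> P x} + card {x. x < N \<and> \<not> P x}"
    by (intro card_Un_disjoint) auto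
  moreover have "{x. x < N \<and> P x} \<union> {x. x < N \<and> \<not> P x} = {..<N}" by auto
  ultimately show ?thesis by simp
qed

text \<open>By minimality \<open>svl Cs n k - 1\<close> is too small, which bounds the kernel size
  from above; the passage to its successor uses
  \<open>(x + 1)\<^sup>2 \<le> 2 * (x - 1)\<^sup>2 + 8\<close>.\<close>

lemma svl_square:
  assumes "1 \<le> k" "1 \<le> n" "1 \<le> Cs"
  shows "1 \<le> svl Cs n k" "n^2 \<le> k * (svl Cs n k)^2" "16 * (real (svl Cs n k) + 1)^2 \<le> 64 * real Cs * (real n^2 / k * lg k) + 128"
proof -
  let ?s = "svl Cs n k"
  have s: "Cs * (n * n) * bits k \<le> k * ?s * ?s" by (rule svl(1)[OF assms(1)])
  have "1 * (n * n) * 1 \<le> Cs * (n * n) * bits k" using assms bits(5)[OF assms(1)] by (intro mult_mono) auto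
  then have A: "n * n \<le> k * ?s * ?s" using s by linarith
  then show "n^2 \<le> k * ?s^2" by (simp add: power2_eq_square mult.assoc)
  have "1 \<le> n * n" using assms by simp
  then show s1: "1 \<le> ?s" using A by (cases ?s) auto
  have "k * (?s - 1) * (?s - 1) < Cs * (n * n) * bits k" using svl(2)[OF assms(1), of "?s - 1"] s1 by simp
  then have "real (k * (?s - 1) * (?s - 1)) \<le> real (Cs * (n * n) * bits k)" by (intro of_nat_mono) simp
  then have "real k * (real ?s - 1)^2 \<le> Cs * (real n^2 * bits k)" using s1 by (simp add: power2_eq_square mult.assoc of_nat_diff)
  also have "\<dots> \<le> Cs * (real n^2 * (2 * lg k))" using bits_lg(2)[OF assms(1)] by (intro mult_left_mono) auto
  finally have "(real ?s - 1)^2 \<le> 2 * (Cs * (real n^2 / k * lg k))" using assms by (simp add: field_simps)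
  moreover have "(real ?s + 1)^2 \<le> 2 * (real ?s - 1)^2 + 8" using zero_le_power2[of "real ?s - 3"] by (simp add: power2_eq_square algebra_simps)
  ultimately show "16 * (real ?s + 1)^2 \<le> 64 * real Cs * (real n^2 / k * lg k) + 128" by simp
qed

text \<open>In the first term of the space one \<open>lg k\<close> stems from the number of kernel
  edges and the other from the bits per edge. In the second term the number of levels contributes a
  factor \<open>lg k\<close>.\<close>

theorem randomized:
  fixes c \<epsilon> :: real
  assumes nk: "1 \<le> k" "k \<le> n" and \<epsilon>: "0 < \<epsilon>" "\<epsilon> < 1 / 100" and E: "simple_graph n E" "edge_stream E es"
    and R: "R = real (RS n (1 / 1000 * \<epsilon>^2 / real k))" and c: "0 < c" "c \<le> Cs" "1 \<le> Cs"
    and c0: "c0 = 128 + 2 * Cs + Cs * Cs" and a: "a = (tau (rand_com Cs) + 5) * (c0 + 30) + 4"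
    and D: "D = 72574 + log 2 c0 + 18 * (64 * real Cs + 128)"
  shows "measure_pmf.prob (run (rand_com Cs) n k \<epsilon> es (exp_time a n))
       {r. matching E (output_edges r) \<and> real (card (output_edges r)) \<ge> (1 - \<epsilon>) * real (mu E)} \<ge> 1 - 1 / real n powr c" (is ?A)
    "halts_within (rand_com Cs) n k \<epsilon> es (exp_time a n)" (is ?B)
    "space_within (rand_com Cs) n k \<epsilon> es (real (maxreg (rand_com Cs) + 2) * D * (real n^2 / real k * (lg (real k))^2
       + R * log 2 (real n^2 / R) * (lg (real k))^2 * log 2 (real k / \<epsilon>)))" (is ?C)
proof -
  define L where "L = log 2 (real k / \<epsilon>)"
  define L1 where "L1 = log 2 (real n^2 / R)"
  define U where "U = real n^2 / k * lg k"
  define s where "s = svl Cs n k"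
  define X where "X = nat \<lfloor>\<epsilon> * n\<rfloor>"
  define b where "b = 128 * (n * n div k)"
  \<comment> \<open>The kernel has at most \<open>64 * Cs * U + 128\<close> edges by
    \<open>svl_square\<close>, and \<open>1 \<le> U\<close> merges the two summands.\<close>
  define m1 where "m1 = (64 * real Cs + 128) * U"
  \<comment> \<open>At most \<open>3 * lg k\<close> levels, each with a cover of at most
    \<open>1300 * R * L\<close> edges.\<close>
  define m2 where "m2 = (3900 * L * lg k) * R"
  define mb where "mb = min (n * n) (nat \<lceil>real b\<rceil>)"
  define mz where "mz = min (n * n) (nat \<lceil>m1 + m2\<rceil>)"
  define V where "V = VV c0 n mb mz"
  have n: "1 \<le> n" using nk by simp
  have L: "1 \<le> L" unfolding L_def using log_k\<epsilon> nk \<epsilon> by auto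
  have lgk: "1 \<le> lg k" by (rule lg1)
  have c01: "1 \<le> c0" unfolding c0 by simp
  have R0: "0 \<le> R" unfolding R by simp
  have Llg: "1 \<le> 3900 * L * lg k" using mult_mono[of 1 "3900 * L" 1 "lg k"] L lgk by simp
  have m2: "0 \<le> m2" unfolding m2_def using Llg R0 by simp
  have nk1: "1 \<le> real n^2 / k"
  proof -
    have "real k \<le> real n * 1" using nk by simp
    also have "\<dots> \<le> real n * real n" using n by (intro mult_left_mono) auto
    finally show ?thesis using nk by (simp add: power2_eq_square)
  qed
  have U1: "real n^2 / k \<le> U" "1 \<le> U"
  proof -
    show "real n^2 / k \<le> U" unfolding U_def using mult_left_mono[OF lgk, of "real n^2 / k"] by simp
    then show "1 \<le> U" using nk1 by linarith
  qed
  have m1: "U \<le> m1" "1 \<le> m1"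
  proof -
    show "U \<le> m1" unfolding m1_def using mult_right_mono[of 1 "64 * real Cs + 128" U] U1 by simp
    then show "1 \<le> m1" using U1 by linarith
  qed
  have kn: "k \<le> n * n" using mult_le_mono[of 1 n k n] nk by simp
  have d1: "1 \<le> n * n div k" using div_le_mono[OF kn, of k] nk by simp
  have b1: "1 \<le> b" unfolding b_def using d1 by linarith
  have mbz: "1 \<le> mb" "mb \<le> n * n" "1 \<le> mz" "mz \<le> n * n"
  proof -
    have "1 \<le> nat \<lceil>m1 + m2\<rceil>" "1 \<le> nat \<lceil>real b\<rceil>" using m1 m2 b1 by linarith+
    moreover have "1 \<le> n * n" using n by simp
    ultimately show "1 \<le> mb" "mb \<le> n * n" "1 \<le> mz" "mz \<le> n * n" unfolding mb_def mz_def by auto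
  qed
  note es = stream_facts[OF E]
  have poly: "x \<le> V" if "x \<le> c' * (n + 1) ^ j" "c' \<le> c0" "j \<le> 9" for x c' j
    unfolding V_def using that by (intro VV_poly[OF n c01])
  have bk: "bits k \<le> n + 1" "bits n \<le> n + 1" using bits(3)[of k] bits(3)[of n] nk by auto
  have nn: "n * n \<le> (n + 1)^2" by (simp add: power2_eq_square)
  have s3: "Cs * (n * n) * bits k \<le> Cs * (n + 1) ^ 3"
  proof -
    have "n * n * bits k \<le> (n + 1)^2 * (n + 1)" using nn bk by (intro mult_mono) auto
    then have "Cs * (n * n * bits k) \<le> Cs * ((n + 1)^2 * (n + 1))" by (intro mult_left_mono) auto
    then show ?thesis by (simp only: power3_eq_cube power2_eq_square mult.assoc)
  qed
  have ss: "s \<le> Cs * (n + 1) ^ 3" using svl(3)[OF nk(1), of Cs n] s3 unfolding s_def by linarith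
  have c0s: "128 \<le> c0" "Cs \<le> c0" "2 * Cs \<le> c0" "Cs * Cs \<le> c0" unfolding c0 by auto
  have le: "n * n \<le> V" "(n + 1) ^ n \<le> V" "128 \<le> V" "128 * (n * n) \<le> V" "n < V" "2 * k \<le> V" "2 * n \<le> V" "Cs \<le> V"
      "Cs * (n * n) \<le> V" "Cs * (n * n) * bits k \<le> V" "k * svl Cs n k * svl Cs n k \<le> V" "n * bits n \<le> V"
  proof -
    show "n * n \<le> V" by (rule poly[of _ 1 2]) (use nn c0s in auto)
    show "(n + 1) ^ n \<le> V" unfolding V_def by (rule VV_ge(2)[OF n c01])
    show "128 \<le> V" by (rule poly[of _ 128 0]) (use c0s in auto)
    show "128 * (n * n) \<le> V" by (rule poly[of _ 128 2]) (use nn c0s in auto)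
    have "n + 1 \<le> V" by (rule poly[of _ 1 1]) (use c0s in auto)
    then show "n < V" by simp
    show "2 * k \<le> V" by (rule poly[of _ 2 1]) (use nk c0s in auto)
    show "2 * n \<le> V" by (rule poly[of _ 2 1]) (use nk c0s in auto)
    show "Cs \<le> V" by (rule poly[of _ Cs 0]) (use c0s in auto)
    show "Cs * (n * n) \<le> V" by (rule poly[of _ Cs 2]) (use nn c0s in auto)
    show "Cs * (n * n) * bits k \<le> V" by (rule poly[of _ Cs 3]) (use s3 c0s in auto)
    show "k * svl Cs n k * svl Cs n k \<le> V"
    proof (rule poly[of _ "Cs * Cs" 7])
      have "k * (s * s) \<le> (n + 1) * ((Cs * (n + 1) ^ 3) * (Cs * (n + 1) ^ 3))" using ss nk by (intro mult_mono) auto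
      also have "N * ((Cs * N ^ 3) * (Cs * N ^ 3)) = Cs * Cs * N ^ 7" for N by (simp add: eval_nat_numeral algebra_simps)
      finally show "k * svl Cs n k * svl Cs n k \<le> Cs * Cs * (n + 1) ^ 7" unfolding s_def by (simp only: mult.assoc)
    qed (use c0s in auto)
    have "n * bits n \<le> (n + 1) * (n + 1)" using bk by (intro mult_mono) auto
    then show "n * bits n \<le> V" by (intro poly[of _ 1 2]) (use c0s in \<open>auto simp: power2_eq_square\<close>)
  qed
  have le': "length es < V" "(n * n + 2) * (n * n + 2) \<le> V" "2 * s \<le> V" "n * X \<le> V" "b \<le> V" "2 ^ (n * bits n) \<le> V"
  proof -
    have "length es + 1 \<le> V" by (rule poly[of _ 1 2]) (use es(4) c0s in \<open>auto simp: power2_eq_square\<close>)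
    then show "length es < V" by simp
    have "n * n + 2 \<le> 2 * (n + 1)^2" by (simp add: power2_eq_square)
    then have "(n * n + 2) * (n * n + 2) \<le> (2 * (n + 1)^2) * (2 * (n + 1)^2)" by (intro mult_mono) auto
    also have "(2 * N^2) * (2 * N^2) = 4 * N ^ 4" for N :: nat by (simp add: power4_eq_xxxx power2_eq_square)
    finally show "(n * n + 2) * (n * n + 2) \<le> V" by (rule poly) (use c0s in auto)
    show "2 * s \<le> V" by (rule poly[of _ "2 * Cs" 3]) (use ss c0s in auto)
    have "\<epsilon> * n \<le> n" using \<epsilon> mult_right_mono[of \<epsilon> 1 "real n"] by simp
    then have "X \<le> n" unfolding X_def by linarith
    then have "n * X \<le> n * n" by (rule mult_left_mono) simp
    then show "n * X \<le> V" using le(1) by linarith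
    have "b \<le> 128 * (n * n)" unfolding b_def by (intro mult_left_mono) auto
    then show "b \<le> V" using le(4) by linarith
    have "(2 ^ bits n) ^ n \<le> (2 * n) ^ n" using bits(4)[OF n] by (rule power_mono) simp
    also have "\<dots> \<le> V" unfolding V_def by (rule VV_ge(3)[OF n c01])
    finally show "2 ^ (n * bits n) \<le> V" by (simp add: power_mult[symmetric] mult.commute)
  qed
  note sv = svl_square[OF nk(1) n c(3)]
  have core: "core \<epsilon> V n k b s s (2 ^ bits n) H X" for H
  proof (rule core_intro[OF nk _ c01 _ b1])
    show "\<epsilon> \<le> 1" using \<epsilon> by simp
    show "1 \<le> m1 + m2" using m1 m2 by simp
    show "V = VV c0 n (min (n * n) (nat \<lceil>real b\<rceil>)) (min (n * n) (nat \<lceil>m1 + m2\<rceil>))" unfolding V_def mb_def mz_def ..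
    fix Z assume Z: "Z \<subseteq> arcs n"
    show "\<exists>W\<subseteq>Z. goodN \<epsilon> n k s s (2 ^ bits n) H X W Z \<and> real (card W) \<le> m1 + m2"
    proof (cases "2 \<le> n")
      case True
      let ?K = "1300 * R * L"
      have K: "lcost (lev n i) (qq \<epsilon> n k X i) \<le> ?K" if "i \<le> n" "level s (2 ^ bits n) i" for i
        unfolding X_def R L_def by (rule lcost_rand[OF nk True \<epsilon> that(1)])
      obtain W where W: "W \<subseteq> Z" "goodN \<epsilon> n k s s (2 ^ bits n) H X W Z"
        "real (card W) \<le> 16 * (real s + 1)^2 + card {i. i \<le> n \<and> level s (2 ^ bits n) i} * ?K"
        using goodN_exists[OF Z K] by blast
      have "real (card {i. i \<le> n \<and> level s (2 ^ bits n) i}) \<le> 3 * lg k"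
        unfolding s_def by (rule card_levels[OF nk(1) sv(1,2) refl])
      then have "card {i. i \<le> n \<and> level s (2 ^ bits n) i} * ?K \<le> (3 * lg k) * ?K" using R0 L by (intro mult_right_mono) auto
      also have "\<dots> = m2" unfolding m2_def by simp
      finally have "card {i. i \<le> n \<and> level s (2 ^ bits n) i} * ?K \<le> m2" .
      moreover have "16 * (real s + 1)^2 \<le> m1"
        using sv(3) U1(2) unfolding m1_def U_def[symmetric] s_def by (simp add: algebra_simps)
      ultimately have "real (card W) \<le> m1 + m2" using W(3) by linarith
      then show ?thesis using W by blast
    next
      case False
      then have n1: "n = 1" using n by simp
      have "arcs n = {}" unfolding n1 arcs_def by auto
      then have Z0: "Z = {}" using Z by auto
      \<comment> \<open>With a single vertex there is no edge, and any common bound on the finitely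
        many costs will do.\<close>
      define K where "K = Max ((\<lambda>i. lcost (lev n i) (qq \<epsilon> n k X i)) ` {..n})"
      have "lcost (lev n i) (qq \<epsilon> n k X i) \<le> K" if "i \<le> n" for i unfolding K_def using that by (intro Max_ge) auto
      then obtain W where "W \<subseteq> Z" "goodN \<epsilon> n k s s (2 ^ bits n) H X W Z" using goodN_exists[OF Z, of s "2 ^ bits n" \<epsilon> k X K] by blast
      then show ?thesis using Z0 m1 m2 by (intro exI[of _ W]) auto
    qed
  qed (use le' in auto)
  interpret machine \<epsilon> V by unfold_locales (use le \<epsilon> in auto)
  note core' = core[unfolded b_def s_def X_def]
  have t: "ttc \<epsilon> V (rand_com Cs) (init_config n k es) (\<lambda>_. True)"
    by (rule ttc_rand[OF nk(1) n le le'(6) core' es(1) le'(1)])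
  have T5: "(V + 2) ^ (tau (rand_com Cs) + 5) \<le> exp_time a n" unfolding V_def a by (rule VV_time[OF n c01 mbz])
  have "(V + 2) ^ tau (rand_com Cs) \<le> (V + 2) ^ (tau (rand_com Cs) + 5)" by (rule power_increasing) auto
  then have T: "(V + 2) ^ tau (rand_com Cs) \<le> exp_time a n" using T5 by linarith
  have V1: "1 \<le> V" using le(5) by simp
  show ?B by (rule finish(1)[OF t T V1])
  show ?A
  proof -
    let ?m = "n * bits n"
    let ?P = "\<lambda>t. matching E (edges_of (stream_out t)) \<and> (1 - \<epsilon>) * mu E \<le> card (edges_of (stream_out t))"
    let ?Good = "\<lambda>H. \<forall>Z r. faithful \<epsilon> n k s s (2 ^ bits n) H X (arcset n es) Z r \<and> r * b \<le> length es \<longrightarrow>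
      (1 - \<epsilon>) * mu (gr n (arcset n es)) \<le> mu (gr n Z)"
    have Ta: "arcset n es \<subseteq> arcs n"
    proof
      fix e assume "e \<in> arcset n es"
      then obtain u v where uv: "(u, v) \<in> set es" "e = u * n + v" unfolding arcset_def by auto
      then have h: "u < n" "v < n" "u \<noteq> v" using es(1) by auto
      have "u * n + v < (u + 1) * n" using h by simp
      also have "\<dots> \<le> n * n" using h by (intro mult_right_mono) auto
      finally show "e \<in> arcs n" using h uv unfolding arcs_def by simp
    qed
    have "real (card {H. H < 2 ^ ?m \<and> \<not> ?Good H}) \<le> 1 / real n powr c * 2 ^ ?m"
      using few_bad_seeds[OF nk \<epsilon>(1) _ c(2) c(1) Ta es(4) s_def refl] \<epsilon> unfolding X_def b_def
      by (simp add: power_mult[symmetric] mult.commute)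
    moreover have "real (card {H. H < 2 ^ ?m \<and> ?Good H}) + real (card {H. H < 2 ^ ?m \<and> \<not> ?Good H}) = 2 ^ ?m"
      unfolding of_nat_add[symmetric] card_split_below by simp
    ultimately have "(1 - 1 / real n powr c) * 2 ^ ?m \<le> real (card {H. H < 2 ^ ?m \<and> ?Good H})" by (simp add: algebra_simps)
    then have "1 - 1 / real n powr c \<le> real (card {H. H < 2 ^ ?m \<and> ?Good H}) / 2 ^ ?m" by (simp add: le_divide_eq)
    also have "\<dots> \<le> measure_pmf.prob (run (rand_com Cs) n k \<epsilon> es (exp_time a n)) (halted ?P)"
    proof (rule rand_prob[OF nk(1) n le le'(6) core' es(1) le'(1) _ T5])
      fix H Z r s' assume g: "?Good H" and f: "faithful \<epsilon> n k (svl Cs n k) (svl Cs n k) (2 ^ bits n) H (nat \<lfloor>\<epsilon> * n\<rfloor>) (arcset n es) Z r"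
        and r: "r * (128 * (n * n div k)) \<le> length es"
        and o: "matching (gr n Z) (edges_of (stream_out s'))" "card (edges_of (stream_out s')) = mu (gr n Z)"
      have "(1 - \<epsilon>) * mu (gr n (arcset n es)) \<le> mu (gr n Z)" using g f r unfolding s_def X_def b_def by blast
      moreover have "matching E (edges_of (stream_out s'))" using o(1) faithful_0(3)[OF f] es(2) unfolding matching_def by auto
      ultimately show "?P s'" using o(2) es(2) by simp
    qed
    also have "\<dots> \<le> measure_pmf.prob (run (rand_com Cs) n k \<epsilon> es (exp_time a n))
        {r. matching E (output_edges r) \<and> real (card (output_edges r)) \<ge> (1 - \<epsilon>) * real (mu E)}"
      by (rule measure_pmf.finite_measure_mono) (auto simp: halted_def output_edges_def)
    finally show ?thesis .
  qed
  show ?C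
  proof (rule finish(3)[OF t T V1])
    let ?U = "real n^2 / k * (lg k)^2" and ?R = "R * L1 * (lg k)^2 * L"
    have "log 2 V + 1 \<le> (70 + 18 * real 128 + log 2 (real c0)) * (real n^2 / k * lg k) + 18 * (m1 * lg k + m2 * L1)"
      unfolding V_def
    proof (rule log_VV[OF nk c01 b_def _ _ m2 _ mb_def mz_def])
      show "real n^2 / k \<le> m1" using U1 m1 by linarith
      show "1 \<le> L1 \<and> log 2 (real n^2 / m2 + 2) \<le> 2 * L1" if "0 < m2"
        using RS_L1[OF R Llg] that unfolding m2_def L1_def by simp
    qed simp
    also have "m1 * lg k = (64 * real Cs + 128) * ?U" unfolding m1_def U_def by (simp add: power2_eq_square)
    also have "m2 * L1 = 3900 * (R * L1 * L * lg k)" unfolding m2_def by simp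
    \<comment> \<open>\<open>70 + 18 * 128 = 2374\<close> and \<open>18 * 3900 = 70200\<close> add
      up to the numeral \<open>72574\<close> in \<open>D\<close>.\<close>
    also have "(70 + 18 * real 128 + log 2 (real c0)) * (real n^2 / k * lg k) + 18 * ((64 * real Cs + 128) * ?U + 3900 * (R * L1 * L * lg k)) \<le> D * ?U + D * ?R"
    proof -
      have RL: "0 \<le> R * L1 * L" using RS_L0[OF R] L unfolding L1_def by simp
      have l0: "0 \<le> log 2 (real c0)" using c01 by simp
      have "lg k * 1 \<le> lg k * lg k" using lgk by (intro mult_left_mono) auto
      then have lg2: "lg k \<le> (lg k)^2" by (simp add: power2_eq_square)
      have "(70 + 18 * real 128 + log 2 (real c0)) * (real n^2 / k * lg k) \<le> (70 + 18 * real 128 + log 2 (real c0)) * ?U"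
        using lg2 l0 by (intro mult_left_mono) auto
      moreover have "(70 + 18 * real 128 + log 2 (real c0)) * ?U + 18 * ((64 * real Cs + 128) * ?U) = (2374 + log 2 (real c0) + 18 * (64 * real Cs + 128)) * ?U"
        by (simp add: algebra_simps)
      moreover have "\<dots> \<le> D * ?U" unfolding D by (intro mult_right_mono) auto
      moreover have "R * L1 * L * lg k \<le> R * L1 * L * (lg k)^2" using lg2 RL by (rule mult_left_mono)
      moreover have "70200 * ?R \<le> D * ?R"
      proof (rule mult_right_mono)
        show "0 \<le> ?R" using mult_nonneg_nonneg[OF RL, of "(lg k)^2"] by (simp add: mult_ac)
      qed (use l0 in \<open>simp add: D\<close>)
      moreover have "?R = R * L1 * L * (lg k)^2" by simp
      ultimately show ?thesis unfolding distrib_left by linarith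
    qed
    finally have "log 2 V + 1 \<le> D * (?U + ?R)" by (simp only: distrib_left)
    then have "real (maxreg (rand_com Cs) + 2) * (log 2 V + 1) \<le> real (maxreg (rand_com Cs) + 2) * (D * (?U + ?R))"
      by (rule mult_left_mono) simp
    then show "real (maxreg (rand_com Cs) + 2) * (log 2 V + 1) \<le> real (maxreg (rand_com Cs) + 2) * D * (?U + R * log 2 (real n^2 / R) * (lg k)^2 * log 2 (k / \<epsilon>))"
      unfolding L1_def L_def by (simp only: mult.assoc)
  qed
qed


theorem theorem6p7:
  shows
    "(\<exists>\<eta>::real. \<eta> > 0 \<and>
       (\<forall>c::real. c > 0 \<longrightarrow>
         (\<exists>(A::com) (C::real) (a::nat). \<forall>(n::nat) (k::nat) (\<epsilon>::real) E es.
            1 \<le> k \<and> k \<le> n \<and> 0 < \<epsilon> \<and> \<epsilon> < 1/100 \<and> simple_graph n E \<and> edge_stream E es \<longrightarrow>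
            (let R = real (RS n (\<eta> * \<epsilon>^2 / real k)) in
               measure_pmf.prob (run A n k \<epsilon> es (exp_time a n))
                 {r. matching E (output_edges r) \<and>
                     real (card (output_edges r)) \<ge> (1 - \<epsilon>) * real (max_matching_size E)}
                 \<ge> 1 - 1 / real n powr c \<and>
               halts_within A n k \<epsilon> es (exp_time a n) \<and>
               space_within A n k \<epsilon> es
                 (C * (real n^2 / real k * (lg (real k))^2
                       + R * log 2 (real n^2 / R) * (lg (real k))^2 * log 2 (real k / \<epsilon>)))))))
     \<and>
     (\<exists>(A::com) (C::real) (a::nat). coin_free A \<and>
        (\<forall>(n::nat) (k::nat) (\<epsilon>::real) E es.
            1 \<le> k \<and> k \<le> n \<and> 0 < \<epsilon> \<and> \<epsilon> < 1/100 \<and> simple_graph n E \<and> edge_stream E es \<longrightarrow>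
            (let R = real (RS n (\<epsilon> / (16 * real k))) in
               (\<forall>r \<in> set_pmf (run A n k \<epsilon> es (exp_time a n)).
                  matching E (output_edges r) \<and>
                  real (card (output_edges r)) \<ge> real (max_matching_size E) - \<epsilon> * real n) \<and>
               halts_within A n k \<epsilon> es (exp_time a n) \<and>
               space_within A n k \<epsilon> es
                 (C * (real n^2 / real k * lg (real k)
                       + R * log 2 (real n^2 / R) * lg (real k) * log 2 (real k / \<epsilon>))))))"
proof (rule conjI, goal_cases)
  case 1
  show ?case
  proof (rule exI[of _ "1 / 1000"], intro conjI allI impI, goal_cases)
    case (2 c)
    \<comment> \<open>The exponent \<open>c\<close> of the failure probability enters the program
      through the constant \<open>Cs\<close>; the program, the space constant and the time exponent
      depend on \<open>c\<close> but not on \<open>n\<close>, \<open>k\<close> or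
      \<open>\<epsilon>\<close>.\<close>
    define Cs where "Cs = nat \<lceil>c\<rceil> + 1"
    have Cs: "c \<le> Cs" "1 \<le> Cs" unfolding Cs_def using 2 by linarith+
    show ?case unfolding Let_def
      by (intro exI allI impI conjI; elim conjE; rule randomized[OF _ _ _ _ _ _ refl 2 Cs refl refl refl]; assumption)
  qed simp
next
  case 2
  show ?case unfolding Let_def
    by (rule exI[of _ det_com]; intro exI conjI[OF coin_free_det_com] allI impI; intro conjI; elim conjE; rule deterministic[OF _ _ _ _ _ _ refl refl]; assumption)
qed

end
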